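(* Let $\Omega$ be a domain in $\mathbb{C}^n$. Let $\varepsilon\in(0,1]$, $k\in\{0,1\}$, and set $\varepsilon_k=\frac{k+\varepsilon}{2}$. Suppose $p\in\partial\Omega$ is a $\mathcal{C}^{k+2,\varepsilon}$-smooth strictly pseudoconvex boundary point of $\Omega$. Then there exist a constant $C>0$ and a neighborhood $U$ of $p$ such that for all $z\in\Omega\cap U$ and $X\in\mathbb{C}^n$, $$(1-C\delta_\Omega(z)^{\varepsilon_k})\Bigl(\frac{|\langle\partial\delta_\Omega(z),X\rangle|^2}{\delta^2_\Omega(z)}+\frac{L(z;X)}{\delta_\Omega(z)}\Bigr)^{1/2}\leq\kappa_\Omega(z;X)\leq (1+C\delta_\Omega(z)^{\varepsilon_k})\Bigl(\frac{|\langle\partial\delta_\Omega(z),X\rangle|^2}{\delta^2_\Omega(z)}+\frac{L(z;X)}{\delta_\Omega(z)}\Bigr)^{1/2}.$$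
   Context: $\delta_\Omega(z)$ is the Euclidean distance from $z$ to $\partial\Omega$ (which is of class $\mathcal C^2$ in $\Omega$ near $p$). $\langle\partial\delta_\Omega(z),X\rangle=\sum_{j=1}^n\frac{\partial\delta_\Omega}{\partial z_j}(z)X_j$, and $L(z;X)=\sum_{j,l=1}^n\frac{\partial^2(-\delta_\Omega)}{\partial z_j\partial\bar z_l}(z)X_j\bar X_l$ is the Levi form of $-\delta_\Omega$. The Kobayashi metric is $\kappa_{\Omega}(z;X)=\inf\{|\alpha|:\exists\varphi\in \mathcal{O}(\mathbb{D},\Omega),\ \varphi(0)=z,\ \alpha\varphi'(0)=X\}$, where $\mathbb D$ is the unit disc. A boundary point $p$ is a $\mathcal{C}^{k+2,\varepsilon}$-smooth strictly pseudoconvex boundary point if there are a neighborhood $W$ of $p$ and $\rho\in\mathcal{C}^{k+2,\varepsilon}(W)$ with $\Omega\cap W=\{\rho<0\}$, $d\rho\neq0$ on $W$, and the Levi form of $\rho$ at $p$ positive definite on the complex tangent space at $p$; $\mathcal{C}^{m,\varepsilon}$ means $m$-th derivatives locally Hölder continuous of exponent $\varepsilon$. *)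

theory Defs
  imports "HOL-Analysis.Analysis"
begin

definition ddir :: "('a::real_normed_vector \<Rightarrow> 'b::real_normed_vector) \<Rightarrow> 'a \<Rightarrow> 'a \<Rightarrow> 'b" where
  "ddir f v z = frechet_derivative f (at z) v"

fun iter_dd :: "('a::real_normed_vector \<Rightarrow> 'b::real_normed_vector) \<Rightarrow> 'a list \<Rightarrow> 'a \<Rightarrow> 'b" where
  "iter_dd f [] = f"
| "iter_dd f (v # vs) = ddir (iter_dd f vs) v"

definition Ck_on :: "nat \<Rightarrow> 'a::real_normed_vector set \<Rightarrow> ('a \<Rightarrow> 'b::real_normed_vector) \<Rightarrow> bool" where
  "Ck_on m W f \<longleftrightarrow>
     (\<forall>vs. length vs < m \<longrightarrow> iter_dd f vs differentiable_on W) \<and>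
     (\<forall>vs. length vs = m \<longrightarrow> continuous_on W (iter_dd f vs))"

definition locally_holder_on :: "real \<Rightarrow> 'a::metric_space set \<Rightarrow> ('a \<Rightarrow> 'b::real_normed_vector) \<Rightarrow> bool" where
  "locally_holder_on e W g \<longleftrightarrow>
     (\<forall>z\<in>W. \<exists>r>0. \<exists>M. \<forall>x\<in>ball z r \<inter> W. \<forall>y\<in>ball z r \<inter> W.
        norm (g x - g y) \<le> M * dist x y powr e)"

definition Ck_holder_on :: "nat \<Rightarrow> real \<Rightarrow> 'a::real_normed_vector set \<Rightarrow> ('a \<Rightarrow> 'b::real_normed_vector) \<Rightarrow> bool" where
  "Ck_holder_on m e W f \<longleftrightarrow> Ck_on m W f \<and>
     (\<forall>vs. length vs = m \<longrightarrow> locally_holder_on e W (iter_dd f vs))"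

definition dz :: "(complex^'n \<Rightarrow> complex) \<Rightarrow> 'n \<Rightarrow> complex^'n \<Rightarrow> complex" where
  "dz f j z = (ddir f (axis j 1) z - \<i> * ddir f (axis j \<i>) z) / 2"

definition dzbar :: "(complex^'n \<Rightarrow> complex) \<Rightarrow> 'n \<Rightarrow> complex^'n \<Rightarrow> complex" where
  "dzbar f j z = (ddir f (axis j 1) z + \<i> * ddir f (axis j \<i>) z) / 2"

definition del_pair :: "(complex^'n \<Rightarrow> real) \<Rightarrow> complex^'n \<Rightarrow> complex^'n \<Rightarrow> complex" where
  "del_pair u z X = (\<Sum>j\<in>UNIV. dz (\<lambda>w. complex_of_real (u w)) j z * X $ j)"

text \<open>Levi form of a real valued function u: sum_{j,l} d^2 u/dz_j dzbar_l (z) X_j conj(X_l)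
  (real for C^2 functions; we take the real part).\<close>
definition levi :: "(complex^'n \<Rightarrow> real) \<Rightarrow> complex^'n \<Rightarrow> complex^'n \<Rightarrow> real" where
  "levi u z X = Re (\<Sum>j\<in>UNIV. \<Sum>l\<in>UNIV.
      dz (dzbar (\<lambda>w. complex_of_real (u w)) l) j z * X $ j * cnj (X $ l))"

definition bdist :: "(complex^'n) set \<Rightarrow> complex^'n \<Rightarrow> real" where
  "bdist \<Omega> z = infdist z (frontier \<Omega>)"

definition kobayashi :: "(complex^'n) set \<Rightarrow> complex^'n \<Rightarrow> complex^'n \<Rightarrow> real" where
  "kobayashi \<Omega> z X = Inf {norm \<alpha> | \<alpha>. \<exists>\<phi> :: complex \<Rightarrow> complex^'n.
      (\<forall>i. (\<lambda>\<zeta>. \<phi> \<zeta> $ i) holomorphic_on ball 0 1) \<and> \<phi> ` ball 0 1 \<subseteq> \<Omega> \<and>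
      \<phi> 0 = z \<and> (\<forall>i. \<alpha> * deriv (\<lambda>\<zeta>. \<phi> \<zeta> $ i) 0 = X $ i)}"

definition spsc_boundary_point :: "nat \<Rightarrow> real \<Rightarrow> (complex^'n) set \<Rightarrow> complex^'n \<Rightarrow> bool" where
  "spsc_boundary_point m e \<Omega> p \<longleftrightarrow> p \<in> frontier \<Omega> \<and>
     (\<exists>W \<rho>. open W \<and> p \<in> W \<and> Ck_holder_on m e W \<rho> \<and>
        \<Omega> \<inter> W = {z\<in>W. \<rho> z < 0} \<and>
        (\<forall>z\<in>W. frechet_derivative \<rho> (at z) \<noteq> (\<lambda>_. 0)) \<and>
        (\<forall>X. X \<noteq> 0 \<and> del_pair \<rho> p X = 0 \<longrightarrow> levi \<rho> p X > 0))"

end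

(* Write \<delta> for the distance to the boundary and Q for the square root in the theorem.  The signed distance
   is as regular as the boundary, because the foot point, the unit normal, the signed distance and a multiplier
   solve a system of equations to which the inverse function theorem applies.  Hence r = - \<delta> + B \<delta>^2,
   which has a positive definite Levi form for large B, has a Taylor expansion
     r(z + w) = - d + 2 Re P(w) + L(w) + 2 Re M(w, w, conj w) + O(|w|^(k+2+\<epsilon>))
   with holomorphic P, and the mixed cubic term is absorbed by w |-> V = w + q(w) with q quadratic.

   Lower bound: on \<Omega> near p this gives 2 Re P + L(V) <= d + C |w|^(k+2+\<epsilon>), so
   (P, sqrt d V) / (d - P) maps the domain into the ball of squared radius 1 + C d^((k+\<epsilon>)/2), and the
   Schwarz lemma yields the estimate for discs that stay near p.  A disc in \<Omega> centred at z stays near p on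
   |\<zeta>| < 1 - C d: a first localization on a fixed radius comes from Sibony's plurisubharmonic functions,
   and it is propagated by Harnack's inequality for Re (d - 2 P).

   Upper bound: the extremal discs V = s X \<zeta> / (1 + \<alpha> \<zeta>) of the model 2 Re l(V) + L(V) < d, slightly
   shrunk, are carried into \<Omega> by an explicit polynomial change of coordinates. *)

theory Submission
  imports Defs "HOL-Complex_Analysis.Complex_Analysis"
begin

section \<open>Second-order Taylor expansions with uniform remainder\<close>

text \<open>The Levi form of - \<delta> may be negative in the complex normal direction, whereas
  completing squares, representing the cubic term and the Cauchy-Schwarz inequality all need an
  inner product. The term B \<delta>^2 supplies one and changes the metric only by a factor 1 +
  O(\<delta>), harmless because the exponent of the theorem is at most 1. That exponent, \<theta> =
  (\<sigma> - 1) / 2 = (k + \<epsilon>) / 2, comes from scaling: d |w|^(2 + 2 \<theta>) is at most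
  d^\<theta> (d + |w|^2)^2, and d + |w|^2 is dominated by |d - P|. A mixed cubic term left in place
  would cost d^(1/2), too much for k = 1; hence the quadratic change of coordinates. Localization
  may cost no more than d^\<theta>, with \<theta> up to 1. A fixed smaller radius would cost a
  constant factor, hence the propagation up to radius 1 - C d. All constants have to be uniform in
  the centre z, so Taylor expansions are carried as a predicate with one constant for a whole
  neighbourhood.\<close>

text \<open>For \<open>\<sigma> \<le> 2\<close> the quadratic term is redundant; keeping it lets the cases \<open>k = 0\<close> and \<open>k = 1\<close> be
  treated together, with \<open>\<sigma> = k + 1 + \<epsilon>\<close>.\<close>
definition taylor2 :: "real \<Rightarrow> 'a::euclidean_space set \<Rightarrow> ('a \<Rightarrow> 'b::euclidean_space) \<Rightarrow>
    ('a \<Rightarrow> 'a \<Rightarrow> 'b) \<Rightarrow> ('a \<Rightarrow> 'a \<Rightarrow> 'a \<Rightarrow> 'b) \<Rightarrow> real \<Rightarrow> bool" where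
  "taylor2 \<sigma> U f f1 f2 C \<longleftrightarrow> 0 \<le> C \<and> (\<forall>x\<in>U. bounded_linear (f1 x) \<and> bounded_bilinear (f2 x) \<and>
     (\<forall>w. norm (f1 x w) \<le> C * norm w) \<and> (\<forall>v w. norm (f2 x v w) \<le> C * norm v * norm w) \<and>
     (\<forall>y\<in>U. norm (f y - f x - f1 x (y - x) - f2 x (y - x) (y - x)) \<le> C * norm (y - x) powr \<sigma>))"

lemma taylor2D:
  assumes "taylor2 \<sigma> U f f1 f2 C"
  shows "0 \<le> C"
    and "x \<in> U \<Longrightarrow> bounded_linear (f1 x)"
    and "x \<in> U \<Longrightarrow> bounded_bilinear (f2 x)"
    and "x \<in> U \<Longrightarrow> norm (f1 x w) \<le> C * norm w"
    and "x \<in> U \<Longrightarrow> norm (f2 x v w) \<le> C * norm v * norm w"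
    and "x \<in> U \<Longrightarrow> y \<in> U \<Longrightarrow>
      norm (f y - f x - f1 x (y - x) - f2 x (y - x) (y - x)) \<le> C * norm (y - x) powr \<sigma>"
  using assms unfolding taylor2_def by blast+

lemma taylor2_mono:
  assumes "taylor2 \<sigma> U f f1 f2 C" "C \<le> C'" "U' \<subseteq> U"
  shows "taylor2 \<sigma> U' f f1 f2 C'"
  unfolding taylor2_def
proof (intro conjI ballI allI)
  note D = taylor2D[OF assms(1)]
  show "0 \<le> C'" using D(1) assms(2) by linarith
  fix x assume "x \<in> U'"
  then have x: "x \<in> U" using assms by blast
  show "bounded_linear (f1 x)" "bounded_bilinear (f2 x)" using D x by auto
  show "norm (f1 x w) \<le> C' * norm w" for w
    using D(4)[OF x, of w] mult_right_mono[OF assms(2), of "norm w"] by simp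
  show "norm (f2 x v w) \<le> C' * norm v * norm w" for v w
    using D(5)[OF x, of v w] mult_right_mono[OF assms(2), of "norm v * norm w"] by (simp add: mult.assoc)
  fix y assume "y \<in> U'"
  then have y: "y \<in> U" using assms by blast
  show "norm (f y - f x - f1 x (y - x) - f2 x (y - x) (y - x)) \<le> C' * norm (y - x) powr \<sigma>"
    using D(6)[OF x y] mult_right_mono[OF assms(2), of "norm (y - x) powr \<sigma>"] by simp
qed

lemma taylor2_first_order:
  assumes T: "taylor2 \<sigma> U f f1 f2 C" and "x \<in> U" "y \<in> U"
  shows "norm (f y - f x - f1 x (y - x)) \<le> C * norm (y - x) powr \<sigma> + C * (norm (y - x))\<^sup>2"
proof -
  have "norm (f y - f x - f1 x (y - x)) \<le>
      norm (f y - f x - f1 x (y - x) - f2 x (y - x) (y - x)) + norm (f2 x (y - x) (y - x))"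
    by (metis diff_add_cancel norm_triangle_ineq)
  then show ?thesis
    using taylor2D(6)[OF T assms(2,3)] taylor2D(5)[OF T assms(2), of "y-x" "y-x"]
    by (simp add: power2_eq_square mult.assoc)
qed

lemma powr_small:
  fixes h :: real assumes "1 < \<sigma>" "0 \<le> h"
  shows "h powr \<sigma> = h * h powr (\<sigma> - 1)"
  using assms powr_add[of h 1 "\<sigma> - 1"] by (cases "h = 0") auto

lemma taylor2_has_derivative:
  assumes T: "taylor2 \<sigma> U f f1 f2 C" and "1 < \<sigma>" "open U" "x \<in> U"
  shows "(f has_derivative f1 x) (at x)"
proof (rule has_derivativeI)
  show "bounded_linear (f1 x)" using taylor2D(2)[OF T] assms by blast
  let ?g = "\<lambda>y. C * norm (y - x) powr (\<sigma> - 1) + C * norm (y - x)"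
  have "((\<lambda>y. norm (y - x)) \<longlongrightarrow> 0) (at x)"
    by (intro tendsto_eq_intros) auto
  then have lim: "(?g \<longlongrightarrow> 0) (at x)"
    using assms(2) by (auto intro!: tendsto_eq_intros)
  have "\<forall>\<^sub>F y in at x. y \<in> U"
    using assms(3,4) by (simp add: eventually_at_in_open')
  then have ev: "\<forall>\<^sub>F y in at x. norm ((f y - f x - f1 x (y - x)) /\<^sub>R norm (y - x)) \<le> ?g y"
  proof eventually_elim
    case (elim y)
    show ?case
    proof (cases "y = x")
      case True then show ?thesis using taylor2D(1)[OF T] by simp
    next
      case False
      then have p: "norm (y - x) > 0" by simp
      have "norm (f y - f x - f1 x (y - x)) \<le> norm (y - x) * ?g y"
        using taylor2_first_order[OF T assms(4) elim] powr_small[OF assms(2), of "norm (y - x)"]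
        by (simp add: algebra_simps power2_eq_square)
      then have "norm (f y - f x - f1 x (y - x)) / norm (y - x) \<le> ?g y"
        using p by (simp add: pos_divide_le_eq mult.commute)
      then show ?thesis by (simp add: divide_inverse mult.commute)
    qed
  qed
  show "((\<lambda>y. (f y - f x - f1 x (y - x)) /\<^sub>R norm (y - x)) \<longlongrightarrow> 0) (at x)"
    by (rule Lim_null_comparison[OF ev lim])
qed

lemma two_powr_le: "\<sigma> \<le> 3 \<Longrightarrow> 0 \<le> h \<Longrightarrow> (2 * h) powr \<sigma> \<le> 8 * h powr \<sigma>" for \<sigma> h :: real
proof -
  assume "\<sigma> \<le> 3" "0 \<le> h"
  moreover have "2 powr \<sigma> \<le> 2 powr (3::real)" using \<open>\<sigma> \<le> 3\<close> by (intro powr_mono) auto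
  ultimately show ?thesis by (simp add: powr_mult mult_right_mono)
qed

text \<open>\<open>taylor2\<close> demands no continuity of \<open>f1\<close>; the expansions force
  it. Expanding \<open>f\<close> at \<open>p\<close> and \<open>p + v\<close> from \<open>x\<close>,
  and at \<open>p + v\<close> from \<open>p\<close>, writes the difference of the two derivatives at
  \<open>v\<close> as a combination of three remainders.\<close>

lemma taylor2_derivative_continuous:
  assumes T: "taylor2 \<sigma> U f f1 f2 C" and \<sigma>: "1 < \<sigma>" "\<sigma> \<le> 3" and U: "open U" "p \<in> U" and e: "0 < e"
  shows "\<exists>\<delta>>0. ball p \<delta> \<subseteq> U \<and> (\<forall>x\<in>ball p \<delta>. \<forall>w. norm (f1 x w - f1 p w) \<le> e * norm w)"
proof -
  note C = taylor2D(1)[OF T]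
  obtain R where R: "R > 0" "ball p R \<subseteq> U" using U openE by blast
  have "((\<lambda>h::real. 10 * C * h powr (\<sigma> - 1) + 6 * C * h) \<longlongrightarrow> 0) (at_right 0)"
    using \<sigma> by (auto intro!: tendsto_eq_intros simp: eventually_at_filter)
  then have "\<forall>\<^sub>F h in at_right 0. 10 * C * h powr (\<sigma> - 1) + 6 * C * h < e"
    using e order_tendstoD(2) by blast
  then obtain b where b: "b > 0" "\<And>h. 0 < h \<Longrightarrow> h < b \<Longrightarrow> 10 * C * h powr (\<sigma> - 1) + 6 * C * h < e"
    unfolding eventually_at_right_field by auto
  define \<delta> where "\<delta> = min b R"
  show ?thesis
  proof (intro exI[of _ \<delta>] conjI ballI allI)
    show "\<delta> > 0" using b R by (simp add: \<delta>_def)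
    show "ball p \<delta> \<subseteq> U" using R by (auto simp: \<delta>_def)
    fix x w assume x: "x \<in> ball p \<delta>"
    then have xU: "x \<in> U" using R by (auto simp: \<delta>_def)
    \<comment> \<open>Taking \<open>v\<close> as long as \<open>x - p\<close> makes all three
      remainders O(h^\<sigma> + h^2), which is o(h) since \<sigma> > 1; other vectors follow by
      scaling. The 8 and 4 in \<open>E1\<close> come from the doubled distance from \<open>x\<close>
      to \<open>p + v\<close>.\<close>
    have main: "norm (f1 x v - f1 p v) \<le> e * norm v" if v: "norm v = norm (x - p)" "x \<noteq> p" for v
    proof -
      define h where "h = norm v"
      have h: "0 < h" "h < b" "h < R" using v x by (auto simp: h_def \<delta>_def dist_norm norm_minus_commute)
      have pv: "p + v \<in> U" using R h by (auto simp: h_def dist_norm)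
      have l: "linear (f1 x)" using taylor2D(2)[OF T xU] bounded_linear.linear by blast
      have E1: "norm (f (p+v) - f x - f1 x (p + v - x)) \<le> 8 * C * h powr \<sigma> + 4 * C * h\<^sup>2"
      proof -
        have n: "norm (p + v - x) \<le> 2 * h"
          using norm_triangle_ineq[of "p - x" v] v by (simp add: h_def algebra_simps norm_minus_commute)
        have "C * norm (p + v - x) powr \<sigma> \<le> C * (8 * h powr \<sigma>)"
          using n \<sigma> C h by (intro mult_left_mono order_trans[OF powr_mono2 two_powr_le]) auto
        moreover have "C * (norm (p + v - x))\<^sup>2 \<le> C * (4 * h\<^sup>2)"
          using power_mono[OF n, of 2] C by (intro mult_left_mono) (auto simp: power_mult_distrib)
        ultimately show ?thesis using taylor2_first_order[OF T xU pv] by simp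
      qed
      have E2: "norm (f p - f x - f1 x (p - x)) \<le> C * h powr \<sigma> + C * h\<^sup>2"
        using taylor2_first_order[OF T xU U(2)] v by (simp add: h_def norm_minus_commute)
      have E3: "norm (f (p + v) - f p - f1 p v) \<le> C * h powr \<sigma> + C * h\<^sup>2"
        using taylor2_first_order[OF T U(2) pv] by (simp add: h_def)
      have eq: "f1 x v - f1 p v = (f (p + v) - f p - f1 p v) + (f p - f x - f1 x (p - x)) - (f (p+v) - f x - f1 x (p + v - x))"
        using linear_add[OF l, of "p - x" v] by (simp add: algebra_simps)
      have "norm (f1 x v - f1 p v) \<le> (C * h powr \<sigma> + C * h\<^sup>2) + (C * h powr \<sigma> + C * h\<^sup>2) + (8 * C * h powr \<sigma> + 4 * C * h\<^sup>2)"
        unfolding eq by (intro order_trans[OF norm_triangle_ineq4] order_trans[OF norm_triangle_ineq] add_mono E1 E2 E3)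
      also have "\<dots> = h * (10 * C * h powr (\<sigma> - 1) + 6 * C * h)"
        using powr_small[OF \<sigma>(1), of h] h by (simp add: algebra_simps power2_eq_square)
      also have "\<dots> \<le> h * e" using b(2)[OF h(1,2)] h by (intro mult_left_mono) auto
      finally show ?thesis by (simp add: h_def mult.commute)
    qed
    show "norm (f1 x w - f1 p w) \<le> e * norm w"
    proof (cases "w = 0 \<or> x = p")
      case True
      then show ?thesis using taylor2D(2)[OF T xU] taylor2D(2)[OF T U(2)] e
        by (auto simp: linear_0 bounded_linear.linear)
    next
      case False
      define c where "c = norm (x - p) / norm w"
      have c: "c > 0" using False by (simp add: c_def)
      have "norm (f1 x (c *\<^sub>R w) - f1 p (c *\<^sub>R w)) \<le> e * norm (c *\<^sub>R w)"
        by (rule main) (use False in \<open>auto simp: c_def\<close>)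
      moreover have "f1 x (c *\<^sub>R w) - f1 p (c *\<^sub>R w) = c *\<^sub>R (f1 x w - f1 p w)"
        using taylor2D(2)[OF T xU] taylor2D(2)[OF T U(2)]
        by (simp add: linear_cmul bounded_linear.linear scaleR_diff_right)
      ultimately have "c * norm (f1 x w - f1 p w) \<le> c * (e * norm w)" using c by simp
      then show ?thesis using c by simp
    qed
  qed
qed

text \<open>Integrating the expansion of the gradient along the segment from \<open>x\<close> to
  \<open>x + w\<close> gains one order in the remainder; 1/2 and 1/3 are the integrals of t and t^2.
  The integration is replaced by a derivative bound for \<open>h\<close> on [0, 1].\<close>

lemma taylor2_gradient_expansion:
  fixes f :: "'a::euclidean_space \<Rightarrow> real"
  assumes T: "taylor2 \<sigma> U g g1 g2 C" and \<sigma>: "0 < \<sigma>" and U: "convex U" "open U"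
    and d: "\<And>x. x \<in> U \<Longrightarrow> (f has_derivative (\<lambda>w. g x \<bullet> w)) (at x)"
    and xy: "x \<in> U" "x + w \<in> U"
  shows "\<bar>f (x + w) - f x - g x \<bullet> w - (g1 x w \<bullet> w) / 2 - (g2 x w w \<bullet> w) / 3\<bar> \<le> C * norm w powr (\<sigma> + 1)"
proof -
  interpret b1: bounded_linear "g1 x" using taylor2D(2)[OF T] xy by blast
  interpret b2: bounded_bilinear "g2 x" using taylor2D(3)[OF T] xy by blast
  define h where "h t = f (x + t *\<^sub>R w) - t * (g x \<bullet> w) - t^2 * (g1 x w \<bullet> w) / 2 - t^3 * (g2 x w w \<bullet> w) / 3" for t
  define h' where "h' t = (g (x + t *\<^sub>R w) - g x - g1 x (t *\<^sub>R w) - g2 x (t *\<^sub>R w) (t *\<^sub>R w)) \<bullet> w" for t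
  have inU: "x + t *\<^sub>R w \<in> U" if "t \<in> {0..1}" for t
  proof -
    have "(1 - t) *\<^sub>R x + t *\<^sub>R (x + w) \<in> U"
      using that xy by (intro convexD[OF U(1)]) auto
    then show ?thesis by (simp add: algebra_simps)
  qed
  have der: "(h has_field_derivative h' t) (at t within {0..1})" if t: "t \<in> {0..1}" for t
  proof -
    have "((\<lambda>t. f (x + t *\<^sub>R w)) has_derivative (\<lambda>s. g (x + t *\<^sub>R w) \<bullet> (s *\<^sub>R w))) (at t)"
      by (rule has_derivative_compose[of "\<lambda>t. x + t *\<^sub>R w" _ _ _ f, OF _ d[OF inU[OF t]]])
        (auto intro!: derivative_eq_intros)
    then have 1: "((\<lambda>t. f (x + t *\<^sub>R w)) has_field_derivative (g (x + t *\<^sub>R w) \<bullet> w)) (at t)"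
      by (simp add: has_field_derivative_def mult_commute_abs)
    show ?thesis unfolding h_def
      by (rule has_field_derivative_at_within)
        (auto intro!: derivative_eq_intros 1 simp: h'_def b1.scaleR b2.scaleR_left b2.scaleR_right
          inner_diff_left power2_eq_square)
  qed
  have bd: "norm (h' t) \<le> C * norm w powr \<sigma> * norm w" if t: "t \<in> {0..1}" for t
  proof -
    have "norm (h' t) \<le> norm (g (x + t *\<^sub>R w) - g x - g1 x (t *\<^sub>R w) - g2 x (t *\<^sub>R w) (t *\<^sub>R w)) * norm w"
      unfolding h'_def using Cauchy_Schwarz_ineq2 by auto
    also have "\<dots> \<le> (C * norm (t *\<^sub>R w) powr \<sigma>) * norm w"
      using taylor2D(6)[OF T xy(1) inU[OF t]] by (intro mult_right_mono) auto
    also have "\<dots> \<le> C * norm w powr \<sigma> * norm w"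
      using t taylor2D(1)[OF T] \<sigma>
      by (intro mult_right_mono mult_left_mono powr_mono2) (auto intro: mult_left_le_one_le)
    finally show ?thesis .
  qed
  have "norm (h 1 - h 0) \<le> C * norm w powr \<sigma> * norm w * norm (1 - 0 :: real)"
    by (rule field_differentiable_bound[OF convex_real_interval(5) der bd]) auto
  moreover have "h 1 - h 0 = f (x + w) - f x - g x \<bullet> w - (g1 x w \<bullet> w) / 2 - (g2 x w w \<bullet> w) / 3"
    by (simp add: h_def)
  moreover have "norm w powr \<sigma> * norm w = norm w powr (\<sigma> + 1)"
    using \<sigma> by (cases "w = 0") (auto simp: powr_add)
  ultimately show ?thesis by (simp add: mult.assoc)
qed

text \<open>The cubic term goes into the remainder, since \<sigma>' <= 3 and displacements have
  length at most 1. Thus the second order part of \<open>f\<close> is half of the first order part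
  of its gradient.\<close>

lemma taylor2_of_gradient:
  fixes f :: "'a::euclidean_space \<Rightarrow> real"
  assumes T: "taylor2 \<sigma> U g g1 g2 C" and \<sigma>: "0 < \<sigma>" "\<sigma>' \<le> \<sigma> + 1" "\<sigma>' \<le> 3" and U: "convex U" "open U"
    and d: "\<And>x. x \<in> U \<Longrightarrow> (f has_derivative (\<lambda>w. g x \<bullet> w)) (at x)"
    and bd: "\<And>x. x \<in> U \<Longrightarrow> norm (g x) \<le> D" and diam: "\<And>x y. x \<in> U \<Longrightarrow> y \<in> U \<Longrightarrow> norm (y - x) \<le> 1"
  shows "taylor2 \<sigma>' U f (\<lambda>x w. g x \<bullet> w) (\<lambda>x v w. (g1 x v \<bullet> w) / 2) (\<bar>D\<bar> + 2 * C)"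
  unfolding taylor2_def
proof (intro conjI ballI allI)
  note C = taylor2D(1)[OF T]
  show "0 \<le> \<bar>D\<bar> + 2 * C" using C by simp
  fix x assume x: "x \<in> U"
  interpret b1: bounded_linear "g1 x" using taylor2D(2)[OF T] x by blast
  show "bounded_linear (\<lambda>w. g x \<bullet> w)" by (rule bounded_linear_inner_right)
  show nn: "norm (g x \<bullet> w) \<le> (\<bar>D\<bar> + 2 * C) * norm w" for w
  proof -
    have "norm (g x \<bullet> w) \<le> norm (g x) * norm w" using Cauchy_Schwarz_ineq2 by auto
    also have "\<dots> \<le> (\<bar>D\<bar> + 2 * C) * norm w" using bd[OF x] C by (intro mult_right_mono) auto
    finally show ?thesis .
  qed
  show n2: "norm ((g1 x v \<bullet> w) / 2) \<le> (\<bar>D\<bar> + 2 * C) * norm v * norm w" for v w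
  proof -
    have "norm ((g1 x v \<bullet> w) / 2) \<le> norm (g1 x v) * norm w"
      using Cauchy_Schwarz_ineq2[of "g1 x v" w] by simp
    also have "\<dots> \<le> (C * norm v) * norm w"
      using taylor2D(4)[OF T x, of v] by (intro mult_right_mono) auto
    also have "\<dots> \<le> ((\<bar>D\<bar> + 2 * C) * norm v) * norm w"
      using C by (intro mult_right_mono) auto
    finally show ?thesis .
  qed
  show "bounded_bilinear (\<lambda>v w. (g1 x v \<bullet> w) / 2)"
    by (unfold_locales, auto simp: b1.add b1.scaleR inner_add_left inner_add_right add_divide_distrib)
      (use n2 in \<open>auto intro!: exI[of _ "\<bar>D\<bar> + 2 * C"] simp: mult_ac\<close>)
  fix y assume y: "y \<in> U"
  define w where "w = y - x"
  have w1: "norm w \<le> 1" using diam[OF x y] by (simp add: w_def)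
  have yw: "y = x + w" by (simp add: w_def)
  have "norm (g2 x w w \<bullet> w) \<le> norm (g2 x w w) * norm w" using Cauchy_Schwarz_ineq2 by auto
  also have "\<dots> \<le> C * norm w * norm w * norm w" using taylor2D(5)[OF T x] by (intro mult_right_mono) auto
  also have "\<dots> = C * norm w powr 3" by (cases "w = 0") (auto simp: powr_numeral power3_eq_cube)
  also have "\<dots> \<le> C * norm w powr \<sigma>'" using w1 \<sigma> C powr_mono'[of \<sigma>' 3 "norm w"] by (intro mult_left_mono) auto
  finally have 1: "\<bar>(g2 x w w \<bullet> w) / 3\<bar> \<le> C * norm w powr \<sigma>'"
    using C by (simp add: abs_le_iff)
  have "C * norm w powr (\<sigma> + 1) \<le> C * norm w powr \<sigma>'"
    using w1 \<sigma> C by (cases "w = 0") (auto intro!: mult_left_mono powr_mono')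
  then have "\<bar>f (x + w) - f x - g x \<bullet> w - (g1 x w \<bullet> w) / 2 - (g2 x w w \<bullet> w) / 3\<bar> \<le> C * norm w powr \<sigma>'"
    using taylor2_gradient_expansion[OF T \<sigma>(1) U d x, of w] y yw by fastforce
  with 1 have "\<bar>f y - f x - g x \<bullet> w - (g1 x w \<bullet> w) / 2\<bar> \<le> 2 * C * norm w powr \<sigma>'"
    unfolding yw by linarith
  moreover have "\<dots> \<le> (\<bar>D\<bar> + 2 * C) * norm w powr \<sigma>'" by (intro mult_right_mono) auto
  ultimately show "norm (f y - f x - g x \<bullet> (y - x) - (g1 x (y - x) \<bullet> (y - x)) / 2) \<le> (\<bar>D\<bar> + 2 * C) * norm (y - x) powr \<sigma>'"
    unfolding w_def[symmetric] by simp
qed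

section \<open>Closure properties of uniform Taylor expansions\<close>

definition taylor2_on :: "real \<Rightarrow> 'a::euclidean_space set \<Rightarrow> ('a \<Rightarrow> 'b::euclidean_space) \<Rightarrow> bool" where
  "taylor2_on \<sigma> U f \<longleftrightarrow> (\<exists>f1 f2 C. taylor2 \<sigma> U f f1 f2 C)"

text \<open>Diameter at most 1 makes every power of a displacement dominate all higher
  powers.\<close>

definition small_diam :: "'a::real_normed_vector set \<Rightarrow> bool" where
  "small_diam U \<longleftrightarrow> (\<forall>x\<in>U. \<forall>y\<in>U. norm (y - x) \<le> 1)"

lemma small_diam_ball: "R \<le> 1 / 2 \<Longrightarrow> small_diam (ball p R)"
proof -
  assume R: "R \<le> 1 / 2"
  show ?thesis unfolding small_diam_def
  proof (intro ballI)
    fix x y assume "x \<in> ball p R" "y \<in> ball p R"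
    then have "dist y x < R + R" using dist_triangle_less_add[of y p R x R] by (simp add: dist_commute)
    then show "norm (y - x) \<le> 1" using R by (simp add: dist_norm)
  qed
qed

lemma taylor2_bounded:
  assumes T: "taylor2 \<sigma> U f f1 f2 C" and U: "small_diam U" "x \<in> U" "y \<in> U" and \<sigma>: "0 < \<sigma>"
  shows "norm (f y - f x) \<le> 3 * C"
proof -
  have n: "norm (y - x) \<le> 1" using U by (auto simp: small_diam_def)
  note C = taylor2D(1)[OF T]
  have 1: "norm (f y - f x - f1 x (y - x) - f2 x (y - x) (y - x)) \<le> C"
    using taylor2D(6)[OF T U(2,3)] powr_le1[of \<sigma> "norm (y-x)"] n C \<sigma> mult_left_mono[of "norm (y - x) powr \<sigma>" 1 C] by fastforce
  have 2: "norm (f1 x (y - x)) \<le> C" using taylor2D(4)[OF T U(2), of "y-x"] n C mult_left_mono[of "norm (y-x)" 1 C] by simp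
  have "norm (y - x) * norm (y - x) \<le> 1" using n by (simp add: mult_le_one)
  then have 3: "norm (f2 x (y - x) (y - x)) \<le> C"
    using taylor2D(5)[OF T U(2), of "y-x" "y-x"] C mult_left_mono[of "norm (y-x) * norm (y - x)" 1 C] by (simp add: mult.assoc)
  have "f y - f x = (f y - f x - f1 x (y - x) - f2 x (y - x) (y - x)) + f1 x (y - x) + f2 x (y - x) (y - x)" by simp
  then have "norm (f y - f x) \<le> norm (f y - f x - f1 x (y - x) - f2 x (y - x) (y - x)) + norm (f1 x (y - x)) + norm (f2 x (y - x) (y - x))"
    by (metis norm_triangle_ineq norm_triangle_le add_right_mono)
  then show ?thesis using 1 2 3 by linarith
qed

lemma taylor2_on_bounded:
  assumes T: "taylor2_on \<sigma> U f" and U: "small_diam U" and \<sigma>: "0 < \<sigma>"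
  shows "\<exists>D\<ge>0. \<forall>x\<in>U. norm (f x) \<le> D"
proof (cases "U = {}")
  case True then show ?thesis by auto
next
  case False
  then obtain x where x: "x \<in> U" by auto
  obtain f1 f2 C where T': "taylor2 \<sigma> U f f1 f2 C" using T taylor2_on_def by blast
  have "norm (f y) \<le> 3 * C + norm (f x)" if "y \<in> U" for y
    using taylor2_bounded[OF T' U x that \<sigma>] norm_triangle_ineq[of "f y - f x" "f x"] by simp
  then show ?thesis using taylor2D(1)[OF T'] by (intro exI[of _ "3 * C + norm (f x)"]) auto
qed

lemma taylor2_on_linear_image:
  assumes T: "taylor2_on \<sigma> U f" and h: "bounded_linear h"
  shows "taylor2_on \<sigma> U (\<lambda>x. h (f x))"
proof -
  obtain f1 f2 C where T': "taylor2 \<sigma> U f f1 f2 C" using T taylor2_on_def by blast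
  interpret h: bounded_linear h by fact
  obtain K where K: "0 < K" "\<And>x. norm (h x) \<le> norm x * K" using h.pos_bounded by blast
  note C = taylor2D(1)[OF T']
  have "taylor2 \<sigma> U (\<lambda>x. h (f x)) (\<lambda>x w. h (f1 x w)) (\<lambda>x v w. h (f2 x v w)) (C * K)"
    unfolding taylor2_def
  proof (intro conjI ballI allI)
    show "0 \<le> C * K" using C K by simp
    fix x assume x: "x \<in> U"
    show "bounded_linear (\<lambda>w. h (f1 x w))"
      using bounded_linear_compose[OF h taylor2D(2)[OF T' x]] .
    interpret b: bounded_bilinear "f2 x" using taylor2D(3)[OF T' x] .
    show "norm (h (f1 x w)) \<le> C * K * norm w" for w
      using order_trans[OF K(2) mult_right_mono[OF taylor2D(4)[OF T' x, of w], of K]] K by (simp add: mult_ac)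
    show n2: "norm (h (f2 x v w)) \<le> C * K * norm v * norm w" for v w
      using order_trans[OF K(2) mult_right_mono[OF taylor2D(5)[OF T' x, of v w], of K]] K by (simp add: mult_ac)
    show "bounded_bilinear (\<lambda>v w. h (f2 x v w))"
      by (unfold_locales, auto simp: b.add_left b.add_right b.scaleR_left b.scaleR_right h.add h.scaleR)
        (use n2 in \<open>auto intro!: exI[of _ "C * K"] simp: mult_ac\<close>)
    fix y assume y: "y \<in> U"
    show "norm (h (f y) - h (f x) - h (f1 x (y - x)) - h (f2 x (y - x) (y - x))) \<le> C * K * norm (y - x) powr \<sigma>"
      using order_trans[OF K(2) mult_right_mono[OF taylor2D(6)[OF T' x y], of K]] K by (simp add: h.diff mult_ac)
  qed
  then show ?thesis unfolding taylor2_on_def by blast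
qed

lemma taylor2_on_add:
  assumes "taylor2_on \<sigma> U f" and "taylor2_on \<sigma> U g"
  shows "taylor2_on \<sigma> U (\<lambda>x. f x + g x)"
proof -
  obtain f1 f2 C where F: "taylor2 \<sigma> U f f1 f2 C" using assms taylor2_on_def by blast
  obtain g1 g2 C' where G: "taylor2 \<sigma> U g g1 g2 C'" using assms taylor2_on_def by blast
  have "taylor2 \<sigma> U (\<lambda>x. f x + g x) (\<lambda>x w. f1 x w + g1 x w) (\<lambda>x v w. f2 x v w + g2 x v w) (C + C')"
    unfolding taylor2_def
  proof (intro conjI ballI allI)
    show "0 \<le> C + C'" using taylor2D(1)[OF F] taylor2D(1)[OF G] by simp
    fix x assume x: "x \<in> U"
    show "bounded_linear (\<lambda>w. f1 x w + g1 x w)"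
      using bounded_linear_add taylor2D(2)[OF F x] taylor2D(2)[OF G x] by blast
    interpret a: bounded_bilinear "f2 x" using taylor2D(3)[OF F x] .
    interpret b: bounded_bilinear "g2 x" using taylor2D(3)[OF G x] .
    show n1: "norm (f1 x w + g1 x w) \<le> (C + C') * norm w" for w
      using norm_triangle_mono[OF taylor2D(4)[OF F x, of w] taylor2D(4)[OF G x, of w]] by (simp add: algebra_simps)
    show n2: "norm (f2 x v w + g2 x v w) \<le> (C + C') * norm v * norm w" for v w
      using norm_triangle_mono[OF taylor2D(5)[OF F x, of v w] taylor2D(5)[OF G x, of v w]] by (simp add: algebra_simps)
    show "bounded_bilinear (\<lambda>v w. f2 x v w + g2 x v w)"
      by (unfold_locales, auto simp: a.add_left a.add_right b.add_left b.add_right a.scaleR_left a.scaleR_right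
        b.scaleR_left b.scaleR_right scaleR_add_right) (use n2 in \<open>auto intro!: exI[of _ "C + C'"] simp: mult_ac\<close>)
    fix y assume y: "y \<in> U"
    have "f y + g y - (f x + g x) - (f1 x (y - x) + g1 x (y - x)) - (f2 x (y - x) (y - x) + g2 x (y - x) (y - x))
      = (f y - f x - f1 x (y - x) - f2 x (y - x) (y - x)) + (g y - g x - g1 x (y - x) - g2 x (y - x) (y - x))" by simp
    then show "norm (f y + g y - (f x + g x) - (f1 x (y - x) + g1 x (y - x)) - (f2 x (y - x) (y - x) + g2 x (y - x) (y - x)))
        \<le> (C + C') * norm (y - x) powr \<sigma>"
      using norm_triangle_mono[OF taylor2D(6)[OF F x y] taylor2D(6)[OF G x y]] by (simp add: algebra_simps)
  qed
  then show ?thesis unfolding taylor2_on_def by blast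
qed

lemma taylor2_on_affine:
  assumes h: "bounded_linear h"
  shows "taylor2_on \<sigma> U (\<lambda>x. a + h x)"
proof -
  interpret h: bounded_linear h by fact
  obtain K where K: "0 < K" "\<And>x. norm (h x) \<le> norm x * K" using h.pos_bounded by blast
  have "taylor2 \<sigma> U (\<lambda>x. a + h x) (\<lambda>x. h) (\<lambda>x v w. 0) K"
    unfolding taylor2_def using K h
    by (auto simp: h.diff mult_ac bounded_bilinear_def intro!: exI[of _ 0])
  then show ?thesis unfolding taylor2_on_def by blast
qed

lemma taylor2_on_const: "taylor2_on \<sigma> U (\<lambda>x. a)"
  using taylor2_on_affine[OF bounded_linear_zero, of \<sigma> U a] by simp

lemma taylor2_on_linear: "bounded_linear h \<Longrightarrow> taylor2_on \<sigma> U h"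
  using taylor2_on_affine[of h \<sigma> U 0] by simp

lemma taylor2_on_sum:
  assumes "finite B" "\<And>b. b \<in> B \<Longrightarrow> taylor2_on \<sigma> U (f b)"
  shows "taylor2_on \<sigma> U (\<lambda>x. \<Sum>b\<in>B. f b x)"
  using assms by (induction B rule: finite_induct) (auto intro: taylor2_on_const taylor2_on_add)

lemma taylor2_on_Pair:
  assumes "taylor2_on \<sigma> U f" and "taylor2_on \<sigma> U g"
  shows "taylor2_on \<sigma> U (\<lambda>x. (f x, g x))"
proof -
  have 1: "bounded_linear (\<lambda>x. (x, 0))" "bounded_linear (\<lambda>x. (0, x))"
    by (auto intro!: bounded_linear_Pair bounded_linear_ident bounded_linear_zero)
  show ?thesis
    using taylor2_on_add[OF taylor2_on_linear_image[OF assms(1) 1(1)] taylor2_on_linear_image[OF assms(2) 1(2)]] by simp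
qed

lemma taylor2_on_compose_linear:
  assumes "taylor2_on \<sigma> U f" and A: "bounded_linear A" "\<And>x. norm (A x) \<le> norm x" and V: "A ` V \<subseteq> U" and \<sigma>: "0 < \<sigma>"
  shows "taylor2_on \<sigma> V (\<lambda>x. f (A x))"
proof -
  obtain f1 f2 C where F: "taylor2 \<sigma> U f f1 f2 C" using assms taylor2_on_def by blast
  interpret A: bounded_linear A by fact
  note C = taylor2D(1)[OF F]
  have "taylor2 \<sigma> V (\<lambda>x. f (A x)) (\<lambda>x w. f1 (A x) (A w)) (\<lambda>x v w. f2 (A x) (A v) (A w)) C"
    unfolding taylor2_def
  proof (intro conjI ballI allI)
    fix x assume "x \<in> V"
    then have x: "A x \<in> U" using V by auto
    interpret b: bounded_bilinear "f2 (A x)" using taylor2D(3)[OF F x] .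
    show "bounded_linear (\<lambda>w. f1 (A x) (A w))"
      using bounded_linear_compose[OF taylor2D(2)[OF F x] A(1)] .
    show "norm (f1 (A x) (A w)) \<le> C * norm w" for w
      by (rule order_trans[OF taylor2D(4)[OF F x]]) (intro mult_left_mono A(2) C)
    show n2: "norm (f2 (A x) (A v) (A w)) \<le> C * norm v * norm w" for v w
      by (rule order_trans[OF taylor2D(5)[OF F x]]) (intro mult_mono A(2) C, auto simp: C)
    show "bounded_bilinear (\<lambda>v w. f2 (A x) (A v) (A w))"
      by (unfold_locales, auto simp: A.add A.scaleR b.add_left b.add_right b.scaleR_left b.scaleR_right)
       (use n2 in \<open>auto intro!: exI[of _ C] simp: mult_ac\<close>)
    fix y assume "y \<in> V"
    then have y: "A y \<in> U" using V by auto
    have "norm (A y - A x) powr \<sigma> \<le> norm (y - x) powr \<sigma>"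
      using A(2)[of "y - x"] \<sigma> by (intro powr_mono2) (auto simp: A.diff)
    then show "norm (f (A y) - f (A x) - f1 (A x) (A (y - x)) - f2 (A x) (A (y - x)) (A (y - x))) \<le> C * norm (y - x) powr \<sigma>"
      using taylor2D(6)[OF F x y] mult_left_mono[OF _ C] by (fastforce simp: A.diff)
  qed (rule C)
  then show ?thesis unfolding taylor2_on_def by blast
qed

text \<open>Multiplying the two expansions leaves terms of order |w|^3 and |w|^4 such as
  \<open>h F1 G2\<close>; \<sigma> <= 3 makes them part of the remainder. The constant 7 counts four
  remainder terms, two cubic ones and a quartic one.\<close>

lemma taylor2_on_bilinear:
  assumes "taylor2_on \<sigma> U f" "taylor2_on \<sigma> U g" and h: "bounded_bilinear h"
    and U: "small_diam U" and \<sigma>: "0 < \<sigma>" "\<sigma> \<le> 3"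
  shows "taylor2_on \<sigma> U (\<lambda>x. h (f x) (g x))"
proof -
  obtain f1 f2 C0 where F0: "taylor2 \<sigma> U f f1 f2 C0" using assms taylor2_on_def by blast
  obtain g1 g2 C0' where G0: "taylor2 \<sigma> U g g1 g2 C0'" using assms taylor2_on_def by blast
  obtain D1 where D1: "\<And>x. x \<in> U \<Longrightarrow> norm (f x) \<le> D1" using taylor2_on_bounded[OF assms(1) U \<sigma>(1)] by blast
  obtain D2 where D2: "\<And>x. x \<in> U \<Longrightarrow> norm (g x) \<le> D2" using taylor2_on_bounded[OF assms(2) U \<sigma>(1)] by blast
  define C where "C = Max {C0, C0', D1, D2}"
  have F: "taylor2 \<sigma> U f f1 f2 C" and G: "taylor2 \<sigma> U g g1 g2 C"
    by (rule taylor2_mono[OF F0], auto simp: C_def, rule taylor2_mono[OF G0], auto simp: C_def)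
  have fb: "norm (f x) \<le> C" and gb: "norm (g x) \<le> C" if "x \<in> U" for x
    using D1[OF that] D2[OF that] by (auto simp: C_def)
  note C = taylor2D(1)[OF F]
  interpret h: bounded_bilinear h by fact
  obtain K where K: "0 < K" "\<And>x y. norm (h x y) \<le> norm x * norm y * K" using h.pos_bounded by blast
  have hb: "norm (h x y) \<le> a * b * K" if "norm x \<le> a" "norm y \<le> b" for x y a b
  proof -
    have "0 \<le> a" using that norm_ge_zero order_trans by blast
    then show ?thesis using order_trans[OF K(2) mult_right_mono[OF mult_mono[OF that]]] K by auto
  qed
  have "taylor2 \<sigma> U (\<lambda>x. h (f x) (g x)) (\<lambda>x w. h (f x) (g1 x w) + h (f1 x w) (g x))
     (\<lambda>x v w. h (f x) (g2 x v w) + h (f1 x v) (g1 x w) + h (f2 x v w) (g x)) (7 * C * C * K)"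
    unfolding taylor2_def
  proof (intro conjI ballI allI)
    show "0 \<le> 7 * C * C * K" using C K by simp
    fix x assume x: "x \<in> U"
    interpret a1: bounded_linear "f1 x" using taylor2D(2)[OF F x] .
    interpret b1: bounded_linear "g1 x" using taylor2D(2)[OF G x] .
    interpret a: bounded_bilinear "f2 x" using taylor2D(3)[OF F x] .
    interpret b: bounded_bilinear "g2 x" using taylor2D(3)[OF G x] .
    show "bounded_linear (\<lambda>w. h (f x) (g1 x w) + h (f1 x w) (g x))"
      by (intro bounded_linear_add bounded_linear_compose[OF h.bounded_linear_right b1.bounded_linear_axioms]
         bounded_linear_compose[OF h.bounded_linear_left a1.bounded_linear_axioms])
    have CCK: "0 \<le> C * C * K" using C K by simp
    show "norm (h (f x) (g1 x w) + h (f1 x w) (g x)) \<le> 7 * C * C * K * norm w" for w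
    proof -
      have "norm (h (f x) (g1 x w) + h (f1 x w) (g x)) \<le> C * (C * norm w) * K + (C * norm w) * C * K"
        by (intro norm_triangle_mono hb fb gb x taylor2D(4)[OF F x] taylor2D(4)[OF G x])
      also have "\<dots> = 2 * (C * C * K * norm w)" by simp
      also have "\<dots> \<le> 7 * (C * C * K * norm w)" using CCK by (intro mult_right_mono) auto
      finally show ?thesis by (simp add: mult_ac)
    qed
    show n2: "norm (h (f x) (g2 x v w) + h (f1 x v) (g1 x w) + h (f2 x v w) (g x)) \<le> 7 * C * C * K * norm v * norm w" for v w
    proof -
      have "norm (h (f x) (g2 x v w) + h (f1 x v) (g1 x w) + h (f2 x v w) (g x))
        \<le> C * (C * norm v * norm w) * K + (C * norm v) * (C * norm w) * K + (C * norm v * norm w) * C * K"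
        by (intro norm_triangle_mono hb fb gb x taylor2D(4)[OF F x] taylor2D(4)[OF G x] taylor2D(5)[OF F x] taylor2D(5)[OF G x])
      also have "\<dots> = 3 * (C * C * K * norm v * norm w)" by simp
      also have "\<dots> \<le> 7 * (C * C * K * norm v * norm w)" using CCK by (intro mult_right_mono) auto
      finally show ?thesis by (simp add: mult_ac)
    qed
    show "bounded_bilinear (\<lambda>v w. h (f x) (g2 x v w) + h (f1 x v) (g1 x w) + h (f2 x v w) (g x))"
      by (unfold_locales, auto simp: h.add_left h.add_right h.scaleR_left h.scaleR_right a1.add a1.scaleR b1.add b1.scaleR
        a.add_left a.add_right a.scaleR_left a.scaleR_right b.add_left b.add_right b.scaleR_left b.scaleR_right
        scaleR_add_right) (use n2 in \<open>auto intro!: exI[of _ "7 * C * C * K"] simp: mult_ac\<close>)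
    fix y assume y: "y \<in> U"
    define w where "w = y - x"
    have w1: "norm w \<le> 1" using U x y by (auto simp: w_def small_diam_def)
    define F1 F2 G1 G2 where FG: "F1 = f1 x w" "F2 = f2 x w w" "G1 = g1 x w" "G2 = g2 x w w"
    define ef eg where e: "ef = f y - f x - F1 - F2" "eg = g y - g x - G1 - G2"
    define P where "P = norm w powr \<sigma>"
    have P0: "0 \<le> P" by (simp add: P_def)
    have ef: "norm ef \<le> C * P" using taylor2D(6)[OF F x y] by (simp add: e FG w_def P_def)
    have eg: "norm eg \<le> C * P" using taylor2D(6)[OF G x y] by (simp add: e FG w_def P_def)
    have n: "norm F1 \<le> C * norm w" "norm G1 \<le> C * norm w" "norm F2 \<le> C * (norm w)^2" "norm G2 \<le> C * (norm w)^2"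
      using taylor2D(4)[OF F x, of w] taylor2D(4)[OF G x, of w] taylor2D(5)[OF F x, of w w] taylor2D(5)[OF G x, of w w]
      by (auto simp: FG power2_eq_square mult.assoc)
    have "norm w powr 3 \<le> P" unfolding P_def using w1 \<sigma> powr_mono'[of \<sigma> 3 "norm w"] by auto
    then have w3: "norm w ^ 3 \<le> P" by simp
    moreover have "norm w ^ 4 \<le> norm w ^ 3" using w1 by (intro power_decreasing) auto
    ultimately have w4: "norm w ^ 4 \<le> P" by simp
    have c1: "norm F1 \<le> C" using n(1) w1 C mult_left_mono[of "norm w" 1 C] by linarith
    have eq: "h (f y) (g y) - h (f x) (g x) - (h (f x) G1 + h F1 (g x)) - (h (f x) G2 + h F1 G1 + h F2 (g x))
       = h ef (g y) + h (f x) eg + h F1 eg + h F2 eg + h F1 G2 + h F2 G1 + h F2 G2"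
      unfolding e by (simp add: h.add_left h.add_right h.diff_left h.diff_right algebra_simps)
    have "(norm w)^2 \<le> 1" using w1 by (simp add: power_le_one)
    then have c2: "norm F2 \<le> C" using n(3) C mult_left_mono[of "(norm w)^2" 1 C] by linarith
    have "norm (h (f y) (g y) - h (f x) (g x) - (h (f x) G1 + h F1 (g x)) - (h (f x) G2 + h F1 G1 + h F2 (g x)))
       \<le> (C * P) * C * K + C * (C * P) * K + C * (C * P) * K + C * (C * P) * K
         + (C * norm w) * (C * (norm w)^2) * K + (C * (norm w)^2) * (C * norm w) * K + (C * (norm w)^2) * (C * (norm w)^2) * K"
      unfolding eq by (intro norm_triangle_mono hb ef eg n c1 c2 fb gb x y)
    also have "\<dots> = C * C * K * (4 * P + 2 * norm w ^ 3 + norm w ^ 4)"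
      by (simp add: algebra_simps power2_eq_square power3_eq_cube power4_eq_xxxx)
    also have "\<dots> \<le> C * C * K * (7 * P)" using w3 w4 CCK by (intro mult_left_mono) auto
    finally show "norm (h (f y) (g y) - h (f x) (g x) - (h (f x) (g1 x (y - x)) + h (f1 x (y - x)) (g x)) -
            (h (f x) (g2 x (y - x) (y - x)) + h (f1 x (y - x)) (g1 x (y - x)) + h (f2 x (y - x) (y - x)) (g x)))
         \<le> 7 * C * C * K * norm (y - x) powr \<sigma>"
      by (simp add: FG w_def P_def mult_ac)
  qed
  then show ?thesis unfolding taylor2_on_def by blast
qed

text \<open>A quantitative inverse function theorem: besides local solvability it gives lower bounds
  for increments of \<open>G\<close> and for \<open>G1\<close>, the two inputs of the implicit
  function lemma below. Both hold because \<open>G1\<close> stays within \<open>B / 2\<close> of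
  \<open>G1 Y0\<close>, which is bounded below by \<open>B\<close>.\<close>

lemma taylor2_local_inverse:
  fixes G :: "'e::euclidean_space \<Rightarrow> 'e"
  assumes T: "taylor2 \<sigma> U G G1 G2 C" and \<sigma>: "1 < \<sigma>" "\<sigma> \<le> 3" and U: "open U" "Y0 \<in> U"
    and inj: "\<And>\<eta>. G1 Y0 \<eta> = 0 \<Longrightarrow> \<eta> = 0" and \<epsilon>: "0 < \<epsilon>"
  shows "\<exists>R c r. 0 < R \<and> R \<le> \<epsilon> \<and> 0 < c \<and> 0 < r \<and> ball Y0 R \<subseteq> U \<and>
     (\<forall>Y\<in>ball Y0 R. \<forall>Y'\<in>ball Y0 R. c * norm (Y' - Y) \<le> norm (G Y' - G Y)) \<and>
     (\<forall>Y\<in>ball Y0 R. \<forall>\<eta>. c * norm \<eta> \<le> norm (G1 Y \<eta>)) \<and> ball (G Y0) r \<subseteq> G ` ball Y0 R"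
proof -
  have bl: "bounded_linear (G1 Y)" if "Y \<in> U" for Y using taylor2D(2)[OF T that] .
  have lin0: "linear (G1 Y0)" using bl U bounded_linear.linear by blast
  have inj0: "inj (G1 Y0)" using inj linear_injective_0[OF lin0] by blast
  obtain B where B: "B > 0" "\<And>x. B * norm x \<le> norm (G1 Y0 x)"
    using linear_inj_bounded_below_pos[OF lin0 inj0] by blast
  obtain R0 where R0: "R0 > 0" "ball Y0 R0 \<subseteq> U" "\<And>x w. x \<in> ball Y0 R0 \<Longrightarrow> norm (G1 x w - G1 Y0 w) \<le> B / 2 * norm w"
    using taylor2_derivative_continuous[OF T \<sigma> U, of "B/2"] B by auto
  define R where "R = min R0 \<epsilon>"
  have R: "R > 0" "R \<le> \<epsilon>" "ball Y0 R \<subseteq> ball Y0 R0" using R0 \<epsilon> by (auto simp: R_def)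
  define c where "c = B / 2"
  have l: "c * norm \<eta> \<le> norm (G1 Y \<eta>)" if "Y \<in> ball Y0 R" for Y \<eta>
  proof -
    have "Y \<in> ball Y0 R0" using that R by blast
    from R0(3)[OF this, of \<eta>] B(2)[of \<eta>] norm_triangle_ineq2[of "G1 Y0 \<eta>" "G1 Y \<eta>"]
    have "B * norm \<eta> - B / 2 * norm \<eta> \<le> norm (G1 Y \<eta>)" by (simp add: norm_minus_commute)
    then show ?thesis by (simp add: c_def algebra_simps)
  qed
  have m: "c * norm (Y' - Y) \<le> norm (G Y' - G Y)" if Y: "Y \<in> ball Y0 R" "Y' \<in> ball Y0 R" for Y Y'
  proof -
    have d: "(G has_derivative G1 x) (at x within ball Y0 R)" if "x \<in> ball Y0 R" for x
      using taylor2_has_derivative[OF T \<sigma>(1) U(1)] that R R0 has_derivative_at_withinI by blast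
    have "norm (G Y' - G Y - G1 Y0 (Y' - Y)) \<le> norm (Y' - Y) * c"
    proof (rule differentiable_bound_linearization[of Y Y' "ball Y0 R" G G1])
      show "Y + t *\<^sub>R (Y' - Y) \<in> ball Y0 R" if "t \<in> {0..1}" for t
      proof -
        have "(1 - t) *\<^sub>R Y + t *\<^sub>R Y' \<in> ball Y0 R"
          using that Y by (intro convexD[OF convex_ball]) auto
        then show ?thesis by (simp add: algebra_simps)
      qed
      show "onorm (G1 x - G1 Y0) \<le> c" if "x \<in> ball Y0 R" for x
        using R0(3)[of x] R that B by (intro onorm_bound) (auto simp: c_def)
    qed (use d R in auto)
    then have "norm (G1 Y0 (Y' - Y)) - norm (G Y' - G Y) \<le> norm (Y' - Y) * c"
      using norm_triangle_ineq3[of "G1 Y0 (Y' - Y)" "G Y' - G Y"] by (simp add: norm_minus_commute abs_le_iff)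
    then show ?thesis using B(2)[of "Y' - Y"] by (simp add: c_def algebra_simps)
  qed
  have "bij (G1 Y0)" using linear_injective_imp_surjective[OF lin0 inj0] inj0 by (simp add: bij_def)
  obtain g' where g': "linear g'" "G1 Y0 \<circ> g' = id"
    using linear_surjective_right_inverse[OF lin0 linear_injective_imp_surjective[OF lin0 inj0]] by blast
  have "G Y0 \<in> interior (G ` ball Y0 R)"
  proof (rule sussmann_open_mapping[OF U(1) _ U(2) taylor2_has_derivative[OF T \<sigma>(1) U] _ g'(2)])
    show "continuous_on U G"
      using taylor2_has_derivative[OF T \<sigma>(1) U(1)]
      by (meson continuous_at_imp_continuous_on has_derivative_continuous)
    show "bounded_linear g'" using g' linear_conv_bounded_linear by blast
    show "Y0 \<in> interior (ball Y0 R)" using R by simp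
  qed (use R R0 in auto)
  then obtain r where "r > 0" "ball (G Y0) r \<subseteq> G ` ball Y0 R" using mem_interior by blast
  then show ?thesis using R R0 B l m by (intro exI[of _ R] exI[of _ c] exI[of _ r]) (auto simp: c_def)
qed

text \<open>Formal differentiation of \<open>G (y z) = a + A z\<close> predicts the expansion of
  \<open>y\<close>: with \<open>H\<close> inverse to \<open>G1 (y z)\<close>, first order part
  \<open>H A\<close> and second order part \<open>- H G2\<close> evaluated at the first order part
  twice. The proof inserts the increment of \<open>y\<close> into the expansion of \<open>G\<close>
  and solves with \<open>H\<close>.\<close>

lemma taylor2_on_implicit:
  fixes G :: "'e::euclidean_space \<Rightarrow> 'e" and y :: "'d::euclidean_space \<Rightarrow> 'e"
  assumes T: "taylor2 \<sigma> B G G1 G2 C" and \<sigma>: "1 < \<sigma>" "\<sigma> \<le> 3" and c: "0 < c"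
    and lip: "\<And>Y Y'. Y \<in> B \<Longrightarrow> Y' \<in> B \<Longrightarrow> c * norm (Y' - Y) \<le> norm (G Y' - G Y)"
    and inj: "\<And>Y \<eta>. Y \<in> B \<Longrightarrow> c * norm \<eta> \<le> norm (G1 Y \<eta>)"
    and D: "small_diam D" and A: "bounded_linear A"
    and y: "\<And>z. z \<in> D \<Longrightarrow> y z \<in> B" "\<And>z. z \<in> D \<Longrightarrow> G (y z) = a + A z"
  shows "taylor2_on \<sigma> D y"
proof -
  interpret A: bounded_linear A by fact
  obtain K0 where K0: "0 < K0" "\<And>x. norm (A x) \<le> norm x * K0" using A.pos_bounded by blast
  \<comment> \<open>One constant at least 1 that dominates all others, so that every estimate below
    becomes a power of \<open>M\<close>.\<close>
  define M where "M = K0 / c + 1 + C + C / c + 1 / c"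
  note C = taylor2D(1)[OF T]
  have M1: "1 \<le> M" and MK: "K0 / c \<le> M" and MC: "C \<le> M" "C / c \<le> M" "1 / c \<le> M" using c K0 C by (auto simp: M_def)
  define H where "H z = inv (G1 (y z))" for z
  have Hlin: "linear (H z)" and HG: "\<And>\<eta>. H z (G1 (y z) \<eta>) = \<eta>" and GH: "\<And>\<eta>. G1 (y z) (H z \<eta>) = \<eta>"
    and Hb: "\<And>\<eta>. norm (H z \<eta>) \<le> norm \<eta> / c" if z: "z \<in> D" for z
  proof -
    have lin: "linear (G1 (y z))" using taylor2D(2)[OF T y(1)[OF z]] bounded_linear.linear by blast
    have "\<eta> = 0" if "G1 (y z) \<eta> = 0" for \<eta> using inj[OF y(1)[OF z], of \<eta>] that c by (simp add: mult_le_0_iff)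
    then have i: "inj (G1 (y z))" using linear_injective_0[OF lin] by blast
    have s: "surj (G1 (y z))" using linear_injective_imp_surjective[OF lin i] by simp
    show "H z (G1 (y z) \<eta>) = \<eta>" for \<eta> using i by (simp add: H_def)
    show GH: "G1 (y z) (H z \<eta>) = \<eta>" for \<eta> using s by (simp add: H_def surj_f_inv_f)
    show "linear (H z)" using inj_linear_imp_inv_linear[OF lin i] by (simp add: H_def)
    show "norm (H z \<eta>) \<le> norm \<eta> / c" for \<eta>
      using inj[OF y(1)[OF z], of "H z \<eta>"] c by (simp add: GH field_simps)
  qed
  define f1 where "f1 z w = H z (A w)" for z w
  define f2 where "f2 z v w = - H z (G2 (y z) (f1 z v) (f1 z w))" for z v w
  have f1b: "norm (f1 z w) \<le> M * norm w" if z: "z \<in> D" for z w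
  proof -
    have "norm (f1 z w) \<le> (norm w * K0) / c"
      unfolding f1_def using order_trans[OF Hb[OF z] divide_right_mono[OF K0(2)]] c by auto
    also have "\<dots> = K0 / c * norm w" by simp
    also have "\<dots> \<le> M * norm w" using MK by (intro mult_right_mono) auto
    finally show ?thesis .
  qed
  have "taylor2 \<sigma> D y f1 f2 (M + M^5 + 4 * M ^ 7)"
    unfolding taylor2_def
  proof (intro conjI ballI allI)
    show "0 \<le> M + M^5 + 4 * M ^ 7" using M1 by simp
    fix z assume z: "z \<in> D"
    interpret b: bounded_bilinear "G2 (y z)" using taylor2D(3)[OF T y(1)[OF z]] .
    have f1l: "linear (f1 z)" using linear_compose[OF A.linear_axioms Hlin[OF z]] by (simp add: f1_def[abs_def] comp_def)
    then show "bounded_linear (f1 z)" by (simp add: linear_conv_bounded_linear)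
    show "norm (f1 z w) \<le> (M + M^5 + 4 * M ^ 7) * norm w" for w
      using order_trans[OF f1b[OF z] mult_right_mono[of M "M + M^5 + 4 * M ^ 7"]] M1 by simp
    show n2: "norm (f2 z v w) \<le> (M + M^5 + 4 * M ^ 7) * norm v * norm w" for v w
    proof -
      have "norm (f2 z v w) \<le> norm (G2 (y z) (f1 z v) (f1 z w)) / c" unfolding f2_def using Hb[OF z] by simp
      also have "\<dots> \<le> (C * norm (f1 z v) * norm (f1 z w)) / c"
        using taylor2D(5)[OF T y(1)[OF z]] c by (intro divide_right_mono) auto
      also have "\<dots> = C / c * (norm (f1 z v) * norm (f1 z w))" by simp
      also have "\<dots> \<le> M * ((M * norm v) * (M * norm w))"
        using MC f1b[OF z] M1 C c by (intro mult_mono) auto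
      also have "\<dots> = M^3 * (norm v * norm w)" by (simp add: power3_eq_cube)
      also have "\<dots> \<le> (M + M^5 + 4 * M ^ 7) * (norm v * norm w)"
        using M1 power_increasing[of 3 5 M] by (intro mult_right_mono) (auto intro: order_trans)
      finally show ?thesis by (simp add: mult.assoc)
    qed
    show "bounded_bilinear (f2 z)"
      by (unfold_locales, auto simp: f2_def linear_add[OF f1l] linear_cmul[OF f1l] b.add_left b.add_right b.scaleR_left b.scaleR_right
         linear_add[OF Hlin[OF z]] linear_cmul[OF Hlin[OF z]])
        (use n2 in \<open>auto simp: f2_def intro!: exI[of _ "M + M^5 + 4 * M ^ 7"] simp: mult_ac\<close>)
    fix z' assume z': "z' \<in> D"
    define w where "w = z' - z"
    define \<eta> where "\<eta> = y z' - y z"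
    define \<eta>1 where "\<eta>1 = f1 z w"
    define e where "e = A w - G1 (y z) \<eta> - G2 (y z) \<eta> \<eta>"
    define P where "P = norm w powr \<sigma>"
    have w1: "norm w \<le> 1" using D z z' by (auto simp: w_def small_diam_def)
    have Gd: "G (y z') - G (y z) = A w" using y(2)[OF z] y(2)[OF z'] by (simp add: w_def A.diff)
    have \<eta>b: "norm \<eta> \<le> M * norm w"
    proof -
      have "c * norm \<eta> \<le> norm w * K0" using lip[OF y(1)[OF z] y(1)[OF z']] K0(2)[of w] Gd by (simp add: \<eta>_def)
      then have "norm \<eta> \<le> K0 / c * norm w" using c by (simp add: field_simps)
      also have "\<dots> \<le> M * norm w" using MK by (intro mult_right_mono) auto
      finally show ?thesis .
    qed
    have powb: "norm \<eta> powr \<sigma> \<le> M^3 * P"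
    proof -
      have "norm \<eta> powr \<sigma> \<le> (M * norm w) powr \<sigma>" using \<eta>b \<sigma> by (intro powr_mono2) auto
      also have "\<dots> = M powr \<sigma> * P" using M1 by (simp add: powr_mult P_def)
      also have "M powr \<sigma> \<le> M powr 3" using M1 \<sigma> by (intro powr_mono) auto
      finally show ?thesis using M1 by (simp add: P_def mult_right_mono)
    qed
    have eb: "norm e \<le> M^4 * P"
    proof -
      have "norm e \<le> C * norm \<eta> powr \<sigma>"
        using taylor2D(6)[OF T y(1)[OF z] y(1)[OF z']] Gd by (simp add: e_def \<eta>_def)
      also have "\<dots> \<le> M * (M^3 * P)" using MC powb C M1 by (intro mult_mono) auto
      finally show ?thesis by (simp add: power_numeral_reduce mult_ac)
    qed
    have \<eta>1b: "norm \<eta>1 \<le> M * norm w" unfolding \<eta>1_def using f1b[OF z] .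
    have H: "H z (A w) = \<eta> + H z (G2 (y z) \<eta> \<eta>) + H z e"
      using HG[OF z, of \<eta>] by (simp add: e_def linear_diff[OF Hlin[OF z]])
    \<comment> \<open>Only the product with \<open>norm w\<close> is estimated: \<eta> - \<eta>1 is
      of order |w|^2 + |w|^\<sigma>, it enters below multiplied by vectors of length O(|w|), and
      |w|^3 <= \<open>P\<close>.\<close>
    have dif: "norm (\<eta> - \<eta>1) * norm w \<le> 2 * M^5 * P"
    proof -
      have "\<eta> - \<eta>1 = - H z (G2 (y z) \<eta> \<eta>) - H z e" using H by (simp add: \<eta>1_def f1_def)
      then have "norm (\<eta> - \<eta>1) \<le> norm (H z (G2 (y z) \<eta> \<eta>)) + norm (H z e)" by (metis norm_triangle_ineq4 norm_minus_cancel)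
      also have "\<dots> \<le> (C * norm \<eta> * norm \<eta>) / c + norm e / c"
        using Hb[OF z, of e] order_trans[OF Hb[OF z, of "G2 (y z) \<eta> \<eta>"] divide_right_mono[OF taylor2D(5)[OF T y(1)[OF z], of \<eta> \<eta>], of c]] c
        by (intro add_mono) auto
      also have "\<dots> = C / c * (norm \<eta> * norm \<eta>) + 1 / c * norm e" by simp
      also have "\<dots> \<le> M * ((M * norm w) * (M * norm w)) + M * (M^4 * P)"
        using MC \<eta>b eb M1 C c by (intro add_mono mult_mono) auto
      finally have "norm (\<eta> - \<eta>1) * norm w \<le> (M * ((M * norm w) * (M * norm w)) + M * (M^4 * P)) * norm w"
        by (rule mult_right_mono) simp
      also have "\<dots> = M^3 * norm w ^ 3 + M^5 * P * norm w"
        by (simp add: power_numeral_reduce algebra_simps)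
      also have "\<dots> \<le> M^5 * P + M^5 * P * 1"
      proof (intro add_mono mult_mono)
        show "M^3 \<le> M^5" using M1 by (intro power_increasing) auto
        show "norm w ^ 3 \<le> P" using w1 \<sigma> powr_mono'[of \<sigma> 3 "norm w"] by (auto simp: P_def)
      qed (use M1 w1 in \<open>auto simp: P_def\<close>)
      finally show ?thesis by (simp add: mult_ac)
    qed
    have eq: "y z' - y z - f1 z w - f2 z w w = - H z (G2 (y z) (\<eta> - \<eta>1) \<eta> + G2 (y z) \<eta>1 (\<eta> - \<eta>1)) - H z e"
    proof -
      have "G2 (y z) (\<eta> - \<eta>1) \<eta> + G2 (y z) \<eta>1 (\<eta> - \<eta>1) = G2 (y z) \<eta> \<eta> - G2 (y z) \<eta>1 \<eta>1"
        by (simp add: b.diff_left b.diff_right)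
      moreover have "y z' - y z = \<eta>" "f2 z w w = - H z (G2 (y z) \<eta>1 \<eta>1)" "f1 z w = H z (A w)"
        by (auto simp: \<eta>_def f2_def \<eta>1_def f1_def)
      ultimately show ?thesis using H by (simp add: linear_diff[OF Hlin[OF z]])
    qed
    have "norm (y z' - y z - f1 z w - f2 z w w) \<le>
       norm (H z (G2 (y z) (\<eta> - \<eta>1) \<eta> + G2 (y z) \<eta>1 (\<eta> - \<eta>1))) + norm (H z e)"
      unfolding eq by (metis norm_triangle_ineq4 norm_minus_cancel)
    also have "\<dots> \<le> (C * norm (\<eta> - \<eta>1) * norm \<eta> + C * norm \<eta>1 * norm (\<eta> - \<eta>1)) / c + norm e / c"
      using c by (intro add_mono Hb[OF z] order_trans[OF Hb[OF z]] divide_right_mono norm_triangle_mono taylor2D(5)[OF T y(1)[OF z]]) auto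
    also have "\<dots> = C / c * (norm (\<eta> - \<eta>1) * (norm \<eta> + norm \<eta>1)) + 1 / c * norm e"
      by (simp add: algebra_simps add_divide_distrib)
    also have "\<dots> \<le> M * (norm (\<eta> - \<eta>1) * (M * norm w + M * norm w)) + M * (M^4 * P)"
      using MC \<eta>b \<eta>1b eb M1 C c by (intro add_mono mult_mono) auto
    also have "\<dots> = 2 * M^2 * (norm (\<eta> - \<eta>1) * norm w) + M^5 * P"
      by (simp add: power_numeral_reduce algebra_simps)
    also have "\<dots> \<le> 2 * M^2 * (2 * M^5 * P) + M^5 * P"
      using dif M1 by (intro add_right_mono mult_left_mono) auto
    also have "\<dots> = (4 * M^7 + M^5) * P" by (simp add: power_numeral_reduce algebra_simps)
    finally have "norm (y z' - y z - f1 z w - f2 z w w) \<le> (4 * M^7 + M^5) * P" .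
    then show "norm (y z' - y z - f1 z (z' - z) - f2 z (z' - z) (z' - z)) \<le> (M + M^5 + 4 * M ^ 7) * norm (z' - z) powr \<sigma>"
      using M1 mult_right_mono[of "4 * M^7 + M^5" "M + M^5 + 4 * M ^ 7" P] by (auto simp: w_def P_def)
  qed
  then show ?thesis unfolding taylor2_on_def by blast
qed

section \<open>Boundaries of Hoelder class\<close>

lemma linear_bound_Basis:
  fixes h :: "'a::euclidean_space \<Rightarrow> 'b::real_normed_vector" and m :: real
  assumes h: "linear h" and m: "\<And>b. b \<in> Basis \<Longrightarrow> norm (h b) \<le> m"
  shows "norm (h w) \<le> DIM('a) * m * norm w"
proof -
  have "h w = h (\<Sum>b\<in>Basis. (w \<bullet> b) *\<^sub>R b)" by (simp add: euclidean_representation)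
  also have "\<dots> = (\<Sum>b\<in>Basis. (w \<bullet> b) *\<^sub>R h b)" by (simp add: linear_sum[OF h] linear_cmul[OF h])
  finally have e: "h w = (\<Sum>b\<in>Basis. (w \<bullet> b) *\<^sub>R h b)" .
  have "norm (h w) \<le> (\<Sum>b\<in>Basis. norm ((w \<bullet> b) *\<^sub>R h b))" unfolding e by (rule norm_sum)
  also have "\<dots> \<le> (\<Sum>b\<in>(Basis::'a set). norm w * m)"
    using m by (intro sum_mono) (auto intro!: mult_mono Basis_le_norm)
  finally show ?thesis by (simp add: mult_ac)
qed

text \<open>The mean value inequality on a segment turns the Hoelder bound for the derivative into
  the remainder, with quadratic part 0. The bound is required along \<open>Basis\<close> only, since
  this is what iterated directional derivatives provide.\<close>

lemma taylor2_of_holder_derivative: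
  fixes f :: "'a::euclidean_space \<Rightarrow> real"
  assumes U: "convex U" "open U" "small_diam U" and \<epsilon>: "0 < \<epsilon>"
    and d: "\<And>x. x \<in> U \<Longrightarrow> (f has_derivative f' x) (at x)"
    and h: "\<And>x y b. x \<in> U \<Longrightarrow> y \<in> U \<Longrightarrow> b \<in> Basis \<Longrightarrow> \<bar>f' x b - f' y b\<bar> \<le> M * dist x y powr \<epsilon>"
  shows "taylor2_on (1 + \<epsilon>) U f"
proof (cases "U = {}")
  case True
  then show ?thesis unfolding taylor2_on_def taylor2_def by auto
next
  case False
  then obtain x0 where x0: "x0 \<in> U" by auto
  define D where "D = Max ((\<lambda>b. \<bar>f' x0 b\<bar>) ` Basis)"
  define K where "K = DIM('a) * (\<bar>D\<bar> + \<bar>M\<bar>)"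
  have lin: "linear (f' x)" if "x \<in> U" for x using d[OF that] has_derivative_linear by blast
  have "taylor2 (1 + \<epsilon>) U f f' (\<lambda>x v w. 0) K"
    unfolding taylor2_def
  proof (intro conjI ballI allI)
    show K0: "0 \<le> K" by (simp add: K_def)
    fix x assume x: "x \<in> U"
    show "bounded_linear (f' x)" using d[OF x] has_derivative_bounded_linear by blast
    show "bounded_bilinear (\<lambda>v w. 0::real)" by (auto simp: bounded_bilinear_def intro!: exI[of _ 0])
    show "norm (0::real) \<le> K * norm v * norm w" for v w :: 'a using K0 by simp
    have fb: "norm (f' x b) \<le> \<bar>D\<bar> + \<bar>M\<bar>" if b: "b \<in> Basis" for b
    proof -
      have "\<bar>f' x0 b\<bar> \<le> D" unfolding D_def using b by (intro Max_ge) auto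
      moreover have "M * dist x x0 powr \<epsilon> \<le> \<bar>M\<bar> * 1"
        using U(3) x x0 \<epsilon> by (intro mult_mono powr_le1) (auto simp: small_diam_def dist_norm)
      ultimately show ?thesis using h[OF x x0 b] by simp
    qed
    show "norm (f' x w) \<le> K * norm w" for w
      using linear_bound_Basis[OF lin[OF x] fb, of w] unfolding K_def by simp
    fix y assume y: "y \<in> U"
    let ?B = "DIM('a) * \<bar>M\<bar> * norm (y - x) powr \<epsilon>"
    have seg: "closed_segment x y \<subseteq> U" using U(1) x y closed_segment_subset by blast
    have "norm (f y - f x - f' x (y - x)) \<le> norm (y - x) * ?B"
    proof (rule differentiable_bound_linearization[of x y "closed_segment x y" f f'])
      show "x + t *\<^sub>R (y - x) \<in> closed_segment x y" if "t \<in> {0..1}" for t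
        using that by (auto simp: in_segment algebra_simps intro!: exI[of _ t])
      show "(f has_derivative f' u) (at u within closed_segment x y)" if "u \<in> closed_segment x y" for u
        using d that seg has_derivative_at_withinI by blast
      fix u assume u: "u \<in> closed_segment x y"
      then have uU: "u \<in> U" using seg by auto
      have ux: "norm (u - x) \<le> norm (y - x)"
        using u dist_in_closed_segment[of u x y] by (simp add: dist_norm norm_minus_commute)
      have l: "linear (f' u - f' x)" using lin[OF uU] lin[OF x] by (auto simp: linear_iff algebra_simps)
      show "onorm (f' u - f' x) \<le> ?B"
      proof (rule onorm_bound)
        show "norm ((f' u - f' x) w) \<le> ?B * norm w" for w
        proof -
          have "norm ((f' u - f' x) w) \<le> DIM('a) * (\<bar>M\<bar> * norm (y - x) powr \<epsilon>) * norm w"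
          proof (rule linear_bound_Basis[OF l])
            fix b :: 'a assume b: "b \<in> Basis"
            have "norm ((f' u - f' x) b) \<le> M * dist u x powr \<epsilon>" using h[OF uU x b] by simp
            also have "\<dots> \<le> \<bar>M\<bar> * norm (y - x) powr \<epsilon>"
              using ux \<epsilon> by (intro mult_mono powr_mono2) (auto simp: dist_norm)
            finally show "norm ((f' u - f' x) b) \<le> \<bar>M\<bar> * norm (y - x) powr \<epsilon>" .
          qed
          then show ?thesis by (simp add: mult.assoc)
        qed
      qed simp
    qed simp
    also have "\<dots> = DIM('a) * \<bar>M\<bar> * norm (y - x) powr (1 + \<epsilon>)"
      using powr_small[of "1 + \<epsilon>" "norm (y - x)"] \<epsilon> by (simp add: mult_ac)
    also have "\<dots> \<le> K * norm (y - x) powr (1 + \<epsilon>)" unfolding K_def by (intro mult_right_mono mult_left_mono) auto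
    finally show "norm (f y - f x - f' x (y - x) - 0) \<le> K * norm (y - x) powr (1 + \<epsilon>)" by simp
  qed
  then show ?thesis unfolding taylor2_on_def by blast
qed

lemma taylor2_on_of_gradient:
  fixes f :: "'a::euclidean_space \<Rightarrow> real"
  assumes T: "taylor2_on \<sigma> U g" and \<sigma>: "0 < \<sigma>" "\<sigma>' \<le> \<sigma> + 1" "\<sigma>' \<le> 3" and U: "convex U" "open U" "small_diam U"
    and d: "\<And>x. x \<in> U \<Longrightarrow> (f has_derivative (\<lambda>w. g x \<bullet> w)) (at x)"
  shows "taylor2_on \<sigma>' U f"
proof -
  obtain D where D: "\<forall>x\<in>U. norm (g x) \<le> D" using taylor2_on_bounded[OF T U(3) \<sigma>(1)] by blast
  obtain g1 g2 C where T': "taylor2 \<sigma> U g g1 g2 C" using T taylor2_on_def by blast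
  show ?thesis unfolding taylor2_on_def
    using taylor2_of_gradient[OF T' \<sigma> U(1,2) d, of D] D U(3) by (auto simp: small_diam_def)
qed

definition grad :: "('a::euclidean_space \<Rightarrow> real) \<Rightarrow> 'a \<Rightarrow> 'a" where
  "grad f x = (\<Sum>b\<in>Basis. ddir f b x *\<^sub>R b)"

lemma grad_has_derivative:
  assumes "f differentiable (at x)"
  shows "(f has_derivative (\<lambda>w. grad f x \<bullet> w)) (at x)"
proof -
  have d: "(f has_derivative frechet_derivative f (at x)) (at x)" using assms frechet_derivative_works by blast
  then have l: "linear (frechet_derivative f (at x))" using has_derivative_linear by blast
  have "frechet_derivative f (at x) w = grad f x \<bullet> w" for w
  proof -
    have "frechet_derivative f (at x) w = frechet_derivative f (at x) (\<Sum>b\<in>Basis. (w \<bullet> b) *\<^sub>R b)"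
      by (simp add: euclidean_representation)
    also have "\<dots> = (\<Sum>b\<in>Basis. (w \<bullet> b) * frechet_derivative f (at x) b)"
      by (simp add: linear_sum[OF l] linear_cmul[OF l])
    also have "\<dots> = grad f x \<bullet> w"
      unfolding grad_def ddir_def inner_sum_left
      by (intro sum.cong) (auto simp: inner_commute)
    finally show ?thesis .
  qed
  then show ?thesis using d by (metis ext)
qed

text \<open>There are only finitely many lists of k + 2 basis vectors, so one radius and one Hoelder
  constant serve them all. For k = 0 the entries of the gradient have Hoelder derivatives; for k = 1
  this holds one level higher and is integrated once.\<close>

lemma Ck_holder_grad_taylor2:
  fixes \<rho> :: "'a::euclidean_space \<Rightarrow> real"
  assumes C: "Ck_holder_on (k + 2) \<epsilon> W \<rho>" and W: "open W" "p \<in> W" and \<epsilon>: "0 < \<epsilon>" "\<epsilon> \<le> 1" and k: "k \<in> {0, 1}"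
  shows "\<exists>R>0. R \<le> 1 / 2 \<and> ball p R \<subseteq> W \<and> taylor2_on (k + 1 + \<epsilon>) (ball p R) (grad \<rho>) \<and>
     (\<forall>x\<in>ball p R. (\<rho> has_derivative (\<lambda>w. grad \<rho> x \<bullet> w)) (at x))"
proof -
  define LL where "LL = {vs. set vs \<subseteq> (Basis::'a set) \<and> length vs = k + 2}"
  have finLL: "finite LL" unfolding LL_def by (rule finite_lists_length_eq) simp
  have dif: "iter_dd \<rho> vs differentiable (at x)" if "length vs < k + 2" "x \<in> W" for vs x
    using C that W(1) unfolding Ck_holder_on_def Ck_on_def
    by (metis at_within_open differentiable_on_def)
  have dd: "(iter_dd \<rho> vs has_derivative (\<lambda>w. iter_dd \<rho> (w # vs) x)) (at x)" if "length vs < k + 2" "x \<in> W" for vs x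
    using dif[OF that] frechet_derivative_works[of "iter_dd \<rho> vs" "at x"] by (simp add: ddir_def)
  have "\<forall>vs\<in>LL. \<exists>r>0. \<exists>M. \<forall>x\<in>ball p r \<inter> W. \<forall>y\<in>ball p r \<inter> W. norm (iter_dd \<rho> vs x - iter_dd \<rho> vs y) \<le> M * dist x y powr \<epsilon>"
    using C W unfolding Ck_holder_on_def locally_holder_on_def LL_def by blast
  then obtain r M where rM: "\<And>vs. vs \<in> LL \<Longrightarrow> r vs > 0"
    "\<And>vs x y. vs \<in> LL \<Longrightarrow> x \<in> ball p (r vs) \<inter> W \<Longrightarrow> y \<in> ball p (r vs) \<inter> W \<Longrightarrow> norm (iter_dd \<rho> vs x - iter_dd \<rho> vs y) \<le> M vs * dist x y powr \<epsilon>"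
    by metis
  obtain R0 where R0: "R0 > 0" "ball p R0 \<subseteq> W" using W openE by blast
  define R where "R = Min (insert (1/2) (insert R0 (r ` LL)))"
  have Rle: "R \<le> 1/2" "R \<le> R0" "\<And>vs. vs \<in> LL \<Longrightarrow> R \<le> r vs" proof -
    have "finite (insert (1/2) (insert R0 (r ` LL)))" using finLL by simp
    note * = Min_le[OF this]
    show "R \<le> 1/2" unfolding R_def by (rule *) simp
    show "R \<le> R0" unfolding R_def by (rule *) simp
    show "R \<le> r vs" if "vs \<in> LL" for vs unfolding R_def by (rule *) (use that in simp)
  qed
  have R: "R > 0" unfolding R_def using finLL rM(1) R0 by (subst Min_gr_iff) auto
  define U where "U = ball p R"
  have UW: "U \<subseteq> W" using R0 Rle by (auto simp: U_def)
  have U: "convex U" "open U" "small_diam U" using small_diam_ball[OF Rle(1)] by (auto simp: U_def)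
  define M0 where "M0 = Max (insert 0 (M ` LL))"
  have hol: "\<bar>iter_dd \<rho> vs x - iter_dd \<rho> vs y\<bar> \<le> M0 * dist x y powr \<epsilon>" if "vs \<in> LL" "x \<in> U" "y \<in> U" for vs x y
  proof -
    have "norm (iter_dd \<rho> vs x - iter_dd \<rho> vs y) \<le> M vs * dist x y powr \<epsilon>"
      using that UW Rle(3)[OF that(1)] by (intro rM(2)) (auto simp: U_def)
    also have "\<dots> \<le> M0 * dist x y powr \<epsilon>" using finLL that by (intro mult_right_mono) (auto simp: M0_def)
    finally show ?thesis by simp
  qed
  have base: "taylor2_on (1 + \<epsilon>) U (iter_dd \<rho> vs)" if vs: "set vs \<subseteq> Basis" "length vs = k + 1" for vs
  proof (rule taylor2_of_holder_derivative[OF U \<epsilon>(1)])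
    show "(iter_dd \<rho> vs has_derivative (\<lambda>w. iter_dd \<rho> (w # vs) x)) (at x)" if "x \<in> U" for x
      using vs that UW by (intro dd) auto
    fix x y b assume "x \<in> U" "y \<in> U" "b \<in> (Basis::'a set)"
    then show "\<bar>iter_dd \<rho> (b # vs) x - iter_dd \<rho> (b # vs) y\<bar> \<le> M0 * dist x y powr \<epsilon>"
      using vs by (intro hol) (auto simp: LL_def)
  qed
  have gradT: "taylor2_on \<sigma> U (grad (iter_dd \<rho> vs))" if "\<And>b. b \<in> Basis \<Longrightarrow> taylor2_on \<sigma> U (iter_dd \<rho> (b # vs))" for \<sigma> vs
    unfolding grad_def
  proof (rule taylor2_on_sum)
    fix b :: 'a assume "b \<in> Basis"
    then show "taylor2_on \<sigma> U (\<lambda>x. ddir (iter_dd \<rho> vs) b x *\<^sub>R b)"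
      using taylor2_on_linear_image[OF that bounded_linear_scaleR_left, of b b] by simp
  qed simp
  have one: "taylor2_on (real k + 1 + \<epsilon>) U (iter_dd \<rho> [b])" if b: "b \<in> Basis" for b
  proof (cases "k = 0")
    case True
    have "taylor2_on (1 + \<epsilon>) U (iter_dd \<rho> [b])" by (rule base) (use b True in auto)
    then show ?thesis using True by (simp del: iter_dd.simps)
  next
    case False
    then have k1: "k = 1" using k by auto
    have "taylor2_on (1 + \<epsilon>) U (iter_dd \<rho> (c # [b]))" if "c \<in> Basis" for c
      by (rule base) (use b that k1 in auto)
    then have g: "taylor2_on (1 + \<epsilon>) U (grad (iter_dd \<rho> [b]))" by (rule gradT)
    have d: "(iter_dd \<rho> [b] has_derivative (\<lambda>w. grad (iter_dd \<rho> [b]) x \<bullet> w)) (at x)" if "x \<in> U" for x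
      by (rule grad_has_derivative, rule dif) (use that UW k1 in auto)
    have "taylor2_on (2 + \<epsilon>) U (iter_dd \<rho> [b])"
      by (rule taylor2_on_of_gradient[OF g _ _ _ U d]) (use \<epsilon> in auto)
    then show ?thesis using k1 by (simp add: add.commute add.left_commute del: iter_dd.simps)
  qed
  have "taylor2_on (real k + 1 + \<epsilon>) U (grad (iter_dd \<rho> []))" by (rule gradT) (rule one)
  then have "taylor2_on (real k + 1 + \<epsilon>) U (grad \<rho>)" by simp
  moreover have "(\<rho> has_derivative (\<lambda>w. grad \<rho> x \<bullet> w)) (at x)" if "x \<in> U" for x
  proof (rule grad_has_derivative)
    show "\<rho> differentiable at x" using dif[of "[]" x] that UW by auto
  qed
  ultimately show ?thesis using R Rle UW unfolding U_def by blast
qed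

section \<open>The signed distance\<close>

text \<open>Testing with the component \<open>w\<close> of \<open>g\<close> orthogonal to
  \<open>u\<close>, tilted slightly towards \<open>u\<close>, forces \<open>w = 0\<close>. Then
  \<open>g\<close> is a nonpositive multiple of \<open>u\<close>, expressed here without dividing by
  a norm.\<close>

lemma multiplier_of_halfspace:
  fixes g u :: "'a::real_inner"
  assumes u: "u \<noteq> 0" and h: "\<And>v. 0 < v \<bullet> u \<Longrightarrow> g \<bullet> v \<le> 0"
  shows "norm u *\<^sub>R g + norm g *\<^sub>R u = 0"
proof -
  define k where "k = (g \<bullet> u) / (u \<bullet> u)"
  define w where "w = g - k *\<^sub>R u"
  have uu: "u \<bullet> u > 0" using u by simp
  have wu: "w \<bullet> u = 0" using uu by (simp add: w_def k_def inner_diff_left)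
  have gw: "g \<bullet> w = w \<bullet> w" using wu by (simp add: w_def inner_diff_left inner_diff_right inner_commute)
  have "w = 0"
  proof (rule ccontr)
    assume "w \<noteq> 0"
    then have ww: "w \<bullet> w > 0" by simp
    define t where "t = (w \<bullet> w) / (2 * (1 + \<bar>g \<bullet> u\<bar>))"
    have t: "t > 0" using ww by (simp add: t_def)
    have "g \<bullet> (w + t *\<^sub>R u) \<le> 0" using t uu wu by (intro h) (simp add: inner_add_left)
    then have "w \<bullet> w \<le> t * \<bar>g \<bullet> u\<bar>" using gw t
      by (smt (verit) abs_le_iff inner_add_right inner_scaleR_right mult_left_mono mult_minus_right)
    also have "\<dots> \<le> t * (1 + \<bar>g \<bullet> u\<bar>)" using t by simp
    also have "\<dots> = (w \<bullet> w) / 2"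
    proof -
      have "1 + \<bar>g \<bullet> u\<bar> \<noteq> 0" using abs_ge_zero[of "g \<bullet> u"] by linarith
      moreover have "x / (2 * A) * A = x / 2" if "A \<noteq> 0" for x A :: real using that by simp
      ultimately show ?thesis unfolding t_def by blast
    qed
    finally show False using ww by simp
  qed
  then have g: "g = k *\<^sub>R u" by (simp add: w_def)
  have "g \<bullet> u \<le> 0" using h[OF uu] .
  then have "k \<le> 0" using uu by (simp add: k_def divide_nonpos_pos)
  then show ?thesis unfolding g by (simp add: scaleR_left_distrib[symmetric] mult.commute)
qed

text \<open>The interior ball touches the boundary at \<open>q\<close>. A direction with positive
  product with \<open>z - q\<close> enters the ball, where \<rho> < 0, so \<rho> cannot increase
  along it. This is the Lagrange condition for a nearest point.\<close>

lemma boundary_multiplier: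
  fixes \<rho> :: "'a::euclidean_space \<Rightarrow> real"
  assumes d: "(\<rho> has_derivative (\<lambda>w. g \<bullet> w)) (at q)" and B: "ball z \<delta> \<inter> N \<subseteq> {x. \<rho> x < 0}"
    and N: "open N" "q \<in> N" and q: "\<rho> q = 0" "dist z q = \<delta>" "0 < \<delta>"
  shows "\<delta> *\<^sub>R g + norm g *\<^sub>R (z - q) = 0"
proof -
  have nu: "norm (z - q) = \<delta>" using q by (simp add: dist_norm)
  have "norm (z - q) *\<^sub>R g + norm g *\<^sub>R (z - q) = 0"
  proof (rule multiplier_of_halfspace)
    show "z - q \<noteq> 0" using q by auto
    fix v assume v: "0 < v \<bullet> (z - q)"
    show "g \<bullet> v \<le> 0"
    proof (rule ccontr)
      assume "\<not> g \<bullet> v \<le> 0"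
      then have gv: "g \<bullet> v > 0" by simp
      have "((\<lambda>t. \<rho> (q + t *\<^sub>R v)) has_derivative (\<lambda>s. g \<bullet> (s *\<^sub>R v))) (at 0)"
        by (rule has_derivative_compose[of "\<lambda>t. q + t *\<^sub>R v" _ _ _ \<rho>]) (use d in \<open>auto intro!: derivative_eq_intros\<close>)
      then have "((\<lambda>t. \<rho> (q + t *\<^sub>R v)) has_field_derivative (g \<bullet> v)) (at 0)"
        by (simp add: has_field_derivative_def mult_commute_abs)
      from DERIV_pos_inc_right[OF this gv] obtain d1 where d1: "d1 > 0"
        "\<And>h. 0 < h \<Longrightarrow> h < d1 \<Longrightarrow> \<rho> q < \<rho> (q + h *\<^sub>R v)" by auto
      obtain e where e: "e > 0" "ball q e \<subseteq> N" using N openE by blast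
      have v0: "v \<noteq> 0" using v by auto
      \<comment> \<open>Three requirements: \<rho> has increased, the point is still in
        \<open>N\<close>, and it lies in the ball around \<open>z\<close>.\<close>
      define h where "h = min (d1 / 2) (min (e / (2 * norm v)) ((v \<bullet> (z - q)) / (v \<bullet> v)))"
      have h: "h > 0" "h < d1" using d1 e v v0 by (auto simp: h_def)
      have "h \<le> e / (2 * norm v)" "h \<le> (v \<bullet> (z - q)) / (v \<bullet> v)" unfolding h_def by linarith+
      then have "h * norm v \<le> e / 2" and hv: "h * (v \<bullet> v) \<le> v \<bullet> (z - q)"
        using v0 by (simp_all add: field_simps)
      then have hN: "q + h *\<^sub>R v \<in> N" using e h \<open>h * norm v \<le> e / 2\<close> by (intro subsetD[OF e(2)]) (auto simp: dist_norm)
      have "(norm (z - (q + h *\<^sub>R v)))\<^sup>2 = \<delta>\<^sup>2 - 2 * h * (v \<bullet> (z - q)) + h * (h * (v \<bullet> v))"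
        unfolding nu[symmetric] power2_norm_eq_inner
        by (simp add: inner_diff_left inner_diff_right inner_add_left inner_add_right inner_commute algebra_simps)
      also have "\<dots> \<le> \<delta>\<^sup>2 - 2 * h * (v \<bullet> (z - q)) + h * (v \<bullet> (z - q))"
        using hv h by (intro add_left_mono mult_left_mono) auto
      also have "\<dots> < \<delta>\<^sup>2" using h v by (simp add: algebra_simps)
      finally have "norm (z - (q + h *\<^sub>R v)) < \<delta>" using q(3) power2_less_imp_less by fastforce
      then have "q + h *\<^sub>R v \<in> ball z \<delta> \<inter> N" using hN by (simp add: dist_norm)
      then have "\<rho> (q + h *\<^sub>R v) < 0" using B by blast
      then show False using d1(2)[OF h] q(1) by simp
    qed
  qed
  then show ?thesis by (simp add: nu)
qed

lemma frontier_defining_zero: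
  fixes \<rho> :: "'a::euclidean_space \<Rightarrow> real"
  assumes "open \<Omega>" "open N" "\<Omega> \<inter> N = {z\<in>N. \<rho> z < 0}" "q \<in> N" "q \<in> frontier \<Omega>" "isCont \<rho> q"
  shows "\<rho> q = 0"
proof (rule antisym)
  have "q \<notin> \<Omega>" using assms by (simp add: frontier_def interior_open)
  then show "0 \<le> \<rho> q" using assms by force
  show "\<rho> q \<le> 0"
  proof (rule ccontr)
    assume "\<not> \<rho> q \<le> 0"
    then have "\<forall>\<^sub>F x in at q. 0 < \<rho> x" using assms(6) unfolding isCont_def by (intro order_tendstoD) auto
    moreover have "\<forall>\<^sub>F x in at q. x \<in> N" using assms by (simp add: eventually_at_in_open')
    ultimately have "\<forall>\<^sub>F x in at q. x \<notin> \<Omega>" 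
    proof eventually_elim
      case (elim x)
      show ?case
      proof
        assume "x \<in> \<Omega>"
        then have "x \<in> {z\<in>N. \<rho> z < 0}" using elim assms(3) by blast
        then show False using elim by simp
      qed
    qed
    moreover have "q islimpt \<Omega>" using assms \<open>q \<notin> \<Omega>\<close> by (auto simp: frontier_def closure_def)
    ultimately show False by (simp add: islimpt_iff_eventually)
  qed
qed

lemma ball_infdist_subset:
  fixes \<Omega> :: "'a::euclidean_space set"
  assumes "open \<Omega>" "z \<in> \<Omega>"
  shows "ball z (infdist z (frontier \<Omega>)) \<subseteq> \<Omega>"
proof (rule ccontr)
  let ?B = "ball z (infdist z (frontier \<Omega>))"
  assume n: "\<not> ?B \<subseteq> \<Omega>"
  then have "?B \<inter> \<Omega> \<noteq> {}" using assms by (metis IntI ball_empty centre_in_ball empty_iff empty_subsetI linorder_not_less)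
  with n have "?B \<inter> frontier \<Omega> \<noteq> {}" by (intro connected_Int_frontier) auto
  then obtain x where "x \<in> frontier \<Omega>" "dist z x < infdist z (frontier \<Omega>)" by auto
  then show False using infdist_le[of x "frontier \<Omega>" z] by simp
qed

text \<open>The quadruple \<open>(q, n, s, l)\<close> of foot point, inner unit normal, signed distance and
  Lagrange multiplier of \<open>z\<close> is characterised by \<open>foot_map \<rho> (q, n, s, l) = (z, 0, 0, 1)\<close>.\<close>
definition foot_map :: "('a::euclidean_space \<Rightarrow> real) \<Rightarrow> 'a \<times> 'a \<times> real \<times> real \<Rightarrow> 'a \<times> 'a \<times> real \<times> real" where
  "foot_map \<rho> Y = (fst Y + fst (snd (snd Y)) *\<^sub>R fst (snd Y), grad \<rho> (fst Y) + snd (snd (snd Y)) *\<^sub>R fst (snd Y),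
     \<rho> (fst Y), fst (snd Y) \<bullet> fst (snd Y))"

lemma foot_map_Pair [simp]: "foot_map \<rho> (q, n, s, l) = (q + s *\<^sub>R n, grad \<rho> q + l *\<^sub>R n, \<rho> q, n \<bullet> n)"
  by (simp add: foot_map_def)

lemma dist_fourth_le: "dist d d' \<le> dist (a, b, c, d) (a', b', c', d')"
  using dist_snd_le[of "(a, b, c, d)" "(a', b', c', d')"] dist_snd_le[of "(b, c, d)" "(b', c', d')"]
    dist_snd_le[of "(c, d)" "(c', d')"] by simp

lemma foot_map_taylor2:
  fixes \<rho> :: "'a::euclidean_space \<Rightarrow> real"
  assumes T: "taylor2_on \<sigma> (ball p R) (grad \<rho>)" and \<sigma>: "1 < \<sigma>" "\<sigma> \<le> 3" and R: "R \<le> 1 / 2"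
    and d: "\<And>x. x \<in> ball p R \<Longrightarrow> (\<rho> has_derivative (\<lambda>w. grad \<rho> x \<bullet> w)) (at x)" and Y0: "fst Y0 = p"
  shows "taylor2_on \<sigma> (ball Y0 R) (foot_map \<rho>)"
proof -
  have sd: "small_diam (ball p R)" "small_diam (ball Y0 R)" using R by (auto intro: small_diam_ball)
  have im: "fst ` ball Y0 R \<subseteq> ball p R"
  proof
    fix x assume "x \<in> fst ` ball Y0 R"
    then obtain Y where "x = fst Y" "dist Y0 Y < R" by auto
    then show "x \<in> ball p R" using dist_fst_le[of Y0 Y] Y0 by simp
  qed
  have nf: "norm (fst x) \<le> norm x" for x :: "'a \<times> 'a \<times> real \<times> real" using norm_fst_le[of "fst x" "snd x"] by simp
  have g: "taylor2_on \<sigma> (ball Y0 R) (\<lambda>Y. grad \<rho> (fst Y))"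
    using taylor2_on_compose_linear[OF T bounded_linear_fst nf im] \<sigma> by simp
  have r0: "taylor2_on \<sigma> (ball p R) \<rho>"
    by (rule taylor2_on_of_gradient[OF T _ _ _ _ _ sd(1) d]) (use \<sigma> in auto)
  have r: "taylor2_on \<sigma> (ball Y0 R) (\<lambda>Y. \<rho> (fst Y))"
    using taylor2_on_compose_linear[OF r0 bounded_linear_fst nf im] \<sigma> by simp
  note bl = bounded_linear_fst bounded_linear_snd bounded_linear_compose[OF bounded_linear_fst bounded_linear_snd]
    bounded_linear_compose[OF bounded_linear_snd bounded_linear_snd]
    bounded_linear_compose[OF bounded_linear_fst bounded_linear_compose[OF bounded_linear_snd bounded_linear_snd]]
    bounded_linear_compose[OF bounded_linear_snd bounded_linear_compose[OF bounded_linear_snd bounded_linear_snd]]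
  have q: "taylor2_on \<sigma> (ball Y0 R) (\<lambda>Y::'a \<times> 'a \<times> real \<times> real. fst Y)" by (rule taylor2_on_linear[OF bl(1)])
  have n: "taylor2_on \<sigma> (ball Y0 R) (\<lambda>Y. fst (snd Y))" by (rule taylor2_on_linear[OF bl(3)])
  have s: "taylor2_on \<sigma> (ball Y0 R) (\<lambda>Y. fst (snd (snd Y)))" by (rule taylor2_on_linear[OF bl(5)])
  have l: "taylor2_on \<sigma> (ball Y0 R) (\<lambda>Y. snd (snd (snd Y)))" by (rule taylor2_on_linear[OF bl(6)])
  show ?thesis unfolding foot_map_def
    by (intro taylor2_on_Pair taylor2_on_add taylor2_on_bilinear[OF _ _ bounded_bilinear_scaleR]
        taylor2_on_bilinear[OF _ _ bounded_bilinear_inner] q n s l g r sd) (use \<sigma> in auto)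
qed

lemma foot_map_has_derivative:
  fixes \<rho> :: "'a::euclidean_space \<Rightarrow> real"
  assumes "(grad \<rho> has_derivative g1) (at q)" "(\<rho> has_derivative (\<lambda>w. grad \<rho> q \<bullet> w)) (at q)"
  shows "(foot_map \<rho> has_derivative (\<lambda>(a, b, c, e). (a + c *\<^sub>R n + s *\<^sub>R b, g1 a + e *\<^sub>R n + l *\<^sub>R b,
     grad \<rho> q \<bullet> a, 2 * (n \<bullet> b)))) (at (q, n, s, l))"
proof -
  have f: "(fst has_derivative fst) (at (q, n, s, l))" by (rule bounded_linear_imp_has_derivative[OF bounded_linear_fst])
  have 1: "((\<lambda>Y. grad \<rho> (fst Y)) has_derivative (\<lambda>Y. g1 (fst Y))) (at (q, n, s, l))"
    by (rule has_derivative_compose[OF f]) (use assms in simp)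
  have 2: "((\<lambda>Y. \<rho> (fst Y)) has_derivative (\<lambda>Y. grad \<rho> q \<bullet> fst Y)) (at (q, n, s, l))"
    by (rule has_derivative_compose[OF f]) (use assms in simp)
  show ?thesis unfolding foot_map_def
    by (rule has_derivative_eq_rhs, (rule derivative_intros 1 2)+)
      (auto simp: fun_eq_iff inner_commute algebra_simps)
qed

text \<open>\<open>n\<close> and \<open>s\<close> are the second and third components of the
  solution of the foot point system. Since \<open>n\<close> is the gradient of \<open>s\<close> and
  expands as well as \<open>grad \<rho>\<close>, no derivative is lost. The last conclusion
  transfers the second fundamental form from \<rho> to \<open>s\<close>, as needed for the Levi form
  at \<open>p\<close>.\<close>

lemma signed_distance_exists:
  fixes \<rho> :: "'a::euclidean_space \<Rightarrow> real"
  assumes \<Omega>: "open \<Omega>" "p \<in> frontier \<Omega>" and R0: "0 < R0" "R0 \<le> 1 / 2" and \<sigma>: "1 < \<sigma>" "\<sigma> \<le> 3"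
    and T: "taylor2_on \<sigma> (ball p R0) (grad \<rho>)"
    and d: "\<And>x. x \<in> ball p R0 \<Longrightarrow> (\<rho> has_derivative (\<lambda>w. grad \<rho> x \<bullet> w)) (at x)"
    and def: "\<Omega> \<inter> ball p R0 = {z\<in>ball p R0. \<rho> z < 0}" and nz: "grad \<rho> p \<noteq> 0"
  shows "\<exists>R s n. 0 < R \<and> R \<le> R0 \<and> taylor2_on \<sigma> (ball p R) s \<and> taylor2_on \<sigma> (ball p R) n \<and>
     (\<forall>z\<in>ball p R. (s has_derivative (\<lambda>w. n z \<bullet> w)) (at z) \<and> n z \<bullet> n z = 1) \<and> s p = 0 \<and>
     grad \<rho> p = - norm (grad \<rho> p) *\<^sub>R n p \<and>
     (\<forall>z\<in>\<Omega> \<inter> ball p R. 0 < s z \<and> s z = infdist z (frontier \<Omega>)) \<and>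
     (\<forall>g1 n1 w. (grad \<rho> has_derivative g1) (at p) \<longrightarrow> (n has_derivative n1) (at p) \<longrightarrow> n p \<bullet> w = 0 \<longrightarrow>
        norm (grad \<rho> p) * (n1 w \<bullet> w) = - (g1 w \<bullet> w))"
proof -
  define l0 where "l0 = norm (grad \<rho> p)"
  define n0 where "n0 = - (1 / l0) *\<^sub>R grad \<rho> p"
  \<comment> \<open>The solution over \<open>p\<close>: foot point \<open>p\<close>, inner unit
    normal, distance 0, and the length of the gradient as multiplier.\<close>
  define Y0 where "Y0 = (p, n0, 0::real, l0)"
  define U where "U = ball Y0 R0"
  have l0: "l0 > 0" using nz by (simp add: l0_def)
  have gp: "grad \<rho> p = - l0 *\<^sub>R n0" using l0 by (simp add: n0_def)
  have n0n0: "n0 \<bullet> n0 = 1" using l0 by (simp add: n0_def l0_def power2_norm_eq_inner[symmetric] power2_eq_square)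
  obtain g1 g2 Cg where Tg: "taylor2 \<sigma> (ball p R0) (grad \<rho>) g1 g2 Cg" using T taylor2_on_def by blast
  have gd: "(grad \<rho> has_derivative g1 x) (at x)" if "x \<in> ball p R0" for x
    using taylor2_has_derivative[OF Tg \<sigma>(1) open_ball that] .
  have cont\<rho>: "isCont \<rho> x" if "x \<in> ball p R0" for x using d[OF that] has_derivative_continuous by blast
  have zero: "\<rho> q = 0" if "q \<in> ball p R0" "q \<in> frontier \<Omega>" for q
    using frontier_defining_zero[OF \<Omega>(1) open_ball def that cont\<rho>[OF that(1)]] .
  have GY0: "foot_map \<rho> Y0 = (p, 0, 0, 1)" using zero[of p] \<Omega> R0 by (simp add: Y0_def gp n0n0)
  obtain G1 G2 C where TG: "taylor2 \<sigma> U (foot_map \<rho>) G1 G2 C"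
    using foot_map_taylor2[OF T \<sigma> R0(2) d, of Y0] unfolding taylor2_on_def U_def Y0_def by auto
  have G1: "G1 (q, n, s, l) (a, b, c, e) = (a + c *\<^sub>R n + s *\<^sub>R b, g1 q a + e *\<^sub>R n + l *\<^sub>R b, grad \<rho> q \<bullet> a, 2 * (n \<bullet> b))"
    if "(q, n, s, l) \<in> U" for q n s l a b c e
  proof -
    have "q \<in> ball p R0" using that dist_fst_le[of Y0 "(q, n, s, l)"] by (auto simp: U_def Y0_def)
    then have "(foot_map \<rho> has_derivative (\<lambda>(a, b, c, e). (a + c *\<^sub>R n + s *\<^sub>R b, g1 q a + e *\<^sub>R n + l *\<^sub>R b,
       grad \<rho> q \<bullet> a, 2 * (n \<bullet> b)))) (at (q, n, s, l))"
      by (intro foot_map_has_derivative gd d)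
    from has_derivative_unique[OF this taylor2_has_derivative[OF TG \<sigma>(1) _ that]]
    show ?thesis by (auto simp: U_def fun_eq_iff)
  qed
  have Y0U: "Y0 \<in> U" using R0 by (simp add: U_def)
  \<comment> \<open>Pairing the first equation with the normal gives c = 0, then a = 0; pairing the
    second with the normal gives e = 0, then b = 0.\<close>
  have inj: "\<eta> = 0" if "G1 Y0 \<eta> = 0" for \<eta>
  proof -
    obtain a b c e where \<eta>: "\<eta> = (a, b, c, e)" by (metis prod.exhaust)
    have 1: "a + c *\<^sub>R n0 = 0" "g1 p a + e *\<^sub>R n0 + l0 *\<^sub>R b = 0" "grad \<rho> p \<bullet> a = 0" "n0 \<bullet> b = 0"
      using that Y0U unfolding \<eta> Y0_def by (auto simp: G1 zero_prod_def)
    then have "n0 \<bullet> a = 0" using gp l0 by auto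
    moreover have "n0 \<bullet> a + c = 0" using arg_cong[OF 1(1), of "\<lambda>x. n0 \<bullet> x"] n0n0 by (simp add: inner_add_right)
    ultimately have c: "c = 0" by simp
    then have a: "a = 0" using 1 by simp
    have "g1 p 0 = 0" using taylor2D(2)[OF Tg, of p] R0 by (simp add: bounded_linear.linear linear_0)
    then have 2: "e *\<^sub>R n0 + l0 *\<^sub>R b = 0" using 1(2) a by simp
    have "n0 \<bullet> (e *\<^sub>R n0 + l0 *\<^sub>R b) = 0" using 2 by simp
    then have "e = 0" using n0n0 1(4) by (simp add: inner_add_right)
    then have "b = 0" using 2 l0 by simp
    then show ?thesis using a c \<open>e = 0\<close> \<eta> by (simp add: zero_prod_def)
  qed
  \<comment> \<open>A radius of at most \<open>l0 / 2\<close> keeps the multiplier positive on the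
    whole ball.\<close>
  obtain R1 c r where R1: "0 < R1" "R1 \<le> l0 / 2" "0 < c" "0 < r" "ball Y0 R1 \<subseteq> U"
    and lip: "\<And>Y Y'. Y \<in> ball Y0 R1 \<Longrightarrow> Y' \<in> ball Y0 R1 \<Longrightarrow> c * norm (Y' - Y) \<le> norm (foot_map \<rho> Y' - foot_map \<rho> Y)"
    and injc: "\<And>Y \<eta>. Y \<in> ball Y0 R1 \<Longrightarrow> c * norm \<eta> \<le> norm (G1 Y \<eta>)"
    and sur: "ball (foot_map \<rho> Y0) r \<subseteq> foot_map \<rho> ` ball Y0 R1"
    using taylor2_local_inverse[OF TG \<sigma> _ Y0U inj, of "l0 / 2"] l0 unfolding U_def by (auto simp: Ball_def)
  have unique: "Y = Y'" if "Y \<in> ball Y0 R1" "Y' \<in> ball Y0 R1" "foot_map \<rho> Y = foot_map \<rho> Y'" for Y Y'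
    using lip[OF that(1,2)] that(3) R1(3) by (simp add: mult_le_0_iff)
  define N where "N q = (- (1 / norm (grad \<rho> q)) *\<^sub>R grad \<rho> q)" for q
  have "isCont (grad \<rho>) p" using gd[of p] R0 has_derivative_continuous by force
  then have contF: "isCont (\<lambda>q. (q, N q, 0::real, norm (grad \<rho> q))) p"
    unfolding N_def using nz by (intro continuous_intros) auto
  \<comment> \<open>Normals and gradient lengths at points near \<open>p\<close> stay within
    \<open>R1 / 2\<close> of \<open>Y0\<close>; the other half of \<open>R1\<close> is reserved for
    the distance component.\<close>
  have "\<exists>R2>0. \<forall>q. dist q p < R2 \<longrightarrow> dist (q, N q, 0::real, norm (grad \<rho> q)) Y0 < R1 / 2"
    using contF R1(1) unfolding continuous_at_eps_delta
    by (auto simp: Y0_def N_def n0_def l0_def dest!: spec[of _ "R1/2"])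
  then obtain R2 where R2: "R2 > 0" "\<And>q. dist q p < R2 \<Longrightarrow> dist (q, N q, 0::real, norm (grad \<rho> q)) Y0 < R1 / 2"
    by blast
  define R where "R = min (min r (R0 / 2)) (min (R1 / 2) (R2 / 2))"
  have R: "0 < R" "R \<le> r" "2 * R \<le> R0" "2 * R \<le> R1" "2 * R \<le> R2" using R0 R1 R2 by (auto simp: R_def)
  have ex: "\<exists>Y. Y \<in> ball Y0 R1 \<and> foot_map \<rho> Y = (z, 0, 0, 1)" if z: "z \<in> ball p R" for z
  proof -
    have "dist (foot_map \<rho> Y0) (z, 0, 0, 1) < r" using z R unfolding GY0 by (simp add: dist_Pair_Pair)
    then have "(z, 0, 0, 1) \<in> ball (foot_map \<rho> Y0) r" by simp
    then have "(z, 0, 0, 1) \<in> foot_map \<rho> ` ball Y0 R1" using sur by blast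
    then show ?thesis by (metis imageE)
  qed
  define y where "y z = (SOME Y. Y \<in> ball Y0 R1 \<and> foot_map \<rho> Y = (z, 0, 0, 1))" for z
  have y: "y z \<in> ball Y0 R1" "foot_map \<rho> (y z) = (z, 0, 0, 1)" if z: "z \<in> ball p R" for z
    using someI_ex[OF ex[OF z]] unfolding y_def by blast+
  have Ty: "taylor2_on \<sigma> (ball p R) y"
  proof (rule taylor2_on_implicit[OF _ \<sigma> R1(3) lip injc])
    show "taylor2 \<sigma> (ball Y0 R1) (foot_map \<rho>) G1 G2 C" by (rule taylor2_mono[OF TG order_refl R1(5)])
    show "small_diam (ball p R)" using R R0 by (intro small_diam_ball) auto
    show "bounded_linear (\<lambda>z::'a. (z, 0::'a, 0::real, 0::real))"
      by (intro bounded_linear_Pair bounded_linear_ident bounded_linear_zero)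
    show "foot_map \<rho> (y z) = (0, 0, 0, 1) + (z, 0, 0, 0)" if "z \<in> ball p R" for z using y[OF that] by simp
  qed (use y in auto)
  define q n s l where qnsl: "q z = fst (y z)" "n z = fst (snd (y z))" "s z = fst (snd (snd (y z)))" "l z = snd (snd (snd (y z)))" for z
  have yq: "y z = (q z, n z, s z, l z)" for z by (simp add: qnsl)
  have eqs: "q z + s z *\<^sub>R n z = z" "grad \<rho> (q z) + l z *\<^sub>R n z = 0" "\<rho> (q z) = 0" "n z \<bullet> n z = 1"
    if z: "z \<in> ball p R" for z using y(2)[OF z] by (auto simp: yq)
  have Ts: "taylor2_on \<sigma> (ball p R) s" and Tn: "taylor2_on \<sigma> (ball p R) n"
    unfolding qnsl
    by (rule taylor2_on_linear_image[OF Ty], intro bounded_linear_compose[OF bounded_linear_fst] bounded_linear_compose[OF bounded_linear_snd] bounded_linear_snd bounded_linear_ident)+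
  obtain y1 y2 Cy where Ty': "taylor2 \<sigma> (ball p R) y y1 y2 Cy" using Ty taylor2_on_def by blast
  have deqs: "\<exists>a b c e. y1 z w = (a, b, c, e) \<and> a + c *\<^sub>R n z + s z *\<^sub>R b = w \<and> g1 (q z) a + e *\<^sub>R n z + l z *\<^sub>R b = 0 \<and>
      grad \<rho> (q z) \<bullet> a = 0 \<and> n z \<bullet> b = 0" if z: "z \<in> ball p R" for z w
  proof -
    have yU: "y z \<in> U" using y(1)[OF z] R1 by blast
    have "(y has_derivative y1 z) (at z)" by (rule taylor2_has_derivative[OF Ty' \<sigma>(1) open_ball z])
    then have "((\<lambda>x. foot_map \<rho> (y x)) has_derivative (\<lambda>w. G1 (y z) (y1 z w))) (at z)"
      by (rule has_derivative_compose) (rule taylor2_has_derivative[OF TG \<sigma>(1) _ yU], simp add: U_def)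
    moreover have "((\<lambda>x. foot_map \<rho> (y x)) has_derivative (\<lambda>w. (w, 0, 0, 0))) (at z)"
    proof (rule has_derivative_transform_within_open[of "\<lambda>x. (x, 0, 0, 1)" _ _ _ "ball p R"])
      show "((\<lambda>x::'a. (x, 0::'a, 0::real, 1::real)) has_derivative (\<lambda>w. (w, 0, 0, 0))) (at z)"
        by (auto intro!: derivative_eq_intros simp: zero_prod_def fun_eq_iff)
    qed (use y z in auto)
    ultimately have "G1 (y z) (y1 z w) = (w, 0, 0, 0)" using has_derivative_unique by metis
    moreover obtain a b c e where "y1 z w = (a, b, c, e)" by (metis prod.exhaust)
    ultimately show ?thesis using yU by (auto simp: G1 yq)
  qed
  have lpos: "l z > 0" if z: "z \<in> ball p R" for z
  proof -
    have "dist l0 (l z) \<le> dist Y0 (y z)"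
      unfolding Y0_def yq by (rule dist_fourth_le)
    then show ?thesis using y(1)[OF z] R1(2) l0 by (simp add: dist_real_def)
  qed
  have y1l: "bounded_linear (y1 z)" "(y has_derivative y1 z) (at z)" if "z \<in> ball p R" for z
    using taylor2D(2)[OF Ty' that] taylor2_has_derivative[OF Ty' \<sigma>(1) open_ball that] by auto
  \<comment> \<open>In the differentiated first equation, paired with \<open>n z\<close>, the foot
    point moves tangentially and \<open>n\<close> moves orthogonally to itself, so only the distance
    component survives.\<close>
  have sder: "(s has_derivative (\<lambda>w. n z \<bullet> w)) (at z)" if z: "z \<in> ball p R" for z
  proof -
    have "fst (snd (snd (y1 z w))) = n z \<bullet> w" for w
    proof -
      obtain a b c e where *: "y1 z w = (a, b, c, e)" "a + c *\<^sub>R n z + s z *\<^sub>R b = w"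
        "grad \<rho> (q z) \<bullet> a = 0" "n z \<bullet> b = 0" using deqs[OF z, of w] by blast
      have "grad \<rho> (q z) = - l z *\<^sub>R n z" using eqs(2)[OF z] by (simp add: eq_neg_iff_add_eq_0)
      then have "n z \<bullet> a = 0" using *(3) lpos[OF z] by simp
      then have "n z \<bullet> w = c" using eqs(4)[OF z] *(4) unfolding *(2)[symmetric] by (simp add: inner_add_right)
      then show ?thesis using *(1) by simp
    qed
    moreover have "(s has_derivative (\<lambda>w. fst (snd (snd (y1 z w))))) (at z)"
      unfolding qnsl by (intro has_derivative_fst has_derivative_snd y1l z)
    ultimately show ?thesis by simp
  qed
  have pB: "p \<in> ball p R" using R by simp
  have yp: "y p = Y0" using unique[OF y(1)[OF pB] _] y(2)[OF pB] GY0 R1 by simp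
  have vp: "q p = p" "n p = n0" "s p = 0" "l p = l0" using yp by (auto simp: qnsl Y0_def)
  \<comment> \<open>A genuine nearest point with its normal, distance and multiplier solves the same
    system inside the ball around \<open>Y0\<close>. By uniqueness it is \<open>y z\<close>, so
    \<open>s z\<close> is the true distance.\<close>
  have dist: "0 < s z \<and> s z = infdist z (frontier \<Omega>)" if z: "z \<in> \<Omega> \<inter> ball p R" for z
  proof -
    define \<delta> where "\<delta> = infdist z (frontier \<Omega>)"
    have ne: "frontier \<Omega> \<noteq> {}" using \<Omega> by auto
    have "z \<notin> frontier \<Omega>" using z \<Omega> by (simp add: frontier_def interior_open)
    then have \<delta>0: "0 < \<delta>" using infdist_pos_not_in_closed[OF frontier_closed ne] by (simp add: \<delta>_def)
    obtain q' where q': "q' \<in> frontier \<Omega>" "\<delta> = dist z q'"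
      using infdist_attains_inf[OF frontier_closed ne] unfolding \<delta>_def by blast
    have "\<delta> \<le> dist z p" unfolding \<delta>_def by (rule infdist_le[OF \<Omega>(2)])
    then have \<delta>R: "\<delta> < R" using z by (simp add: dist_commute)
    have q'p: "dist q' p < 2 * R" using q'(2) \<delta>R z dist_triangle[of q' p z] by (simp add: dist_commute)
    then have q'B: "q' \<in> ball p R0" using R by (simp add: dist_commute)
    define l' where "l' = norm (grad \<rho> q')"
    have near: "dist (q', N q', 0::real, l') Y0 < R1 / 2"
      unfolding l'_def using q'p R by (intro R2) auto
    have "dist l' l0 \<le> dist (q', N q', 0::real, l') Y0"
      unfolding Y0_def by (rule dist_fourth_le)
    then have l': "l' > 0" using near R1(2) l0 by (simp add: dist_real_def)
    have mult: "\<delta> *\<^sub>R grad \<rho> q' + l' *\<^sub>R (z - q') = 0" unfolding l'_def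
    proof (rule boundary_multiplier[OF d[OF q'B] _ open_ball q'B zero[OF q'B q'(1)] q'(2)[symmetric] \<delta>0])
      show "ball z \<delta> \<inter> ball p R0 \<subseteq> {x. \<rho> x < 0}"
        using ball_infdist_subset[OF \<Omega>(1), of z] z def unfolding \<delta>_def by blast
    qed
    have "l' *\<^sub>R (z - q') = l' *\<^sub>R (\<delta> *\<^sub>R N q')"
    proof -
      have "l' *\<^sub>R (\<delta> *\<^sub>R N q') = - (\<delta> *\<^sub>R grad \<rho> q')" using l' by (simp add: N_def l'_def)
      then show ?thesis using mult by (metis add_eq_0_iff)
    qed
    then have "z - q' = \<delta> *\<^sub>R N q'" using l' unfolding scaleR_cancel_left by auto
    then have zq: "z = q' + \<delta> *\<^sub>R N q'" by (metis add.commute diff_add_cancel)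
    have NN: "N q' \<bullet> N q' = 1" using l' by (simp add: N_def l'_def power2_norm_eq_inner[symmetric] power2_eq_square)
    have F: "foot_map \<rho> (q', N q', \<delta>, l') = (z, 0, 0, 1)"
      using zq[symmetric] NN zero[OF q'B q'(1)] l' by (simp add: N_def l'_def)
    have "dist (q', N q', \<delta>, l') (q', N q', 0, l') = \<delta>" using \<delta>0 by (simp add: dist_Pair_Pair dist_real_def)
    then have "dist (q', N q', \<delta>, l') Y0 < R1"
      using near \<delta>R R dist_triangle[of "(q', N q', \<delta>, l')" Y0 "(q', N q', 0, l')"] by simp
    then have "(q', N q', \<delta>, l') \<in> ball Y0 R1" by (simp add: dist_commute)
    then have "y z = (q', N q', \<delta>, l')" using unique[OF y(1)] y(2) F z by auto
    then have "s z = \<delta>" by (simp add: qnsl)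
    then show ?thesis using \<delta>0 \<delta>_def by simp
  qed
  \<comment> \<open>The distance vanishes at \<open>p\<close>, so a tangential \<open>w\<close>
    moves the foot point by \<open>w\<close> itself; the differentiated second equation is then
    paired with \<open>w\<close>.\<close>
  have levi: "l0 * (n1 w \<bullet> w) = - (g1' w \<bullet> w)"
    if g: "(grad \<rho> has_derivative g1') (at p)" and n1: "(n has_derivative n1) (at p)" and w: "n p \<bullet> w = 0" for g1' n1 w
  proof -
    have g1': "g1' = g1 p" using has_derivative_unique[OF g gd] R0 by simp
    have "(n has_derivative (\<lambda>w. fst (snd (y1 p w)))) (at p)"
      unfolding qnsl by (intro has_derivative_fst has_derivative_snd y1l pB)
    then have n1': "n1 = (\<lambda>w. fst (snd (y1 p w)))" using has_derivative_unique[OF n1] by blast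
    obtain a b c e where *: "y1 p w = (a, b, c, e)" "a + c *\<^sub>R n0 = w" "g1 p a + e *\<^sub>R n0 + l0 *\<^sub>R b = 0"
      "grad \<rho> p \<bullet> a = 0" using deqs[OF pB, of w] by (auto simp: vp)
    have "n0 \<bullet> a = 0" using *(4) gp l0 by simp
    then have "c = 0" using w n0n0 unfolding *(2)[symmetric] vp by (simp add: inner_add_right)
    then have a: "a = w" using * by simp
    have "(g1 p a + e *\<^sub>R n0 + l0 *\<^sub>R b) \<bullet> w = 0" using *(3) by simp
    then show ?thesis using w unfolding g1' n1' *(1) a vp by (simp add: inner_add_left)
  qed
  show ?thesis
  proof (intro exI[of _ R] exI[of _ s] exI[of _ n] conjI ballI allI impI)
    show "R \<le> R0" using R R0 by simp
    show "grad \<rho> p = - norm (grad \<rho> p) *\<^sub>R n p" using gp by (simp add: l0_def vp)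
    show "0 < s z" if "z \<in> \<Omega> \<inter> ball p R" for z using dist[OF that] by blast
    show "s z = infdist z (frontier \<Omega>)" if "z \<in> \<Omega> \<inter> ball p R" for z using dist[OF that] by blast
  qed (use R Ts Tn sder eqs vp levi in \<open>auto simp: l0_def\<close>)
qed

section \<open>Defining functions with positive definite Levi form\<close>

abbreviation imul :: "complex^'n \<Rightarrow> complex^'n" ("J") where
  "J w \<equiv> \<i> *s w"

lemma vec_scaleR_eq: "a *\<^sub>R (w::complex^'n) = of_real a *s w"
  by (simp add: vec_eq_iff scaleR_conv_of_real[symmetric])

lemma smult_decompose: "c *s (w::complex^'n) = Re c *\<^sub>R w + Im c *\<^sub>R J w"
  by (simp add: vec_eq_iff complex_eq_iff)

lemma J_J [simp]: "J (J w) = - (w::complex^'n)"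
  by (simp add: vec_eq_iff)

lemma J_add: "J (v + w) = J v + J (w::complex^'n)"
  by (simp add: vec_eq_iff distrib_left)

lemma J_scaleR: "J (a *\<^sub>R w) = a *\<^sub>R J (w::complex^'n)"
  by (simp add: vec_eq_iff)

lemma J_minus: "J (- w) = - J (w::complex^'n)"
  by (simp add: vec_eq_iff)

lemma norm_smult: "norm (c *s (w::complex^'n)) = cmod c * norm w"
  by (simp add: norm_vec_def norm_mult L2_set_def power_mult_distrib sum_distrib_left[symmetric] real_sqrt_mult)

lemma norm_J [simp]: "norm (J w) = norm (w::complex^'n)"
  by (simp add: norm_smult)

lemma bounded_linear_J: "bounded_linear (\<lambda>w::complex^'n. J w)"
  by (rule bounded_linear_intro[of _ 1]) (auto simp: J_add J_scaleR)

lemma inner_J: "J u \<bullet> v = - (u \<bullet> J (v::complex^'n))"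
  by (simp add: inner_vec_def inner_complex_def sum_negf[symmetric] algebra_simps)

definition hprod :: "complex^'n \<Rightarrow> complex^'n \<Rightarrow> complex" where
  "hprod u v = (\<Sum>j\<in>UNIV. u $ j * cnj (v $ j))"

lemma Re_hprod: "Re (hprod u v) = u \<bullet> v"
  by (simp add: hprod_def inner_vec_def inner_complex_def)

lemma hprod_J: "hprod (J u) v = \<i> * hprod u v"
  by (simp add: hprod_def sum_distrib_left mult.assoc)

lemma hprod_eq: "hprod u v = complex_of_real (u \<bullet> v) - \<i> * complex_of_real (J u \<bullet> v)"
proof (rule complex_eqI)
  show "Im (hprod u v) = Im (complex_of_real (u \<bullet> v) - \<i> * complex_of_real (J u \<bullet> v))"
    using arg_cong[OF hprod_J[of u v], of Re] Re_hprod[of "J u" v] by simp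
qed (simp add: Re_hprod)

lemma ddir_eq: "(f has_derivative D) (at z) \<Longrightarrow> ddir f v z = D v"
  unfolding ddir_def using frechet_derivative_at by metis

lemma gradient_axis:
  "complex_of_real (g \<bullet> axis j 1) = complex_of_real (Re (g $ j))" "complex_of_real (g \<bullet> axis j \<i>) = complex_of_real (Im (g $ j))"
  for g :: "complex^'n"
  by (auto simp: inner_axis inner_complex_def)

lemma ddir_of_real:
  assumes "(f has_derivative (\<lambda>w. g \<bullet> w)) (at z)"
  shows "ddir (\<lambda>w. complex_of_real (f w)) v z = complex_of_real (g \<bullet> v)"
  by (rule ddir_eq) (rule has_derivative_of_real[OF assms])

lemma dz_of_real:
  assumes "(f has_derivative (\<lambda>w. g \<bullet> w)) (at z)"
  shows "dz (\<lambda>w. complex_of_real (f w)) j z = cnj (g $ j) / 2"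
    and "dzbar (\<lambda>w. complex_of_real (f w)) j z = g $ j / 2"
  unfolding dz_def dzbar_def ddir_of_real[OF assms] gradient_axis
  by (auto simp: complex_eq_iff)

lemma del_pair_eq:
  assumes "(f has_derivative (\<lambda>w. g \<bullet> w)) (at z)"
  shows "del_pair f z X = hprod X g / 2"
  unfolding del_pair_def hprod_def dz_of_real[OF assms] by (simp add: sum_divide_distrib mult.commute)

definition clin :: "(complex^'n \<Rightarrow> complex) \<Rightarrow> bool" where
  "clin f \<longleftrightarrow> (\<forall>u v. f (u + v) = f u + f v) \<and> (\<forall>c u. f (c *s u) = c * f u)"

lemma clinI:
  assumes "\<And>u v. f (u + v) = f u + f v" "\<And>a u. f (a *\<^sub>R u) = a *\<^sub>R f u" "\<And>u. f (J u) = \<i> * f u"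
  shows "clin f"
  unfolding clin_def
proof (intro conjI allI)
  fix c :: complex and u
  have "f (c *s u) = Re c *\<^sub>R f u + Im c *\<^sub>R (\<i> * f u)"
    by (simp add: smult_decompose[of c u] assms)
  then show "f (c *s u) = c * f u" by (simp add: complex_eq_iff)
qed (rule assms)

lemma clin_sum:
  assumes "clin f" shows "f (\<Sum>i\<in>A. g i) = (\<Sum>i\<in>A. f (g i))"
proof -
  have "f (0 *s 0) = 0 * f 0" using assms unfolding clin_def by blast
  then have "f 0 = 0" by simp
  then show ?thesis using assms unfolding clin_def by (induction A rule: infinite_finite_induct) auto
qed

lemma clin_expand:
  assumes "clin f" shows "f w = (\<Sum>j\<in>UNIV. w $ j * f (axis j 1))"
proof -
  have "f w = f (\<Sum>j\<in>UNIV. w $ j *s axis j 1)" by (simp add: basis_expansion)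
  also have "\<dots> = (\<Sum>j\<in>UNIV. f (w $ j *s axis j 1))" by (rule clin_sum[OF assms])
  finally show ?thesis using assms unfolding clin_def by simp
qed

text \<open>Averaging the Hessian over \<open>X\<close> and \<open>J X\<close> removes the pure
  second derivatives. \<open>D\<close> is the part of the Hessian that is complex linear in
  \<open>X\<close>, so expanding it in the coordinates of \<open>X\<close> collapses the double
  sum.\<close>

lemma levi_eq:
  assumes S: "open S" "z \<in> S" and f: "\<And>w. w \<in> S \<Longrightarrow> (f has_derivative (\<lambda>v. g w \<bullet> v)) (at w)"
    and g: "(g has_derivative g1) (at z)"
  shows "levi f z X = (g1 X \<bullet> X + g1 (J X) \<bullet> J X) / 4"
proof -
  interpret g1: bounded_linear g1 using g has_derivative_bounded_linear by blast
  have db: "dz (dzbar (\<lambda>w. complex_of_real (f w)) l) j z = ((g1 (axis j 1)) $ l - \<i> * (g1 (axis j \<i>)) $ l) / 4" for j l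
  proof -
    have "((\<lambda>w. g w $ l / 2) has_derivative (\<lambda>v. g1 v $ l / 2)) (at z)"
      by (rule bounded_linear.has_derivative[OF bounded_linear_compose[OF bounded_linear_divide bounded_linear_vec_nth] g])
    then have "(dzbar (\<lambda>w. complex_of_real (f w)) l has_derivative (\<lambda>v. g1 v $ l / 2)) (at z)"
      by (rule has_derivative_transform_within_open[OF _ S]) (simp add: dz_of_real[OF f])
    then show ?thesis unfolding dz_def by (simp add: ddir_eq diff_divide_distrib)
  qed
  define D where "D X l = (g1 X $ l - \<i> * g1 (J X) $ l)" for X l
  have D: "clin (\<lambda>X. D X l)" for l
  proof (rule clinI)
    show "D (a *\<^sub>R u) l = a *\<^sub>R D u l" for a u
      unfolding D_def J_scaleR g1.scaleR vector_scaleR_component by (simp add: scaleR_diff_right)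
  qed (auto simp: D_def J_add g1.add g1.neg algebra_simps)
  have Jaxis: "J (axis j 1) = axis j \<i>" for j by (simp add: vec_eq_iff axis_def)
  have "(\<Sum>j\<in>UNIV. \<Sum>l\<in>UNIV. dz (dzbar (\<lambda>w. complex_of_real (f w)) l) j z * X $ j * cnj (X $ l))
      = (\<Sum>j\<in>UNIV. \<Sum>l\<in>UNIV. X $ j * D (axis j 1) l * cnj (X $ l) / 4)"
    unfolding db D_def Jaxis by (intro sum.cong refl) (simp add: field_simps)
  also have "\<dots> = (\<Sum>l\<in>UNIV. \<Sum>j\<in>UNIV. X $ j * D (axis j 1) l * cnj (X $ l) / 4)" by (rule sum.swap)
  also have "\<dots> = (\<Sum>l\<in>UNIV. D X l * cnj (X $ l) / 4)"
    by (simp add: clin_expand[OF D, of X] sum_distrib_right sum_divide_distrib)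
  also have "\<dots> = (hprod (g1 X) X - \<i> * hprod (g1 (J X)) X) / 4"
    by (simp add: D_def hprod_def sum_distrib_left sum_subtractf[symmetric] sum_divide_distrib algebra_simps diff_divide_distrib)
  finally have "levi f z X = Re ((hprod (g1 X) X - \<i> * hprod (g1 (J X)) X) / 4)"
    unfolding levi_def by (rule arg_cong[of _ _ Re])
  also have "\<dots> = (g1 X \<bullet> X - J (g1 (J X)) \<bullet> X) / 4"
    by (simp add: hprod_J[symmetric] Re_hprod)
  finally show ?thesis by (simp add: inner_J)
qed

text \<open>Compactness of the sphere: where \<open>f\<close> is positive the penalty does no harm,
  and on the compact rest \<open>g\<close> is bounded below, because \<open>g = 0\<close> forces
  \<open>f > 0\<close>. Homogeneity of degree two spreads the bound.\<close>

lemma penalty_positive: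
  fixes f g :: "'a::euclidean_space \<Rightarrow> real"
  assumes cont: "continuous_on UNIV f" "continuous_on UNIV g" and g: "\<And>w. 0 \<le> g w"
    and hom: "\<And>t w. f (t *\<^sub>R w) = t\<^sup>2 * f w" "\<And>t w. g (t *\<^sub>R w) = t\<^sup>2 * g w"
    and pos: "\<And>w. w \<noteq> 0 \<Longrightarrow> g w = 0 \<Longrightarrow> 0 < f w"
  shows "\<exists>B>0. \<exists>c>0. \<forall>w. c * (norm w)\<^sup>2 \<le> f w + B * g w"
proof -
  define S where "S = sphere (0::'a) 1"
  have S: "compact S" "S \<noteq> {}" by (auto simp: S_def)
  have cS: "continuous_on S f" "continuous_on S g" using cont continuous_on_subset by blast+
  have "\<exists>B>0. \<forall>w\<in>S. 0 < f w + B * g w"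
  proof -
    define K where "K = S \<inter> {w. f w \<le> 0}"
    have "closed {w. f w \<le> 0}" by (rule closed_Collect_le[OF cont(1) continuous_on_const])
    then have K: "compact K" unfolding K_def using S by blast
    show ?thesis
    proof (cases "K = {}")
      case True
      then have "0 < f w + 1 * g w" if "w \<in> S" for w using that g[of w] by (auto simp: K_def not_le)
      then show ?thesis using zero_less_one by blast
    next
      case False
      obtain w0 where w0: "w0 \<in> K" "\<forall>w\<in>K. g w0 \<le> g w"
        using continuous_attains_inf[OF K False continuous_on_subset[OF cont(2)]] by blast
      obtain w1 where w1: "w1 \<in> S" "\<forall>w\<in>S. f w1 \<le> f w"
        using continuous_attains_inf[OF S cS(1)] by blast
      have "w0 \<noteq> 0" using w0 by (auto simp: K_def S_def)
      then have "g w0 \<noteq> 0" using pos[of w0] w0 by (auto simp: K_def)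
      then have g0: "g w0 > 0" using g[of w0] by linarith
      define B where "B = (\<bar>f w1\<bar> + 1) / g w0"
      have B: "B > 0" using g0 by (simp add: B_def)
      have "0 < f w + B * g w" if "w \<in> S" for w
      proof (cases "f w \<le> 0")
        case True
        then have "g w0 \<le> g w" using w0 that by (auto simp: K_def)
        then have "B * g w0 \<le> B * g w" using B by simp
        moreover have "B * g w0 = \<bar>f w1\<bar> + 1" using g0 by (simp add: B_def)
        moreover have "f w1 \<le> f w" using w1 that by blast
        ultimately show ?thesis by linarith
      next
        case False
        then show ?thesis using B g[of w] by (simp add: add_pos_nonneg)
      qed
      then show ?thesis using B by blast
    qed
  qed
  then obtain B where B: "B > 0" "\<And>w. w \<in> S \<Longrightarrow> 0 < f w + B * g w" by blast
  have "continuous_on S (\<lambda>w. f w + B * g w)" by (intro continuous_intros cS)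
  then obtain w0 where w0: "w0 \<in> S" "\<forall>w\<in>S. f w0 + B * g w0 \<le> f w + B * g w"
    using continuous_attains_inf[OF S] by blast
  define c where "c = f w0 + B * g w0"
  have "c * (norm w)\<^sup>2 \<le> f w + B * g w" for w
  proof (cases "w = 0")
    case True
    then show ?thesis using hom(1)[of 0 w] hom(2)[of 0 w] by simp
  next
    case False
    then have "(1 / norm w) *\<^sub>R w \<in> S" by (simp add: S_def)
    then have "c \<le> f ((1 / norm w) *\<^sub>R w) + B * g ((1 / norm w) *\<^sub>R w)" using w0 by (simp add: c_def)
    also have "\<dots> = (f w + B * g w) / (norm w)\<^sup>2" unfolding hom by (simp add: power_divide add_divide_distrib)
    finally show ?thesis using False by (simp add: field_simps)
  qed
  moreover have "c > 0" using B(2)[OF w0(1)] by (simp add: c_def)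
  ultimately show ?thesis using B(1) by blast
qed

text \<open>The interface for all disc estimates: a function \<open>r\<close> with gradient
  \<open>m\<close> whose Levi form is positive on all of C^n, not only on complex tangent vectors.
  The distance does not occur in it and returns only in the final comparison.\<close>

locale levi_chart =
  fixes \<Omega> :: "(complex^'n) set" and p :: "complex^'n" and R :: real and r :: "complex^'n \<Rightarrow> real"
    and m :: "complex^'n \<Rightarrow> complex^'n" and m1 m2 and C c \<sigma> :: real
  assumes open_\<Omega>: "open \<Omega>" and p_frontier: "p \<in> frontier \<Omega>"
    and R: "0 < R" "R \<le> 1 / 2" and \<sigma>: "1 < \<sigma>" "\<sigma> \<le> 3"
    and T: "taylor2 \<sigma> (ball p R) m m1 m2 C"
    and r_der: "\<And>z. z \<in> ball p R \<Longrightarrow> (r has_derivative (\<lambda>w. m z \<bullet> w)) (at z)"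
    and c: "0 < c"
    and levi_pos: "\<And>z w. z \<in> ball p R \<Longrightarrow> c * (norm w)\<^sup>2 \<le> (m1 z w \<bullet> w + m1 z (J w) \<bullet> J w) / 4"
    and m_bounds: "\<And>z. z \<in> ball p R \<Longrightarrow> 1 / 2 \<le> norm (m z)" "\<And>z. z \<in> ball p R \<Longrightarrow> norm (m z) \<le> 2"
    and r_p: "r p = 0"
    and r_neg: "\<And>z. z \<in> \<Omega> \<inter> ball p R \<Longrightarrow> r z < 0"
    and r_frontier: "\<And>z. z \<in> frontier \<Omega> \<inter> ball p R \<Longrightarrow> r z = 0"

text \<open>The square B s^2 adds positivity in the complex normal direction, strict pseudoconvexity
  covers the complex tangent vectors, and \<open>penalty_positive\<close> finds \<open>B\<close>.
  The conclusion also records how \<open>r\<close>, its gradient and its Levi form are expressed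
  through the distance.\<close>

lemma levi_chart_exists:
  fixes \<Omega> :: "(complex^'n) set"
  assumes \<Omega>: "open \<Omega>" and \<epsilon>: "0 < \<epsilon>" "\<epsilon> \<le> 1" and k: "k \<in> {0, 1::nat}" and sp: "spsc_boundary_point (k + 2) \<epsilon> \<Omega> p"
  shows "\<exists>R r m m1 m2 C c B. levi_chart \<Omega> p R r m m1 m2 C c (k + 1 + \<epsilon>) \<and> 0 < B \<and>
    (\<forall>z\<in>\<Omega> \<inter> ball p R. let \<delta> = bdist \<Omega> z in 0 < \<delta> \<and> B * \<delta> \<le> 1 / 8 \<and> r z = - \<delta> + B * \<delta>\<^sup>2 \<and>
      (\<forall>X. hprod X (m z) / 2 = (2 * B * \<delta> - 1) * del_pair (bdist \<Omega>) z X \<and>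
         (m1 z X \<bullet> X + m1 z (J X) \<bullet> J X) / 4 = (1 - 2 * B * \<delta>) * levi (\<lambda>w. - bdist \<Omega> w) z X
             + 2 * B * (cmod (del_pair (bdist \<Omega>) z X))\<^sup>2))"
proof -
  define \<sigma> where "\<sigma> = real k + 1 + \<epsilon>"
  have \<sigma>: "1 < \<sigma>" "\<sigma> \<le> 3" using \<epsilon> k by (auto simp: \<sigma>_def)
  obtain W \<rho> where p: "p \<in> frontier \<Omega>" and W: "open W" "p \<in> W" and C: "Ck_holder_on (k + 2) \<epsilon> W \<rho>"
    and def: "\<Omega> \<inter> W = {z\<in>W. \<rho> z < 0}" and nz: "\<And>z. z \<in> W \<Longrightarrow> frechet_derivative \<rho> (at z) \<noteq> (\<lambda>_. 0)"
    and lp: "\<And>X. X \<noteq> 0 \<Longrightarrow> del_pair \<rho> p X = 0 \<Longrightarrow> levi \<rho> p X > 0"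
    using sp unfolding spsc_boundary_point_def by blast
  obtain R0 where R0: "0 < R0" "R0 \<le> 1 / 2" "ball p R0 \<subseteq> W" and T\<rho>: "taylor2_on \<sigma> (ball p R0) (grad \<rho>)"
    and d\<rho>: "\<And>x. x \<in> ball p R0 \<Longrightarrow> (\<rho> has_derivative (\<lambda>w. grad \<rho> x \<bullet> w)) (at x)"
    using Ck_holder_grad_taylor2[OF C W \<epsilon> k] unfolding \<sigma>_def by blast
  have pB: "p \<in> ball p R0" using R0 by simp
  have gnz: "grad \<rho> p \<noteq> 0"
  proof
    assume "grad \<rho> p = 0"
    then have "(\<rho> has_derivative (\<lambda>w. 0)) (at p)" using d\<rho>[OF pB] by simp
    then show False using nz[OF W(2)] frechet_derivative_at by metis
  qed
  have def0: "\<Omega> \<inter> ball p R0 = {z\<in>ball p R0. \<rho> z < 0}" using def R0(3) by blast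
  obtain R1 s n where R1: "0 < R1" "R1 \<le> R0" and Ts: "taylor2_on \<sigma> (ball p R1) s" and Tn: "taylor2_on \<sigma> (ball p R1) n"
    and sd: "\<And>z. z \<in> ball p R1 \<Longrightarrow> (s has_derivative (\<lambda>w. n z \<bullet> w)) (at z)" and nn: "\<And>z. z \<in> ball p R1 \<Longrightarrow> n z \<bullet> n z = 1"
    and sp0: "s p = 0" and gn: "grad \<rho> p = - norm (grad \<rho> p) *\<^sub>R n p"
    and sdist: "\<And>z. z \<in> \<Omega> \<inter> ball p R1 \<Longrightarrow> 0 < s z" "\<And>z. z \<in> \<Omega> \<inter> ball p R1 \<Longrightarrow> s z = infdist z (frontier \<Omega>)"
    and lev: "\<And>g1 n1 w. (grad \<rho> has_derivative g1) (at p) \<Longrightarrow> (n has_derivative n1) (at p) \<Longrightarrow> n p \<bullet> w = 0 \<Longrightarrow>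
        norm (grad \<rho> p) * (n1 w \<bullet> w) = - (g1 w \<bullet> w)"
    using signed_distance_exists[OF \<Omega> p R0(1,2) \<sigma> T\<rho> d\<rho> def0 gnz] by blast
  have p1: "p \<in> ball p R1" using R1 by simp
  obtain g1 g2 Cg where "taylor2 \<sigma> (ball p R0) (grad \<rho>) g1 g2 Cg" using T\<rho> taylor2_on_def by blast
  then have gd: "(grad \<rho> has_derivative g1 p) (at p)" using taylor2_has_derivative \<sigma> pB open_ball by blast
  obtain n1 n2 Cn where Tn': "taylor2 \<sigma> (ball p R1) n n1 n2 Cn" using Tn taylor2_on_def by blast
  have nd: "(n has_derivative n1 z) (at z)" "bounded_linear (n1 z)" if "z \<in> ball p R1" for z
    using taylor2_has_derivative[OF Tn' \<sigma>(1) open_ball that] taylor2D(2)[OF Tn' that] by auto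
  interpret n1p: bounded_linear "n1 p" using nd p1 by blast
  interpret Jb: bounded_linear "\<lambda>w::complex^'n. J w" by (rule bounded_linear_J)
  define f where "f w = - (n1 p w \<bullet> w + n1 p (J w) \<bullet> J w)" for w
  define g where "g w = (n p \<bullet> w)\<^sup>2 + (n p \<bullet> J w)\<^sup>2" for w
  have "\<exists>B>0. \<exists>c>0. \<forall>w. c * (norm w)\<^sup>2 \<le> f w + B * g w"
  proof (rule penalty_positive)
    have cJ: "continuous_on UNIV (\<lambda>w::complex^'n. J w)" by (rule linear_continuous_on[OF bounded_linear_J])
    have c1: "continuous_on UNIV (\<lambda>w. n1 p w)" by (rule linear_continuous_on[OF n1p.bounded_linear_axioms])
    have c2: "continuous_on UNIV (\<lambda>w. n1 p (J w))"
      by (rule linear_continuous_on[OF bounded_linear_compose[OF n1p.bounded_linear_axioms bounded_linear_J]])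
    have ci: "continuous_on UNIV (\<lambda>w::complex^'n. w)" by (rule continuous_on_id)
    show "continuous_on UNIV f" unfolding f_def
      by (rule continuous_on_minus, rule continuous_on_add, rule continuous_on_inner[OF c1 ci], rule continuous_on_inner[OF c2 cJ])
    show "continuous_on UNIV g" unfolding g_def
      by (rule continuous_on_add, rule continuous_on_power, rule continuous_on_inner[OF continuous_on_const ci],
        rule continuous_on_power, rule continuous_on_inner[OF continuous_on_const cJ])
    show "f (t *\<^sub>R w) = t\<^sup>2 * f w" "g (t *\<^sub>R w) = t\<^sup>2 * g w" for t w
      unfolding f_def g_def J_scaleR n1p.scaleR inner_scaleR_left inner_scaleR_right
      by (simp_all add: power2_eq_square algebra_simps)
    show "0 \<le> g w" for w by (simp add: g_def)
    fix w assume w: "w \<noteq> 0" "g w = 0"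
    then have w0: "n p \<bullet> w = 0" "n p \<bullet> J w = 0" unfolding g_def sum_power2_eq_zero_iff by blast+
    have "grad \<rho> p \<bullet> w = 0" "grad \<rho> p \<bullet> J w = 0" 
      by (subst gn, simp add: w0)+
    then have "hprod w (grad \<rho> p) = 0" by (simp add: hprod_eq inner_commute)
    then have "del_pair \<rho> p w = 0" by (simp add: del_pair_eq[OF d\<rho>[OF pB]])
    then have "levi \<rho> p w > 0" using lp w by blast
    then have "g1 p w \<bullet> w + g1 p (J w) \<bullet> J w > 0" using levi_eq[OF open_ball pB d\<rho> gd, of w] by simp
    moreover have "norm (grad \<rho> p) * (n1 p w \<bullet> w) = - (g1 p w \<bullet> w)" "norm (grad \<rho> p) * (n1 p (J w) \<bullet> J w) = - (g1 p (J w) \<bullet> J w)"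
      using lev[OF gd nd(1)[OF p1] w0(1)] lev[OF gd nd(1)[OF p1] w0(2)] .
    moreover have "norm (grad \<rho> p) * f w = - (norm (grad \<rho> p) * (n1 p w \<bullet> w)) - norm (grad \<rho> p) * (n1 p (J w) \<bullet> J w)"
      unfolding f_def by (simp only: right_diff_distrib minus_add_distrib) (simp add: right_diff_distrib distrib_left)
    ultimately have "norm (grad \<rho> p) * f w > 0" by linarith
    then show "0 < f w" using gnz by (simp add: zero_less_mult_iff)
  qed
  then obtain B0 c0 where B0: "B0 > 0" "c0 > 0" "\<And>w. c0 * (norm w)\<^sup>2 \<le> f w + B0 * g w" by blast
  \<comment> \<open>At \<open>p\<close>, where \<open>s\<close> vanishes, the second derivative of
    \<open>r\<close> contributes f + 2 B g (see \<open>form\<close>); hence half of the penalty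
    constant.\<close>
  define B where "B = B0 / 2"
  have B: "B > 0" using B0 by (simp add: B_def)
  define r where "r z = - s z + B * (s z)\<^sup>2" for z
  define m where "m z = (- 1 + 2 * B * s z) *\<^sub>R n z" for z
  have sd1: "small_diam (ball p R1)" using R1 R0 by (intro small_diam_ball) auto
  have "taylor2_on \<sigma> (ball p R1) (\<lambda>z. - 1 + 2 * B * s z)"
    by (rule taylor2_on_add[OF taylor2_on_const taylor2_on_linear_image[OF Ts bounded_linear_mult_right]])
  then have "taylor2_on \<sigma> (ball p R1) (\<lambda>z. (- 1 + 2 * B * s z) *\<^sub>R n z)"
    using taylor2_on_bilinear[OF _ Tn bounded_bilinear_scaleR sd1] \<sigma> by simp
  then have "taylor2_on \<sigma> (ball p R1) m" by (simp add: m_def[abs_def])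
  then obtain m1 m2 C where Tm: "taylor2 \<sigma> (ball p R1) m m1 m2 C" using taylor2_on_def by blast
  have rd: "(r has_derivative (\<lambda>w. m z \<bullet> w)) (at z)" if "z \<in> ball p R1" for z
    unfolding r_def
    by (rule has_derivative_eq_rhs, (rule derivative_intros sd[OF that])+)
      (simp add: m_def algebra_simps fun_eq_iff)
  have m1: "m1 z w = (2 * B * (n z \<bullet> w)) *\<^sub>R n z + (- 1 + 2 * B * s z) *\<^sub>R n1 z w" if z: "z \<in> ball p R1" for z w
  proof -
    have "(m has_derivative (\<lambda>w. (2 * B * (n z \<bullet> w)) *\<^sub>R n z + (- 1 + 2 * B * s z) *\<^sub>R n1 z w)) (at z)"
    proof -
      have "((\<lambda>z. - 1 + 2 * B * s z) has_derivative (\<lambda>w. 2 * B * (n z \<bullet> w))) (at z)"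
        using has_derivative_add[OF has_derivative_const has_derivative_mult_right[OF sd[OF z], of "2 * B"], of "- 1"]
        by (simp only: add_0_left)
      from has_derivative_scaleR[OF this nd(1)[OF z]] show ?thesis by (simp add: m_def[abs_def] add.commute)
    qed
    from fun_cong[OF has_derivative_unique[OF taylor2_has_derivative[OF Tm \<sigma>(1) open_ball z] this]]
    show ?thesis .
  qed
  have form: "m1 z w \<bullet> w + m1 z (J w) \<bullet> J w = 2 * B * ((n z \<bullet> w)\<^sup>2 + (n z \<bullet> J w)\<^sup>2)
      - (1 - 2 * B * s z) * (n1 z w \<bullet> w + n1 z (J w) \<bullet> J w)" if z: "z \<in> ball p R1" for z w
    unfolding m1[OF z] inner_add_left inner_scaleR_left power2_eq_square by (simp add: left_diff_distrib distrib_left)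
  have posp: "c0 * (norm w)\<^sup>2 \<le> m1 p w \<bullet> w + m1 p (J w) \<bullet> J w" for w
    using B0(3)[of w] by (simp add: form[OF p1] sp0 f_def g_def B_def)
  obtain R2 where R2: "R2 > 0" "ball p R2 \<subseteq> ball p R1" "\<And>x w. x \<in> ball p R2 \<Longrightarrow> norm (m1 x w - m1 p w) \<le> c0 / 4 * norm w"
    using taylor2_derivative_continuous[OF Tm \<sigma> open_ball p1, of "c0 / 4"] B0 by auto
  have "isCont s p" using sd[OF p1] has_derivative_continuous by blast
  then obtain R3 where R3: "R3 > 0" "\<And>x. dist x p < R3 \<Longrightarrow> dist (s x) (s p) < 1 / (8 * B)"
    unfolding continuous_at_eps_delta using B by (metis divide_pos_pos mult_pos_pos zero_less_numeral zero_less_one)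
  define R where "R = min R1 (min R2 R3)"
  have R: "0 < R" "R \<le> R1" "R \<le> R2" "R \<le> R3" using R1 R2 R3 by (auto simp: R_def)
  \<comment> \<open>This bound makes r = - s + B s^2 negative for s > 0 and keeps the length of m =
    (- 1 + 2 B s) n between 3/4 and 5/4.\<close>
  have sB: "\<bar>B * s z\<bar> \<le> 1 / 8" if "z \<in> ball p R" for z
  proof -
    have "\<bar>s z\<bar> < 1 / (8 * B)" using R3(2)[of z] that R sp0 by (auto simp: dist_commute dist_real_def)
    then show ?thesis using B by (simp add: abs_mult field_simps)
  qed
  have sub: "z \<in> ball p R1" if "z \<in> ball p R" for z using that R by auto
  have chart: "levi_chart \<Omega> p R r m m1 m2 C (c0 / 8) \<sigma>"
  proof
    show "open \<Omega>" "p \<in> frontier \<Omega>" "0 < R" "1 < \<sigma>" "\<sigma> \<le> 3" by fact+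
    show "0 < c0 / 8" using B0(2) by simp
    show "R \<le> 1 / 2" using R R1 R0 by simp
    show "taylor2 \<sigma> (ball p R) m m1 m2 C" using taylor2_mono[OF Tm order_refl] sub by blast
    show "r p = 0" by (simp add: r_def sp0)
    fix z
    show "z \<in> ball p R \<Longrightarrow> (r has_derivative (\<lambda>w. m z \<bullet> w)) (at z)" using rd sub by blast
    \<comment> \<open>Two perturbations of at most c0 / 4 leave c0 / 2, which the factor 1/4 turns
      into c0 / 8.\<close>
    show "c0 / 8 * (norm w)\<^sup>2 \<le> (m1 z w \<bullet> w + m1 z (J w) \<bullet> J w) / 4" if z: "z \<in> ball p R" for w
    proof -
      have zz: "z \<in> ball p R2" using z R by auto
      have e: "\<bar>(m1 z w - m1 p w) \<bullet> w\<bar> \<le> c0 / 4 * (norm w)\<^sup>2" for w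
        using order_trans[OF Cauchy_Schwarz_ineq2 mult_right_mono[OF R2(3)[OF zz, of w], of "norm w"]]
        by (simp add: power2_eq_square mult.assoc)
      show ?thesis 
      proof -
        have "\<bar>m1 z w \<bullet> w - m1 p w \<bullet> w\<bar> \<le> c0 / 4 * (norm w)\<^sup>2" "\<bar>m1 z (J w) \<bullet> J w - m1 p (J w) \<bullet> J w\<bar> \<le> c0 / 4 * (norm w)\<^sup>2"
          using e[of w] e[of "J w"] by (simp_all only: inner_diff_left norm_J)
        then show ?thesis using posp[of w] unfolding abs_le_iff by (simp add: field_simps)
      qed
    qed
    assume z: "z \<in> ball p R"
    have nz: "norm (n z) = 1" using nn[OF sub[OF z]] by (simp add: norm_eq_sqrt_inner)
    have "norm (m z) = \<bar>- 1 + 2 * (B * s z)\<bar>" by (simp add: m_def nz mult.assoc)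
    then show "1 / 2 \<le> norm (m z)" "norm (m z) \<le> 2" using sB[OF z] by linarith+
  next
    fix z assume z: "z \<in> \<Omega> \<inter> ball p R"
    then have "0 < s z" "\<bar>B * s z\<bar> \<le> 1 / 8" using sdist(1)[of z] sub[of z] sB[of z] z by blast+
    then have "s z * (B * s z) \<le> s z * (1 / 8)" by (intro mult_left_mono) auto
    then show "r z < 0" using \<open>0 < s z\<close> by (simp add: r_def power2_eq_square algebra_simps)
  next
    fix z assume z: "z \<in> frontier \<Omega> \<inter> ball p R"
    \<comment> \<open>Inside \<Omega> the function \<open>s\<close> is the distance. Both are
      continuous and the frontier point is a limit of points of \<Omega>, so they agree there as
      well.\<close>
    have "s z = 0"
    proof -
      have "isCont s z" using sd[of z] z sub has_derivative_continuous by blast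
      moreover have "isCont (\<lambda>x. infdist x (frontier \<Omega>)) z" by (intro continuous_intros)
      ultimately have co: "isCont (\<lambda>x. s x - infdist x (frontier \<Omega>)) z" by (intro continuous_intros)
      have zn: "z \<notin> \<Omega>" using z \<Omega> by (simp add: frontier_def interior_open)
      have "s z - infdist z (frontier \<Omega>) = 0"
      proof (rule ccontr)
        assume "s z - infdist z (frontier \<Omega>) \<noteq> 0"
        then have "\<forall>\<^sub>F x in at z. s x - infdist x (frontier \<Omega>) \<noteq> 0"
          using co unfolding isCont_def by (intro tendsto_imp_eventually_ne) auto
        moreover have "\<forall>\<^sub>F x in at z. x \<in> ball p R" using z by (intro eventually_at_in_open') auto
        ultimately have "\<forall>\<^sub>F x in at z. x \<notin> \<Omega>"
        proof eventually_elim
          case (elim x)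
          show ?case
          proof
            assume "x \<in> \<Omega>"
            then have "s x = infdist x (frontier \<Omega>)" using sdist(2)[of x] sub[OF elim(2)] by blast
            then show False using elim(1) by simp
          qed
        qed
        moreover have "z islimpt \<Omega>" using z zn by (auto simp: frontier_def closure_def)
        ultimately show False by (simp add: islimpt_iff_eventually)
      qed
      then show ?thesis using z by simp
    qed
    then show "r z = 0" by (simp add: r_def)
  qed
  have rel: "let \<delta> = bdist \<Omega> z in 0 < \<delta> \<and> B * \<delta> \<le> 1 / 8 \<and> r z = - \<delta> + B * \<delta>\<^sup>2 \<and>
      (\<forall>X. hprod X (m z) / 2 = (2 * B * \<delta> - 1) * del_pair (bdist \<Omega>) z X \<and>
         (m1 z X \<bullet> X + m1 z (J X) \<bullet> J X) / 4 = (1 - 2 * B * \<delta>) * levi (\<lambda>w. - bdist \<Omega> w) z X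
             + 2 * B * (cmod (del_pair (bdist \<Omega>) z X))\<^sup>2)" if z: "z \<in> \<Omega> \<inter> ball p R" for z
  proof -
    have z1: "z \<in> ball p R1" using z sub by blast
    have S: "open (\<Omega> \<inter> ball p R1)" "z \<in> \<Omega> \<inter> ball p R1" using \<Omega> z1 z by auto
    have eq: "s w = bdist \<Omega> w" if "w \<in> \<Omega> \<inter> ball p R1" for w using sdist(2)[OF that] by (simp add: bdist_def)
    have bd: "(bdist \<Omega> has_derivative (\<lambda>v. n w \<bullet> v)) (at w)" if w: "w \<in> \<Omega> \<inter> ball p R1" for w
      by (rule has_derivative_transform_within_open[OF sd S(1) w eq]) (use w in auto)
    have dp: "del_pair (bdist \<Omega>) z X = hprod X (n z) / 2" for X by (rule del_pair_eq[OF bd[OF S(2)]])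
    have le: "levi (\<lambda>w. - bdist \<Omega> w) z X = - (n1 z X \<bullet> X + n1 z (J X) \<bullet> J X) / 4" for X
    proof -
      have "levi (\<lambda>w. - bdist \<Omega> w) z X = ((- n1 z X) \<bullet> X + (- n1 z (J X)) \<bullet> J X) / 4"
      proof (rule levi_eq[OF S, of _ "\<lambda>w. - n w"])
        show "((\<lambda>w. - bdist \<Omega> w) has_derivative (\<lambda>v. - n w \<bullet> v)) (at w)" if "w \<in> \<Omega> \<inter> ball p R1" for w
          using has_derivative_minus[OF bd[OF that]] by simp
        show "((\<lambda>w. - n w) has_derivative (\<lambda>w. - n1 z w)) (at z)" using has_derivative_minus[OF nd(1)[OF z1]] .
      qed
      then show ?thesis by simp
    qed
    have cm: "(cmod (hprod X (n z) / 2))\<^sup>2 = ((n z \<bullet> X)\<^sup>2 + (n z \<bullet> J X)\<^sup>2) / 4" for X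
      unfolding hprod_eq cmod_power2 by (simp add: inner_commute[of X] inner_commute[of "J X"] power_divide add_divide_distrib)
    have h: "hprod X (m z) = (2 * B * s z - 1) * hprod X (n z)" for X
      unfolding m_def hprod_def sum_distrib_left by (intro sum.cong refl) (simp add: complex_eq_iff algebra_simps)
    have e1: "hprod X (m z) / 2 = (2 * B * s z - 1) * (hprod X (n z) / 2)" for X by (simp add: h)
    have e2: "(2 * B * (a + b) - (1 - 2 * B * s z) * N) / 4 = (1 - 2 * B * s z) * (- N / 4) + 2 * B * ((a + b) / 4)" for a b N :: real
      by (simp add: field_simps)
    have e3: "B * s z \<le> 1 / 8" using sB[of z] z by auto
    show ?thesis
      unfolding Let_def eq[OF S(2), symmetric] dp le cm form[OF z1]
      by (intro conjI allI) (rule sdist(1)[OF S(2)] e3 r_def e1 e2)+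
  qed
  show ?thesis
    by (rule exI[of _ R], rule exI[of _ r], rule exI[of _ m], rule exI[of _ m1], rule exI[of _ m2], rule exI[of _ C],
      rule exI[of _ "c0 / 8"], rule exI[of _ B], rule conjI[OF chart[unfolded \<sigma>_def] conjI[OF B ballI[OF rel]]])
qed

section \<open>Complex decomposition of the Taylor polynomial\<close>

definition real_bilin :: "(complex^'n \<Rightarrow> complex^'n \<Rightarrow> real) \<Rightarrow> real \<Rightarrow> bool" where
  "real_bilin b K \<longleftrightarrow> (\<forall>u u' v. b (u + u') v = b u v + b u' v) \<and> (\<forall>u v v'. b u (v + v') = b u v + b u v') \<and>
     (\<forall>a u v. b (a *\<^sub>R u) v = a * b u v) \<and> (\<forall>a u v. b u (a *\<^sub>R v) = a * b u v) \<and>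
     (\<forall>u v. \<bar>b u v\<bar> \<le> K * norm u * norm v)"

definition real_trilin :: "(complex^'n \<Rightarrow> complex^'n \<Rightarrow> complex^'n \<Rightarrow> real) \<Rightarrow> real \<Rightarrow> bool" where
  "real_trilin T K \<longleftrightarrow> (\<forall>u u' v w. T (u + u') v w = T u v w + T u' v w) \<and>
     (\<forall>u v v' w. T u (v + v') w = T u v w + T u v' w) \<and> (\<forall>u v w w'. T u v (w + w') = T u v w + T u v w') \<and>
     (\<forall>a u v w. T (a *\<^sub>R u) v w = a * T u v w) \<and> (\<forall>a u v w. T u (a *\<^sub>R v) w = a * T u v w) \<and>
     (\<forall>a u v w. T u v (a *\<^sub>R w) = a * T u v w) \<and> (\<forall>u v w. \<bar>T u v w\<bar> \<le> K * norm u * norm v * norm w)"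

lemma real_bilin_minus:
  assumes "real_bilin b K" shows "b (- u) v = - b u v" "b u (- v) = - b u v"
proof -
  have "b ((-1) *\<^sub>R u) v = (-1) * b u v" "b u ((-1) *\<^sub>R v) = (-1) * b u v" using assms unfolding real_bilin_def by blast+
  then show "b (- u) v = - b u v" "b u (- v) = - b u v" by simp_all
qed

lemma real_trilin_minus:
  assumes "real_trilin T K" shows "T (- u) v w = - T u v w" "T u (- v) w = - T u v w" "T u v (- w) = - T u v w"
proof -
  have "T ((-1) *\<^sub>R u) v w = (-1) * T u v w" "T u ((-1) *\<^sub>R v) w = (-1) * T u v w" "T u v ((-1) *\<^sub>R w) = (-1) * T u v w"
    using assms unfolding real_trilin_def by blast+
  then show "T (- u) v w = - T u v w" "T u (- v) w = - T u v w" "T u v (- w) = - T u v w" by simp_all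
qed

text \<open>The complex bilinear part of \<open>b\<close>; \<open>herm_part\<close> below is the
  sesquilinear one, conjugate linear in its second argument. Symmetry of \<open>b\<close> is not
  assumed, so \<open>herm_re\<close> averages over both orders of the arguments. Only the diagonal
  has to reproduce \<open>b\<close>.\<close>

definition pure_part2 :: "(complex^'n \<Rightarrow> complex^'n \<Rightarrow> real) \<Rightarrow> complex^'n \<Rightarrow> complex^'n \<Rightarrow> complex" where
  "pure_part2 b u v = Complex ((b u v - b (J u) (J v)) / 4) (- (b (J u) v + b u (J v)) / 4)"

definition herm_re :: "(complex^'n \<Rightarrow> complex^'n \<Rightarrow> real) \<Rightarrow> complex^'n \<Rightarrow> complex^'n \<Rightarrow> real" where
  "herm_re b u v = (b u v + b v u + b (J u) (J v) + b (J v) (J u)) / 4"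

definition herm_part :: "(complex^'n \<Rightarrow> complex^'n \<Rightarrow> real) \<Rightarrow> complex^'n \<Rightarrow> complex^'n \<Rightarrow> complex" where
  "herm_part b u v = Complex (herm_re b u v) (herm_re b u (J v))"

lemma cmod_Complex_le: "cmod (Complex a b) \<le> \<bar>a\<bar> + \<bar>b\<bar>"
  using cmod_le[of "Complex a b"] by simp

lemma abs_average_le:
  fixes a b c d M :: real
  assumes "\<bar>a\<bar> \<le> M" "\<bar>b\<bar> \<le> M" "\<bar>c\<bar> \<le> M" "\<bar>d\<bar> \<le> M"
  shows "\<bar>(a - b) / 4\<bar> \<le> M / 2" "\<bar>- (a + b) / 4\<bar> \<le> M / 2" "\<bar>(a + b + c + d) / 4\<bar> \<le> M"
    "\<bar>(a - b - c - d) / 8\<bar> \<le> M / 2" "\<bar>(a - b + c + d) / 8\<bar> \<le> M / 2"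
  using assms unfolding abs_le_iff by (simp_all add: field_simps)

lemma bilinear_parts:
  fixes b :: "complex^'n \<Rightarrow> complex^'n \<Rightarrow> real"
  assumes b: "real_bilin b K"
  shows "clin (\<lambda>u. pure_part2 b u v)" "clin (pure_part2 b u)" "clin (\<lambda>u. herm_part b u v)"
    and "herm_part b v u = cnj (herm_part b u v)"
    and "b w w = 2 * Re (pure_part2 b w w) + Re (herm_part b w w)"
    and "Re (herm_part b w w) = (b w w + b (J w) (J w)) / 2"
    and "cmod (pure_part2 b u v) \<le> K * norm u * norm v" "cmod (herm_part b u v) \<le> 2 * K * norm u * norm v"
proof -
  have a: "b (x + x') y = b x y + b x' y" "b x (y + y') = b x y + b x y'" "b (t *\<^sub>R x) y = t * b x y"
    "b x (t *\<^sub>R y) = t * b x y" "\<bar>b x y\<bar> \<le> K * norm x * norm y" for x x' y y' t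
    using b unfolding real_bilin_def by blast+
  note s = a(1-4) real_bilin_minus[OF b] J_add J_scaleR J_minus J_J
  show "clin (\<lambda>u. pure_part2 b u v)"
    by (rule clinI) (simp_all add: pure_part2_def s complex_eq_iff algebra_simps add_divide_distrib diff_divide_distrib)
  show "clin (pure_part2 b u)"
    by (rule clinI) (simp_all add: pure_part2_def s complex_eq_iff algebra_simps add_divide_distrib diff_divide_distrib)
  show "clin (\<lambda>u. herm_part b u v)"
    by (rule clinI) (simp_all add: herm_part_def herm_re_def s complex_eq_iff algebra_simps add_divide_distrib diff_divide_distrib)
  show "herm_part b v u = cnj (herm_part b u v)"
    by (simp add: herm_part_def herm_re_def s complex_eq_iff add_divide_distrib diff_divide_distrib)
  show "b w w = 2 * Re (pure_part2 b w w) + Re (herm_part b w w)"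
    by (simp add: pure_part2_def herm_part_def herm_re_def field_simps)
  show "Re (herm_part b w w) = (b w w + b (J w) (J w)) / 2"
    by (simp add: herm_part_def herm_re_def field_simps)
  have n: "\<bar>b u v\<bar> \<le> K * norm u * norm v" "\<bar>b (J u) v\<bar> \<le> K * norm u * norm v" "\<bar>b u (J v)\<bar> \<le> K * norm u * norm v"
    "\<bar>b (J u) (J v)\<bar> \<le> K * norm u * norm v" "\<bar>b v u\<bar> \<le> K * norm u * norm v" "\<bar>b (J v) u\<bar> \<le> K * norm u * norm v"
    "\<bar>b v (J u)\<bar> \<le> K * norm u * norm v" "\<bar>b (J v) (J u)\<bar> \<le> K * norm u * norm v" for u v
    using a(5)[of u v] a(5)[of "J u" v] a(5)[of u "J v"] a(5)[of "J u" "J v"]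
      a(5)[of v u] a(5)[of "J v" u] a(5)[of v "J u"] a(5)[of "J v" "J u"] by (simp_all add: mult_ac)
  show "cmod (pure_part2 b u v) \<le> K * norm u * norm v"
    unfolding pure_part2_def by (rule order_trans[OF cmod_Complex_le])
      (use add_mono[OF abs_average_le(1)[OF n(1)[of u v] n(4)[of u v] n(1)[of u v] n(1)[of u v]]
        abs_average_le(2)[OF n(2)[of u v] n(3)[of u v] n(1)[of u v] n(1)[of u v]]] in \<open>simp only: field_sum_of_halves\<close>)
  have h: "\<bar>herm_re b u v\<bar> \<le> K * norm u * norm v" for u v
    unfolding herm_re_def by (rule abs_average_le(3)[OF n(1,5,4,8)])
  show "cmod (herm_part b u v) \<le> 2 * K * norm u * norm v"
    unfolding herm_part_def by (rule order_trans[OF cmod_Complex_le]) (use h[of u v] h[of u "J v"] in simp)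
qed

definition pure_part3 :: "(complex^'n \<Rightarrow> complex^'n \<Rightarrow> complex^'n \<Rightarrow> real) \<Rightarrow> complex^'n \<Rightarrow> complex^'n \<Rightarrow> complex^'n \<Rightarrow> complex" where
  "pure_part3 T u v w = Complex ((T u v w - T (J u) (J v) w - T (J u) v (J w) - T u (J v) (J w)) / 8)
     ((T (J u) (J v) (J w) - T (J u) v w - T u (J v) w - T u v (J w)) / 8)"

text \<open>The part that is complex linear in the first two arguments and conjugate linear in the
  third. There is one such part for each position of the conjugated argument, hence the permuted
  copies in \<open>trilinear_diagonal\<close>.\<close>

definition mixed_part3 :: "(complex^'n \<Rightarrow> complex^'n \<Rightarrow> complex^'n \<Rightarrow> real) \<Rightarrow> complex^'n \<Rightarrow> complex^'n \<Rightarrow> complex^'n \<Rightarrow> complex" where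
  "mixed_part3 T u v y = Complex ((T u v y - T (J u) (J v) y + T (J u) v (J y) + T u (J v) (J y)) / 8)
     ((T u v (J y) - T (J u) v y - T u (J v) y - T (J u) (J v) (J y)) / 8)"

lemma trilinear_parts:
  fixes T :: "complex^'n \<Rightarrow> complex^'n \<Rightarrow> complex^'n \<Rightarrow> real"
  assumes T: "real_trilin T K"
  shows "clin (\<lambda>u. pure_part3 T u v w)" "clin (\<lambda>v. pure_part3 T u v w)" "clin (\<lambda>w. pure_part3 T u v w)"
    and "clin (\<lambda>u. mixed_part3 T u v y)" "clin (\<lambda>v. mixed_part3 T u v y)" "clin (\<lambda>y. cnj (mixed_part3 T u v y))"
    and "cmod (pure_part3 T u v w) \<le> K * norm u * norm v * norm w"
    and "cmod (mixed_part3 T u v y) \<le> K * norm u * norm v * norm y"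
proof -
  have a: "T (x + x') y z = T x y z + T x' y z" "T x (y + y') z = T x y z + T x y' z" "T x y (z + z') = T x y z + T x y z'"
    "T (t *\<^sub>R x) y z = t * T x y z" "T x (t *\<^sub>R y) z = t * T x y z" "T x y (t *\<^sub>R z) = t * T x y z"
    "\<bar>T x y z\<bar> \<le> K * norm x * norm y * norm z" for x x' y y' z z' t
    using T[unfolded real_trilin_def] by simp_all
  note s = a(1-6) real_trilin_minus[OF T] J_add J_scaleR J_minus J_J
  show "clin (\<lambda>u. pure_part3 T u v w)" "clin (\<lambda>v. pure_part3 T u v w)" "clin (\<lambda>w. pure_part3 T u v w)"
    by (rule clinI; simp add: pure_part3_def s complex_eq_iff algebra_simps add_divide_distrib diff_divide_distrib)+
  show "clin (\<lambda>u. mixed_part3 T u v y)" "clin (\<lambda>v. mixed_part3 T u v y)" "clin (\<lambda>y. cnj (mixed_part3 T u v y))"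
    by (rule clinI; simp add: mixed_part3_def s complex_eq_iff algebra_simps add_divide_distrib diff_divide_distrib)+
  have n: "\<bar>T u v w\<bar> \<le> K * norm u * norm v * norm w" "\<bar>T (J u) v w\<bar> \<le> K * norm u * norm v * norm w"
    "\<bar>T u (J v) w\<bar> \<le> K * norm u * norm v * norm w" "\<bar>T u v (J w)\<bar> \<le> K * norm u * norm v * norm w"
    "\<bar>T (J u) (J v) w\<bar> \<le> K * norm u * norm v * norm w" "\<bar>T (J u) v (J w)\<bar> \<le> K * norm u * norm v * norm w"
    "\<bar>T u (J v) (J w)\<bar> \<le> K * norm u * norm v * norm w" "\<bar>T (J u) (J v) (J w)\<bar> \<le> K * norm u * norm v * norm w" for u v w
    using a(7)[of u v w] a(7)[of "J u" v w] a(7)[of u "J v" w] a(7)[of u v "J w"]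
      a(7)[of "J u" "J v" w] a(7)[of "J u" v "J w"] a(7)[of u "J v" "J w"] a(7)[of "J u" "J v" "J w"] by simp_all
  show "cmod (pure_part3 T u v w) \<le> K * norm u * norm v * norm w"
    unfolding pure_part3_def by (rule order_trans[OF cmod_Complex_le])
      (use add_mono[OF abs_average_le(4)[OF n(1)[of u v w] n(5)[of u v w] n(6)[of u v w] n(7)[of u v w]]
        abs_average_le(4)[OF n(8)[of u v w] n(2)[of u v w] n(3)[of u v w] n(4)[of u v w]]] in \<open>simp only: field_sum_of_halves\<close>)
  show "cmod (mixed_part3 T u v y) \<le> K * norm u * norm v * norm y"
    unfolding mixed_part3_def by (rule order_trans[OF cmod_Complex_le])
      (use add_mono[OF abs_average_le(5)[OF n(1)[of u v y] n(5)[of u v y] n(6)[of u v y] n(7)[of u v y]]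
        abs_average_le(4)[OF n(4)[of u v y] n(2)[of u v y] n(3)[of u v y] n(8)[of u v y]]] in \<open>simp only: field_sum_of_halves\<close>)
qed

lemma trilinear_diagonal:
  "T w w w = 2 * Re (pure_part3 T w w w) + 2 * Re (mixed_part3 T w w w + mixed_part3 (\<lambda>a b c. T a c b) w w w
     + mixed_part3 (\<lambda>a b c. T c a b) w w w)"
  by (simp add: pure_part3_def mixed_part3_def field_simps)

text \<open>These data encode the real Taylor polynomial
  \<open>2 Re (ell w + \<beta> w w + \<tau> w w w) + Re (\<gamma> w w) + 2 Re (\<mu> w w w)\<close>, where \<open>\<mu>\<close> is antilinear in its
  last argument.\<close>
locale levi_poly =
  fixes ell :: "complex^'n \<Rightarrow> complex" and \<beta> \<gamma> :: "complex^'n \<Rightarrow> complex^'n \<Rightarrow> complex"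
    and \<tau> \<mu> :: "complex^'n \<Rightarrow> complex^'n \<Rightarrow> complex^'n \<Rightarrow> complex" and K c :: real
  assumes ell: "clin ell"
    and \<beta>: "\<And>v. clin (\<lambda>u. \<beta> u v)" "\<And>u. clin (\<beta> u)"
    and \<tau>: "\<And>v w. clin (\<lambda>u. \<tau> u v w)" "\<And>u w. clin (\<lambda>v. \<tau> u v w)" "\<And>u v. clin (\<lambda>w. \<tau> u v w)"
    and \<mu>: "\<And>v y. clin (\<lambda>u. \<mu> u v y)" "\<And>u y. clin (\<lambda>v. \<mu> u v y)" "\<And>u v. clin (\<lambda>y. cnj (\<mu> u v y))"
    and \<gamma>: "\<And>v. clin (\<lambda>u. \<gamma> u v)" and \<gamma>_cnj: "\<And>u v. \<gamma> v u = cnj (\<gamma> u v)"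
    and c: "0 < c" and \<gamma>_pos: "\<And>u. c * (norm u)\<^sup>2 \<le> Re (\<gamma> u u)"
    and K: "1 \<le> K" and ell_bound: "\<And>u. cmod (ell u) \<le> K * norm u"
    and \<beta>_bound: "\<And>u v. cmod (\<beta> u v) \<le> K * norm u * norm v"
    and \<gamma>_bound: "\<And>u v. cmod (\<gamma> u v) \<le> K * norm u * norm v"
    and \<tau>_bound: "\<And>u v w. cmod (\<tau> u v w) \<le> K * norm u * norm v * norm w"
    and \<mu>_bound: "\<And>u v w. cmod (\<mu> u v w) \<le> K * norm u * norm v * norm w"
    and ell_lower: "\<exists>u. u \<noteq> 0 \<and> norm u \<le> K * cmod (ell u)"

lemma clin_add2: "clin f \<Longrightarrow> clin g \<Longrightarrow> clin (\<lambda>x. f x + g x)"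
  by (simp add: clin_def algebra_simps)

context levi_chart
begin

text \<open>The complex form of \<open>taylor2_gradient_expansion\<close>, with \<open>K\<close>
  independent of \<open>z\<close>. In \<open>3 * C + 4\<close> the first term covers the three mixed
  parts; the second covers the bounds on the linear part, which come from 1/2 <= |m z| <= 2.\<close>

lemma levi_poly_exists:
  "\<exists>K. \<forall>z\<in>ball p R. \<exists>\<beta> \<gamma> \<tau> \<mu>. levi_poly (\<lambda>X. hprod X (m z) / 2) \<beta> \<gamma> \<tau> \<mu> K c \<and>
     (\<forall>X. Re (\<gamma> X X) = (m1 z X \<bullet> X + m1 z (J X) \<bullet> J X) / 4) \<and>
     (\<forall>w. z + w \<in> ball p R \<longrightarrow> \<bar>r (z + w) - (r z + 2 * Re (hprod w (m z) / 2 + \<beta> w w + \<tau> w w w) + Re (\<gamma> w w)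
        + 2 * Re (\<mu> w w w))\<bar> \<le> K * norm w powr (\<sigma> + 1))"
proof (intro exI[of _ "3 * C + 4"] ballI)
  fix z assume z: "z \<in> ball p R"
  note C = taylor2D(1)[OF T]
  interpret m1: bounded_linear "m1 z" by (rule taylor2D(2)[OF T z])
  interpret m2: bounded_bilinear "m2 z" by (rule taylor2D(3)[OF T z])
  define b where "b u v = (m1 z u \<bullet> v) / 2" for u v
  define T3 where "T3 u v w = (m2 z u v \<bullet> w) / 3" for u v w
  have b: "real_bilin b C"
    unfolding real_bilin_def
  proof (intro conjI allI)
    show "\<bar>b u v\<bar> \<le> C * norm u * norm v" for u v
    proof -
      have "\<bar>b u v\<bar> \<le> norm (m1 z u) * norm v" unfolding b_def using Cauchy_Schwarz_ineq2[of "m1 z u" v] by simp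
      also have "\<dots> \<le> C * norm u * norm v" using taylor2D(4)[OF T z] by (intro mult_right_mono) auto
      finally show ?thesis .
    qed
  qed (simp_all add: b_def m1.add m1.scaleR inner_add_left inner_add_right add_divide_distrib)
  have tri: "\<bar>T3 u v w\<bar> \<le> C * norm u * norm v * norm w" for u v w
  proof -
    have "\<bar>T3 u v w\<bar> \<le> norm (m2 z u v) * norm w" unfolding T3_def using Cauchy_Schwarz_ineq2[of "m2 z u v" w] by simp
    also have "\<dots> \<le> C * norm u * norm v * norm w" using taylor2D(5)[OF T z] by (intro mult_right_mono) auto
    finally show ?thesis .
  qed
  note s3 = m2.add_left m2.add_right m2.scaleR_left m2.scaleR_right inner_add_left inner_add_right add_divide_distrib
  have T1: "real_trilin T3 C"
    unfolding real_trilin_def by (intro conjI allI tri) (simp_all add: T3_def s3)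
  have tri2: "\<bar>T3 u w v\<bar> \<le> C * norm u * norm v * norm w" for u v w using tri[of u w v] by (simp add: mult_ac)
  have T2: "real_trilin (\<lambda>a b c. T3 a c b) C"
    unfolding real_trilin_def by (intro conjI allI tri2) (simp_all add: T3_def s3)
  have tri3: "\<bar>T3 w u v\<bar> \<le> C * norm u * norm v * norm w" for u v w using tri[of w u v] by (simp add: mult_ac)
  have T3: "real_trilin (\<lambda>a b c. T3 c a b) C"
    unfolding real_trilin_def by (intro conjI allI tri3) (simp_all add: T3_def s3)
  define \<mu> where "\<mu> u v y = mixed_part3 T3 u v y + mixed_part3 (\<lambda>a b c. T3 a c b) u v y + mixed_part3 (\<lambda>a b c. T3 c a b) u v y" for u v y
  note B = bilinear_parts[OF b]
  have levi: "Re (herm_part b X X) = (m1 z X \<bullet> X + m1 z (J X) \<bullet> J X) / 4" for X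
    by (simp add: B(6)) (simp add: b_def)
  have lp: "levi_poly (\<lambda>X. hprod X (m z) / 2) (pure_part2 b) (herm_part b) (pure_part3 T3) \<mu> (3 * C + 4) c"
  proof
    show "clin (\<lambda>X. hprod X (m z) / 2)"
      unfolding clin_def hprod_def by (auto simp: sum.distrib sum_distrib_left add_divide_distrib algebra_simps)
    show "clin (\<lambda>u. pure_part2 b u v)" "clin (pure_part2 b u)" "clin (\<lambda>u. herm_part b u v)" for u v by (rule B)+
    show "clin (\<lambda>u. pure_part3 T3 u v w)" "clin (\<lambda>v. pure_part3 T3 u v w)" "clin (\<lambda>w. pure_part3 T3 u v w)" for u v w
      by (rule trilinear_parts[OF T1])+
    show "clin (\<lambda>u. \<mu> u v y)" "clin (\<lambda>v. \<mu> u v y)" "clin (\<lambda>y. cnj (\<mu> u v y))" for u v y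
      unfolding \<mu>_def complex_cnj_add
      by (intro clin_add2 trilinear_parts(4)[OF T1] trilinear_parts(4)[OF T2] trilinear_parts(4)[OF T3]
        trilinear_parts(5)[OF T1] trilinear_parts(5)[OF T2] trilinear_parts(5)[OF T3]
        trilinear_parts(6)[OF T1] trilinear_parts(6)[OF T2] trilinear_parts(6)[OF T3])+
    show "herm_part b v u = cnj (herm_part b u v)" for u v by (rule B)
    show "0 < c" by (rule c)
    show "c * (norm u)\<^sup>2 \<le> Re (herm_part b u u)" for u using levi_pos[OF z, of u] by (simp add: levi)
    show "1 \<le> 3 * C + 4" using C by simp
    have up: "x \<le> (3 * C + 4) * norm u" if "x \<le> D * norm u" "D \<le> 3 * C + 4" for x D and u :: "complex^'n"
      using that(1) mult_right_mono[OF that(2), of "norm u"] by simp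
    have up2: "x \<le> (3 * C + 4) * norm u * norm v" if "x \<le> D * norm u * norm v" "D \<le> 3 * C + 4" for x D and u v :: "complex^'n"
      using that(1) mult_right_mono[OF that(2), of "norm u * norm v"] by (simp add: mult.assoc)
    have up3: "x \<le> (3 * C + 4) * norm u * norm v * norm w" if "x \<le> D * norm u * norm v * norm w" "D \<le> 3 * C + 4" for x D and u v w :: "complex^'n"
      using that(1) mult_right_mono[OF that(2), of "norm u * norm v * norm w"] by (simp add: mult.assoc)
    show "cmod (hprod u (m z) / 2) \<le> (3 * C + 4) * norm u" for u
    proof (rule up)
      have "cmod (hprod u (m z)) \<le> \<bar>u \<bullet> m z\<bar> + \<bar>J u \<bullet> m z\<bar>"
        unfolding hprod_eq by (rule order_trans[OF norm_triangle_ineq4]) (simp add: norm_mult)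
      also have "\<dots> \<le> norm u * norm (m z) + norm (J u) * norm (m z)" by (intro add_mono Cauchy_Schwarz_ineq2)
      also have "\<dots> \<le> 2 * (norm u * 2)" using m_bounds(2)[OF z] mult_left_mono[of "norm (m z)" 2 "norm u"] by simp
      finally show "cmod (hprod u (m z) / 2) \<le> 2 * norm u" by (simp add: norm_divide)
    qed (use C in simp)
    show "cmod (pure_part2 b u v) \<le> (3 * C + 4) * norm u * norm v" for u v by (rule up2[OF B(7)]) (use C in simp)
    show "cmod (herm_part b u v) \<le> (3 * C + 4) * norm u * norm v" for u v by (rule up2[OF B(8)]) (use C in simp)
    show "cmod (pure_part3 T3 u v w) \<le> (3 * C + 4) * norm u * norm v * norm w" for u v w
      by (rule up3[OF trilinear_parts(7)[OF T1]]) (use C in simp)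
    show "cmod (\<mu> u v w) \<le> (3 * C + 4) * norm u * norm v * norm w" for u v w
    proof (rule up3)
      show "cmod (\<mu> u v w) \<le> (3 * C) * norm u * norm v * norm w"
        using norm_triangle_mono[OF norm_triangle_mono[OF trilinear_parts(8)[OF T1, of u v w] trilinear_parts(8)[OF T2, of u v w]]
          trilinear_parts(8)[OF T3, of u v w]] unfolding \<mu>_def by simp
    qed simp
    have "hprod (m z) (m z) = complex_of_real ((norm (m z))\<^sup>2)"
    proof -
      have "J (m z) \<bullet> m z = 0" using inner_J[of "m z" "m z"] by (simp add: inner_commute)
      then show ?thesis by (simp add: hprod_eq power2_norm_eq_inner)
    qed
    then have hm: "cmod (hprod (m z) (m z) / 2) = (norm (m z))\<^sup>2 / 2" by (simp add: norm_divide norm_power)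
    show "\<exists>u. u \<noteq> 0 \<and> norm u \<le> (3 * C + 4) * cmod (hprod u (m z) / 2)"
    proof (intro exI conjI)
      show "m z \<noteq> 0" using m_bounds(1)[OF z] by auto
      have "norm (m z) * 1 \<le> norm (m z) * (4 * norm (m z) / 2)" using m_bounds(1)[OF z] by (intro mult_left_mono) auto
      also have "\<dots> = 4 * ((norm (m z))\<^sup>2 / 2)" by (simp add: power2_eq_square)
      also have "\<dots> \<le> (3 * C + 4) * ((norm (m z))\<^sup>2 / 2)" using C by (intro mult_right_mono) auto
      finally show "norm (m z) \<le> (3 * C + 4) * cmod (hprod (m z) (m z) / 2)" unfolding hm by simp
    qed
  qed
  have exp: "\<bar>r (z + w) - (r z + 2 * Re (hprod w (m z) / 2 + pure_part2 b w w + pure_part3 T3 w w w) + Re (herm_part b w w)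
        + 2 * Re (\<mu> w w w))\<bar> \<le> (3 * C + 4) * norm w powr (\<sigma> + 1)" if w: "z + w \<in> ball p R" for w
  proof -
    have e: "\<bar>r (z + w) - r z - m z \<bullet> w - (m1 z w \<bullet> w) / 2 - (m2 z w w \<bullet> w) / 3\<bar> \<le> C * norm w powr (\<sigma> + 1)"
      using taylor2_gradient_expansion[OF T _ convex_ball open_ball r_der z w] \<sigma> by simp
    have gen: "A - (B + 2 * (x + y + t) + g + 2 * u) = A - B - M - P - Q"
      if "P = 2 * y + g" "Q = 2 * t + 2 * u" "M = 2 * x" for A B x y t g u M P Q :: real
      using that by simp
    have "(m1 z w \<bullet> w) / 2 = 2 * Re (pure_part2 b w w) + Re (herm_part b w w)" using B(5)[of w] by (simp add: b_def)
    moreover have "(m2 z w w \<bullet> w) / 3 = 2 * Re (pure_part3 T3 w w w) + 2 * Re (\<mu> w w w)"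
      using trilinear_diagonal[of T3 w] by (simp add: \<mu>_def T3_def)
    moreover have "m z \<bullet> w = 2 * Re (hprod w (m z) / 2)" by (simp add: Re_hprod inner_commute)
    ultimately have "r (z + w) - (r z + 2 * Re (hprod w (m z) / 2 + pure_part2 b w w + pure_part3 T3 w w w) + Re (herm_part b w w)
        + 2 * Re (\<mu> w w w)) = r (z + w) - r z - m z \<bullet> w - (m1 z w \<bullet> w) / 2 - (m2 z w w \<bullet> w) / 3"
      unfolding plus_complex.sel by (rule gen)
    then have "\<bar>r (z + w) - (r z + 2 * Re (hprod w (m z) / 2 + pure_part2 b w w + pure_part3 T3 w w w) + Re (herm_part b w w)
        + 2 * Re (\<mu> w w w))\<bar> \<le> C * norm w powr (\<sigma> + 1)" using e by (simp only:)
    also have "\<dots> \<le> (3 * C + 4) * norm w powr (\<sigma> + 1)" using C by (intro mult_right_mono) auto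
    finally show ?thesis .
  qed
  show "\<exists>\<beta> \<gamma> \<tau> \<mu>. levi_poly (\<lambda>X. hprod X (m z) / 2) \<beta> \<gamma> \<tau> \<mu> (3 * C + 4) c \<and>
     (\<forall>X. Re (\<gamma> X X) = (m1 z X \<bullet> X + m1 z (J X) \<bullet> J X) / 4) \<and>
     (\<forall>w. z + w \<in> ball p R \<longrightarrow> \<bar>r (z + w) - (r z + 2 * Re (hprod w (m z) / 2 + \<beta> w w + \<tau> w w w) + Re (\<gamma> w w)
        + 2 * Re (\<mu> w w w))\<bar> \<le> (3 * C + 4) * norm w powr (\<sigma> + 1))"
    using lp levi exp by (intro exI[of _ "pure_part2 b"] exI[of _ "herm_part b"] exI[of _ "pure_part3 T3"] exI[of _ \<mu>] conjI allI impI)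
qed

end

section \<open>The Levi form as an inner product\<close>

context levi_poly
begin

lemma \<gamma>_add_left: "\<gamma> (u + u') v = \<gamma> u v + \<gamma> u' v" and \<gamma>_smult_left: "\<gamma> (a *s u) v = a * \<gamma> u v"
  using \<gamma> unfolding clin_def by blast+

lemma \<gamma>_add_right: "\<gamma> u (v + v') = \<gamma> u v + \<gamma> u v'"
  using \<gamma>_add_left[of v v' u] \<gamma>_cnj[of u "v + v'"] \<gamma>_cnj[of u v] \<gamma>_cnj[of u v'] by (metis complex_cnj_add complex_cnj_cnj)

lemma \<gamma>_smult_right: "\<gamma> u (a *s v) = cnj a * \<gamma> u v"
  using \<gamma>_smult_left[of a v u] \<gamma>_cnj[of u "a *s v"] \<gamma>_cnj[of u v] by (metis complex_cnj_cnj complex_cnj_mult)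

lemma ell_add: "ell (u + v) = ell u + ell v" and ell_smult: "ell (a *s u) = a * ell u"
  using ell unfolding clin_def by blast+

lemma Im_\<gamma>: "Im (\<gamma> u u) = 0"
  using \<gamma>_cnj[of u u] by (simp add: complex_eq_iff)

lemma \<gamma>_nonneg: "0 \<le> Re (\<gamma> u u)"
  using \<gamma>_pos[of u] c by (meson mult_nonneg_nonneg order_less_imp_le order_trans zero_le_power2)

text \<open>Positivity of \<gamma> makes the map from \<open>Q\<close> to its functional injective,
  hence surjective in finite dimension. The norm bound comes from testing with \<open>Q\<close>
  itself.\<close>

lemma riesz:
  assumes f: "clin (\<lambda>y. cnj (f y))" and b: "\<And>y. cmod (f y) \<le> D * norm y"
  shows "\<exists>Q. (\<forall>y. \<gamma> Q y = f y) \<and> c * norm Q \<le> D"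
proof -
  define A where "A Q = (\<chi> j. \<gamma> Q (axis j 1))" for Q
  have lin: "linear A"
    unfolding A_def by (rule linearI) (simp_all add: vec_eq_iff \<gamma>_add_left vec_scaleR_eq \<gamma>_smult_left)
  have ext: "\<gamma> Q y = (\<Sum>j\<in>UNIV. cnj (y $ j) * \<gamma> Q (axis j 1))" for Q y
  proof -
    have "clin (\<lambda>y. cnj (\<gamma> Q y))" unfolding clin_def by (simp add: \<gamma>_add_right \<gamma>_smult_right)
    from arg_cong[OF clin_expand[OF this, of y], of cnj] show ?thesis by simp
  qed
  have inj: "inj A"
  proof (subst linear_injective_0[OF lin], intro allI impI)
    fix Q assume "A Q = 0"
    then have "\<gamma> Q (axis j 1) = 0" for j by (simp add: A_def vec_eq_iff)
    then have "\<gamma> Q Q = 0" using ext[of Q Q] by simp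
    then show "Q = 0" using \<gamma>_pos[of Q] c by (simp add: mult_le_0_iff)
  qed
  have "surj A" by (rule linear_injective_imp_surjective[OF lin inj]) simp
  then obtain Q where Q: "A Q = (\<chi> j. f (axis j 1))" by (metis surjD)
  have eq: "\<gamma> Q y = f y" for y
  proof -
    have "\<gamma> Q (axis j 1) = f (axis j 1)" for j using Q by (simp add: A_def vec_eq_iff)
    then show ?thesis using ext[of Q y] arg_cong[OF clin_expand[OF f, of y], of cnj] by simp
  qed
  have "c * norm Q \<le> D"
  proof (cases "Q = 0")
    case True
    have "0 \<le> D * norm (axis undefined 1 :: complex^'n)" using b norm_ge_zero order_trans by blast
    then show ?thesis using True by (simp add: zero_le_mult_iff)
  next
    case False
    have "c * (norm Q)\<^sup>2 \<le> D * norm Q"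
      using \<gamma>_pos[of Q] complex_Re_le_cmod[of "\<gamma> Q Q"] b[of Q] by (simp add: eq)
    then show ?thesis using False by (simp add: power2_eq_square)
  qed
  then show ?thesis using eq by blast
qed

text \<open>The polarized quadratic part of the coordinate change: it represents the mixed cubic
  term through \<gamma>.\<close>

definition riesz_\<mu> :: "complex^'n \<Rightarrow> complex^'n \<Rightarrow> complex^'n" where
  "riesz_\<mu> u v = (SOME Q. (\<forall>y. \<gamma> Q y = \<mu> u v y) \<and> c * norm Q \<le> K * norm u * norm v)"

lemma riesz_\<mu>: "\<gamma> (riesz_\<mu> u v) y = \<mu> u v y" "norm (riesz_\<mu> u v) \<le> K / c * norm u * norm v"
proof -
  have "\<exists>Q. (\<forall>y. \<gamma> Q y = \<mu> u v y) \<and> c * norm Q \<le> K * norm u * norm v"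
    by (rule riesz[OF \<mu>(3) \<mu>_bound])
  from someI_ex[OF this] have "(\<forall>y. \<gamma> (riesz_\<mu> u v) y = \<mu> u v y) \<and> c * norm (riesz_\<mu> u v) \<le> K * norm u * norm v"
    unfolding riesz_\<mu>_def .
  then show "\<gamma> (riesz_\<mu> u v) y = \<mu> u v y" "norm (riesz_\<mu> u v) \<le> K / c * norm u * norm v"
    using c by (auto simp: field_simps)
qed

lemma \<gamma>_eqI:
  assumes "\<And>y. \<gamma> Q y = \<gamma> Q' y" shows "Q = Q'"
proof -
  have "\<gamma> (Q + (- 1) *s Q') (Q + (- 1) *s Q') = 0"
    unfolding \<gamma>_add_left \<gamma>_smult_left using assms by simp
  then have "Q + (- 1) *s Q' = 0" using \<gamma>_pos[of "Q + (- 1) *s Q'"] c by (simp add: mult_le_0_iff)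
  then show ?thesis by (simp add: vec_eq_iff)
qed

text \<open>Uniqueness of the representing vector makes it complex linear in both arguments, so the
  change of coordinates is holomorphic.\<close>

lemma riesz_\<mu>_clin: "clin (\<lambda>u. riesz_\<mu> u v $ k)" "clin (\<lambda>v. riesz_\<mu> u v $ k)"
proof -
  have "riesz_\<mu> (x + y) v = riesz_\<mu> x v + riesz_\<mu> y v" "riesz_\<mu> (a *s x) v = a *s riesz_\<mu> x v"
    "riesz_\<mu> v (x + y) = riesz_\<mu> v x + riesz_\<mu> v y" "riesz_\<mu> v (a *s x) = a *s riesz_\<mu> v x" for a x y v
    using \<mu>(1,2)[unfolded clin_def] by (auto intro!: \<gamma>_eqI simp: riesz_\<mu> \<gamma>_add_left \<gamma>_smult_left)
  then show "clin (\<lambda>u. riesz_\<mu> u v $ k)" "clin (\<lambda>v. riesz_\<mu> u v $ k)" unfolding clin_def by simp_all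
qed

text \<open>The vector \<gamma>-dual to \<open>ell\<close>, scaled to \<open>ell \<nu> = 1\<close>,
  is \<gamma>-orthogonal to the kernel of \<open>ell\<close>; corrections along \<nu> will therefore
  be nearly invisible to \<gamma>. The bound \<open>ell_lower\<close> prevents \<nu> from becoming
  large.\<close>

lemma normal_vector:
  "\<exists>\<nu> \<kappa>. 0 < \<kappa> \<and> ell \<nu> = 1 \<and> (\<forall>u. \<gamma> \<nu> u = cnj (ell u) / complex_of_real \<kappa>) \<and>
     norm \<nu> \<le> K * K / c \<and> 1 / \<kappa> \<le> K * K * K * K / (c * c) * K"
proof -
  have "clin (\<lambda>y. cnj (cnj (ell y)))" using ell by simp
  from riesz[OF this, of K] obtain n where n: "\<And>y. \<gamma> n y = cnj (ell y)" "c * norm n \<le> K" using ell_bound by auto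
  obtain u where u: "u \<noteq> 0" "norm u \<le> K * cmod (ell u)" using ell_lower by blast
  have "cmod (ell u) \<le> K * norm n * norm u" using \<gamma>_bound[of n u] by (simp add: n)
  then have "K * cmod (ell u) \<le> K * (K * norm n * norm u)" using K by (intro mult_left_mono) auto
  then have "1 * norm u \<le> (K * K * norm n) * norm u" using u(2) by (simp add: mult_ac)
  then have nl: "1 \<le> K * K * norm n" using u(1) unfolding mult_le_cancel_right by simp
  then have n0: "norm n > 0" using nl by (cases "norm n = 0") auto
  define \<kappa> where "\<kappa> = Re (\<gamma> n n)"
  have \<kappa>l: "c * (norm n)\<^sup>2 \<le> \<kappa>" unfolding \<kappa>_def by (rule \<gamma>_pos)
  then have \<kappa>: "\<kappa> > 0" using c n0 by (meson less_le_trans mult_pos_pos zero_less_power)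
  have \<gamma>nn: "\<gamma> n n = complex_of_real \<kappa>" by (simp add: complex_eq_iff \<kappa>_def Im_\<gamma>)
  have elln: "ell n = complex_of_real \<kappa>" using n(1)[of n] \<gamma>nn by (metis complex_cnj_cnj complex_cnj_complex_of_real)
  define \<nu> where "\<nu> = complex_of_real (1 / \<kappa>) *s n"
  have 1: "ell \<nu> = 1" using \<kappa> by (simp add: \<nu>_def ell_smult elln)
  have 2: "\<gamma> \<nu> u = cnj (ell u) / \<kappa>" for u by (simp add: \<nu>_def \<gamma>_smult_left n)
  have "norm n / \<kappa> \<le> norm n / (c * (norm n)\<^sup>2)" using \<kappa>l c n0 \<kappa> by (intro divide_left_mono mult_pos_pos) auto
  also have "\<dots> = 1 / (c * norm n)" using n0 by (simp add: power2_eq_square)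
  also have "\<dots> \<le> K * K / c" using nl c n0 by (simp add: field_simps)
  finally have 3: "norm \<nu> \<le> K * K / c" using \<kappa> by (simp add: \<nu>_def norm_smult norm_divide)
  have "1 / \<kappa> = cmod (\<gamma> \<nu> \<nu>)" using 2[of \<nu>] 1 \<kappa> by (simp add: norm_divide)
  also have "\<dots> \<le> K * norm \<nu> * norm \<nu>" by (rule \<gamma>_bound)
  also have "\<dots> \<le> K * (K * K / c) * (K * K / c)" using 3 K c by (intro mult_mono) auto
  finally have 4: "1 / \<kappa> \<le> K * K * K * K / (c * c) * K" by (simp add: mult_ac)
  show ?thesis using \<kappa> 1 2 3 4 by blast
qed

end

section \<open>The Schwarz lemma on the model domain\<close>

definition holo_vec :: "(complex \<Rightarrow> complex^'n) \<Rightarrow> complex set \<Rightarrow> bool" where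
  "holo_vec \<phi> S \<longleftrightarrow> (\<forall>k. (\<lambda>\<zeta>. \<phi> \<zeta> $ k) holomorphic_on S)"

definition vec_deriv :: "(complex \<Rightarrow> complex^'n) \<Rightarrow> complex^'n \<Rightarrow> complex \<Rightarrow> bool" where
  "vec_deriv \<phi> \<phi>' x \<longleftrightarrow> (\<forall>k. ((\<lambda>\<zeta>. \<phi> \<zeta> $ k) has_field_derivative \<phi>' $ k) (at x))"

lemma clin_0: "clin f \<Longrightarrow> f 0 = 0"
  using clin_expand[of f 0] by simp

lemma clin_holomorphic:
  assumes "clin f" "holo_vec \<phi> S" shows "(\<lambda>\<zeta>. f (\<phi> \<zeta>)) holomorphic_on S"
proof -
  have "(\<lambda>\<zeta>. \<Sum>j\<in>UNIV. \<phi> \<zeta> $ j * f (axis j 1)) holomorphic_on S"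
    using assms(2) unfolding holo_vec_def by (intro holomorphic_intros) auto
  then show ?thesis by (subst clin_expand[OF assms(1)])
qed

lemma clin2_holomorphic:
  assumes "\<And>v. clin (\<lambda>u. f u v)" "\<And>u. clin (f u)" "holo_vec \<phi> S" "holo_vec \<psi> S"
  shows "(\<lambda>\<zeta>. f (\<phi> \<zeta>) (\<psi> \<zeta>)) holomorphic_on S"
proof -
  have "(\<lambda>\<zeta>. \<Sum>j\<in>UNIV. \<phi> \<zeta> $ j * f (axis j 1) (\<psi> \<zeta>)) holomorphic_on S"
    using assms(3) clin_holomorphic[OF assms(2,4)] unfolding holo_vec_def by (intro holomorphic_intros) auto
  moreover have "(\<lambda>\<zeta>. f (\<phi> \<zeta>) (\<psi> \<zeta>)) = (\<lambda>\<zeta>. \<Sum>j\<in>UNIV. \<phi> \<zeta> $ j * f (axis j 1) (\<psi> \<zeta>))"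
    using clin_expand[OF assms(1)] by (intro ext)
  ultimately show ?thesis by simp
qed

lemma clin3_holomorphic:
  assumes "\<And>v w. clin (\<lambda>u. f u v w)" "\<And>u w. clin (\<lambda>v. f u v w)" "\<And>u v. clin (f u v)"
    "holo_vec \<phi> S" "holo_vec \<psi> S" "holo_vec \<eta> S"
  shows "(\<lambda>\<zeta>. f (\<phi> \<zeta>) (\<psi> \<zeta>) (\<eta> \<zeta>)) holomorphic_on S"
proof -
  have "(\<lambda>\<zeta>. \<Sum>j\<in>UNIV. \<phi> \<zeta> $ j * f (axis j 1) (\<psi> \<zeta>) (\<eta> \<zeta>)) holomorphic_on S"
    using assms(4) clin2_holomorphic[OF assms(2,3,5,6)] unfolding holo_vec_def by (intro holomorphic_intros) auto
  moreover have "(\<lambda>\<zeta>. f (\<phi> \<zeta>) (\<psi> \<zeta>) (\<eta> \<zeta>)) = (\<lambda>\<zeta>. \<Sum>j\<in>UNIV. \<phi> \<zeta> $ j * f (axis j 1) (\<psi> \<zeta>) (\<eta> \<zeta>))"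
    using clin_expand[OF assms(1)] by (intro ext)
  ultimately show ?thesis by simp
qed

lemma clin_deriv:
  assumes "clin f" "vec_deriv \<phi> \<phi>' x"
  shows "((\<lambda>\<zeta>. f (\<phi> \<zeta>)) has_field_derivative f \<phi>') (at x)"
proof -
  have "((\<lambda>\<zeta>. \<Sum>j\<in>UNIV. \<phi> \<zeta> $ j * f (axis j 1)) has_field_derivative (\<Sum>j\<in>UNIV. \<phi>' $ j * f (axis j 1))) (at x)"
    using assms(2) unfolding vec_deriv_def by (auto intro!: derivative_eq_intros)
  then show ?thesis by (subst (1 2) clin_expand[OF assms(1)])
qed

lemma clin2_deriv:
  assumes "\<And>v. clin (\<lambda>u. f u v)" "\<And>u. clin (f u)" "vec_deriv \<phi> \<phi>' x" "vec_deriv \<psi> \<psi>' x"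
  shows "((\<lambda>\<zeta>. f (\<phi> \<zeta>) (\<psi> \<zeta>)) has_field_derivative (f \<phi>' (\<psi> x) + f (\<phi> x) \<psi>')) (at x)"
proof -
  have "((\<lambda>\<zeta>. \<Sum>j\<in>UNIV. \<phi> \<zeta> $ j * f (axis j 1) (\<psi> \<zeta>)) has_field_derivative
      (\<Sum>j\<in>UNIV. \<phi>' $ j * f (axis j 1) (\<psi> x) + \<phi> x $ j * f (axis j 1) \<psi>')) (at x)"
    by (rule DERIV_sum) (use assms(3) clin_deriv[OF assms(2,4)] in \<open>auto simp: vec_deriv_def intro!: derivative_eq_intros\<close>)
  moreover have "(\<lambda>\<zeta>. f (\<phi> \<zeta>) (\<psi> \<zeta>)) = (\<lambda>\<zeta>. \<Sum>j\<in>UNIV. \<phi> \<zeta> $ j * f (axis j 1) (\<psi> \<zeta>))"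
    using clin_expand[OF assms(1)] by (intro ext)
  moreover have "f \<phi>' (\<psi> x) + f (\<phi> x) \<psi>' = (\<Sum>j\<in>UNIV. \<phi>' $ j * f (axis j 1) (\<psi> x) + \<phi> x $ j * f (axis j 1) \<psi>')"
    unfolding sum.distrib using clin_expand[OF assms(1)] by metis
  ultimately show ?thesis by simp
qed

lemma clin3_deriv_zero:
  assumes "\<And>v w. clin (\<lambda>u. f u v w)" "\<And>u w. clin (\<lambda>v. f u v w)" "\<And>u v. clin (f u v)" "vec_deriv \<phi> \<phi>' x" "\<phi> x = 0"
  shows "((\<lambda>\<zeta>. f (\<phi> \<zeta>) (\<phi> \<zeta>) (\<phi> \<zeta>)) has_field_derivative 0) (at x)"
proof -
  have "((\<lambda>\<zeta>. f (axis j 1) (\<phi> \<zeta>) (\<phi> \<zeta>)) has_field_derivative 0) (at x)" for j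
    using clin2_deriv[OF assms(2,3,4,4)] clin_0[OF assms(2)] clin_0[OF assms(3)] assms(5) by simp
  then have "((\<lambda>\<zeta>. \<phi> \<zeta> $ j * f (axis j 1) (\<phi> \<zeta>) (\<phi> \<zeta>)) has_field_derivative 0) (at x)" for j
    using assms(4) unfolding vec_deriv_def
    by (auto intro!: derivative_eq_intros simp: assms(5) clin_0[OF assms(3)])
  then have "((\<lambda>\<zeta>. \<Sum>j\<in>UNIV. \<phi> \<zeta> $ j * f (axis j 1) (\<phi> \<zeta>) (\<phi> \<zeta>)) has_field_derivative (\<Sum>j\<in>(UNIV::'a set). 0)) (at x)"
    by (rule DERIV_sum)
  moreover have "(\<lambda>\<zeta>. f (\<phi> \<zeta>) (\<phi> \<zeta>) (\<phi> \<zeta>)) = (\<lambda>\<zeta>. \<Sum>j\<in>UNIV. \<phi> \<zeta> $ j * f (axis j 1) (\<phi> \<zeta>) (\<phi> \<zeta>))"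
    using clin_expand[OF assms(1)] by (intro ext)
  ultimately show ?thesis by simp
qed

text \<open>The closed bound \<open>M\<close>, possibly 0, is reached by applying the strict Schwarz
  lemma with every larger constant.\<close>

lemma Schwarz_bound:
  assumes "f holomorphic_on ball 0 1" "f 0 = 0" "\<And>\<zeta>. norm \<zeta> < 1 \<Longrightarrow> cmod (f \<zeta>) \<le> M"
  shows "cmod (deriv f 0) \<le> M" "norm \<xi> < 1 \<Longrightarrow> cmod (f \<xi>) \<le> M * cmod \<xi>"
proof -
  have M0: "0 \<le> M" using assms(2) assms(3)[of 0] by simp
  have g: "cmod (deriv f 0) \<le> M' \<and> (norm \<xi> < 1 \<longrightarrow> cmod (f \<xi>) \<le> M' * cmod \<xi>)" if "M < M'" for M'
  proof -
    have M': "M' > 0" using that M0 by simp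
    have h: "(\<lambda>\<zeta>. f \<zeta> / M') holomorphic_on ball 0 1" using assms(1) M' by (intro holomorphic_intros) auto
    have b: "cmod (f \<zeta> / M') < 1" if "norm \<zeta> < 1" for \<zeta>
      using assms(3)[OF that] \<open>M < M'\<close> M' by (simp add: norm_divide)
    have "deriv (\<lambda>\<zeta>. f \<zeta> / M') 0 = deriv f 0 / M'"
      using assms(1) by (intro deriv_cdivide_right) (simp add: holomorphic_on_imp_differentiable_at)
    then have "cmod (deriv f 0 / M') = cmod (deriv (\<lambda>\<zeta>. f \<zeta> / M') 0)" by simp
    also have "\<dots> \<le> 1"
      by (rule Schwarz_Lemma(2)[OF h _ b, of 0]) (use assms in auto)
    finally have "cmod (deriv f 0 / M') \<le> 1" .
    moreover have "cmod (f \<xi> / M') \<le> cmod \<xi>" if "norm \<xi> < 1"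
      by (rule Schwarz_Lemma(1)[OF h _ b that]) (use assms in auto)
    ultimately show ?thesis using M' by (auto simp: norm_divide field_simps)
  qed
  show "cmod (deriv f 0) \<le> M" by (rule dense_ge) (use g in blast)
  assume xi: "norm \<xi> < 1"
  show "cmod (f \<xi>) \<le> M * cmod \<xi>"
  proof (rule field_le_epsilon)
    fix e :: real assume e: "0 < e"
    have "cmod (f \<xi>) \<le> (M + e) * cmod \<xi>" using g[of "M + e"] e xi by auto
    also have "\<dots> \<le> M * cmod \<xi> + e" using xi e by (simp add: distrib_right mult_left_le)
    finally show "cmod (f \<xi>) \<le> M * cmod \<xi> + e" .
  qed
qed

context levi_poly
begin

definition pol :: "complex^'n \<Rightarrow> complex" where
  "pol w = ell w + \<beta> w w + \<tau> w w w"

definition shear :: "complex^'n \<Rightarrow> complex^'n" where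
  "shear w = w + riesz_\<mu> w w"

lemma pol_0: "pol 0 = 0" and shear_0: "shear 0 = 0"
proof -
  show "pol 0 = 0" unfolding pol_def using clin_0[OF ell] clin_0[OF \<beta>(2)] clin_0[OF \<tau>(3)] by simp
  show "shear 0 = 0" using clin_0[OF riesz_\<mu>_clin(1)] by (simp add: shear_def vec_eq_iff)
qed

lemma pol_holomorphic: "holo_vec \<phi> S \<Longrightarrow> (\<lambda>\<zeta>. pol (\<phi> \<zeta>)) holomorphic_on S"
  unfolding pol_def
  by (intro holomorphic_on_add clin_holomorphic[OF ell] clin2_holomorphic[OF \<beta>] clin3_holomorphic[OF \<tau>])

lemma shear_holomorphic: "holo_vec \<phi> S \<Longrightarrow> holo_vec (\<lambda>\<zeta>. shear (\<phi> \<zeta>)) S"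
  unfolding shear_def holo_vec_def vector_add_component
  using clin2_holomorphic[OF riesz_\<mu>_clin, of \<phi> S \<phi>] by (auto simp: holo_vec_def intro!: holomorphic_on_add)

lemma pol_deriv:
  assumes v: "vec_deriv \<phi> \<phi>' x" and z: "\<phi> x = 0"
  shows "((\<lambda>\<zeta>. pol (\<phi> \<zeta>)) has_field_derivative ell \<phi>') (at x)"
  unfolding pol_def
  using DERIV_add[OF DERIV_add[OF clin_deriv[OF ell v] clin2_deriv[OF \<beta> v v]] clin3_deriv_zero[OF \<tau> v z]]
  by (simp add: z clin_0[OF \<beta>(1)] clin_0[OF \<beta>(2)])

lemma shear_deriv:
  assumes v: "vec_deriv \<phi> \<phi>' x" and z: "\<phi> x = 0"
  shows "vec_deriv (\<lambda>\<zeta>. shear (\<phi> \<zeta>)) \<phi>' x"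
  unfolding vec_deriv_def
proof
  fix k
  have "((\<lambda>\<zeta>. \<phi> \<zeta> $ k) has_field_derivative \<phi>' $ k) (at x)" using v by (simp add: vec_deriv_def)
  from DERIV_add[OF this clin2_deriv[OF riesz_\<mu>_clin v v, of k]]
  show "((\<lambda>\<zeta>. shear (\<phi> \<zeta>) $ k) has_field_derivative \<phi>' $ k) (at x)"
    by (simp add: shear_def z clin_0[OF riesz_\<mu>_clin(1)] clin_0[OF riesz_\<mu>_clin(2)])
qed

text \<open>Completing the square with q = \<open>riesz_\<mu> w w\<close>: the cross term of
  \<gamma>(w + q, w + q) is 2 Re \<gamma>(q, w) = 2 Re \<mu>(w, w, w), and \<gamma>(q, q) is
  quartic.\<close>

lemma \<gamma>_shear:
  "Re (\<gamma> (shear w) (shear w)) \<le> Re (\<gamma> w w) + 2 * Re (\<mu> w w w) + K * (K / c)\<^sup>2 * norm w ^ 4"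
proof -
  let ?q = "riesz_\<mu> w w"
  have "Re (\<gamma> ?q ?q) \<le> K * norm ?q * norm ?q" using \<gamma>_bound complex_Re_le_cmod order_trans by blast
  also have "\<dots> \<le> K * (K / c * norm w * norm w) * (K / c * norm w * norm w)"
    using riesz_\<mu>(2)[of w w] K c by (intro mult_mono mult_nonneg_nonneg) auto
  finally have "Re (\<gamma> ?q ?q) \<le> K * (K / c)\<^sup>2 * norm w ^ 4" by (simp add: power2_eq_square power4_eq_xxxx mult_ac)
  moreover have "\<gamma> (shear w) (shear w) = \<gamma> w w + cnj (\<mu> w w w) + \<mu> w w w + \<gamma> ?q ?q"
    unfolding shear_def \<gamma>_add_left \<gamma>_add_right using \<gamma>_cnj[of w ?q] by (simp add: riesz_\<mu>)
  ultimately show ?thesis by simp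
qed

lemma \<gamma>_shear_lower:
  assumes "norm w \<le> c / (2 * K)"
  shows "c / 4 * (norm w)\<^sup>2 \<le> Re (\<gamma> (shear w) (shear w))"
proof -
  have "norm (riesz_\<mu> w w) \<le> (K / c * norm w) * norm w" using riesz_\<mu>(2)[of w w] .
  also have "\<dots> \<le> (1 / 2) * norm w" using assms K c by (intro mult_right_mono) (auto simp: field_simps)
  finally have "norm w / 2 \<le> norm (shear w)"
    unfolding shear_def using norm_triangle_ineq4[of "w + riesz_\<mu> w w" "riesz_\<mu> w w"] by simp
  then have "(norm w / 2)\<^sup>2 \<le> (norm (shear w))\<^sup>2" by (intro power_mono) auto
  then have "c * ((norm w)\<^sup>2 / 4) \<le> c * (norm (shear w))\<^sup>2" using c by (intro mult_left_mono) (auto simp: power_divide)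
  then show ?thesis using \<gamma>_pos[of "shear w"] by simp
qed

text \<open>This is Cauchy-Schwarz in the direct sum of C and C^n with Hermitian form x cnj y +
  \<gamma>(u, v), from expanding the squared norm of B (x, u) - z (y, v).\<close>

lemma cauchy_schwarz:
  "(cmod (x * cnj y + \<gamma> u v))\<^sup>2 \<le> ((cmod x)\<^sup>2 + Re (\<gamma> u u)) * ((cmod y)\<^sup>2 + Re (\<gamma> v v))"
proof -
  define z where "z = x * cnj y + \<gamma> u v"
  define A B where "A = (cmod x)\<^sup>2 + Re (\<gamma> u u)" and "B = (cmod y)\<^sup>2 + Re (\<gamma> v v)"
  have B0: "0 \<le> B" using \<gamma>_nonneg[of v] by (simp add: B_def)
  show ?thesis
  proof (cases "B = 0")
    case True
    then have "cmod y = 0" "Re (\<gamma> v v) = 0" using \<gamma>_nonneg[of v] zero_le_power2[of "cmod y"] unfolding B_def by (simp_all add: add_nonneg_eq_0_iff)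
    then have "y = 0" "v = 0" using \<gamma>_pos[of v] c by (auto simp: mult_le_0_iff)
    moreover have "\<gamma> u 0 = 0" using \<gamma>_smult_right[of u 0 0] by simp
    moreover have "0 \<le> A * B" using B0 \<gamma>_nonneg[of u] by (simp add: A_def)
    ultimately show ?thesis unfolding A_def B_def by simp
  next
    case False
    then have B: "B > 0" using B0 by simp
    have "0 \<le> (cmod (of_real B * x - z * y))\<^sup>2 + Re (\<gamma> (of_real B *s u + (- z) *s v) (of_real B *s u + (- z) *s v))"
      using \<gamma>_nonneg by simp
    also have "(cmod (of_real B * x - z * y))\<^sup>2 = B\<^sup>2 * (cmod x)\<^sup>2 - 2 * B * Re (cnj z * (x * cnj y)) + (cmod z)\<^sup>2 * (cmod y)\<^sup>2"
      unfolding cmod_power2 by (simp add: power2_eq_square algebra_simps)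
    also have "Re (\<gamma> (of_real B *s u + (- z) *s v) (of_real B *s u + (- z) *s v))
       = B\<^sup>2 * Re (\<gamma> u u) - 2 * B * Re (cnj z * \<gamma> u v) + (cmod z)\<^sup>2 * Re (\<gamma> v v)"
    proof -
      define r2 where "r2 = (cmod z)\<^sup>2"
      define B2 where "B2 = B\<^sup>2"
      have "z * cnj z = of_real r2" unfolding r2_def by (rule complex_norm_square[symmetric])
      moreover have "\<gamma> (of_real B *s u + (- z) *s v) (of_real B *s u + (- z) *s v)
        = of_real B2 * \<gamma> u u - of_real B * (cnj z * \<gamma> u v) - of_real B * cnj (cnj z * \<gamma> u v) + (z * cnj z) * \<gamma> v v"
        unfolding \<gamma>_add_left \<gamma>_add_right \<gamma>_smult_left \<gamma>_smult_right \<gamma>_cnj[of u v] B2_def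
        by (simp add: algebra_simps power2_eq_square)
      ultimately have "\<gamma> (of_real B *s u + (- z) *s v) (of_real B *s u + (- z) *s v)
        = of_real B2 * \<gamma> u u - of_real B * (cnj z * \<gamma> u v) - of_real B * cnj (cnj z * \<gamma> u v) + of_real r2 * \<gamma> v v" by simp
      from arg_cong[OF this, of Re] show ?thesis
        unfolding r2_def[symmetric] B2_def[symmetric] by (simp add: Im_\<gamma> algebra_simps)
    qed
    also have "B\<^sup>2 * (cmod x)\<^sup>2 - 2 * B * Re (cnj z * (x * cnj y)) + (cmod z)\<^sup>2 * (cmod y)\<^sup>2
        + (B\<^sup>2 * Re (\<gamma> u u) - 2 * B * Re (cnj z * \<gamma> u v) + (cmod z)\<^sup>2 * Re (\<gamma> v v))
        = B\<^sup>2 * A - 2 * B * Re (cnj z * z) + (cmod z)\<^sup>2 * B"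
      by (simp add: A_def B_def z_def algebra_simps)
    also have "Re (cnj z * z) = (cmod z)\<^sup>2" unfolding cmod_power2 by (simp add: power2_eq_square)
    finally have "0 \<le> B * (A * B - (cmod z)\<^sup>2)" by (simp add: power2_eq_square algebra_simps)
    then have "0 \<le> A * B - (cmod z)\<^sup>2" using B by (simp add: zero_le_mult_iff)
    then show ?thesis by (simp add: z_def A_def B_def)
  qed
qed

text \<open>The map (P, sqrt d V) / (d - P) vanishes at 0 and has derivative (\<alpha>, b) there,
  whose squared norm \<open>N\<close> is to be bounded. Pairing the map with (\<alpha>, b) gives a
  scalar function \<open>S\<close> with derivative \<open>N\<close> at 0, so the scalar Schwarz
  lemma yields N <= sqrt (N M).\<close>

lemma schwarz_lower:
  fixes \<phi> :: "complex \<Rightarrow> complex^'n"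
  assumes d: "0 < d" and hol: "holo_vec \<phi> (ball 0 1)" and \<phi>0: "\<phi> 0 = 0" and der: "vec_deriv \<phi> \<phi>' 0"
    and a: "0 < a" "a \<le> 1" and D: "0 \<le> D" and \<theta>: "0 \<le> \<theta>" "\<theta> \<le> 1"
    and est: "\<And>\<zeta>. norm \<zeta> < 1 \<Longrightarrow> 2 * Re (pol (\<phi> \<zeta>)) + Re (\<gamma> (shear (\<phi> \<zeta>)) (shear (\<phi> \<zeta>))) \<le> d + D * norm (\<phi> \<zeta>) powr (2 * (1 + \<theta>))"
    and est2: "\<And>\<zeta>. norm \<zeta> < 1 \<Longrightarrow> 2 * Re (pol (\<phi> \<zeta>)) \<le> d - a * (norm (\<phi> \<zeta>))\<^sup>2"
  shows "(cmod (ell \<phi>'))\<^sup>2 / d\<^sup>2 + Re (\<gamma> \<phi>' \<phi>') / d \<le> 1 + 4 * D / a\<^sup>2 * d powr \<theta>"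
proof -
  define \<alpha> where "\<alpha> = ell \<phi>' / d"
  define b where "b = complex_of_real (1 / sqrt d) *s \<phi>'"
  define N where "N = (cmod \<alpha>)\<^sup>2 + Re (\<gamma> b b)"
  define M where "M = 1 + 4 * D / a\<^sup>2 * d powr \<theta>"
  have M: "1 \<le> M" using D by (simp add: M_def)
  have \<gamma>b: "\<gamma> b b = \<gamma> \<phi>' \<phi>' / d"
  proof -
    have "complex_of_real (sqrt d) * complex_of_real (sqrt d) = complex_of_real d" using d by (simp flip: of_real_mult)
    then have "1 / (complex_of_real (sqrt d) * complex_of_real (sqrt d)) = 1 / complex_of_real d" by simp
    then have "complex_of_real (1 / sqrt d) * complex_of_real (1 / sqrt d) = 1 / complex_of_real d" by simp
    then show ?thesis by (simp only: b_def \<gamma>_smult_left \<gamma>_smult_right complex_cnj_complex_of_real mult.assoc[symmetric]) simp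
  qed
  have N_eq: "N = (cmod (ell \<phi>'))\<^sup>2 / d\<^sup>2 + Re (\<gamma> \<phi>' \<phi>') / d"
    using d by (simp add: N_def \<alpha>_def \<gamma>b norm_divide power_divide)
  have N0: "0 \<le> N" using \<gamma>_nonneg[of b] by (simp add: N_def)
  define S where "S \<zeta> = (pol (\<phi> \<zeta>) * cnj \<alpha> + \<gamma> (complex_of_real (sqrt d) *s shear (\<phi> \<zeta>)) b) / (d - pol (\<phi> \<zeta>))" for \<zeta>
  have Re_lower: "a / 2 * (d + (norm (\<phi> \<zeta>))\<^sup>2) \<le> Re (d - pol (\<phi> \<zeta>))" if "norm \<zeta> < 1" for \<zeta>
  proof -
    have "a * d \<le> d" using a d by simp
    then show ?thesis using est2[OF that] by (simp add: algebra_simps)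
  qed
  have den: "d - pol (\<phi> \<zeta>) \<noteq> 0" if "norm \<zeta> < 1" for \<zeta>
  proof -
    have "0 < a / 2 * (d + (norm (\<phi> \<zeta>))\<^sup>2)" using a d by (simp add: add_pos_nonneg)
    then have "0 < Re (d - pol (\<phi> \<zeta>))" using Re_lower[OF that] by linarith
    then show ?thesis by (metis less_irrefl zero_complex.sel(1))
  qed
  have S0: "S 0 = 0" by (simp add: S_def \<phi>0 pol_0 shear_0 \<gamma>_smult_left) (use \<gamma>_smult_left[of 0 0 b] in simp)
  have Shol: "S holomorphic_on ball 0 1"
    unfolding S_def \<gamma>_smult_left
    by (intro holomorphic_intros pol_holomorphic[OF hol] clin_holomorphic[OF \<gamma> shear_holomorphic[OF hol]]) (use den in auto)
  have Sder: "deriv S 0 = of_real N"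
  proof -
    have "((\<lambda>\<zeta>. pol (\<phi> \<zeta>) * cnj \<alpha> + of_real (sqrt d) * \<gamma> (shear (\<phi> \<zeta>)) b) has_field_derivative
       (ell \<phi>' * cnj \<alpha> + of_real (sqrt d) * \<gamma> \<phi>' b)) (at 0)"
      by (rule DERIV_add[OF DERIV_cmult_right[OF pol_deriv[OF der \<phi>0]] DERIV_cmult[OF clin_deriv[OF \<gamma> shear_deriv[OF der \<phi>0]]]])
    moreover have "((\<lambda>\<zeta>. complex_of_real d - pol (\<phi> \<zeta>)) has_field_derivative (0 - ell \<phi>')) (at 0)"
      by (rule DERIV_diff[OF DERIV_const pol_deriv[OF der \<phi>0]])
    ultimately have "(S has_field_derivative ((ell \<phi>' * cnj \<alpha> + of_real (sqrt d) * \<gamma> \<phi>' b) * (d - pol (\<phi> 0))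
       - (pol (\<phi> 0) * cnj \<alpha> + of_real (sqrt d) * \<gamma> (shear (\<phi> 0)) b) * (0 - ell \<phi>')) / ((d - pol (\<phi> 0)) * (d - pol (\<phi> 0)))) (at 0)"
      unfolding S_def \<gamma>_smult_left by (rule DERIV_divide) (use den[of 0] in auto)
    moreover have "\<gamma> 0 b = 0" using \<gamma>_smult_left[of 0 0 b] by simp
    ultimately have "(S has_field_derivative ((ell \<phi>' * cnj \<alpha> + of_real (sqrt d) * \<gamma> \<phi>' b) / d)) (at 0)"
      using d by (simp add: \<phi>0 pol_0 shear_0)
    then have 1: "deriv S 0 = (ell \<phi>' * cnj \<alpha> + of_real (sqrt d) * \<gamma> \<phi>' b) / d" by (rule DERIV_imp_deriv)
    have "of_real (sqrt d) * \<gamma> \<phi>' b / d = \<gamma> b b"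
    proof -
      have "complex_of_real (sqrt d) / complex_of_real d = complex_of_real (1 / sqrt d)"
        using d by (simp flip: of_real_divide) (simp add: real_div_sqrt field_simps)
      then have "of_real (sqrt d) * \<gamma> \<phi>' b / d = of_real (1 / sqrt d) * \<gamma> \<phi>' b"
        by (metis times_divide_eq_left)
      then show ?thesis by (simp add: b_def \<gamma>_smult_left)
    qed
    moreover have "\<gamma> b b = of_real (Re (\<gamma> b b))" by (simp add: complex_eq_iff Im_\<gamma>)
    moreover have "ell \<phi>' * cnj \<alpha> / d = of_real ((cmod \<alpha>)\<^sup>2)"
      unfolding complex_norm_square by (simp add: \<alpha>_def)
    ultimately show ?thesis unfolding 1 N_def add_divide_distrib of_real_add by metis
  qed
  have Sb: "cmod (S \<zeta>) \<le> sqrt (N * M)" if z: "norm \<zeta> < 1" for \<zeta>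
  proof -
    define w where "w = \<phi> \<zeta>"
    define E where "E = cmod (d - pol w)"
    have E: "a / 2 * (d + (norm w)\<^sup>2) \<le> E" unfolding E_def w_def
      using Re_lower[OF z] complex_Re_le_cmod order_trans by blast
    have ap: "0 < a / 2 * (d + (norm w)\<^sup>2)" using a d by (simp add: add_pos_nonneg)
    have E0: "0 < E" using ap E by linarith
    \<comment> \<open>With this identity, \<open>est\<close> multiplied by d becomes |P|^2 + d
      \<gamma>(V, V) <= |d - P|^2 plus an error: the Cayley transform from the model domain to the
      ball.\<close>
    have E2: "E\<^sup>2 = d\<^sup>2 - 2 * d * Re (pol w) + (cmod (pol w))\<^sup>2"
      unfolding E_def cmod_power2 by (simp add: power2_eq_square algebra_simps)
    \<comment> \<open>Split d = d^\<theta> d^(1 - \<theta>) and bound the two remaining factors by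
      powers of d + |w|^2.\<close>
    have pw: "d * norm w powr (2 * (1 + \<theta>)) \<le> d powr \<theta> * (d + (norm w)\<^sup>2)\<^sup>2"
    proof (cases "w = 0")
      case False
      define y where "y = (norm w)\<^sup>2"
      have y: "0 < y" using False by (simp add: y_def)
      have "norm w powr (2 * (1 + \<theta>)) = y powr (1 + \<theta>)"
        by (simp only: y_def powr_powr[symmetric]) (use False in simp)
      then have "d * norm w powr (2 * (1 + \<theta>)) = d powr \<theta> * (d powr (1 - \<theta>) * y powr (1 + \<theta>))"
        using d by (simp add: powr_add[symmetric] mult.assoc[symmetric])
      also have "\<dots> \<le> d powr \<theta> * ((d + y) powr (1 - \<theta>) * (d + y) powr (1 + \<theta>))"
        using \<theta> d y by (intro mult_left_mono mult_mono powr_mono2) auto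
      also have "(d + y) powr (1 - \<theta>) * (d + y) powr (1 + \<theta>) = (d + y)\<^sup>2"
        using d y by (simp add: powr_add[symmetric])
      finally show ?thesis by (simp add: y_def)
    qed simp
    have "(cmod (pol w))\<^sup>2 + d * Re (\<gamma> (shear w) (shear w)) \<le> E\<^sup>2 + D * (d * norm w powr (2 * (1 + \<theta>)))"
      using mult_left_mono[OF est[OF z], of d] d unfolding E2 w_def by (simp add: algebra_simps power2_eq_square)
    also have "\<dots> \<le> E\<^sup>2 + D * (d powr \<theta> * (d + (norm w)\<^sup>2)\<^sup>2)" using pw D by (intro add_left_mono mult_left_mono) auto
    also have "\<dots> \<le> E\<^sup>2 + D * (d powr \<theta> * (4 / a\<^sup>2 * E\<^sup>2))"
    proof -
      have "(a / 2 * (d + (norm w)\<^sup>2))\<^sup>2 \<le> E\<^sup>2" using E ap by (intro power_mono) auto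
      then have "a\<^sup>2 / 4 * (d + (norm w)\<^sup>2)\<^sup>2 \<le> E\<^sup>2" by (simp only: power_mult_distrib power_divide) simp
      then have "4 / a\<^sup>2 * (a\<^sup>2 / 4 * (d + (norm w)\<^sup>2)\<^sup>2) \<le> 4 / a\<^sup>2 * E\<^sup>2" by (rule mult_left_mono) simp
      then have "(d + (norm w)\<^sup>2)\<^sup>2 \<le> 4 / a\<^sup>2 * E\<^sup>2" using a by simp
      then show ?thesis using D by (intro add_left_mono mult_left_mono) auto
    qed
    also have "\<dots> = M * E\<^sup>2" by (simp add: M_def algebra_simps)
    finally have main: "(cmod (pol w))\<^sup>2 + d * Re (\<gamma> (shear w) (shear w)) \<le> M * E\<^sup>2" .
    have sq: "Re (\<gamma> (complex_of_real (sqrt d) *s shear w) (complex_of_real (sqrt d) *s shear w)) = d * Re (\<gamma> (shear w) (shear w))"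
      using d by (simp add: \<gamma>_smult_left \<gamma>_smult_right mult.assoc[symmetric] flip: of_real_mult)
    have "(cmod (pol w * cnj \<alpha> + \<gamma> (complex_of_real (sqrt d) *s shear w) b))\<^sup>2
       \<le> ((cmod (pol w))\<^sup>2 + d * Re (\<gamma> (shear w) (shear w))) * N"
      using cauchy_schwarz[of "pol w" \<alpha> "complex_of_real (sqrt d) *s shear w" b] unfolding sq N_def .
    also have "\<dots> \<le> (M * E\<^sup>2) * N" using main N0 by (intro mult_right_mono)
    finally have "(cmod (S \<zeta>))\<^sup>2 \<le> N * M"
      using E0 unfolding S_def w_def[symmetric] norm_divide power_divide E_def[symmetric]
      by (simp add: field_simps)
    then show ?thesis by (intro real_le_rsqrt)
  qed
  have "cmod (deriv S 0) \<le> sqrt (N * M)" by (rule Schwarz_bound(1)[OF Shol S0 Sb])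
  then have "N \<le> sqrt (N * M)" using N0 unfolding Sder by simp
  then have "N\<^sup>2 \<le> N * M" using N0 M real_sqrt_pow2[of "N * M"] power_mono[of N "sqrt (N * M)" 2] by simp
  then have "N \<le> M"
  proof (cases "N = 0")
    case False
    then have "0 < N" using N0 by simp
    then show ?thesis using \<open>N\<^sup>2 \<le> N * M\<close> by (simp add: power2_eq_square)
  qed (use M in simp)
  then show ?thesis by (simp add: N_eq M_def)
qed

end

section \<open>Localization and the lower bound\<close>

text \<open>Local lower supports of the form \<open>cmod \<circ> h\<close> with \<open>h\<close> holomorphic replace subharmonicity of \<open>ln F\<close>.\<close>
lemma support_maximum_principle:
  fixes F :: "complex \<Rightarrow> real"
  assumes s: "0 < s" and cont: "continuous_on (cball 0 s) F" and M: "0 \<le> M" "\<And>\<zeta>. norm \<zeta> = s \<Longrightarrow> F \<zeta> \<le> M"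
    and supp: "\<And>\<zeta>0. norm \<zeta>0 < s \<Longrightarrow> 0 < F \<zeta>0 \<Longrightarrow>
      \<exists>e>0. \<exists>h. h holomorphic_on ball \<zeta>0 e \<and> cmod (h \<zeta>0) = F \<zeta>0 \<and> (\<forall>\<zeta>\<in>ball \<zeta>0 e. cmod (h \<zeta>) \<le> F \<zeta>)"
    and \<zeta>: "norm \<zeta> \<le> s"
  shows "F \<zeta> \<le> M"
proof (rule ccontr)
  assume n: "\<not> F \<zeta> \<le> M"
  have ne: "cball (0::complex) s \<noteq> {}" using s by auto
  obtain \<zeta>s where zs: "\<zeta>s \<in> cball 0 s" "\<forall>x\<in>cball 0 s. F x \<le> F \<zeta>s"
    using continuous_attains_sup[OF compact_cball ne cont] by blast
  define Fs where "Fs = F \<zeta>s"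
  have Fs: "M < Fs" using zs(2) \<zeta> n by (force simp: Fs_def)
  have zs': "\<zeta>s \<in> ball 0 s" using zs(1) M(2)[of \<zeta>s] Fs by (fastforce simp: Fs_def less_eq_real_def)
  \<comment> \<open>The set where the interior maximum is attained. It is open because the support
    function has constant modulus by the maximum modulus principle, closed by continuity, hence the
    whole disc, and the maximum reaches the circle.\<close>
  define T where "T = {x\<in>ball 0 s. F x = Fs}"
  have "open T"
  proof (subst open_subopen, intro ballI)
    fix \<zeta>0 assume z0: "\<zeta>0 \<in> T"
    then have a: "norm \<zeta>0 < s" "0 < F \<zeta>0" "F \<zeta>0 = Fs" using Fs M by (auto simp: T_def)
    obtain e h where eh: "e > 0" "h holomorphic_on ball \<zeta>0 e" "cmod (h \<zeta>0) = F \<zeta>0" "\<And>\<zeta>. \<zeta> \<in> ball \<zeta>0 e \<Longrightarrow> cmod (h \<zeta>) \<le> F \<zeta>"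
      using supp[OF a(1,2)] by blast
    define e' where "e' = min e (s - norm \<zeta>0)"
    have e': "e' > 0" "ball \<zeta>0 e' \<subseteq> ball \<zeta>0 e" using eh a by (auto simp: e'_def)
    have sub: "x \<in> ball 0 s" if "x \<in> ball \<zeta>0 e'" for x
    proof -
      have "norm x \<le> norm \<zeta>0 + norm (x - \<zeta>0)" using norm_triangle_sub by blast
      then show ?thesis using that by (auto simp: e'_def dist_norm norm_minus_commute)
    qed
    have le: "F x \<le> Fs" if "x \<in> ball \<zeta>0 e'" for x using zs(2) sub[OF that] by (auto simp: Fs_def)
    have "h constant_on ball \<zeta>0 e'"
    proof (rule maximum_modulus_principle[OF holomorphic_on_subset[OF eh(2) e'(2)] open_ball connected_ball open_ball order_refl])
      show "\<zeta>0 \<in> ball \<zeta>0 e'" using e' by simp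
      show "cmod (h x) \<le> cmod (h \<zeta>0)" if "x \<in> ball \<zeta>0 e'" for x
        using eh(4)[of x] e'(2) le[OF that] that a(3) eh(3) by (auto simp: subset_iff)
    qed
    then have "h x = h \<zeta>0" if "x \<in> ball \<zeta>0 e'" for x using that e'(1) unfolding constant_on_def by (metis centre_in_ball)
    then have "F x = Fs" if "x \<in> ball \<zeta>0 e'" for x
      using le[OF that] eh(3) eh(4)[of x] e'(2) that a(3) by (metis order_antisym subsetD)
    then have "ball \<zeta>0 e' \<subseteq> T" using sub by (auto simp: T_def)
    then show "\<exists>T'. open T' \<and> \<zeta>0 \<in> T' \<and> T' \<subseteq> T" using e' by (intro exI[of _ "ball \<zeta>0 e'"]) auto
  qed
  moreover have "T \<subseteq> ball 0 s" by (auto simp: T_def)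
  ultimately have "openin (top_of_set (ball 0 s)) T" by (simp add: openin_open_eq)
  moreover have "closedin (top_of_set (ball 0 s)) T"
    unfolding T_def by (rule continuous_closedin_preimage_constant) (rule continuous_on_subset[OF cont ball_subset_cball])
  ultimately have "T = {} \<or> T = ball 0 s" using connected_ball[of "0::complex" s] unfolding connected_clopen by blast
  then have Teq: "T = ball 0 s" using zs' by (auto simp: T_def Fs_def)
  have bF: "F x = Fs" if "x \<in> ball 0 s" for x
  proof -
    have "x \<in> T" using that Teq by blast
    then show ?thesis by (simp add: T_def)
  qed
  have "closure (ball (0::complex) s) = cball 0 s" using s by simp
  then have "\<forall>x\<in>closure (ball 0 s). F x = Fs"
    using continuous_constant_on_closure[of "ball 0 s" F Fs] cont bF by auto
  then have "F (of_real s) = Fs" using s by simp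
  then show False using M(2)[of "of_real s"] s Fs by simp
qed

lemma holo_vec_continuous: "holo_vec \<phi> S \<Longrightarrow> continuous_on S \<phi>"
proof -
  assume "holo_vec \<phi> S"
  then have "continuous_on S (\<lambda>\<zeta>. \<chi> k. \<phi> \<zeta> $ k)"
    unfolding holo_vec_def by (intro continuous_on_vec_lambda holomorphic_on_imp_continuous_on) auto
  then show ?thesis by (simp add: vec_lambda_eta)
qed

lemma holo_vec_affine:
  assumes "holo_vec \<phi> S" "\<And>\<xi>. \<xi> \<in> T \<Longrightarrow> a + b * \<xi> \<in> S"
  shows "holo_vec (\<lambda>\<xi>. \<phi> (a + b * \<xi>)) T"
  unfolding holo_vec_def
proof
  fix k
  have "((\<lambda>\<zeta>. \<phi> \<zeta> $ k) \<circ> (\<lambda>\<xi>. a + b * \<xi>)) holomorphic_on T"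
    by (rule holomorphic_on_compose_gen[of _ _ _ S]) (use assms in \<open>auto simp: holo_vec_def intro!: holomorphic_intros\<close>)
  then show "(\<lambda>\<xi>. \<phi> (a + b * \<xi>) $ k) holomorphic_on T" by (simp add: comp_def)
qed

lemma holo_vec_diff_const: "holo_vec \<phi> S \<Longrightarrow> holo_vec (\<lambda>\<zeta>. \<phi> \<zeta> - v) S"
  unfolding holo_vec_def by (auto intro!: holomorphic_intros)

lemma holo_vec_subset: "holo_vec \<phi> S \<Longrightarrow> T \<subseteq> S \<Longrightarrow> holo_vec \<phi> T"
  unfolding holo_vec_def using holomorphic_on_subset by blast

lemma clin_hprod: "clin (\<lambda>u. hprod u v)"
  unfolding clin_def hprod_def by (auto simp: sum.distrib sum_distrib_left algebra_simps)

lemma cmod_hprod_le: "cmod (hprod u v) \<le> norm u * norm v"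
proof (cases "hprod u v = 0")
  case False
  define e where "e = cnj (hprod u v) / cmod (hprod u v)"
  have e: "cmod e = 1" using False by (simp add: e_def norm_divide)
  have "e * hprod u v = of_real (cmod (hprod u v))"
    using False complex_norm_square[of "hprod u v"] by (simp add: e_def power2_eq_square field_simps)
  then have "cmod (hprod u v) = Re (hprod (e *s u) v)"
    using clin_hprod[of v] unfolding clin_def by (metis Re_complex_of_real)
  also have "\<dots> \<le> norm (e *s u) * norm v" unfolding Re_hprod by (rule norm_cauchy_schwarz)
  finally show ?thesis by (simp add: norm_smult e)
qed simp

lemma cmod_hprod_self: "cmod (hprod v v) = (norm v)\<^sup>2"
  using cmod_hprod_le[of v v] complex_Re_le_cmod[of "hprod v v"] Re_hprod[of v v]
  by (simp add: power2_norm_eq_inner[symmetric] power2_eq_square)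

lemma holo_vec_factor:
  assumes "holo_vec \<phi> (ball 0 1)" "\<phi> 0 = 0"
  shows "\<exists>\<psi>. holo_vec \<psi> (ball 0 1) \<and> (\<forall>\<zeta>\<in>ball 0 1. \<phi> \<zeta> = \<zeta> *s \<psi> \<zeta>)"
proof -
  have "\<exists>h. h holomorphic_on ball 0 1 \<and> (\<forall>\<zeta>. norm \<zeta> < 1 \<longrightarrow> \<phi> \<zeta> $ k = \<zeta> * h \<zeta>)" for k
    using Schwarz3[of "\<lambda>\<zeta>. \<phi> \<zeta> $ k"] assms unfolding holo_vec_def by (metis zero_index)
  then obtain h where "\<And>k. h k holomorphic_on ball 0 1" "\<And>k \<zeta>. norm \<zeta> < 1 \<Longrightarrow> \<phi> \<zeta> $ k = \<zeta> * h k \<zeta>" by metis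
  then show ?thesis by (intro exI[of _ "\<lambda>\<zeta>. \<chi> k. h k \<zeta>"]) (auto simp: holo_vec_def vec_eq_iff)
qed

text \<open>The quadratic lower bound for ln (1 - s), used to support a truncated squared norm from
  below by the modulus of a holomorphic function.\<close>

lemma exp_lower_bound:
  fixes s :: real assumes "\<bar>s\<bar> \<le> 1 / 2" shows "exp (- s - 2 * s\<^sup>2) \<le> 1 - s"
proof -
  have "\<bar>ln (1 + - s) - - s\<bar> \<le> 2 * (- s)\<^sup>2" using assms by (intro abs_ln_one_plus_x_minus_x_bound) auto
  then have "- s - 2 * s\<^sup>2 \<le> ln (1 - s)" by simp
  then have "exp (- s - 2 * s\<^sup>2) \<le> exp (ln (1 - s))" by simp
  then show ?thesis using assms by simp
qed

section \<open>Localization of analytic discs\<close>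

context levi_chart
begin

text \<open>The first inequality feeds the Schwarz lemma. The second makes the Levi polynomial at
  \<open>z\<close> a local peak function with quadratic gain, uniformly in \<open>z\<close>; it
  controls denominators and localization.\<close>

lemma chart_estimate:
  "\<exists>K D a \<rho>. 1 \<le> K \<and> 0 \<le> D \<and> 0 < a \<and> a \<le> 1 \<and> 0 < \<rho> \<and> \<rho> \<le> R / 2 \<and>
    (\<forall>z\<in>ball p (R / 2). \<exists>\<beta> \<gamma> \<tau> \<mu>. levi_poly (\<lambda>X. hprod X (m z) / 2) \<beta> \<gamma> \<tau> \<mu> K c \<and>
     (\<forall>X. Re (\<gamma> X X) = (m1 z X \<bullet> X + m1 z (J X) \<bullet> J X) / 4) \<and>
     (\<forall>w. z + w \<in> ball p R \<longrightarrow> \<bar>r (z + w) - (r z + 2 * Re (hprod w (m z) / 2 + \<beta> w w + \<tau> w w w) + Re (\<gamma> w w)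
        + 2 * Re (\<mu> w w w))\<bar> \<le> K * norm w powr (\<sigma> + 1)) \<and>
     (\<forall>w. norm w < \<rho> \<longrightarrow> r (z + w) < 0 \<longrightarrow>
        2 * Re (levi_poly.pol (\<lambda>X. hprod X (m z) / 2) \<beta> \<tau> w) + Re (\<gamma> (levi_poly.shear \<gamma> \<mu> K c w) (levi_poly.shear \<gamma> \<mu> K c w))
          \<le> - r z + D * norm w powr (2 * (1 + (\<sigma> - 1) / 2)) \<and>
        2 * Re (levi_poly.pol (\<lambda>X. hprod X (m z) / 2) \<beta> \<tau> w) \<le> - r z - a * (norm w)\<^sup>2))"
proof -
  obtain K where K: "\<And>z. z \<in> ball p R \<Longrightarrow> \<exists>\<beta> \<gamma> \<tau> \<mu>. levi_poly (\<lambda>X. hprod X (m z) / 2) \<beta> \<gamma> \<tau> \<mu> K c \<and>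
     (\<forall>X. Re (\<gamma> X X) = (m1 z X \<bullet> X + m1 z (J X) \<bullet> J X) / 4) \<and>
     (\<forall>w. z + w \<in> ball p R \<longrightarrow> \<bar>r (z + w) - (r z + 2 * Re (hprod w (m z) / 2 + \<beta> w w + \<tau> w w w) + Re (\<gamma> w w)
        + 2 * Re (\<mu> w w w))\<bar> \<le> K * norm w powr (\<sigma> + 1))" using levi_poly_exists by blast
  have "1 \<le> K" using K[of p] R levi_poly.K by fastforce
  \<comment> \<open>\<open>D\<close> adds the Taylor remainder and the quartic error of the shear.
    Below, \<open>a\<close> is what remains of the c / 4 in \<open>\<gamma>_shear_lower\<close>
    after c / 8 is spent on these errors.\<close>
  define D where "D = K + K * (K / c)\<^sup>2"
  have D: "0 \<le> D" using \<open>1 \<le> K\<close> by (simp add: D_def)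
  define a where "a = min 1 (c / 8)"
  have a: "0 < a" "a \<le> 1" "a \<le> c / 8" using c by (auto simp: a_def)
  have "((\<lambda>x::real. D * x powr (\<sigma> - 1)) \<longlongrightarrow> 0) (at_right 0)"
    using \<sigma> by (auto intro!: tendsto_eq_intros simp: eventually_at_filter)
  then have "\<forall>\<^sub>F x in at_right 0. D * x powr (\<sigma> - 1) < c / 8" using c by (intro order_tendstoD(2)[of _ 0]) auto
  then obtain b where b: "b > 0" "\<And>x. 0 < x \<Longrightarrow> x < b \<Longrightarrow> D * x powr (\<sigma> - 1) < c / 8"
    unfolding eventually_at_right_field by auto
  define \<rho> where "\<rho> = min (min b (R / 2)) (c / (2 * K))"
  have \<rho>: "0 < \<rho>" "\<rho> \<le> R / 2" "\<rho> \<le> b" "\<rho> \<le> c / (2 * K)" using b R c \<open>1 \<le> K\<close> by (auto simp: \<rho>_def)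
  show ?thesis
  proof (rule exI[of _ K], rule exI[of _ D], rule exI[of _ a], rule exI[of _ \<rho>], intro conjI ballI)
    fix z assume z: "z \<in> ball p (R / 2)"
    then have zR: "z \<in> ball p R" using R by auto
    obtain \<beta> \<gamma> \<tau> \<mu> where lp: "levi_poly (\<lambda>X. hprod X (m z) / 2) \<beta> \<gamma> \<tau> \<mu> K c"
     and lv: "\<And>X. Re (\<gamma> X X) = (m1 z X \<bullet> X + m1 z (J X) \<bullet> J X) / 4"
     and ex: "\<And>w. z + w \<in> ball p R \<Longrightarrow> \<bar>r (z + w) - (r z + 2 * Re (hprod w (m z) / 2 + \<beta> w w + \<tau> w w w) + Re (\<gamma> w w)
        + 2 * Re (\<mu> w w w))\<bar> \<le> K * norm w powr (\<sigma> + 1)" using K[OF zR] by blast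
    interpret lp: levi_poly "\<lambda>X. hprod X (m z) / 2" \<beta> \<gamma> \<tau> \<mu> K c by (rule lp)
    have main: "2 * Re (lp.pol w) + Re (\<gamma> (lp.shear w) (lp.shear w)) \<le> - r z + D * norm w powr (2 * (1 + (\<sigma> - 1) / 2)) \<and>
       2 * Re (lp.pol w) \<le> - r z - a * (norm w)\<^sup>2" if w: "norm w < \<rho>" "r (z + w) < 0" for w
    proof -
      have "dist p (z + w) \<le> dist p z + norm w" using dist_triangle[of p "z + w" z] by (simp add: dist_norm)
      then have zw: "z + w \<in> ball p R" using z w \<rho> by simp
      have s1: "2 * (1 + (\<sigma> - 1) / 2) = \<sigma> + 1" by (simp add: field_simps)
      have w1: "norm w \<le> 1" using w \<rho> R by simp
      have "norm w powr 4 \<le> norm w powr (\<sigma> + 1)" using w1 \<sigma> by (intro powr_mono') auto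
      then have w4: "norm w ^ 4 \<le> norm w powr (\<sigma> + 1)" by simp
      have "K * (K / c)\<^sup>2 * norm w ^ 4 \<le> K * (K / c)\<^sup>2 * norm w powr (\<sigma> + 1)" using w4 \<open>1 \<le> K\<close> by (intro mult_left_mono) auto
      then have 1: "2 * Re (lp.pol w) + Re (\<gamma> (lp.shear w) (lp.shear w)) \<le> - r z + D * norm w powr (\<sigma> + 1)"
        using ex[OF zw] lp.\<gamma>_shear[of w] w(2) unfolding lp.pol_def D_def distrib_right abs_le_iff by linarith
      have 2: "D * norm w powr (\<sigma> + 1) \<le> c / 8 * (norm w)\<^sup>2"
      proof (cases "w = 0")
        case False
        have "norm w powr (\<sigma> + 1) = norm w powr (\<sigma> - 1) * norm w powr 2" unfolding powr_add[symmetric] by (simp add: add.commute)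
        then have "D * norm w powr (\<sigma> + 1) = (D * norm w powr (\<sigma> - 1)) * (norm w)\<^sup>2" by simp
        also have "\<dots> \<le> c / 8 * (norm w)\<^sup>2" using b(2)[of "norm w"] False w \<rho> by (intro mult_right_mono) auto
        finally show ?thesis .
      qed simp
      have "c / 4 * (norm w)\<^sup>2 \<le> Re (\<gamma> (lp.shear w) (lp.shear w))" using w \<rho> by (intro lp.\<gamma>_shear_lower) auto
      moreover have "a * (norm w)\<^sup>2 \<le> c / 8 * (norm w)\<^sup>2" using a by (intro mult_right_mono) auto
      ultimately show ?thesis using 1 2 unfolding s1 by simp
    qed
    show "\<exists>\<beta> \<gamma> \<tau> \<mu>. levi_poly (\<lambda>X. hprod X (m z) / 2) \<beta> \<gamma> \<tau> \<mu> K c \<and>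
     (\<forall>X. Re (\<gamma> X X) = (m1 z X \<bullet> X + m1 z (J X) \<bullet> J X) / 4) \<and>
     (\<forall>w. z + w \<in> ball p R \<longrightarrow> \<bar>r (z + w) - (r z + 2 * Re (hprod w (m z) / 2 + \<beta> w w + \<tau> w w w) + Re (\<gamma> w w)
        + 2 * Re (\<mu> w w w))\<bar> \<le> K * norm w powr (\<sigma> + 1)) \<and>
     (\<forall>w. norm w < \<rho> \<longrightarrow> r (z + w) < 0 \<longrightarrow>
        2 * Re (levi_poly.pol (\<lambda>X. hprod X (m z) / 2) \<beta> \<tau> w) + Re (\<gamma> (levi_poly.shear \<gamma> \<mu> K c w) (levi_poly.shear \<gamma> \<mu> K c w))
          \<le> - r z + D * norm w powr (2 * (1 + (\<sigma> - 1) / 2)) \<and>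
        2 * Re (levi_poly.pol (\<lambda>X. hprod X (m z) / 2) \<beta> \<tau> w) \<le> - r z - a * (norm w)\<^sup>2)"
    proof (rule exI[of _ \<beta>], rule exI[of _ \<gamma>], rule exI[of _ \<tau>], rule exI[of _ \<mu>], intro conjI allI impI)
      show "levi_poly (\<lambda>X. hprod X (m z) / 2) \<beta> \<gamma> \<tau> \<mu> K c" by (rule lp)
      show "Re (\<gamma> X X) = (m1 z X \<bullet> X + m1 z (J X) \<bullet> J X) / 4" for X by (rule lv)
      show "\<bar>r (z + w) - (r z + 2 * Re (hprod w (m z) / 2 + \<beta> w w + \<tau> w w w) + Re (\<gamma> w w) + 2 * Re (\<mu> w w w))\<bar>
          \<le> K * norm w powr (\<sigma> + 1)" if "z + w \<in> ball p R" for w by (rule ex[OF that])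
      fix w assume w: "norm w < \<rho>" "r (z + w) < 0"
      show "2 * Re (lp.pol w) + Re (\<gamma> (lp.shear w) (lp.shear w)) \<le> - r z + D * norm w powr (2 * (1 + (\<sigma> - 1) / 2))"
        using main[OF w] by (rule conjunct1)
      show "2 * Re (lp.pol w) \<le> - r z - a * (norm w)\<^sup>2" using main[OF w] by (rule conjunct2)
    qed
  qed (use \<open>1 \<le> K\<close> D a \<rho> in auto)
qed

text \<open>With \<phi> - z = \<zeta> \<psi> and x = |\<phi> - z|^2 / t0, the function
  \<open>F\<close> is x truncated at 1, divided by |\<zeta>|^2 and multiplied by exp (A U); for
  large \<open>A\<close> its logarithm is subharmonic. On |\<zeta>| = 1/2 it is at most 4, since U
  <= 0. For small |\<zeta>| this forces the truncated x below 1, so \<phi> is still near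
  \<open>p\<close>.\<close>

lemma disc_localization_small:
  assumes R1: "0 < R1"
  shows "\<exists>r0>0. \<exists>v>0. r0 \<le> 1 \<and> (\<forall>\<phi>. holo_vec \<phi> (ball 0 1) \<longrightarrow> \<phi> ` ball 0 1 \<subseteq> \<Omega> \<longrightarrow> dist (\<phi> 0) p < v \<longrightarrow>
     (\<forall>\<zeta>. norm \<zeta> < r0 \<longrightarrow> dist (\<phi> \<zeta>) p < R1))"
proof -
  obtain K D a \<rho> where a: "0 < a" and \<rho>: "0 < \<rho>" "\<rho> \<le> R / 2" and
    ex: "\<And>z. z \<in> ball p (R / 2) \<Longrightarrow> \<exists>\<beta> \<gamma> \<tau> \<mu>. levi_poly (\<lambda>X. hprod X (m z) / 2) \<beta> \<gamma> \<tau> \<mu> K c \<and>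
      (\<forall>w. norm w < \<rho> \<longrightarrow> r (z + w) < 0 \<longrightarrow> 2 * Re (levi_poly.pol (\<lambda>X. hprod X (m z) / 2) \<beta> \<tau> w) \<le> - r z - a * (norm w)\<^sup>2)"
    using chart_estimate by metis
  have "p \<in> ball p (R / 2)" using R by simp
  from ex[OF this] obtain \<beta> \<gamma> \<tau> \<mu> where lp: "levi_poly (\<lambda>X. hprod X (m p) / 2) \<beta> \<gamma> \<tau> \<mu> K c"
    and pe: "\<And>w. norm w < \<rho> \<Longrightarrow> r (p + w) < 0 \<Longrightarrow> 2 * Re (levi_poly.pol (\<lambda>X. hprod X (m p) / 2) \<beta> \<tau> w) \<le> - a * (norm w)\<^sup>2"
    using r_p by auto
  interpret lp: levi_poly "\<lambda>X. hprod X (m p) / 2" \<beta> \<gamma> \<tau> \<mu> K c by (rule lp)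
  \<comment> \<open>Adding half of the quadratic gain to the Levi polynomial leaves it nonpositive
    on \<Omega> near \<open>p\<close> and makes it strictly plurisubharmonic.\<close>
  define u where "u w = 2 * Re (lp.pol (w - p)) + a / 2 * (norm (w - p))\<^sup>2" for w
  define R2 where "R2 = min R1 \<rho>"
  have R2: "0 < R2" "R2 \<le> R1" "R2 \<le> \<rho>" using R1 \<rho> by (auto simp: R2_def)
  have u_le: "u w \<le> - (a / 2) * (norm (w - p))\<^sup>2" if "w \<in> \<Omega>" "norm (w - p) < R2" for w
  proof -
    have "w \<in> \<Omega> \<inter> ball p R" using that R2 \<rho> R by (auto simp: dist_norm norm_minus_commute)
    then have "r (p + (w - p)) < 0" using r_neg by simp
    then have "2 * Re (lp.pol (w - p)) \<le> - a * (norm (w - p))\<^sup>2" using that R2 by (intro pe) auto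
    then show ?thesis unfolding u_def by (simp add: algebra_simps)
  qed
  define c' where "c' = a / 16 * R2\<^sup>2"
  have c': "0 < c'" using a R2 by (simp add: c'_def)
  have u_far: "u w \<le> - c'" if "w \<in> \<Omega>" "norm (w - p) < R2" "R2 / 2 \<le> norm (w - p)" for w
  proof -
    have "(R2 / 2)\<^sup>2 \<le> (norm (w - p))\<^sup>2" using that R2 by (intro power_mono) auto
    then have "a / 2 * (R2\<^sup>2 / 4) \<le> a / 2 * (norm (w - p))\<^sup>2" using a by (intro mult_left_mono) (auto simp: power_divide)
    moreover have "0 \<le> a * R2\<^sup>2" using a by simp
    ultimately show ?thesis using u_le[OF that(1,2)] unfolding c'_def by simp
  qed
  have lin_bound: "cmod (lp.pol w) \<le> 3 * K * norm w" if "norm w \<le> 1" for w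
  proof -
    have K0: "1 \<le> K" by (rule lp.K)
    have "norm w * norm w \<le> norm w" using that by (simp add: mult_left_le_one_le)
    moreover have "norm w * norm w * norm w \<le> norm w" using that by (simp add: mult_le_one mult_left_le_one_le)
    ultimately have "K * (norm w * norm w) \<le> K * norm w" "K * (norm w * norm w * norm w) \<le> K * norm w" using K0 by simp_all
    moreover have "cmod (lp.pol w) \<le> K * norm w + K * norm w * norm w + K * norm w * norm w * norm w"
      unfolding lp.pol_def by (intro norm_triangle_mono lp.ell_bound lp.\<beta>_bound lp.\<tau>_bound)
    ultimately show ?thesis by (simp add: mult.assoc)
  qed
  define rr where "rr = min (R2 / 2) (min 1 (c' / (2 * (6 * K))))"
  have K1: "1 \<le> K" by (rule lp.K)
  have rr: "0 < rr" "rr \<le> R2 / 2" "rr \<le> 1" "rr \<le> c' / (2 * (6 * K))" using R2 c' K1 by (auto simp: rr_def)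
  have u_near: "- c' < u w" if "norm (w - p) < rr" for w
  proof -
    have "6 * K * norm (w - p) \<le> 6 * K * (c' / (2 * (6 * K)))" using that rr K1 by (intro mult_left_mono) auto
    also have "\<dots> = c' / 2" using K1 by simp
    finally have "6 * K * norm (w - p) \<le> c' / 2" .
    moreover have "\<bar>Re (lp.pol (w - p))\<bar> \<le> 3 * K * norm (w - p)"
      using lin_bound[of "w - p"] that rr abs_Re_le_cmod[of "lp.pol (w - p)"] by linarith
    moreover have "0 \<le> a / 2 * (norm (w - p))\<^sup>2" using a by simp
    ultimately show ?thesis using c' unfolding u_def by linarith
  qed
  \<comment> \<open>In \<Omega> one has \<open>u <= - c'\<close> already from radius
    \<open>R2 / 2\<close> on, so gluing with the constant yields a plurisubharmonic function on all
    of \<Omega> with values in [- c', 0].\<close>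
  define U where "U w = (if norm (w - p) < R2 then max (u w) (- c') else - c')" for w
  have U_ge: "- c' \<le> U w" for w by (simp add: U_def)
  have U_le: "U w \<le> 0" if "w \<in> \<Omega>" for w
    using u_le[OF that] c' a unfolding U_def by (auto intro: order_trans mult_nonpos_nonneg)
  have U_near: "U w = u w" if "norm (w - p) < rr" for w using that rr u_near[OF that] R2 by (auto simp: U_def)
  have U_far: "U w = - c'" if "w \<in> \<Omega>" "R2 / 2 \<le> norm (w - p)" for w using u_far[OF that(1) _ that(2)] by (auto simp: U_def)
  \<comment> \<open>At this scale x <= 1 means distance at most rr / 2 from \<open>z\<close>, hence
    less than rr from \<open>p\<close>, where \<open>U\<close> equals \<open>u\<close>.\<close>
  define t0 where "t0 = (rr / 2)\<^sup>2"
  have t0: "0 < t0" using rr by (simp add: t0_def)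
  \<comment> \<open>The logarithm of the factor \<open>2 - x\<close> below has Levi form at least \<open>- 19 / t0\<close>, which \<open>A u\<close> compensates.\<close>
  define A where "A = 38 / (a * t0)"
  have A: "0 < A" "A * (a / 2) = 19 / t0" using a t0 by (auto simp: A_def)
  \<comment> \<open>\<open>x * \<Theta> x\<close> is x (2 - x) up to 1 and then constant: a C^1
    truncation of x. The factor x is split off so that the division by |\<zeta>|^2 can be done
    through \<psi>, also at \<zeta> = 0.\<close>
  define \<Theta> where "\<Theta> x = (if x \<le> 1 then 2 - x else 1 / x)" for x :: real
  have \<Theta>_ge: "2 - x \<le> \<Theta> x" "0 < \<Theta> x" "x * \<Theta> x \<le> 1" if "0 \<le> x" for x
  proof -
    have "0 \<le> (x - 1)\<^sup>2" by simp
    then have sq: "x * (2 - x) \<le> 1" by (simp add: power2_eq_square algebra_simps)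
    then show "2 - x \<le> \<Theta> x" unfolding \<Theta>_def by (auto simp: pos_le_divide_eq mult.commute)
    show "0 < \<Theta> x" unfolding \<Theta>_def by auto
    show "x * \<Theta> x \<le> 1" using sq unfolding \<Theta>_def by auto
  qed
  have \<Theta>_cont: "continuous_on {0..} \<Theta>"
  proof -
    have "continuous_on ({0..1} \<union> {1..}) \<Theta>" unfolding \<Theta>_def
      by (rule continuous_on_If) (auto intro!: continuous_intros)
    moreover have "{0..1} \<union> {1..} = {0::real..}" by auto
    ultimately show ?thesis by simp
  qed
  \<comment> \<open>This gives 4 r0^2 = exp (- A c') / 4, below the threshold exp (- A c') used at
    the end.\<close>
  define r0 where "r0 = exp (- (A * c') / 2) / 4"
  have r0: "0 < r0" "r0 \<le> 1 / 4" using A c' by (auto simp: r0_def)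
  have main: "dist (\<phi> \<zeta>1) p < R1" if \<phi>: "holo_vec \<phi> (ball 0 1)" "\<phi> ` ball 0 1 \<subseteq> \<Omega>" "dist (\<phi> 0) p < rr / 2" and \<zeta>1: "norm \<zeta>1 < r0" for \<phi> \<zeta>1
  proof -
    define z where "z = \<phi> 0"
    have zp: "norm (z - p) < rr / 2" using \<phi>(3) by (simp add: z_def dist_norm)
    have in\<Omega>: "\<phi> \<zeta> \<in> \<Omega>" if "norm \<zeta> < 1" for \<zeta> using \<phi>(2) that by auto
    obtain \<psi> where \<psi>: "holo_vec \<psi> (ball 0 1)" "\<And>\<zeta>. norm \<zeta> < 1 \<Longrightarrow> \<phi> \<zeta> - z = \<zeta> *s \<psi> \<zeta>"
      using holo_vec_factor[OF holo_vec_diff_const[OF \<phi>(1), of z]] by (auto simp: z_def)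
    define x where "x \<zeta> = (norm (\<phi> \<zeta> - z))\<^sup>2 / t0" for \<zeta>
    have x0: "0 \<le> x \<zeta>" for \<zeta> using t0 by (simp add: x_def)
    have x_eq: "x \<zeta> = (cmod \<zeta>)\<^sup>2 * (norm (\<psi> \<zeta>))\<^sup>2 / t0" if "norm \<zeta> < 1" for \<zeta>
      unfolding x_def \<psi>(2)[OF that] norm_smult by (simp add: power_mult_distrib)
    have x_near: "norm (\<phi> \<zeta> - p) < rr" if "x \<zeta> \<le> 1" for \<zeta>
    proof -
      have "(norm (\<phi> \<zeta> - z))\<^sup>2 \<le> (rr / 2)\<^sup>2" using that t0 unfolding x_def t0_def[symmetric] by (simp add: field_simps)
      then have "norm (\<phi> \<zeta> - z) \<le> rr / 2" using rr by (simp add: power2_le_iff_abs_le)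
      then show ?thesis using zp norm_triangle_ineq[of "\<phi> \<zeta> - z" "z - p"] by simp
    qed
    define F where "F \<zeta> = \<Theta> (x \<zeta>) * ((norm (\<psi> \<zeta>))\<^sup>2 / t0) * exp (A * U (\<phi> \<zeta>))" for \<zeta>
    have c\<phi>: "continuous_on (ball 0 1) \<phi>" and c\<psi>: "continuous_on (ball 0 1) \<psi>"
      using holo_vec_continuous \<phi>(1) \<psi>(1) by auto
    have cpol: "continuous_on (ball 0 1) (\<lambda>\<zeta>. lp.pol (\<phi> \<zeta> - p))"
      by (intro holomorphic_on_imp_continuous_on lp.pol_holomorphic holo_vec_diff_const \<phi>(1))
    have cU: "continuous_on (ball 0 1) (\<lambda>\<zeta>. U (\<phi> \<zeta>))"
    proof -
      define S1 where "S1 = ball 0 1 \<inter> {\<zeta>. norm (\<phi> \<zeta> - p) < R2}"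
      define S2 where "S2 = ball 0 1 \<inter> {\<zeta>. R2 / 2 < norm (\<phi> \<zeta> - p)}"
      have cn: "continuous_on (ball 0 1) (\<lambda>\<zeta>. norm (\<phi> \<zeta> - p))" by (intro continuous_intros c\<phi>)
      have o1: "open S1" using continuous_open_preimage[OF cn open_ball, of "{..<R2}"] by (simp add: S1_def vimage_def)
      have o2: "open S2" using continuous_open_preimage[OF cn open_ball, of "{R2 / 2<..}"] by (simp add: S2_def vimage_def)
      have "continuous_on S1 (\<lambda>\<zeta>. max (u (\<phi> \<zeta>)) (- c'))" unfolding u_def
        by (intro continuous_intros continuous_on_subset[OF cpol] continuous_on_subset[OF c\<phi>]) (auto simp: S1_def)
      then have k1: "continuous_on S1 (\<lambda>\<zeta>. U (\<phi> \<zeta>))"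
        by (rule continuous_on_eq) (auto simp: S1_def U_def)
      have k2: "continuous_on S2 (\<lambda>\<zeta>. U (\<phi> \<zeta>))"
        by (rule continuous_on_eq[OF continuous_on_const[of _ "- c'"]]) (use U_far in\<Omega> in \<open>auto simp: S2_def\<close>)
      have "S1 \<union> S2 = ball 0 1" using R2 by (auto simp: S1_def S2_def)
      then show ?thesis using continuous_on_open_Un[OF o1 o2 k1 k2] by simp
    qed
    have cx: "continuous_on (ball 0 1) x" unfolding x_def by (intro continuous_intros c\<phi>) (use t0 in auto)
    have cF: "continuous_on (ball 0 1) F"
      unfolding F_def
      by (intro continuous_intros c\<psi> cU continuous_on_compose2[OF \<Theta>_cont cx]) (use x0 t0 in auto)
    have supp: "\<exists>e>0. \<exists>h. h holomorphic_on ball \<zeta>0 e \<and> cmod (h \<zeta>0) = F \<zeta>0 \<and> (\<forall>\<zeta>\<in>ball \<zeta>0 e. cmod (h \<zeta>) \<le> F \<zeta>)"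
      if \<zeta>0: "norm \<zeta>0 < 1 / 2" "0 < F \<zeta>0" for \<zeta>0
    proof -
      define w0 where "w0 = \<phi> \<zeta>0"
      have w0\<Omega>: "w0 \<in> \<Omega>" using in\<Omega> \<zeta>0 by (simp add: w0_def)
      have near: "\<exists>e>0. ball \<zeta>0 e \<subseteq> ball 0 1 \<and> (\<forall>\<zeta>\<in>ball \<zeta>0 e. norm (\<phi> \<zeta> - w0) < \<delta>)" if \<delta>: "0 < \<delta>" for \<delta>
      proof -
        have "isCont \<phi> \<zeta>0" using c\<phi> \<zeta>0 by (simp add: continuous_on_eq_continuous_at)
        then obtain e where e: "e > 0" "\<And>x. dist x \<zeta>0 < e \<Longrightarrow> dist (\<phi> x) w0 < \<delta>"
          unfolding continuous_at_eps_delta w0_def using \<delta> by blast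
        have "ball \<zeta>0 (min e (1 / 2)) \<subseteq> ball 0 1"
        proof
          fix x assume "x \<in> ball \<zeta>0 (min e (1 / 2))"
          then have "norm (x - \<zeta>0) < 1 / 2" by (simp add: dist_norm norm_minus_commute)
          then show "x \<in> ball 0 1" using \<zeta>0 norm_triangle_ineq[of "x - \<zeta>0" \<zeta>0] by simp
        qed
        then show ?thesis using e by (intro exI[of _ "min e (1 / 2)"]) (auto simp: dist_norm norm_minus_commute)
      qed
      \<comment> \<open>Its real part is the pluriharmonic part of the increment of
        \<open>u\<close>; the surplus a / 2 |\<phi> - w0|^2 pays for the factor 2 - x.\<close>
      define H where "H \<zeta> = 2 * (lp.pol (\<phi> \<zeta> - p) - lp.pol (w0 - p)) + a * hprod (\<phi> \<zeta> - w0) (w0 - p)" for \<zeta>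
      have H0: "H \<zeta>0 = 0" by (simp add: H_def w0_def hprod_def)
      have Hhol: "H holomorphic_on S" if "S \<subseteq> ball 0 1" for S
        unfolding H_def
        by (intro holomorphic_intros lp.pol_holomorphic clin_holomorphic[OF clin_hprod] holo_vec_diff_const holo_vec_subset[OF \<phi>(1)] that)
      have uH: "u (\<phi> \<zeta>) = u w0 + Re (H \<zeta>) + a / 2 * (norm (\<phi> \<zeta> - w0))\<^sup>2" for \<zeta>
      proof -
        have "(norm (\<phi> \<zeta> - p))\<^sup>2 = (norm (w0 - p))\<^sup>2 + 2 * ((\<phi> \<zeta> - w0) \<bullet> (w0 - p)) + (norm (\<phi> \<zeta> - w0))\<^sup>2"
          unfolding power2_norm_eq_inner by (simp add: inner_diff_left inner_diff_right inner_commute)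
        from arg_cong[OF this, of "\<lambda>t. a / 2 * t"] show ?thesis
          unfolding u_def H_def by (simp add: Re_hprod algebra_simps)
      qed
      show ?thesis
      proof (cases "x \<zeta>0 \<le> 1")
        \<comment> \<open>Beyond the truncation F = exp (A U) / |\<zeta>|^2, so only
          \<open>U\<close> needs a support: a constant where U = - c', and \<open>H\<close>
          otherwise.\<close>
        case False
        have sqt: "sqrt t0 = rr / 2" using rr by (simp add: t0_def)
        have gt: "x \<zeta> > 1 \<longleftrightarrow> rr / 2 < norm (\<phi> \<zeta> - z)" for \<zeta>
        proof -
          have "x \<zeta> > 1 \<longleftrightarrow> t0 < (norm (\<phi> \<zeta> - z))\<^sup>2" using t0 by (simp add: x_def)
          also have "\<dots> \<longleftrightarrow> rr / 2 < norm (\<phi> \<zeta> - z)" unfolding sqt[symmetric]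
            using t0 by (metis norm_ge_zero real_less_lsqrt real_less_rsqrt real_sqrt_less_iff real_sqrt_unique)
          finally show ?thesis .
        qed
        define \<delta>1 where "\<delta>1 = norm (w0 - z) - rr / 2"
        have \<delta>1: "\<delta>1 > 0" using gt[of \<zeta>0] False by (simp add: \<delta>1_def w0_def)
        have xgt: "1 < x \<zeta>" if "norm (\<phi> \<zeta> - w0) < \<delta>1" for \<zeta>
          unfolding gt using that norm_triangle_ineq4[of "\<phi> \<zeta> - z" "\<phi> \<zeta> - w0"] by (simp add: \<delta>1_def)
        have F_eq: "F \<zeta> = exp (A * U (\<phi> \<zeta>)) / (cmod \<zeta>)\<^sup>2" "\<zeta> \<noteq> 0" if "1 < x \<zeta>" "norm \<zeta> < 1" for \<zeta>
        proof -
          show nz: "\<zeta> \<noteq> 0" using that x_eq[of \<zeta>] by auto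
          have "(norm (\<psi> \<zeta>))\<^sup>2 / t0 = x \<zeta> / (cmod \<zeta>)\<^sup>2" using x_eq[OF that(2)] nz by simp
          then show "F \<zeta> = exp (A * U (\<phi> \<zeta>)) / (cmod \<zeta>)\<^sup>2" using that(1) by (simp add: F_def \<Theta>_def)
        qed
        have "\<exists>\<delta>>0. \<exists>H'. (\<forall>S. S \<subseteq> ball 0 1 \<longrightarrow> H' holomorphic_on S) \<and> H' \<zeta>0 = 0 \<and>
            (\<forall>\<zeta>. norm (\<phi> \<zeta> - w0) < \<delta> \<longrightarrow> U w0 + Re (H' \<zeta>) \<le> U (\<phi> \<zeta>))"
        proof (cases "U w0 = - c'")
          case True
          then show ?thesis using U_ge by (intro exI[of _ 1] conjI exI[of _ "\<lambda>_. 0"]) auto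
        next
          case False
          then have n: "norm (w0 - p) < R2" "U w0 = u w0" unfolding U_def by (auto split: if_splits simp: max_def)
          have "U w0 + Re (H \<zeta>) \<le> U (\<phi> \<zeta>)" if "norm (\<phi> \<zeta> - w0) < R2 - norm (w0 - p)" for \<zeta>
          proof -
            have "norm (\<phi> \<zeta> - p) < R2" using that norm_triangle_ineq[of "\<phi> \<zeta> - w0" "w0 - p"] by simp
            then have "u (\<phi> \<zeta>) \<le> U (\<phi> \<zeta>)" by (simp add: U_def)
            moreover have "0 \<le> a / 2 * (norm (\<phi> \<zeta> - w0))\<^sup>2" using a by simp
            ultimately show ?thesis using uH[of \<zeta>] n(2) by linarith
          qed
          then show ?thesis using n(1) H0 Hhol by (intro exI[of _ "R2 - norm (w0 - p)"] conjI exI[of _ H]) auto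
        qed
        then obtain \<delta>2 H' where \<delta>2: "\<delta>2 > 0" "\<And>S. S \<subseteq> ball 0 1 \<Longrightarrow> H' holomorphic_on S" "H' \<zeta>0 = 0"
          "\<And>\<zeta>. norm (\<phi> \<zeta> - w0) < \<delta>2 \<Longrightarrow> U w0 + Re (H' \<zeta>) \<le> U (\<phi> \<zeta>)" by blast
        obtain e where e: "e > 0" "ball \<zeta>0 e \<subseteq> ball 0 1" "\<And>\<zeta>. \<zeta> \<in> ball \<zeta>0 e \<Longrightarrow> norm (\<phi> \<zeta> - w0) < min \<delta>1 \<delta>2"
          using near[of "min \<delta>1 \<delta>2"] \<delta>1 \<delta>2(1) by auto
        define h where "h \<zeta> = exp (of_real (A * U w0) + of_real A * H' \<zeta>) / \<zeta>\<^sup>2" for \<zeta>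
        have n1: "norm \<zeta> < 1" "1 < x \<zeta>" if "\<zeta> \<in> ball \<zeta>0 e" for \<zeta> using e(2) e(3)[OF that] that xgt by auto
        have "h holomorphic_on ball \<zeta>0 e"
          unfolding h_def by (intro holomorphic_intros \<delta>2(2) e(2)) (use F_eq(2) n1 in auto)
        moreover have ch: "cmod (h \<zeta>) = exp (A * U w0 + A * Re (H' \<zeta>)) / (cmod \<zeta>)\<^sup>2" for \<zeta>
          by (simp add: h_def norm_divide norm_power)
        then have "cmod (h \<zeta>0) = F \<zeta>0" using F_eq(1)[OF n1(2,1), of \<zeta>0] e(1) \<delta>2(3) by (simp add: w0_def)
        moreover have "cmod (h \<zeta>) \<le> F \<zeta>" if "\<zeta> \<in> ball \<zeta>0 e" for \<zeta>
        proof -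
          have "A * (U w0 + Re (H' \<zeta>)) \<le> A * U (\<phi> \<zeta>)" using \<delta>2(4)[of \<zeta>] e(3)[OF that] A by (intro mult_left_mono) auto
          then show ?thesis unfolding ch F_eq(1)[OF n1(2)[OF that] n1(1)[OF that]] by (intro divide_right_mono) (auto simp: algebra_simps)
        qed
        ultimately show ?thesis using e(1) by blast
      next
        case True
        define y0 where "y0 = 2 - x \<zeta>0"
        have y0: "1 \<le> y0" using True by (simp add: y0_def)
        have w0p: "norm (w0 - p) < rr" using x_near[OF True] by (simp add: w0_def)
        have \<psi>0: "\<psi> \<zeta>0 \<noteq> 0" using \<zeta>0(2) by (auto simp: F_def)
        define P where "P = norm (\<psi> \<zeta>0)"
        have P: "P > 0" using \<psi>0 by (simp add: P_def)
        \<comment> \<open>The bound rr / 12 gives q <= 1/6 and thus |s| <= 1/2 below, the range of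
          \<open>exp_lower_bound\<close>.\<close>
        define \<delta> where "\<delta> = min (rr - norm (w0 - p)) (rr / 12)"
        have "\<delta> > 0" using w0p rr by (simp add: \<delta>_def)
        then obtain e where e: "e > 0" "ball \<zeta>0 e \<subseteq> ball 0 1" "\<And>\<zeta>. \<zeta> \<in> ball \<zeta>0 e \<Longrightarrow> norm (\<phi> \<zeta> - w0) < \<delta>"
          using near by blast
        define G where "G \<zeta> = of_real A * H \<zeta> - of_real (2 / (t0 * y0)) * hprod (\<phi> \<zeta> - w0) (w0 - z)" for \<zeta>
        \<comment> \<open>|\<psi>|^2 is supported by the squared Hermitian product with its value at
          \<zeta>0, and 2 - x by the exponential of its linearized logarithm; the quadratic loss is
          covered by A u.\<close>
        define h where "h \<zeta> = of_real (y0 / (t0 * P\<^sup>2)) * (hprod (\<psi> \<zeta>) (\<psi> \<zeta>0))\<^sup>2 * exp (of_real (A * u w0) + G \<zeta>)" for \<zeta>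
        have hh: "h holomorphic_on ball \<zeta>0 e"
          unfolding h_def G_def
          by (intro holomorphic_intros Hhol e(2) clin_holomorphic[OF clin_hprod] holo_vec_diff_const
            holo_vec_subset[OF \<phi>(1)] holo_vec_subset[OF \<psi>(1)])
        have ch: "cmod (h \<zeta>) = y0 / (t0 * P\<^sup>2) * (cmod (hprod (\<psi> \<zeta>) (\<psi> \<zeta>0)))\<^sup>2 * exp (A * u w0 + Re (G \<zeta>))" for \<zeta>
          using t0 y0 P by (simp add: h_def norm_mult norm_power norm_divide)
        have G0: "G \<zeta>0 = 0" by (simp add: G_def H0 w0_def hprod_def)
        have h0: "cmod (h \<zeta>0) = F \<zeta>0"
        proof -
          have "cmod (h \<zeta>0) = y0 * (P\<^sup>2 / t0) * exp (A * u w0)"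
            unfolding ch G0 cmod_hprod_self P_def[symmetric] using P by (simp add: power2_eq_square)
          moreover have "\<Theta> (x \<zeta>0) = y0" using True by (simp add: \<Theta>_def y0_def)
          moreover have "U w0 = u w0" using U_near[OF w0p] .
          ultimately show ?thesis by (simp add: F_def P_def w0_def)
        qed
        have hle: "cmod (h \<zeta>) \<le> F \<zeta>" if \<zeta>: "\<zeta> \<in> ball \<zeta>0 e" for \<zeta>
        proof -
          define q where "q = norm (\<phi> \<zeta> - w0) / (rr / 2)"
          have q: "0 \<le> q" "q \<le> 1 / 6" using e(3)[OF \<zeta>] rr by (auto simp: q_def \<delta>_def field_simps)
          have q2: "q\<^sup>2 = (norm (\<phi> \<zeta> - w0))\<^sup>2 / t0" by (simp add: q_def t0_def power_divide)
          have "norm (\<phi> \<zeta> - p) < rr" using e(3)[OF \<zeta>] norm_triangle_ineq[of "\<phi> \<zeta> - w0" "w0 - p"] by (simp add: \<delta>_def)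
          then have Uu: "U (\<phi> \<zeta>) = u (\<phi> \<zeta>)" by (rule U_near)
          define ip where "ip = Re (hprod (\<phi> \<zeta> - w0) (w0 - z))"
          have xx: "x \<zeta> - x \<zeta>0 = 2 * ip / t0 + q\<^sup>2"
          proof -
            have "(norm (\<phi> \<zeta> - z))\<^sup>2 = (norm (w0 - z))\<^sup>2 + 2 * ((\<phi> \<zeta> - w0) \<bullet> (w0 - z)) + (norm (\<phi> \<zeta> - w0))\<^sup>2"
              unfolding power2_norm_eq_inner by (simp add: inner_diff_left inner_diff_right inner_commute)
            then show ?thesis unfolding x_def q2 ip_def Re_hprod w0_def by (simp add: add_divide_distrib)
          qed
          have w0z: "norm (w0 - z) \<le> rr / 2"
          proof -
            have "(norm (w0 - z))\<^sup>2 \<le> (rr / 2)\<^sup>2" using True t0 unfolding x_def t0_def[symmetric] w0_def by (simp add: field_simps)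
            then show ?thesis using rr by (simp add: power2_le_iff_abs_le)
          qed
          have "\<bar>ip\<bar> \<le> norm (\<phi> \<zeta> - w0) * (rr / 2)"
            unfolding ip_def Re_hprod using order_trans[OF Cauchy_Schwarz_ineq2 mult_left_mono[OF w0z]] by simp
          also have "\<dots> = q * t0" using rr by (simp add: q_def t0_def power2_eq_square)
          finally have ip: "\<bar>ip / t0\<bar> \<le> q" using t0 by (simp add: pos_divide_le_eq)
          define s where "s = (x \<zeta> - x \<zeta>0) / y0"
          have qq: "q\<^sup>2 \<le> q" using q mult_left_mono[of q 1 q] by (simp add: power2_eq_square)
          define it where "it = ip / t0"
          have "\<bar>it\<bar> \<le> q" "2 * ip / t0 = 2 * it" using ip by (simp_all only: it_def times_divide_eq_right)
          then have "\<bar>x \<zeta> - x \<zeta>0\<bar> \<le> 3 * q" unfolding xx using qq q zero_le_power2[of q] by linarith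
          then have "\<bar>s\<bar> \<le> 3 * q" using y0 q divide_left_mono[of 1 y0 "3 * q"] divide_right_mono[of "\<bar>x \<zeta> - x \<zeta>0\<bar>" "3 * q" y0]
            unfolding s_def abs_divide by simp
          moreover from this have "\<bar>s\<bar>\<^sup>2 \<le> (3 * q)\<^sup>2" by (intro power_mono) auto
          ultimately have s: "\<bar>s\<bar> \<le> 1 / 2" "s\<^sup>2 \<le> 9 * q\<^sup>2" using q by (auto simp: power_mult_distrib)
          have sx: "s = 2 * ip / (t0 * y0) + q\<^sup>2 / y0" unfolding s_def xx using y0 by (simp add: add_divide_distrib)
          have "q\<^sup>2 / y0 \<le> q\<^sup>2" using y0 divide_left_mono[of 1 y0 "q\<^sup>2"] by simp
          \<comment> \<open>19 = 1 + 18: one q^2 from the quadratic part of \<open>s\<close>, and 2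
            s^2 <= 18 q^2.\<close>
          then have e1: "- (2 * ip / (t0 * y0)) - 19 * q\<^sup>2 \<le> - s - 2 * s\<^sup>2" using s(2) unfolding sx[symmetric] using sx by linarith
          have e2: "y0 * exp (- (2 * ip / (t0 * y0)) - 19 * q\<^sup>2) \<le> 2 - x \<zeta>"
          proof -
            have "y0 * exp (- (2 * ip / (t0 * y0)) - 19 * q\<^sup>2) \<le> y0 * exp (- s - 2 * s\<^sup>2)" using e1 y0 by (intro mult_left_mono) auto
            also have "\<dots> \<le> y0 * (1 - s)" using exp_lower_bound[OF s(1)] y0 by (intro mult_left_mono) auto
            also have "\<dots> = 2 - x \<zeta>"
            proof -
              have "y0 * s = x \<zeta> - x \<zeta>0" using y0 by (simp add: s_def)
              then show ?thesis unfolding right_diff_distrib by (simp add: y0_def)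
            qed
            finally show ?thesis .
          qed
          have "A * u (\<phi> \<zeta>) = A * u w0 + A * Re (H \<zeta>) + (A * (a / 2)) * (norm (\<phi> \<zeta> - w0))\<^sup>2"
            unfolding uH by (simp add: algebra_simps)
          also have "(A * (a / 2)) * (norm (\<phi> \<zeta> - w0))\<^sup>2 = 19 * q\<^sup>2" unfolding A(2) q2 by simp
          finally have Au: "A * u (\<phi> \<zeta>) = A * u w0 + A * Re (H \<zeta>) + 19 * q\<^sup>2" .
          have ReG: "Re (G \<zeta>) = A * Re (H \<zeta>) - 2 * ip / (t0 * y0)" by (simp add: G_def ip_def)
          have hp: "(cmod (hprod (\<psi> \<zeta>) (\<psi> \<zeta>0)))\<^sup>2 \<le> (norm (\<psi> \<zeta>))\<^sup>2 * P\<^sup>2"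
            using power_mono[OF cmod_hprod_le[of "\<psi> \<zeta>" "\<psi> \<zeta>0"], of 2] by (simp add: P_def power_mult_distrib)
          have "cmod (h \<zeta>) \<le> y0 / (t0 * P\<^sup>2) * ((norm (\<psi> \<zeta>))\<^sup>2 * P\<^sup>2) * exp (A * u w0 + Re (G \<zeta>))"
            unfolding ch using hp t0 y0 by (intro mult_right_mono mult_left_mono) auto
          also have "\<dots> = (norm (\<psi> \<zeta>))\<^sup>2 / t0 * (y0 * exp (- (2 * ip / (t0 * y0)) - 19 * q\<^sup>2)) * exp (A * u (\<phi> \<zeta>))"
          proof -
            have "exp (A * u w0 + Re (G \<zeta>)) = exp (- (2 * ip / (t0 * y0)) - 19 * q\<^sup>2) * exp (A * u (\<phi> \<zeta>))"
              unfolding exp_add[symmetric] Au ReG by simp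
            then show ?thesis using P by simp
          qed
          also have "\<dots> \<le> (norm (\<psi> \<zeta>))\<^sup>2 / t0 * \<Theta> (x \<zeta>) * exp (A * u (\<phi> \<zeta>))"
            using e2 \<Theta>_ge(1)[OF x0[of \<zeta>]] t0 by (intro mult_right_mono mult_left_mono) auto
          finally show ?thesis unfolding F_def Uu by (simp add: mult_ac)
        qed
        show ?thesis using e(1) hh h0 hle by blast
      qed
    qed
    have "F \<zeta>1 \<le> 4"
    proof (rule support_maximum_principle[of "1/2" F 4, OF _ _ _ _ supp])
      show "continuous_on (cball 0 (1 / 2)) F" by (rule continuous_on_subset[OF cF]) auto
      fix \<zeta> :: complex assume z: "norm \<zeta> = 1 / 2"
      have "F \<zeta> = x \<zeta> * \<Theta> (x \<zeta>) * 4 * exp (A * U (\<phi> \<zeta>))"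
        using x_eq[of \<zeta>] z by (simp add: F_def power2_eq_square)
      also have "\<dots> \<le> 1 * 4 * exp 0"
        using \<Theta>_ge[OF x0[of \<zeta>]] U_le[OF in\<Omega>[of \<zeta>]] A z x0[of \<zeta>] by (intro mult_mono) (auto simp: mult_nonneg_nonpos)
      finally show "F \<zeta> \<le> 4" by simp
    qed (use \<zeta>1 r0 in auto)
    then have "F \<zeta>1 * (cmod \<zeta>1)\<^sup>2 \<le> 4 * (cmod \<zeta>1)\<^sup>2" by (intro mult_right_mono) auto
    moreover have "F \<zeta>1 * (cmod \<zeta>1)\<^sup>2 = x \<zeta>1 * \<Theta> (x \<zeta>1) * exp (A * U (\<phi> \<zeta>1))"
      using x_eq[of \<zeta>1] \<zeta>1 r0 by (simp add: F_def)
    moreover have "exp (- (A * c')) \<le> exp (A * U (\<phi> \<zeta>1))"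
      using mult_left_mono[OF U_ge[of "\<phi> \<zeta>1"], of A] A by simp
    then have "x \<zeta>1 * \<Theta> (x \<zeta>1) * exp (- (A * c')) \<le> x \<zeta>1 * \<Theta> (x \<zeta>1) * exp (A * U (\<phi> \<zeta>1))"
      using x0[of \<zeta>1] \<Theta>_ge(2)[OF x0[of \<zeta>1]] by (intro mult_left_mono) auto
    moreover have "4 * (cmod \<zeta>1)\<^sup>2 < exp (- (A * c'))"
    proof -
      have "(cmod \<zeta>1)\<^sup>2 < r0\<^sup>2" using \<zeta>1 by (intro power_strict_mono) auto
      also have "r0\<^sup>2 = exp (- (A * c')) / 16"
        by (simp add: r0_def power_divide exp_double[symmetric])
      finally show ?thesis using exp_gt_zero[of "- (A * c')"] by linarith
    qed
    ultimately have "x \<zeta>1 * \<Theta> (x \<zeta>1) * exp (- (A * c')) < 1 * exp (- (A * c'))" by linarith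
    then have "x \<zeta>1 * \<Theta> (x \<zeta>1) < 1" by (simp only: mult_less_cancel_right) auto
    then have "x \<zeta>1 \<le> 1" by (auto simp: \<Theta>_def split: if_splits)
    then show ?thesis using x_near[of \<zeta>1] rr R2 by (simp add: dist_norm)
  qed
  show ?thesis
    using main r0 rr by (intro exI[of _ r0] conjI exI[of _ "rr / 2"] allI impI) auto
qed

text \<open>Let t be the largest radius up to which the disc stays near \<open>p\<close>. Harnack on
  that subdisc keeps it close to \<open>z\<close> up to (1 - \<kappa>) t, and the fixed-radius
  localization at points of this modulus reaches a new radius t'. Maximality, t' <= t, forces t >= 1
  - \<kappa> / r0, and \<kappa> is a multiple of d.\<close>

lemma disc_localization:
  assumes R1: "0 < R1"
  shows "\<exists>v>0. \<exists>C1>0. \<forall>\<phi>. holo_vec \<phi> (ball 0 1) \<longrightarrow> \<phi> ` ball 0 1 \<subseteq> \<Omega> \<longrightarrow> dist (\<phi> 0) p < v \<longrightarrow>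
     (\<forall>\<zeta>. norm \<zeta> < 1 - C1 * (- r (\<phi> 0)) \<longrightarrow> dist (\<phi> \<zeta>) p < R1)"
proof -
  obtain K D a \<rho> where a: "0 < a" and \<rho>: "0 < \<rho>" "\<rho> \<le> R / 2" and
    ex: "\<And>z. z \<in> ball p (R / 2) \<Longrightarrow> \<exists>\<beta> \<gamma> \<tau> \<mu>. levi_poly (\<lambda>X. hprod X (m z) / 2) \<beta> \<gamma> \<tau> \<mu> K c \<and>
      (\<forall>w. norm w < \<rho> \<longrightarrow> r (z + w) < 0 \<longrightarrow> 2 * Re (levi_poly.pol (\<lambda>X. hprod X (m z) / 2) \<beta> \<tau> w) \<le> - r z - a * (norm w)\<^sup>2)"
    using chart_estimate by metis
  define R2 where "R2 = min R1 (\<rho> / 2)"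
  have R2: "0 < R2" "R2 \<le> R1" "R2 \<le> \<rho> / 2" using R1 \<rho> by (auto simp: R2_def)
  obtain r0 v0 where r0: "0 < r0" "r0 \<le> 1" "0 < v0" and
    small: "\<And>\<phi> \<zeta>. holo_vec \<phi> (ball 0 1) \<Longrightarrow> \<phi> ` ball 0 1 \<subseteq> \<Omega> \<Longrightarrow> dist (\<phi> 0) p < v0 \<Longrightarrow> norm \<zeta> < r0 \<Longrightarrow> dist (\<phi> \<zeta>) p < R2"
    using disc_localization_small[OF R2(1)] by metis
  define v where "v = min (v0 / 2) (\<rho> / 2)"
  have v: "0 < v" "v \<le> v0 / 2" "v \<le> \<rho> / 2" using r0 \<rho> by (auto simp: v_def)
  \<comment> \<open>Chosen so that C1 d = \<kappa> / r0; the 9 makes 2 d / (a \<kappa>) = 2 v0^2 / 9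
    smaller than (v0 / 2)^2.\<close>
  define C1 where "C1 = 9 / (a * v0\<^sup>2 * r0)"
  have C1: "0 < C1" using a r0 by (simp add: C1_def)
  have main: "dist (\<phi> \<zeta>) p < R2" if hol: "holo_vec \<phi> (ball 0 1)" and im: "\<phi> ` ball 0 1 \<subseteq> \<Omega>" and z0: "dist (\<phi> 0) p < v"
    and \<zeta>: "norm \<zeta> < 1 - C1 * (- r (\<phi> 0))" for \<phi> \<zeta>
  proof -
    define z where "z = \<phi> 0"
    have zv: "norm (z - p) < v" using z0 by (simp add: z_def dist_norm)
    have zB: "z \<in> ball p (R / 2)" using zv v \<rho> by (simp add: dist_norm norm_minus_commute)
    have z\<Omega>: "z \<in> \<Omega>" using im by (auto simp: z_def)
    define d where "d = - r z"
    have d: "0 < d" using r_neg[of z] z\<Omega> zB R by (simp add: d_def)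
    obtain \<beta> \<gamma> \<tau> \<mu> where lp: "levi_poly (\<lambda>X. hprod X (m z) / 2) \<beta> \<gamma> \<tau> \<mu> K c"
      and pe: "\<And>w. norm w < \<rho> \<Longrightarrow> r (z + w) < 0 \<Longrightarrow> 2 * Re (levi_poly.pol (\<lambda>X. hprod X (m z) / 2) \<beta> \<tau> w) \<le> d - a * (norm w)\<^sup>2"
      using ex[OF zB] unfolding d_def by blast
    interpret lp: levi_poly "\<lambda>X. hprod X (m z) / 2" \<beta> \<gamma> \<tau> \<mu> K c by (rule lp)
    define \<kappa> where "\<kappa> = 9 * d / (a * v0\<^sup>2)"
    have \<kappa>: "0 < \<kappa>" using d a r0 by (simp add: \<kappa>_def)
    have \<kappa>r: "C1 * d = \<kappa> / r0" by (simp add: C1_def \<kappa>_def)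
    have pos: "0 < 1 - \<kappa> / r0" using \<zeta> norm_ge_zero[of \<zeta>] \<kappa>r unfolding d_def z_def by linarith
    then have \<kappa>1: "\<kappa> < r0" "\<kappa> < 1" using r0 by (auto simp: field_simps)
    define I where "I = {t. 0 \<le> t \<and> t \<le> 1 \<and> (\<forall>\<zeta>. norm \<zeta> < t \<longrightarrow> dist (\<phi> \<zeta>) p < R2)}"
    have "r0 \<in> I" using small[OF hol im] z0 v r0 unfolding I_def by auto
    have bdd: "bdd_above I" unfolding I_def by (rule bdd_aboveI[of _ 1]) auto
    define t where "t = Sup I"
    have tr0: "r0 \<le> t" unfolding t_def by (rule cSup_upper[OF \<open>r0 \<in> I\<close> bdd])
    have t1: "t \<le> 1" unfolding t_def using \<open>r0 \<in> I\<close> by (intro cSup_least) (auto simp: I_def)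
    have tI: "dist (\<phi> \<zeta>) p < R2" if nt: "norm \<zeta> < t" for \<zeta>
    proof -
      obtain t' where "t' \<in> I" "norm \<zeta> < t'" using less_cSupD[of I "norm \<zeta>"] nt \<open>r0 \<in> I\<close> unfolding t_def by blast
      then show ?thesis by (auto simp: I_def)
    qed
    have t0: "0 < t" using tr0 r0 by simp
    \<comment> \<open>\<open>f\<close> has nonnegative real part and f 0 = d, so the Schwarz lemma
      for its Cayley transform \<open>g\<close> bounds |f| by d (1 + |\<eta>|) / (1 - |\<eta>|),
      while Re f dominates a |\<phi> - z|^2.\<close>
    have harnack: "a * (norm (\<phi> (of_real t * \<eta>) - z))\<^sup>2 \<le> 2 * d / (1 - cmod \<eta>)" if \<eta>: "norm \<eta> < 1" for \<eta>
    proof -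
      define f where "f \<xi> = d - 2 * lp.pol (\<phi> (of_real t * \<xi>) - z)" for \<xi>
      have nt: "norm (of_real t * \<xi>) < t" if "norm \<xi> < 1" for \<xi> :: complex
        using that t0 by (simp add: norm_mult)
      have fl: "a * (norm (\<phi> (of_real t * \<xi>) - z))\<^sup>2 \<le> Re (f \<xi>)" if xi: "norm \<xi> < 1" for \<xi>
      proof -
        let ?w = "\<phi> (of_real t * \<xi>) - z"
        have 1: "norm (\<phi> (of_real t * \<xi>) - p) < R2" using tI[OF nt[OF xi]] by (simp add: dist_norm)
        then have "norm ?w < \<rho>" using zv v R2 norm_triangle_ineq4[of "\<phi> (of_real t * \<xi>) - p" "z - p"] by simp
        moreover have "\<phi> (of_real t * \<xi>) \<in> \<Omega> \<inter> ball p R"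
          using im nt[OF xi] t1 1 R2 \<rho> R by (auto simp: dist_norm norm_minus_commute)
        then have "r (z + ?w) < 0" using r_neg by simp
        ultimately show ?thesis using pe[of ?w] by (simp add: f_def)
      qed
      have Ref: "0 \<le> Re (f \<xi>)" if "norm \<xi> < 1" for \<xi> using order_trans[OF _ fl[OF that]] a by simp
      define g where "g \<xi> = (f \<xi> - d) / (f \<xi> + d)" for \<xi>
      have ne: "f \<xi> + d \<noteq> 0" if "norm \<xi> < 1" for \<xi>
      proof
        assume "f \<xi> + d = 0"
        from arg_cong[OF this, of Re] show False using Ref[OF that] d by simp
      qed
      have hv: "holo_vec (\<lambda>\<xi>. \<phi> (0 + of_real t * \<xi>) - z) (ball 0 1)"
        by (intro holo_vec_diff_const holo_vec_affine[OF hol]) (use nt t1 in \<open>auto intro: less_le_trans\<close>)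
      have fh: "f holomorphic_on ball 0 1"
        using lp.pol_holomorphic[OF hv] unfolding f_def by (auto intro!: holomorphic_intros)
      have gh: "g holomorphic_on ball 0 1" unfolding g_def by (intro holomorphic_intros fh) (use ne in auto)
      have "f 0 = d" by (simp add: f_def z_def[symmetric] lp.pol_0)
      then have g0: "g 0 = 0" by (simp add: g_def)
      have g1: "cmod (g \<xi>) \<le> 1" if "norm \<xi> < 1" for \<xi>
      proof -
        have "0 \<le> d * Re (f \<xi>)" using Ref[OF that] d by simp
        then have "(cmod (f \<xi> - d))\<^sup>2 \<le> (cmod (f \<xi> + d))\<^sup>2"
          unfolding cmod_power2 by (simp add: power2_eq_square algebra_simps)
        then have "cmod (f \<xi> - d) \<le> cmod (f \<xi> + d)" by (simp add: power2_le_iff_abs_le)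
        then show ?thesis using ne[OF that] by (simp add: g_def norm_divide)
      qed
      have ge: "cmod (g \<eta>) \<le> cmod \<eta>" using Schwarz_bound(2)[OF gh g0 g1 \<eta>] by simp
      have "f \<eta> - d = g \<eta> * (f \<eta> + d)" using ne[OF \<eta>] by (simp add: g_def)
      then have "cmod (f \<eta> - d) \<le> cmod \<eta> * cmod (f \<eta> + d)" using ge by (simp add: norm_mult mult_right_mono)
      also have "\<dots> \<le> cmod \<eta> * (cmod (f \<eta>) + d)" using d norm_triangle_ineq[of "f \<eta>" "of_real d"] by (intro mult_left_mono) auto
      finally have "cmod (f \<eta>) - d \<le> cmod \<eta> * (cmod (f \<eta>) + d)"
        using norm_triangle_ineq2[of "f \<eta>" "of_real d"] d by simp
      then have "(1 - cmod \<eta>) * cmod (f \<eta>) \<le> (1 + cmod \<eta>) * d" by (simp add: algebra_simps)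
      also have "\<dots> \<le> 2 * d" using \<eta> d by (intro mult_right_mono) auto
      finally have "cmod (f \<eta>) \<le> 2 * d / (1 - cmod \<eta>)" using \<eta> by (simp add: field_simps)
      then show ?thesis using fl[OF \<eta>] complex_Re_le_cmod[of "f \<eta>"] by linarith
    qed
    have inner: "dist (\<phi> \<zeta>1) p < v0" if "norm \<zeta>1 \<le> (1 - \<kappa>) * t" for \<zeta>1
    proof -
      define \<eta> where "\<eta> = \<zeta>1 / of_real t"
      have \<eta>: "norm \<eta> \<le> 1 - \<kappa>" using that t0 by (simp add: \<eta>_def norm_divide pos_divide_le_eq)
      have eq: "of_real t * \<eta> = \<zeta>1" using t0 by (simp add: \<eta>_def)
      have "a * (norm (\<phi> \<zeta>1 - z))\<^sup>2 \<le> 2 * d / (1 - cmod \<eta>)" using harnack[of \<eta>] \<eta> \<kappa> unfolding eq by simp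
      also have "\<dots> \<le> 2 * d / \<kappa>" using \<eta> \<kappa> d by (intro divide_left_mono mult_pos_pos) auto
      also have "\<dots> = a * (2 / 9 * v0\<^sup>2)" using d a r0 by (simp add: \<kappa>_def)
      finally have "(norm (\<phi> \<zeta>1 - z))\<^sup>2 \<le> 2 / 9 * v0\<^sup>2" using a by simp
      also have "\<dots> < (v0 / 2)\<^sup>2" using r0 by (simp add: power_divide)
      finally have "norm (\<phi> \<zeta>1 - z) < v0 / 2" by (rule power2_less_imp_less) (use r0 in simp)
      then show ?thesis using zv v norm_triangle_ineq[of "\<phi> \<zeta>1 - z" "z - p"] by (simp add: dist_norm)
    qed
    define t1' where "t1' = (1 - \<kappa>) * t"
    have t1': "0 \<le> t1'" "t1' < 1"
    proof -
      show "0 \<le> t1'" unfolding t1'_def using \<kappa>1 t0 by (intro mult_nonneg_nonneg) auto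
      have "t1' \<le> (1 - \<kappa>) * 1" unfolding t1'_def using \<kappa>1 t1 by (intro mult_left_mono) auto
      then show "t1' < 1" using \<kappa> by simp
    qed
    \<comment> \<open>Discs of radius 1 - t1' around points of modulus at most t1' lie in the unit
      disc, and on the fraction \<open>r0\<close> of each of them \<phi> stays near
      \<open>p\<close>.\<close>
    define t' where "t' = t1' + r0 * (1 - t1')"
    have "t' \<in> I" unfolding I_def
    proof (intro CollectI conjI allI impI)
      show "0 \<le> t'" using t1' r0 by (simp add: t'_def)
      have "r0 * (1 - t1') \<le> 1 * (1 - t1')" using t1' r0 by (intro mult_right_mono) auto
      then show "t' \<le> 1" by (simp add: t'_def)
      fix \<xi> :: complex assume xi: "norm \<xi> < t'"
      show "dist (\<phi> \<xi>) p < R2"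
      proof -
        obtain \<zeta>1 where z1: "norm \<zeta>1 \<le> t1'" "norm (\<xi> - \<zeta>1) < r0 * (1 - t1')"
        proof (cases "norm \<xi> \<le> t1'")
          case True
          then show ?thesis using that[of \<xi>] r0 t1' by simp
        next
          case False
          then have x0: "norm \<xi> > 0" using t1' by linarith
          define \<zeta>1 where "\<zeta>1 = of_real (t1' / norm \<xi>) * \<xi>"
          have "norm \<zeta>1 = t1'" using x0 t1' by (simp add: \<zeta>1_def norm_mult norm_divide)
          moreover have "\<xi> - \<zeta>1 = of_real ((norm \<xi> - t1') / norm \<xi>) * \<xi>"
            using x0 by (simp add: \<zeta>1_def diff_divide_distrib left_diff_distrib)
          then have "norm (\<xi> - \<zeta>1) = norm \<xi> - t1'" using x0 False by (simp only: norm_mult norm_of_real) (simp add: abs_of_nonneg)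
          ultimately show ?thesis using that[of \<zeta>1] xi by (simp add: t'_def)
        qed
        define \<phi>1 where "\<phi>1 \<xi> = \<phi> (\<zeta>1 + of_real (1 - t1') * \<xi>)" for \<xi>
        have ins: "norm (\<zeta>1 + of_real (1 - t1') * \<xi>) < 1" if "norm \<xi> < 1" for \<xi>
        proof -
          have "norm (\<zeta>1 + of_real (1 - t1') * \<xi>) \<le> t1' + (1 - t1') * norm \<xi>"
            using z1(1) t1' by (intro norm_triangle_mono) (auto simp: norm_mult simp flip: of_real_diff)
          also have "\<dots> < t1' + (1 - t1') * 1" using that t1' by (intro add_strict_left_mono mult_strict_left_mono) auto
          finally show ?thesis by simp
        qed
        have "holo_vec \<phi>1 (ball 0 1)" unfolding \<phi>1_def by (rule holo_vec_affine[OF hol]) (use ins in auto)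
        moreover have "\<phi>1 ` ball 0 1 \<subseteq> \<Omega>" using im ins by (auto simp: \<phi>1_def)
        moreover have "dist (\<phi>1 0) p < v0" using inner[of \<zeta>1] z1(1) by (simp add: \<phi>1_def t1'_def)
        moreover have "norm ((\<xi> - \<zeta>1) / of_real (1 - t1')) < r0"
          using z1(2) t1' by (simp add: norm_divide pos_divide_less_eq flip: of_real_diff)
        ultimately have "dist (\<phi>1 ((\<xi> - \<zeta>1) / of_real (1 - t1'))) p < R2" by (rule small)
        moreover have "\<zeta>1 + of_real (1 - t1') * ((\<xi> - \<zeta>1) / of_real (1 - t1')) = \<xi>"
        proof -
          have "complex_of_real (1 - t1') \<noteq> 0" using t1' by (simp only: of_real_eq_0_iff)
          then show ?thesis by simp
        qed
        ultimately show ?thesis by (simp add: \<phi>1_def)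
      qed
    qed
    then have "t' \<le> t" unfolding t_def by (rule cSup_upper[OF _ bdd])
    then have tt: "r0 \<le> t * (r0 + \<kappa> * (1 - r0))" by (simp add: t'_def t1'_def algebra_simps)
    have "1 - \<kappa> / r0 \<le> t"
    proof -
      have s: "0 < r0 + \<kappa> * (1 - r0)" using r0 \<kappa> by (simp add: add_pos_nonneg)
      have "(1 - \<kappa> / r0) * (r0 + \<kappa> * (1 - r0)) = r0 - \<kappa> * r0 - \<kappa> * \<kappa> * (1 - r0) / r0"
        using r0 by (simp add: field_simps)
      also have "\<dots> \<le> r0"
      proof -
        have "0 \<le> \<kappa> * r0" "0 \<le> \<kappa> * \<kappa> * (1 - r0) / r0" using r0 \<kappa> by simp_all
        then show ?thesis by linarith
      qed
      also have "\<dots> \<le> t * (r0 + \<kappa> * (1 - r0))" by (rule tt)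
      finally show ?thesis using s by simp
    qed
    then show ?thesis using tI[of \<zeta>] \<zeta> \<kappa>r unfolding d_def z_def by linarith
  qed
  show ?thesis using main v(1) C1 R2(2) by (intro exI[of _ v] conjI exI[of _ C1] allI impI) (auto intro: less_le_trans)
qed

text \<open>The square of the metric in the theorem, with - r in place of the boundary
  distance.\<close>

definition metric_form :: "complex^'n \<Rightarrow> complex^'n \<Rightarrow> real" where
  "metric_form z X = (cmod (hprod X (m z) / 2))\<^sup>2 / (r z)\<^sup>2 + (m1 z X \<bullet> X + m1 z (J X) \<bullet> J X) / 4 / (- r z)"

text \<open>A disc restricted to |\<zeta>| < 1 - C1 d and rescaled meets the hypotheses of
  \<open>schwarz_lower\<close>. Rescaling costs C1 d <= C1 d^\<theta> and the Schwarz estimate E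
  d^\<theta>, hence C2 = C1 + E.\<close>

lemma kobayashi_disc_lower:
  "\<exists>v>0. \<exists>C2>0. v \<le> R \<and> (\<forall>\<phi> \<alpha> X. holo_vec \<phi> (ball 0 1) \<longrightarrow> \<phi> ` ball 0 1 \<subseteq> \<Omega> \<longrightarrow> dist (\<phi> 0) p < v \<longrightarrow>
     (\<forall>i. \<alpha> * deriv (\<lambda>\<zeta>. \<phi> \<zeta> $ i) 0 = X $ i) \<longrightarrow>
     (1 - C2 * (- r (\<phi> 0)) powr ((\<sigma> - 1) / 2)) * sqrt (metric_form (\<phi> 0) X) \<le> cmod \<alpha>)"
proof -
  define \<theta> where "\<theta> = (\<sigma> - 1) / 2"
  have \<theta>: "0 \<le> \<theta>" "\<theta> \<le> 1" using \<sigma> by (auto simp: \<theta>_def)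
  obtain K D a \<rho> where D: "0 \<le> D" and a: "0 < a" "a \<le> 1" and \<rho>: "0 < \<rho>" "\<rho> \<le> R / 2" and
    ex0: "\<forall>z\<in>ball p (R / 2). \<exists>\<beta> \<gamma> \<tau> \<mu>. levi_poly (\<lambda>X. hprod X (m z) / 2) \<beta> \<gamma> \<tau> \<mu> K c \<and>
     (\<forall>X. Re (\<gamma> X X) = (m1 z X \<bullet> X + m1 z (J X) \<bullet> J X) / 4) \<and>
     (\<forall>w. z + w \<in> ball p R \<longrightarrow> \<bar>r (z + w) - (r z + 2 * Re (hprod w (m z) / 2 + \<beta> w w + \<tau> w w w) + Re (\<gamma> w w)
        + 2 * Re (\<mu> w w w))\<bar> \<le> K * norm w powr (\<sigma> + 1)) \<and>
     (\<forall>w. norm w < \<rho> \<longrightarrow> r (z + w) < 0 \<longrightarrow>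
        2 * Re (levi_poly.pol (\<lambda>X. hprod X (m z) / 2) \<beta> \<tau> w) + Re (\<gamma> (levi_poly.shear \<gamma> \<mu> K c w) (levi_poly.shear \<gamma> \<mu> K c w))
          \<le> - r z + D * norm w powr (2 * (1 + (\<sigma> - 1) / 2)) \<and>
        2 * Re (levi_poly.pol (\<lambda>X. hprod X (m z) / 2) \<beta> \<tau> w) \<le> - r z - a * (norm w)\<^sup>2)"
    using chart_estimate by (elim exE conjE)
  note ex = bspec[OF ex0[folded \<theta>_def]]
  obtain v1 C1 where v1: "0 < v1" "0 < C1" and loc: "\<And>\<phi> \<zeta>. holo_vec \<phi> (ball 0 1) \<Longrightarrow> \<phi> ` ball 0 1 \<subseteq> \<Omega> \<Longrightarrow> dist (\<phi> 0) p < v1 \<Longrightarrow>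
     norm \<zeta> < 1 - C1 * (- r (\<phi> 0)) \<Longrightarrow> dist (\<phi> \<zeta>) p < \<rho> / 2" using disc_localization[of "\<rho> / 2"] \<rho>(1) by auto
  have "isCont r p" using r_der[of p] R has_derivative_continuous by force
  moreover have "0 < min 1 (1 / (2 * C1))" using v1 by simp
  ultimately obtain v2 where v2: "0 < v2" "\<And>x. dist x p < v2 \<Longrightarrow> dist (r x) (r p) < min 1 (1 / (2 * C1))"
    unfolding continuous_at_eps_delta by blast
  define v where "v = min (min v1 v2) (\<rho> / 2)"
  have v: "0 < v" "v \<le> v1" "v \<le> v2" "v \<le> \<rho> / 2" using v1 v2 \<rho> by (auto simp: v_def)
  define E where "E = 4 * D / a\<^sup>2"
  have E: "0 \<le> E" using D by (simp add: E_def)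
  have main: "(1 - (C1 + E) * (- r (\<phi> 0)) powr \<theta>) * sqrt (metric_form (\<phi> 0) X) \<le> cmod \<alpha>"
    if hol: "holo_vec \<phi> (ball 0 1)" and im: "\<phi> ` ball 0 1 \<subseteq> \<Omega>" and z0: "dist (\<phi> 0) p < v"
    and X: "\<forall>i. \<alpha> * deriv (\<lambda>\<zeta>. \<phi> \<zeta> $ i) 0 = X $ i" for \<phi> :: "complex \<Rightarrow> complex^'n" and \<alpha> X
  proof -
    define z where "z = \<phi> 0"
    have zv: "norm (z - p) < v" using z0 by (simp add: z_def dist_norm)
    have zB: "z \<in> ball p (R / 2)" using zv v \<rho> by (simp add: dist_norm norm_minus_commute)
    have z\<Omega>: "z \<in> \<Omega>" using im by (auto simp: z_def)
    define d where "d = - r z"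
    have d: "0 < d" using r_neg[of z] z\<Omega> zB R by (simp add: d_def)
    have "\<bar>r z\<bar> < min 1 (1 / (2 * C1))" using v2(2)[of z] zv v by (simp add: dist_norm r_p)
    then have rb: "\<bar>r z\<bar> < 1" "\<bar>r z\<bar> < 1 / (2 * C1)" by auto
    have dr: "d = \<bar>r z\<bar>" using d by (simp add: d_def)
    have "C1 * d < C1 * (1 / (2 * C1))" unfolding dr using rb v1 by (intro mult_strict_left_mono) auto
    then have d1: "d < 1" "C1 * d < 1 / 2" using v1 rb dr by auto
    define s where "s = 1 - C1 * d"
    have s: "0 < s" "s < 1" using d1 d v1 by (auto simp: s_def)
    obtain \<beta> \<gamma> \<tau> \<mu> where lp: "levi_poly (\<lambda>X. hprod X (m z) / 2) \<beta> \<gamma> \<tau> \<mu> K c"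
      and lv: "\<And>X. Re (\<gamma> X X) = (m1 z X \<bullet> X + m1 z (J X) \<bullet> J X) / 4"
      and pe: "\<And>w. norm w < \<rho> \<Longrightarrow> r (z + w) < 0 \<Longrightarrow>
        2 * Re (levi_poly.pol (\<lambda>X. hprod X (m z) / 2) \<beta> \<tau> w) + Re (\<gamma> (levi_poly.shear \<gamma> \<mu> K c w) (levi_poly.shear \<gamma> \<mu> K c w))
          \<le> d + D * norm w powr (2 * (1 + \<theta>))"
        "\<And>w. norm w < \<rho> \<Longrightarrow> r (z + w) < 0 \<Longrightarrow> 2 * Re (levi_poly.pol (\<lambda>X. hprod X (m z) / 2) \<beta> \<tau> w) \<le> d - a * (norm w)\<^sup>2"
    proof -
      from ex[OF zB] show ?thesis
      proof (elim exE conjE)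
        fix \<beta> \<gamma> \<tau> \<mu>
        assume "levi_poly (\<lambda>X. hprod X (m z) / 2) \<beta> \<gamma> \<tau> \<mu> K c"
          "\<forall>X. Re (\<gamma> X X) = (m1 z X \<bullet> X + m1 z (J X) \<bullet> J X) / 4"
          "\<forall>w. norm w < \<rho> \<longrightarrow> r (z + w) < 0 \<longrightarrow>
        2 * Re (levi_poly.pol (\<lambda>X. hprod X (m z) / 2) \<beta> \<tau> w) + Re (\<gamma> (levi_poly.shear \<gamma> \<mu> K c w) (levi_poly.shear \<gamma> \<mu> K c w))
          \<le> - r z + D * norm w powr (2 * (1 + \<theta>)) \<and>
        2 * Re (levi_poly.pol (\<lambda>X. hprod X (m z) / 2) \<beta> \<tau> w) \<le> - r z - a * (norm w)\<^sup>2"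
        then show thesis using that[of \<beta> \<gamma> \<tau> \<mu>] unfolding d_def by simp
      qed
    qed
    interpret lp: levi_poly "\<lambda>X. hprod X (m z) / 2" \<beta> \<gamma> \<tau> \<mu> K c by (rule lp)
    define \<phi>' where "\<phi>' = (\<chi> k. deriv (\<lambda>\<zeta>. \<phi> \<zeta> $ k) 0)"
    define \<phi>s where "\<phi>s \<zeta> = \<phi> (0 + of_real s * \<zeta>) - z" for \<zeta>
    have ns: "norm (0 + of_real s * \<zeta>) < s" if "norm \<zeta> < 1" for \<zeta> :: complex
      using that s by (simp add: norm_mult)
    have hs: "holo_vec \<phi>s (ball 0 1)" unfolding \<phi>s_def
      by (intro holo_vec_diff_const holo_vec_affine[OF hol]) (use ns s in \<open>auto intro: less_trans\<close>)
    have ds: "vec_deriv \<phi>s (of_real s *s \<phi>') 0"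
      unfolding vec_deriv_def
    proof
      fix k
      have "((\<lambda>\<zeta>. \<phi> \<zeta> $ k) has_field_derivative \<phi>' $ k) (at (0 + of_real s * 0))"
        using hol unfolding holo_vec_def \<phi>'_def by (auto intro!: holomorphic_derivI[of _ "ball 0 1"])
      moreover have "((\<lambda>\<zeta>. 0 + of_real s * \<zeta>) has_field_derivative of_real s) (at 0)" by (auto intro!: derivative_eq_intros)
      ultimately have "((\<lambda>\<zeta>. \<phi> (0 + of_real s * \<zeta>) $ k) has_field_derivative \<phi>' $ k * of_real s) (at 0)" by (rule DERIV_chain2)
      from DERIV_diff[OF this DERIV_const[of "z $ k"]]
      show "((\<lambda>\<zeta>. \<phi>s \<zeta> $ k) has_field_derivative (of_real s *s \<phi>') $ k) (at 0)"
        by (simp add: \<phi>s_def mult.commute)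
    qed
    have w: "norm (\<phi>s \<zeta>) < \<rho>" "r (z + \<phi>s \<zeta>) < 0" if zz: "norm \<zeta> < 1" for \<zeta>
    proof -
      have "dist (\<phi> (0 + of_real s * \<zeta>)) p < \<rho> / 2"
        using loc[OF hol im] z0 v ns[OF zz] unfolding s_def d_def z_def by auto
      then have 1: "norm (\<phi> (0 + of_real s * \<zeta>) - p) < \<rho> / 2" by (simp add: dist_norm)
      then show "norm (\<phi>s \<zeta>) < \<rho>"
        using zv v norm_triangle_ineq4[of "\<phi> (0 + of_real s * \<zeta>) - p" "z - p"] by (simp add: \<phi>s_def)
      have "\<phi> (0 + of_real s * \<zeta>) \<in> \<Omega> \<inter> ball p R"
        using im less_trans[OF ns[OF zz] s(2)] 1 \<rho> R by (auto simp: dist_norm norm_minus_commute)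
      then show "r (z + \<phi>s \<zeta>) < 0" using r_neg by (simp add: \<phi>s_def)
    qed
    have "\<phi>s 0 = 0" by (simp add: \<phi>s_def z_def)
    from lp.schwarz_lower[OF d hs this ds a D \<theta> pe(1)[OF w] pe(2)[OF w]]
    have N: "(cmod (hprod (of_real s *s \<phi>') (m z) / 2))\<^sup>2 / d\<^sup>2 + Re (\<gamma> (of_real s *s \<phi>') (of_real s *s \<phi>')) / d \<le> 1 + E * d powr \<theta>"
      unfolding E_def by simp
    define k where "k = \<alpha> / of_real s"
    have Xk: "X = k *s (of_real s *s \<phi>')" using X s by (simp add: vec_eq_iff \<phi>'_def k_def)
    have ck: "cmod k = cmod \<alpha> / s" using s by (simp add: k_def norm_divide)
    have "metric_form z X = (cmod (hprod X (m z) / 2))\<^sup>2 / d\<^sup>2 + Re (\<gamma> X X) / d"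
      by (simp add: metric_form_def lv d_def)
    also have "\<dots> = (cmod k)\<^sup>2 * ((cmod (hprod (of_real s *s \<phi>') (m z) / 2))\<^sup>2 / d\<^sup>2 + Re (\<gamma> (of_real s *s \<phi>') (of_real s *s \<phi>')) / d)"
    proof -
      have "hprod X (m z) = k * hprod (of_real s *s \<phi>') (m z)" unfolding Xk using clin_hprod unfolding clin_def by blast
      moreover have "Re (\<gamma> X X) = (cmod k)\<^sup>2 * Re (\<gamma> (of_real s *s \<phi>') (of_real s *s \<phi>'))"
      proof -
        define k2 where "k2 = (cmod k)\<^sup>2"
        have kk: "k * cnj k = of_real k2" unfolding k2_def by (rule complex_norm_square[symmetric])
        have "\<gamma> X X = (k * cnj k) * \<gamma> (of_real s *s \<phi>') (of_real s *s \<phi>')"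
          by (subst (1 2) Xk) (simp only: lp.\<gamma>_smult_left[of k] lp.\<gamma>_smult_right[of _ k] mult_ac)
        then show ?thesis unfolding kk k2_def[symmetric] by simp
      qed
      ultimately show ?thesis by (simp add: norm_mult norm_divide power_mult_distrib power_divide distrib_left)
    qed
    also have "\<dots> \<le> (cmod k)\<^sup>2 * (1 + E * d powr \<theta>)" using N by (intro mult_left_mono) auto
    also have "\<dots> \<le> (cmod k)\<^sup>2 * (1 + E * d powr \<theta>)\<^sup>2"
    proof -
      have "1 \<le> 1 + E * d powr \<theta>" using E by simp
      then show ?thesis by (intro mult_left_mono self_le_power) auto
    qed
    finally have "sqrt (metric_form z X) \<le> cmod k * (1 + E * d powr \<theta>)"
      using E by (intro real_le_lsqrt) (auto simp: power_mult_distrib)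
    then have Q: "s * sqrt (metric_form z X) \<le> cmod \<alpha> * (1 + E * d powr \<theta>)" using s by (simp add: ck field_simps)
    define Q' where "Q' = sqrt (metric_form z X)"
    define y where "y = E * d powr \<theta>"
    have y: "0 \<le> y" using E by (simp add: y_def)
    have Q0: "0 \<le> Q'"
    proof -
      have "0 \<le> metric_form z X" unfolding metric_form_def lv[symmetric]
        using lp.\<gamma>_nonneg[of X] d by (intro add_nonneg_nonneg divide_nonneg_nonneg) (auto simp: d_def)
      then show ?thesis by (simp add: Q'_def)
    qed
    have "d \<le> d powr \<theta>" using powr_mono'[of \<theta> 1 d] \<theta> d d1 by simp
    then have "C1 * d \<le> C1 * d powr \<theta>" using v1 by simp
    then have "1 - (C1 + E) * d powr \<theta> \<le> s - y" by (simp add: s_def y_def algebra_simps)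
    also have "\<dots> \<le> s * (1 - y)" using s y mult_right_mono[of s 1 y] by (simp add: algebra_simps)
    finally have le: "1 - (C1 + E) * d powr \<theta> \<le> s * (1 - y)" .
    have "(1 - (C1 + E) * d powr \<theta>) * Q' \<le> (s * (1 - y)) * Q'" using le Q0 by (rule mult_right_mono)
    also have "\<dots> \<le> cmod \<alpha>"
    \<comment> \<open>For y > 1 the left side is nonpositive; otherwise (1 - y) (1 + y) <= 1 removes
      the factor 1 + y.\<close>
    proof (cases "y \<le> 1")
      case True
      have "(1 - y) * (s * Q') \<le> (1 - y) * (cmod \<alpha> * (1 + y))" using True Q unfolding Q'_def y_def by (intro mult_left_mono) auto
      also have "\<dots> = cmod \<alpha> * (1 - y\<^sup>2)" by (simp add: power2_eq_square algebra_simps)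
      also have "\<dots> \<le> cmod \<alpha>" by (simp add: mult_left_le)
      finally show ?thesis by (simp add: mult_ac)
    next
      case False
      then have "(s * (1 - y)) * Q' \<le> 0" using s Q0 by (intro mult_nonpos_nonneg mult_nonneg_nonpos) auto
      then show ?thesis using norm_ge_zero[of \<alpha>] by linarith
    qed
    finally show ?thesis unfolding Q'_def d_def z_def .
  qed
  show ?thesis using main v E v1 \<rho> R unfolding \<theta>_def by (intro exI[of _ v] conjI exI[of _ "C1 + E"] allI impI) auto
qed

end

section \<open>The upper bound\<close>

lemma trilinear_diff_bound:
  fixes f :: "complex^'n \<Rightarrow> complex^'n \<Rightarrow> complex^'n \<Rightarrow> complex"
  assumes add: "\<And>u u' v w. f (u + u') v w = f u v w + f u' v w" "\<And>u v v' w. f u (v + v') w = f u v w + f u v' w"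
      "\<And>u v w w'. f u v (w + w') = f u v w + f u v w'"
    and b: "\<And>u v w. cmod (f u v w) \<le> N * norm u * norm v * norm w" and N: "0 \<le> N"
    and V: "norm V \<le> D * x" "norm (V + a) \<le> D * x" "norm a \<le> A * x\<^sup>2" and x: "0 \<le> x" "0 \<le> D" "0 \<le> A"
  shows "cmod (f (V + a) (V + a) (V + a) - f V V V) \<le> 3 * (N * A * D\<^sup>2) * x ^ 4"
proof -
  let ?w = "V + a"
  have eq: "f ?w ?w ?w - f V V V = f a ?w ?w + f V a ?w + f V V a"
    using add(1)[of V a ?w ?w] add(2)[of V V a ?w] add(3)[of V V V a] by simp
  have "cmod (f a ?w ?w) \<le> N * (A * x\<^sup>2) * (D * x) * (D * x)"
    by (rule order_trans[OF b]) (use V N x in \<open>intro mult_mono mult_nonneg_nonneg; simp\<close>)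
  moreover have "cmod (f V a ?w) \<le> N * (D * x) * (A * x\<^sup>2) * (D * x)"
    by (rule order_trans[OF b]) (use V N x in \<open>intro mult_mono mult_nonneg_nonneg; simp\<close>)
  moreover have "cmod (f V V a) \<le> N * (D * x) * (D * x) * (A * x\<^sup>2)"
    by (rule order_trans[OF b]) (use V N x in \<open>intro mult_mono mult_nonneg_nonneg; simp\<close>)
  ultimately have "cmod (f ?w ?w ?w - f V V V) \<le> N * (A * x\<^sup>2) * (D * x) * (D * x) + N * (D * x) * (A * x\<^sup>2) * (D * x) + N * (D * x) * (D * x) * (A * x\<^sup>2)"
    unfolding eq by (intro norm_triangle_mono)
  also have "\<dots> = 3 * (N * A * D\<^sup>2) * x ^ 4" by (simp add: power2_eq_square power4_eq_xxxx algebra_simps)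
  finally show ?thesis .
qed

section \<open>The inverse coordinate change\<close>

context levi_poly
begin

text \<open>The part - \<open>riesz_\<mu> V V\<close> cancels \<mu> against \<gamma>; the multiple
  of \<nu> is fixed by \<open>ell (corr2 \<nu> V) = - \<beta> V V\<close>, which cancels the
  quadratic term of \<open>pol\<close>.\<close>

definition corr2 :: "complex^'n \<Rightarrow> complex^'n \<Rightarrow> complex^'n" where
  "corr2 \<nu> V = (ell (riesz_\<mu> V V) - \<beta> V V) *s \<nu> - riesz_\<mu> V V"

text \<open>The coefficient along \<nu> that cancels all cubic terms of \<open>pol\<close> created
  by the substitution V + \<open>corr2 \<nu> V\<close>.\<close>

definition corr3 :: "complex^'n \<Rightarrow> complex^'n \<Rightarrow> complex" where
  "corr3 \<nu> V = - (\<tau> V V V + \<beta> V (corr2 \<nu> V) + \<beta> (corr2 \<nu> V) V)"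

text \<open>The inverse coordinate change: it turns the defining function into
  \<open>- d + 2 Re (ell V) + Re (\<gamma> V V)\<close> up to terms that are small on the extremal discs of this model.\<close>
definition unshear :: "complex^'n \<Rightarrow> complex^'n \<Rightarrow> complex^'n" where
  "unshear \<nu> V = V + (corr2 \<nu> V + corr3 \<nu> V *s \<nu>)"

definition bigN :: real where
  "bigN = K + K / c + K * K / c + K * K * K * K / (c * c) * K"

lemma bigN: "1 \<le> bigN" "K \<le> bigN" "K / c \<le> bigN" "K * K / c \<le> bigN" "K * K * K * K / (c * c) * K \<le> bigN"
proof -
  have "0 \<le> K / c" "0 \<le> K * K / c" "0 \<le> K * K * K * K / (c * c) * K" using K c by simp_all
  then show "1 \<le> bigN" "K \<le> bigN" "K / c \<le> bigN" "K * K / c \<le> bigN" "K * K * K * K / (c * c) * K \<le> bigN"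
    using K unfolding bigN_def by linarith+
qed

lemma \<beta>_add: "\<beta> (u + u') v = \<beta> u v + \<beta> u' v" "\<beta> u (v + v') = \<beta> u v + \<beta> u v'"
  using \<beta> unfolding clin_def by blast+

lemma ell_minus: "ell (u - v) = ell u - ell v"
  using ell_add[of "u - v" v] by simp

text \<open>Every leftover is quartic in V except the effect of the \<nu>-part of
  \<open>corr2\<close> on \<gamma>: there \<gamma>(\<nu>, V) is a multiple of cnj (ell V), which
  produces the second error term. The numerical constants are deliberately crude.\<close>

lemma unshear_estimates:
  assumes \<kappa>: "0 < \<kappa>" and \<nu>: "ell \<nu> = 1" "\<And>u. \<gamma> \<nu> u = cnj (ell u) / complex_of_real \<kappa>" "norm \<nu> \<le> bigN" "1 / \<kappa> \<le> bigN"
    and V: "norm V \<le> 1"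
  shows "norm (unshear \<nu> V) \<le> 11 * bigN ^ 5 * norm V"
    and "\<bar>2 * Re (pol (unshear \<nu> V)) + Re (\<gamma> (unshear \<nu> V) (unshear \<nu> V)) + 2 * Re (\<mu> (unshear \<nu> V) (unshear \<nu> V) (unshear \<nu> V))
        - (2 * Re (ell V) + Re (\<gamma> V V))\<bar> \<le> 40000 * bigN ^ 16 * (norm V ^ 4 + (norm V)\<^sup>2 * cmod (ell V))"
proof -
  define N where "N = bigN"
  define x where "x = norm V"
  have x: "0 \<le> x" "x \<le> 1" using V by (auto simp: x_def)
  have N: "1 \<le> N" "K \<le> N" "K / c \<le> N" using bigN by (auto simp: N_def)
  have N0: "0 \<le> N" using N by simp
  have pw: "N ^ i \<le> N ^ j" if "i \<le> j" for i j using N that by (intro power_increasing) auto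
  have xp: "x ^ j \<le> x ^ i" if "i \<le> j" for i j using x that by (intro power_decreasing) auto
  have up: "K * t \<le> N * t" if "0 \<le> t" for t using N that by (intro mult_right_mono) auto
  have b1: "cmod (ell u) \<le> N * norm u" for u using ell_bound[of u] up[of "norm u"] by simp
  have b2: "cmod (\<beta> u v) \<le> N * norm u * norm v" for u v using \<beta>_bound[of u v] up[of "norm u * norm v"] by (simp add: mult.assoc)
  have b3: "cmod (\<gamma> u v) \<le> N * norm u * norm v" for u v using \<gamma>_bound[of u v] up[of "norm u * norm v"] by (simp add: mult.assoc)
  have b4: "cmod (\<tau> u v w) \<le> N * norm u * norm v * norm w" for u v w
    using \<tau>_bound[of u v w] up[of "norm u * norm v * norm w"] by (simp add: mult.assoc)
  have b5: "cmod (\<mu> u v w) \<le> N * norm u * norm v * norm w" for u v w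
    using \<mu>_bound[of u v w] up[of "norm u * norm v * norm w"] by (simp add: mult.assoc)
  define q where "q = riesz_\<mu> V V"
  define c2 where "c2 = ell q - \<beta> V V"
  define A2 where "A2 = corr2 \<nu> V"
  define c3 where "c3 = corr3 \<nu> V"
  define A3 where "A3 = c3 *s \<nu>"
  define a where "a = A2 + A3"
  define w where "w = unshear \<nu> V"
  have wa: "w = V + a" by (simp add: w_def unshear_def a_def A3_def c3_def A2_def)
  have A2: "A2 = c2 *s \<nu> - q" by (simp add: A2_def corr2_def c2_def q_def)
  have nq: "norm q \<le> N * x\<^sup>2"
  proof -
    have "norm q \<le> K / c * (x * x)" using riesz_\<mu>(2)[of V V] by (simp add: q_def x_def mult.assoc)
    also have "\<dots> \<le> N * (x * x)" using N x by (intro mult_right_mono) auto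
    finally show ?thesis by (simp add: power2_eq_square)
  qed
  have nc2: "cmod c2 \<le> 2 * N ^ 2 * x\<^sup>2"
  proof -
    have "cmod c2 \<le> N * (N * x\<^sup>2) + N * x * x"
      unfolding c2_def
      by (intro order_trans[OF norm_triangle_ineq4] add_mono order_trans[OF b1] mult_left_mono nq N0)
        (use b2[of V V] in \<open>simp add: x_def\<close>)
    also have "\<dots> = (N ^ 2 + N ^ 1) * x\<^sup>2" by (simp add: power2_eq_square algebra_simps)
    also have "\<dots> \<le> (N ^ 2 + N ^ 2) * x\<^sup>2" using pw[of 1 2] by (intro mult_right_mono) auto
    finally show ?thesis by simp
  qed
  have nA2: "norm A2 \<le> 3 * N ^ 3 * x\<^sup>2"
  proof -
    have "norm A2 \<le> (2 * N ^ 2 * x\<^sup>2) * N + N * x\<^sup>2"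
      unfolding A2 by (intro order_trans[OF norm_triangle_ineq4] add_mono nq, unfold norm_smult)
        (use nc2 \<nu>(3) N0 in \<open>intro mult_mono; simp add: N_def\<close>)
    also have "\<dots> = (2 * N ^ 3 + N ^ 1) * x\<^sup>2" by (simp add: power2_eq_square power3_eq_cube algebra_simps)
    also have "\<dots> \<le> (2 * N ^ 3 + N ^ 3) * x\<^sup>2" using pw[of 1 3] by (intro mult_right_mono) auto
    finally show ?thesis by simp
  qed
  have nc3: "cmod c3 \<le> 7 * N ^ 4 * x ^ 3"
  proof -
    have "cmod c3 \<le> N * x * x * x + N * x * (3 * N ^ 3 * x\<^sup>2) + N * (3 * N ^ 3 * x\<^sup>2) * x"
    proof -
      have "cmod (\<beta> V A2) \<le> N * x * (3 * N ^ 3 * x\<^sup>2)"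
        by (rule order_trans[OF b2]) (use nA2 N0 x in \<open>unfold x_def[symmetric], intro mult_left_mono mult_nonneg_nonneg\<close>)
      moreover have "cmod (\<beta> A2 V) \<le> N * (3 * N ^ 3 * x\<^sup>2) * x"
        by (rule order_trans[OF b2]) (use nA2 N0 x in \<open>unfold x_def[symmetric], intro mult_right_mono mult_left_mono\<close>)
      moreover have "cmod (\<tau> V V V) \<le> N * x * x * x" using b4[of V V V] by (simp add: x_def)
      ultimately show ?thesis unfolding c3_def corr3_def A2_def[symmetric] norm_minus_cancel by (intro norm_triangle_mono)
    qed
    also have "\<dots> = (N ^ 1 + 6 * N ^ 4) * x ^ 3" by (simp add: power_numeral_reduce algebra_simps)
    also have "\<dots> \<le> (N ^ 4 + 6 * N ^ 4) * x ^ 3" using pw[of 1 4] x by (intro mult_right_mono) auto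
    finally show ?thesis by simp
  qed
  have nA3: "norm A3 \<le> 7 * N ^ 5 * x ^ 3"
  proof -
    have "norm A3 \<le> (7 * N ^ 4 * x ^ 3) * N" unfolding A3_def norm_smult
      using nc3 \<nu>(3) N0 x by (intro mult_mono) (auto simp: N_def)
    then show ?thesis by (simp add: power_numeral_reduce mult_ac)
  qed
  have na: "norm a \<le> 10 * N ^ 5 * x\<^sup>2"
  proof -
    have "norm a \<le> 3 * N ^ 3 * x\<^sup>2 + 7 * N ^ 5 * x ^ 3" unfolding a_def by (intro norm_triangle_mono nA2 nA3)
    also have "\<dots> \<le> 3 * N ^ 5 * x\<^sup>2 + 7 * N ^ 5 * x\<^sup>2"
      using pw[of 3 5] xp[of 2 3] N0 x by (intro add_mono mult_right_mono mult_left_mono) auto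
    finally show ?thesis by (simp add: algebra_simps)
  qed
  have nw: "norm w \<le> 11 * N ^ 5 * x"
  proof -
    have "norm w \<le> x + 10 * N ^ 5 * x\<^sup>2" unfolding wa x_def by (intro norm_triangle_mono order_refl na[unfolded x_def])
    also have "\<dots> \<le> N ^ 5 * x + 10 * N ^ 5 * x"
      using pw[of 0 5] xp[of 1 2] N0 x by (intro add_mono mult_left_mono) (auto intro: mult_right_mono[of 1 "N^5" x, simplified])
    finally show ?thesis by (simp add: algebra_simps)
  qed
  then show "norm (unshear \<nu> V) \<le> 11 * bigN ^ 5 * norm V" by (simp add: w_def N_def x_def)
  have nV: "norm V \<le> 11 * N ^ 5 * x"
    using pw[of 0 5] x N0 mult_right_mono[of 1 "11 * N ^ 5" x] by (simp add: x_def)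
  have d: "cmod (f w w w - f V V V) \<le> 4000 * N ^ 16 * x ^ 4"
    if "\<And>u u' v w. f (u + u') v w = f u v w + f u' v w" "\<And>u v v' w. f u (v + v') w = f u v w + f u v' w"
      "\<And>u v w w'. f u v (w + w') = f u v w + f u v w'" "\<And>u v w. cmod (f u v w) \<le> N * norm u * norm v * norm w" for f
  proof -
    have "cmod (f w w w - f V V V) \<le> 3 * (N * (10 * N ^ 5) * (11 * N ^ 5)\<^sup>2) * x ^ 4"
      unfolding wa by (rule trilinear_diff_bound[OF that]) (use N0 nV nw[unfolded wa] na x in auto)
    also have "\<dots> = 3630 * N ^ 16 * x ^ 4" by (simp add: power_numeral_reduce mult_ac)
    also have "\<dots> \<le> 4000 * N ^ 16 * x ^ 4" using N0 x by (intro mult_right_mono) auto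
    finally show ?thesis .
  qed
  have d\<tau>: "cmod (\<tau> w w w - \<tau> V V V) \<le> 4000 * N ^ 16 * x ^ 4"
    by (rule d[OF _ _ _ b4]) (use \<tau> in \<open>unfold clin_def, blast\<close>)+
  have d\<mu>: "cmod (\<mu> w w w - \<mu> V V V) \<le> 4000 * N ^ 16 * x ^ 4"
  proof (rule d[OF _ _ _ b5])
    show "\<mu> u v (y + y') = \<mu> u v y + \<mu> u v y'" for u v y y'
    proof -
      have "cnj (\<mu> u v (y + y')) = cnj (\<mu> u v y) + cnj (\<mu> u v y')" using \<mu>(3) unfolding clin_def by blast
      then show ?thesis by (metis complex_cnj_add complex_cnj_cancel_iff)
    qed
  qed (use \<mu>(1,2) in \<open>unfold clin_def, blast\<close>)+
  have P_eq: "pol w - ell V = \<beta> V A3 + \<beta> A3 V + \<beta> a a + (\<tau> w w w - \<tau> V V V)"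
  proof -
    have "ell A2 = - \<beta> V V" unfolding A2 ell_minus ell_smult \<nu> by (simp add: c2_def)
    moreover have "ell A3 = c3" by (simp add: A3_def ell_smult \<nu>)
    moreover have "c3 = - (\<tau> V V V + \<beta> V A2 + \<beta> A2 V)" by (simp add: c3_def corr3_def A2_def)
    moreover have "ell w = ell V + ell A2 + ell A3" by (simp add: wa a_def ell_add)
    moreover have "\<beta> w w = \<beta> V V + (\<beta> V A2 + \<beta> V A3) + (\<beta> A2 V + \<beta> A3 V) + \<beta> a a"
      by (simp add: wa \<beta>_add) (simp add: a_def \<beta>_add)
    ultimately show ?thesis unfolding pol_def by simp
  qed
  have e1: "cmod (pol w - ell V) \<le> 5000 * N ^ 16 * x ^ 4"
  proof -
    have "cmod (\<beta> V A3) \<le> N * x * (7 * N ^ 5 * x ^ 3)"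
      by (rule order_trans[OF b2]) (use nA3 N0 x in \<open>unfold x_def[symmetric], intro mult_left_mono mult_nonneg_nonneg\<close>)
    moreover have "cmod (\<beta> A3 V) \<le> N * (7 * N ^ 5 * x ^ 3) * x"
      by (rule order_trans[OF b2]) (use nA3 N0 x in \<open>unfold x_def[symmetric], intro mult_right_mono mult_left_mono\<close>)
    moreover have "cmod (\<beta> a a) \<le> N * (10 * N ^ 5 * x\<^sup>2) * (10 * N ^ 5 * x\<^sup>2)"
      by (rule order_trans[OF b2]) (use na N0 x in \<open>intro mult_mono; simp\<close>)
    ultimately have "cmod (pol w - ell V) \<le> N * x * (7 * N ^ 5 * x ^ 3) + N * (7 * N ^ 5 * x ^ 3) * x
       + N * (10 * N ^ 5 * x\<^sup>2) * (10 * N ^ 5 * x\<^sup>2) + 4000 * N ^ 16 * x ^ 4"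
      unfolding P_eq by (intro norm_triangle_mono d\<tau>)
    also have "\<dots> = (14 * N ^ 6 + 100 * N ^ 11 + 4000 * N ^ 16) * x ^ 4" by (simp add: power_numeral_reduce algebra_simps)
    also have "\<dots> \<le> 5000 * N ^ 16 * x ^ 4" 
    proof (rule mult_right_mono)
      show "14 * N ^ 6 + 100 * N ^ 11 + 4000 * N ^ 16 \<le> 5000 * N ^ 16"
        using pw[of 6 16] pw[of 11 16] zero_le_power[OF N0, of 16] by linarith
    qed (use x in simp)
    finally show ?thesis .
  qed
  have ga: "\<gamma> w w = \<gamma> V V + \<gamma> a V + cnj (\<gamma> a V) + \<gamma> a a"
    unfolding wa \<gamma>_add_left \<gamma>_add_right \<gamma>_cnj[of a V] by simp
  \<comment> \<open>Adding \<open>q\<close> to \<open>a\<close> leaves only multiples of \<nu>,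
    whose product with V is governed by ell V.\<close>
  have gaV: "\<gamma> a V + \<mu> V V V = c2 * (cnj (ell V) / \<kappa>) + c3 * (cnj (ell V) / \<kappa>)"
  proof -
    have "a + q = c2 *s \<nu> + c3 *s \<nu>" by (simp add: a_def A2 A3_def)
    then have "\<gamma> (a + q) V = c2 * \<gamma> \<nu> V + c3 * \<gamma> \<nu> V" by (simp add: \<gamma>_add_left \<gamma>_smult_left)
    then show ?thesis by (simp add: \<gamma>_add_left \<nu>(2) q_def riesz_\<mu>)
  qed
  have nl: "cmod (cnj (ell V) / \<kappa>) \<le> N * cmod (ell V)"
    using \<nu>(4) \<kappa> mult_right_mono[of "1 / \<kappa>" N "cmod (ell V)"] by (simp add: norm_divide N_def)
  have e2: "cmod (\<gamma> a V + \<mu> V V V) \<le> 2 * N ^ 3 * (x\<^sup>2 * cmod (ell V)) + 7 * N ^ 6 * x ^ 4"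
  proof -
    have "cmod (c2 * (cnj (ell V) / \<kappa>)) \<le> (2 * N ^ 2 * x\<^sup>2) * (N * cmod (ell V))"
      unfolding norm_mult[of c2] using nc2 nl N0 by (intro mult_mono) auto
    moreover have "cmod (c3 * (cnj (ell V) / \<kappa>)) \<le> (7 * N ^ 4 * x ^ 3) * (N * (N * x))"
      unfolding norm_mult[of c3] using nc3 order_trans[OF nl mult_left_mono[OF b1 N0]] N0 x by (intro mult_mono) (auto simp: x_def)
    ultimately have "cmod (\<gamma> a V + \<mu> V V V) \<le> (2 * N ^ 2 * x\<^sup>2) * (N * cmod (ell V)) + (7 * N ^ 4 * x ^ 3) * (N * (N * x))"
      unfolding gaV by (intro norm_triangle_mono)
    also have "\<dots> = 2 * N ^ 3 * (x\<^sup>2 * cmod (ell V)) + 7 * N ^ 6 * x ^ 4" by (simp add: power_numeral_reduce mult_ac)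
    finally show ?thesis .
  qed
  have e3: "cmod (\<gamma> a a) \<le> 100 * N ^ 11 * x ^ 4"
  proof -
    have "cmod (\<gamma> a a) \<le> N * (10 * N ^ 5 * x\<^sup>2) * (10 * N ^ 5 * x\<^sup>2)"
      by (rule order_trans[OF b3]) (use na N0 x in \<open>intro mult_mono; simp\<close>)
    then show ?thesis by (simp add: power_numeral_reduce mult_ac)
  qed
  have eq: "2 * Re (pol w) + Re (\<gamma> w w) + 2 * Re (\<mu> w w w) - (2 * Re (ell V) + Re (\<gamma> V V))
     = 2 * Re (pol w - ell V) + 2 * Re (\<gamma> a V + \<mu> V V V) + Re (\<gamma> a a) + 2 * Re (\<mu> w w w - \<mu> V V V)"
    unfolding ga by simp
  have g: "\<bar>2 * a + 2 * b + c + 2 * d\<bar> \<le> 2 * A + 2 * B + C + 2 * D"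
    if "\<bar>a\<bar> \<le> A" "\<bar>b\<bar> \<le> B" "\<bar>c\<bar> \<le> C" "\<bar>d\<bar> \<le> D" for a b c d A B C D :: real
    using that unfolding abs_le_iff by linarith
  have rr: "\<bar>Re y\<bar> \<le> t" if "cmod y \<le> t" for y t using that abs_Re_le_cmod[of y] by linarith
  have "\<bar>2 * Re (pol w) + Re (\<gamma> w w) + 2 * Re (\<mu> w w w) - (2 * Re (ell V) + Re (\<gamma> V V))\<bar>
     \<le> 2 * (5000 * N ^ 16 * x ^ 4) + 2 * (2 * N ^ 3 * (x\<^sup>2 * cmod (ell V)) + 7 * N ^ 6 * x ^ 4) + 100 * N ^ 11 * x ^ 4 + 2 * (4000 * N ^ 16 * x ^ 4)"
    unfolding eq by (rule g[OF rr[OF e1] rr[OF e2] rr[OF e3] rr[OF d\<mu>]])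
  also have "\<dots> = (18000 * N ^ 16 + 14 * N ^ 6 + 100 * N ^ 11) * x ^ 4 + 4 * N ^ 3 * (x\<^sup>2 * cmod (ell V))"
    by (simp add: algebra_simps)
  also have "\<dots> \<le> (40000 * N ^ 16) * x ^ 4 + (40000 * N ^ 16) * (x\<^sup>2 * cmod (ell V))"
  proof -
    have "18000 * N ^ 16 + 14 * N ^ 6 + 100 * N ^ 11 \<le> 40000 * N ^ 16" "4 * N ^ 3 \<le> 40000 * N ^ 16"
      using pw[of 6 16] pw[of 11 16] pw[of 3 16] zero_le_power[OF N0, of 16] by linarith+
    then show ?thesis using x by (intro add_mono mult_right_mono) auto
  qed
  finally show "\<bar>2 * Re (pol (unshear \<nu> V)) + Re (\<gamma> (unshear \<nu> V) (unshear \<nu> V)) + 2 * Re (\<mu> (unshear \<nu> V) (unshear \<nu> V) (unshear \<nu> V))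
        - (2 * Re (ell V) + Re (\<gamma> V V))\<bar> \<le> 40000 * bigN ^ 16 * (norm V ^ 4 + (norm V)\<^sup>2 * cmod (ell V))"
    unfolding w_def N_def x_def by (simp add: algebra_simps)
qed

lemma riesz_holomorphic: "holo_vec \<phi> S \<Longrightarrow> holo_vec (\<lambda>\<zeta>. riesz_\<mu> (\<phi> \<zeta>) (\<phi> \<zeta>)) S"
  unfolding holo_vec_def[of "\<lambda>\<zeta>. riesz_\<mu> (\<phi> \<zeta>) (\<phi> \<zeta>)"] by (intro allI clin2_holomorphic[OF riesz_\<mu>_clin])

lemma corr2_holomorphic: "holo_vec \<phi> S \<Longrightarrow> holo_vec (\<lambda>\<zeta>. corr2 \<nu> (\<phi> \<zeta>)) S"
proof -
  assume h: "holo_vec \<phi> S"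
  have 1: "(\<lambda>\<zeta>. ell (riesz_\<mu> (\<phi> \<zeta>) (\<phi> \<zeta>)) - \<beta> (\<phi> \<zeta>) (\<phi> \<zeta>)) holomorphic_on S"
    by (intro holomorphic_on_diff clin_holomorphic[OF ell riesz_holomorphic[OF h]] clin2_holomorphic[OF \<beta> h h])
  show ?thesis unfolding holo_vec_def corr2_def vector_minus_component vector_smult_component
    using riesz_holomorphic[OF h] holomorphic_on_mult[OF 1 holomorphic_on_const]
    unfolding holo_vec_def by (intro allI holomorphic_on_diff) blast+
qed

lemma unshear_holomorphic: "holo_vec \<phi> S \<Longrightarrow> holo_vec (\<lambda>\<zeta>. unshear \<nu> (\<phi> \<zeta>)) S"
proof -
  assume h: "holo_vec \<phi> S"
  note c2 = corr2_holomorphic[OF h, of \<nu>]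
  have "(\<lambda>\<zeta>. corr3 \<nu> (\<phi> \<zeta>)) holomorphic_on S" unfolding corr3_def
    by (intro holomorphic_on_minus holomorphic_on_add clin3_holomorphic[OF \<tau> h h h] clin2_holomorphic[OF \<beta> h c2] clin2_holomorphic[OF \<beta> c2 h])
  then show ?thesis using h c2 unfolding holo_vec_def unshear_def
    by (auto intro!: holomorphic_on_add holomorphic_on_mult holomorphic_on_const)
qed

lemma unshear_deriv:
  assumes v: "vec_deriv \<phi> \<phi>' x" and z: "\<phi> x = 0"
  shows "vec_deriv (\<lambda>\<zeta>. unshear \<nu> (\<phi> \<zeta>)) \<phi>' x" "unshear \<nu> (\<phi> x) = 0"
proof -
  note zs = clin_0[OF \<beta>(1)] clin_0[OF \<beta>(2)] clin_0[OF ell]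
  have r0: "riesz_\<mu> 0 0 = 0" using clin_0[OF riesz_\<mu>_clin(1)] by (simp add: vec_eq_iff)
  have r: "vec_deriv (\<lambda>\<zeta>. riesz_\<mu> (\<phi> \<zeta>) (\<phi> \<zeta>)) 0 x" unfolding vec_deriv_def
  proof
    fix k show "((\<lambda>\<zeta>. riesz_\<mu> (\<phi> \<zeta>) (\<phi> \<zeta>) $ k) has_field_derivative 0 $ k) (at x)"
      using clin2_deriv[OF riesz_\<mu>_clin v v, of k] by (simp add: z clin_0[OF riesz_\<mu>_clin(1)] clin_0[OF riesz_\<mu>_clin(2)])
  qed
  have c20: "corr2 \<nu> 0 = 0" by (simp add: corr2_def r0 zs)
  have e: "((\<lambda>\<zeta>. ell (riesz_\<mu> (\<phi> \<zeta>) (\<phi> \<zeta>)) - \<beta> (\<phi> \<zeta>) (\<phi> \<zeta>)) has_field_derivative 0) (at x)"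
    using DERIV_diff[OF clin_deriv[OF ell r] clin2_deriv[OF \<beta> v v]] by (simp add: z zs)
  have c2: "vec_deriv (\<lambda>\<zeta>. corr2 \<nu> (\<phi> \<zeta>)) 0 x"
    unfolding vec_deriv_def
  proof
    fix k
    have "((\<lambda>\<zeta>. riesz_\<mu> (\<phi> \<zeta>) (\<phi> \<zeta>) $ k) has_field_derivative 0) (at x)" using r by (simp add: vec_deriv_def)
    from DERIV_diff[OF DERIV_cmult_right[OF e, of "\<nu> $ k"] this]
    show "((\<lambda>\<zeta>. corr2 \<nu> (\<phi> \<zeta>) $ k) has_field_derivative 0 $ k) (at x)"
      unfolding corr2_def vector_minus_component vector_smult_component zero_index by simp
  qed
  have c3: "((\<lambda>\<zeta>. corr3 \<nu> (\<phi> \<zeta>)) has_field_derivative 0) (at x)"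
    using DERIV_minus[OF DERIV_add[OF DERIV_add[OF clin3_deriv_zero[OF \<tau> v z] clin2_deriv[OF \<beta> v c2]] clin2_deriv[OF \<beta> c2 v]]]
    unfolding corr3_def by (simp add: z zs c20)
  show "vec_deriv (\<lambda>\<zeta>. unshear \<nu> (\<phi> \<zeta>)) \<phi>' x"
    unfolding vec_deriv_def
  proof
    fix k
    have "((\<lambda>\<zeta>. \<phi> \<zeta> $ k) has_field_derivative \<phi>' $ k) (at x)" "((\<lambda>\<zeta>. corr2 \<nu> (\<phi> \<zeta>) $ k) has_field_derivative 0) (at x)"
      using v c2 by (simp_all add: vec_deriv_def)
    from DERIV_add[OF this(1) DERIV_add[OF this(2) DERIV_cmult_right[OF c3, of "\<nu> $ k"]]]
    show "((\<lambda>\<zeta>. unshear \<nu> (\<phi> \<zeta>) $ k) has_field_derivative \<phi>' $ k) (at x)" by (simp add: unshear_def)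
  qed
  show "unshear \<nu> (\<phi> x) = 0" by (simp add: unshear_def z c20 corr3_def zs clin_0[OF \<tau>(3)])
qed

end

section \<open>Discs for the upper bound\<close>

context levi_chart
begin

text \<open>Shrinking the model disc by \<eta> = C0 d^\<theta> buys the slack d \<eta> / |1 +
  \<alpha> \<zeta>|^2. All errors are bounded by multiples of d^(1 + \<theta>) / |1 + \<alpha>
  \<zeta>|^2 that do not depend on C0, so a large C0 wins.\<close>

lemma kobayashi_disc_upper:
  "\<exists>v>0. \<exists>C3>0. v \<le> R \<and> (\<forall>z\<in>\<Omega>. \<forall>X. dist z p < v \<longrightarrow> X \<noteq> 0 \<longrightarrow>
     (\<exists>\<phi> \<alpha>. holo_vec \<phi> (ball 0 1) \<and> \<phi> ` ball 0 1 \<subseteq> \<Omega> \<and> \<phi> 0 = z \<and>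
       (\<forall>i. \<alpha> * deriv (\<lambda>\<zeta>. \<phi> \<zeta> $ i) 0 = X $ i) \<and>
       cmod \<alpha> \<le> (1 + C3 * (- r z) powr ((\<sigma> - 1) / 2)) * sqrt (metric_form z X)))"
proof -
  define \<theta> where "\<theta> = (\<sigma> - 1) / 2"
  have \<theta>: "0 < \<theta>" "\<theta> \<le> 1" and \<sigma>\<theta>: "\<sigma> + 1 = 2 * (1 + \<theta>)" using \<sigma> by (auto simp: \<theta>_def field_simps)
  obtain K where K: "\<forall>z\<in>ball p R. \<exists>\<beta> \<gamma> \<tau> \<mu>. levi_poly (\<lambda>X. hprod X (m z) / 2) \<beta> \<gamma> \<tau> \<mu> K c \<and>
     (\<forall>X. Re (\<gamma> X X) = (m1 z X \<bullet> X + m1 z (J X) \<bullet> J X) / 4) \<and>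
     (\<forall>w. z + w \<in> ball p R \<longrightarrow> \<bar>r (z + w) - (r z + 2 * Re (hprod w (m z) / 2 + \<beta> w w + \<tau> w w w) + Re (\<gamma> w w)
        + 2 * Re (\<mu> w w w))\<bar> \<le> K * norm w powr (\<sigma> + 1))" using levi_poly_exists by (elim exE)
  have K1: "1 \<le> K" using bspec[OF K, of p] R levi_poly.K by fastforce
  define N where "N = K + K / c + K * K / c + K * K * K * K / (c * c) * K"
  have "0 \<le> K / c" "0 \<le> K * K / c" "0 \<le> K * K * K * K / (c * c) * K" using K1 c by simp_all
  then have N1: "1 \<le> N" using K1 unfolding N_def by linarith
  define M where "M = 40000 * N ^ 16"
  have M1: "1 \<le> M" using one_le_power[OF N1, of 16] by (simp add: M_def)
  have M11: "11 * N ^ 5 \<le> M" using power_increasing[of 5 16 N] N1 one_le_power[OF N1, of 16] unfolding M_def by linarith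
  define M' where "M' = M + K * M ^ 4"
  have "0 \<le> K * M ^ 4" using M1 K1 by simp
  then have M': "1 \<le> M'" using M1 unfolding M'_def by linarith
  define b where "b = 2 / c"
  have b: "0 < b" using c by (simp add: b_def)
  define v3 where "v3 = min 1 (R / (4 * M))"
  have v3: "0 < v3" "v3 \<le> 1" "M * v3 \<le> R / 4"
  proof -
    have "v3 \<le> R / (4 * M)" by (simp add: v3_def)
    then have "M * v3 \<le> M * (R / (4 * M))" using M1 by (intro mult_left_mono) auto
    then show "M * v3 \<le> R / 4" using M1 by simp
  qed (use R M1 in \<open>auto simp: v3_def\<close>)
  \<comment> \<open>The first summand beats the errors with a factor 4 to spare; the second gives 2
    b / C0 <= v3^2, which keeps the discs in the range of \<open>unshear_estimates\<close> and of
    the chart.\<close>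
  define C0 where "C0 = 4 * M' * (2 * (b + 1)\<^sup>2 + b) + 2 * b / v3\<^sup>2"
  have C0: "0 < C0" using M' b v3 by (simp add: C0_def add_pos_pos add_pos_nonneg)
  have C0a: "2 * b / C0 \<le> v3\<^sup>2" and C0b: "4 * M' * (2 * (b + 1)\<^sup>2 + b) \<le> C0"
  proof -
    have p1: "0 \<le> 4 * M' * (2 * (b + 1)\<^sup>2 + b)" using M' b by simp
    then have "2 * b / v3\<^sup>2 \<le> C0" by (simp add: C0_def)
    then show "2 * b / C0 \<le> v3\<^sup>2" using v3(1) C0 by (simp add: field_simps)
    show "4 * M' * (2 * (b + 1)\<^sup>2 + b) \<le> C0" using b v3 by (simp add: C0_def)
  qed
  have "isCont r p" using r_der[of p] R has_derivative_continuous by force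
  \<comment> \<open>The second bound on d makes \<eta> = C0 d^\<theta> at most 1/2.\<close>
  moreover have e0: "0 < min 1 ((1 / (2 * C0)) powr (1 / \<theta>))" using C0 by simp
  ultimately obtain v2 where v2: "0 < v2" "\<And>x. dist x p < v2 \<Longrightarrow> dist (r x) (r p) < min 1 ((1 / (2 * C0)) powr (1 / \<theta>))"
    unfolding continuous_at_eps_delta by blast
  define v where "v = min v2 (R / 4)"
  have v: "0 < v" "v \<le> v2" "v \<le> R / 4" using v2 R by (auto simp: v_def)
  have main: "\<exists>\<phi> \<alpha>. holo_vec \<phi> (ball 0 1) \<and> \<phi> ` ball 0 1 \<subseteq> \<Omega> \<and> \<phi> 0 = z \<and>
       (\<forall>i. \<alpha> * deriv (\<lambda>\<zeta>. \<phi> \<zeta> $ i) 0 = X $ i) \<and>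
       cmod \<alpha> \<le> (1 + C0 * (- r z) powr \<theta>) * sqrt (metric_form z X)"
    if z\<Omega>: "z \<in> \<Omega>" and zv: "dist z p < v" and X: "X \<noteq> 0" for z X
  proof -
    have zB: "z \<in> ball p R" using zv v R by (simp add: dist_commute)
    define d where "d = - r z"
    have d: "0 < d" using r_neg[of z] z\<Omega> zB by (simp add: d_def)
    have dr: "d = \<bar>r z\<bar>" using d by (simp add: d_def)
    have rs: "\<bar>r z\<bar> < 1" "\<bar>r z\<bar> < (1 / (2 * C0)) powr (1 / \<theta>)" using v2(2)[of z] zv v by (auto simp: r_p dist_real_def)
    have d1: "d < 1" using rs dr by simp
    define \<eta> where "\<eta> = C0 * d powr \<theta>"
    have \<eta>0: "0 < \<eta>" using C0 d by (simp add: \<eta>_def)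
    have "d powr \<theta> \<le> ((1 / (2 * C0)) powr (1 / \<theta>)) powr \<theta>" using rs dr d \<theta> by (intro powr_mono2) auto
    also have "\<dots> = 1 / (2 * C0)" using \<theta> C0 by (simp add: powr_powr)
    finally have \<eta>1: "\<eta> \<le> 1 / 2" using C0 by (simp add: \<eta>_def field_simps)
    have d\<theta>: "d \<le> d powr \<theta>" using powr_mono'[of \<theta> 1 d] \<theta> d d1 by simp
    obtain \<beta> \<gamma> \<tau> \<mu> where lp: "levi_poly (\<lambda>X. hprod X (m z) / 2) \<beta> \<gamma> \<tau> \<mu> K c"
      and lv: "\<forall>X. Re (\<gamma> X X) = (m1 z X \<bullet> X + m1 z (J X) \<bullet> J X) / 4"
      and ex: "\<forall>w. z + w \<in> ball p R \<longrightarrow> \<bar>r (z + w) - (r z + 2 * Re (hprod w (m z) / 2 + \<beta> w w + \<tau> w w w) + Re (\<gamma> w w)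
        + 2 * Re (\<mu> w w w))\<bar> \<le> K * norm w powr (\<sigma> + 1)" using bspec[OF K zB] by (elim exE conjE)
    define l where "l X = hprod X (m z) / 2" for X
    have l_eq: "(\<lambda>X. hprod X (m z) / 2) = l" by (simp add: l_def fun_eq_iff)
    interpret lp: levi_poly l \<beta> \<gamma> \<tau> \<mu> K c using lp unfolding l_eq .
    have N_eq: "lp.bigN = N" by (simp add: lp.bigN_def N_def)
    obtain \<nu> \<kappa> where \<nu>: "0 < \<kappa>" "l \<nu> = 1" "\<And>u. \<gamma> \<nu> u = cnj (l u) / complex_of_real \<kappa>" "norm \<nu> \<le> lp.bigN" "1 / \<kappa> \<le> lp.bigN"
      using lp.normal_vector lp.bigN(4,5) order_trans by metis
    define Q2 where "Q2 = (cmod (l X))\<^sup>2 / d\<^sup>2 + Re (\<gamma> X X) / d"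
    have mf: "metric_form z X = Q2" unfolding metric_form_def Q2_def l_def d_def spec[OF lv, of X] by simp
    have \<gamma>X: "0 < Re (\<gamma> X X)"
    proof -
      have "0 < c * (norm X)\<^sup>2" using c X by simp
      then show ?thesis using lp.\<gamma>_pos[of X] by linarith
    qed
    have Q2: "0 < Q2" unfolding Q2_def using \<gamma>X d by (intro add_nonneg_pos) auto
    \<comment> \<open>Scaled so that the initial velocity \<open>s X\<close> has squared model norm
      1 - \<eta>.\<close>
    define s where "s = sqrt ((1 - \<eta>) / Q2)"
    have s2: "s\<^sup>2 = (1 - \<eta>) / Q2" using Q2 \<eta>1 by (simp add: s_def)
    have s: "0 < s" using Q2 \<eta>1 by (simp add: s_def)
    define \<alpha> where "\<alpha> = of_real s * l X / of_real d"
    have \<alpha>2: "(cmod \<alpha>)\<^sup>2 + s\<^sup>2 * Re (\<gamma> X X) / d = 1 - \<eta>"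
    proof -
      have "(cmod \<alpha>)\<^sup>2 = s\<^sup>2 * ((cmod (l X))\<^sup>2 / d\<^sup>2)"
        using s d by (simp add: \<alpha>_def norm_mult norm_divide power_mult_distrib power_divide)
      then have "(cmod \<alpha>)\<^sup>2 + s\<^sup>2 * Re (\<gamma> X X) / d = s\<^sup>2 * Q2" by (simp add: Q2_def distrib_left)
      then show ?thesis using s2 Q2 by simp
    qed
    define t where "t = s\<^sup>2 * Re (\<gamma> X X) / d"
    have t0: "0 \<le> t" using \<gamma>X d by (simp add: t_def)
    have \<alpha>t: "(cmod \<alpha>)\<^sup>2 + t = 1 - \<eta>" using \<alpha>2 by (simp add: t_def)
    have \<alpha>1: "cmod \<alpha> \<le> 1 - \<eta> / 2"
    proof (rule power2_le_imp_le)
      have "(cmod \<alpha>)\<^sup>2 \<le> 1 - \<eta>" using \<alpha>t t0 by linarith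
      also have "\<dots> \<le> (1 - \<eta> / 2)\<^sup>2" by (simp add: power2_eq_square algebra_simps)
      finally show "(cmod \<alpha>)\<^sup>2 \<le> (1 - \<eta> / 2)\<^sup>2" .
    qed (use \<eta>1 in simp)
    define y where "y \<zeta> = cmod (1 + \<alpha> * \<zeta>)" for \<zeta>
    have y: "1 - cmod \<alpha> \<le> y \<zeta>" "y \<zeta> \<le> 2" "\<eta> / 2 \<le> y \<zeta>" "0 < y \<zeta>" if \<zeta>: "norm \<zeta> < 1" for \<zeta>
    proof -
      have "cmod (\<alpha> * \<zeta>) \<le> cmod \<alpha> * 1" unfolding norm_mult using \<zeta> by (intro mult_left_mono) auto
      moreover have "1 - cmod (\<alpha> * \<zeta>) \<le> y \<zeta>" unfolding y_def using norm_triangle_ineq2[of 1 "- (\<alpha> * \<zeta>)"] by simp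
      moreover have "y \<zeta> \<le> 1 + cmod (\<alpha> * \<zeta>)" unfolding y_def using norm_triangle_ineq[of 1 "\<alpha> * \<zeta>"] by simp
      ultimately show "1 - cmod \<alpha> \<le> y \<zeta>" "y \<zeta> \<le> 2" "\<eta> / 2 \<le> y \<zeta>" "0 < y \<zeta>" using \<alpha>1 \<eta>0 by linarith+
    qed
    have ynz: "1 + \<alpha> * \<zeta> \<noteq> 0" if "norm \<zeta> < 1" for \<zeta> using y(4)[OF that] by (auto simp: y_def)
    define k where "k \<zeta> = of_real s * \<zeta> / (1 + \<alpha> * \<zeta>)" for \<zeta>
    define V where "V \<zeta> = k \<zeta> *s X" for \<zeta>
    have ck: "cmod (k \<zeta>) = s * cmod \<zeta> / y \<zeta>" for \<zeta> using s by (simp add: k_def norm_mult norm_divide y_def)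
    have Vhol: "holo_vec V (ball 0 1)" unfolding holo_vec_def V_def k_def
      by (auto intro!: holomorphic_intros) (use ynz in auto)
    have Vder: "vec_deriv V (of_real s *s X) 0" unfolding vec_deriv_def
    proof
      fix i
      have "(k has_field_derivative ((of_real s * 1) * (1 + \<alpha> * 0) - (of_real s * 0) * (\<alpha> * 1)) / ((1 + \<alpha> * 0) * (1 + \<alpha> * 0))) (at 0)"
        unfolding k_def by (rule DERIV_divide) (auto intro!: derivative_eq_intros)
      from DERIV_cmult_right[OF this, of "X $ i"]
      show "((\<lambda>\<zeta>. V \<zeta> $ i) has_field_derivative (of_real s *s X) $ i) (at 0)" by (simp add: V_def)
    qed
    have V0: "V 0 = 0" by (simp add: V_def k_def vec_eq_iff)
    have lV: "l (V \<zeta>) = of_real d * (\<alpha> * \<zeta>) / (1 + \<alpha> * \<zeta>)" for \<zeta>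
      using d by (simp add: V_def lp.ell_smult k_def \<alpha>_def)
    have \<gamma>V: "Re (\<gamma> (V \<zeta>) (V \<zeta>)) = d * t * (cmod \<zeta>)\<^sup>2 / (y \<zeta>)\<^sup>2" for \<zeta>
    proof -
      define k2 where "k2 = (cmod (k \<zeta>))\<^sup>2"
      have kk: "k \<zeta> * cnj (k \<zeta>) = of_real k2" unfolding k2_def by (rule complex_norm_square[symmetric])
      have "\<gamma> (V \<zeta>) (V \<zeta>) = (k \<zeta> * cnj (k \<zeta>)) * \<gamma> X X"
        unfolding V_def by (simp only: lp.\<gamma>_smult_left lp.\<gamma>_smult_right mult_ac)
      then have "Re (\<gamma> (V \<zeta>) (V \<zeta>)) = k2 * Re (\<gamma> X X)" unfolding kk by simp
      then show ?thesis using d by (simp add: k2_def ck t_def power_mult_distrib power_divide)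
    qed
    have ReV: "d - 2 * Re (l (V \<zeta>)) = d * (1 - (cmod \<alpha>)\<^sup>2 * (cmod \<zeta>)\<^sup>2) / (y \<zeta>)\<^sup>2" if \<zeta>: "norm \<zeta> < 1" for \<zeta>
    proof -
      define e where "e = 1 + \<alpha> * \<zeta>"
      have e: "e \<noteq> 0" "y \<zeta> = cmod e" using ynz[OF \<zeta>] by (auto simp: e_def y_def)
      have "l (V \<zeta>) = of_real d * (e - 1) / e" unfolding lV by (simp add: e_def)
      also have "\<dots> = of_real d * ((e - 1) * cnj e) / (e * cnj e)" using e(1) by simp
      also have "e * cnj e = of_real ((cmod e)\<^sup>2)" by (rule complex_norm_square[symmetric])
      finally have "Re (l (V \<zeta>)) = d * Re ((e - 1) * cnj e) / (cmod e)\<^sup>2"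
        unfolding Re_divide_of_real by simp
      moreover have "(cmod e)\<^sup>2 \<noteq> 0" using e by simp
      ultimately have "d - 2 * Re (l (V \<zeta>)) = d * ((cmod e)\<^sup>2 - 2 * Re ((e - 1) * cnj e)) / (cmod e)\<^sup>2"
        by (simp add: field_simps)
      also have "(cmod e)\<^sup>2 - 2 * Re ((e - 1) * cnj e) = 1 - (cmod (e - 1))\<^sup>2"
        unfolding cmod_power2 by (simp add: power2_eq_square algebra_simps)
      also have "(cmod (e - 1))\<^sup>2 = (cmod \<alpha>)\<^sup>2 * (cmod \<zeta>)\<^sup>2" by (simp add: e_def norm_mult power_mult_distrib)
      finally show ?thesis by (simp add: e)
    qed
    have slack: "- d + (2 * Re (l (V \<zeta>)) + Re (\<gamma> (V \<zeta>) (V \<zeta>))) \<le> - (d * \<eta> / (y \<zeta>)\<^sup>2)" if \<zeta>: "norm \<zeta> < 1" for \<zeta>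
    proof -
      have z2: "(cmod \<zeta>)\<^sup>2 \<le> 1" using \<zeta> by (simp add: power_le_one)
      have "d - 2 * Re (l (V \<zeta>)) - Re (\<gamma> (V \<zeta>) (V \<zeta>)) = d * (1 - (cmod \<alpha>)\<^sup>2 * (cmod \<zeta>)\<^sup>2) / (y \<zeta>)\<^sup>2 - d * t * (cmod \<zeta>)\<^sup>2 / (y \<zeta>)\<^sup>2"
        unfolding ReV[OF \<zeta>] \<gamma>V ..
      also have "\<dots> = d * (1 - (cmod \<zeta>)\<^sup>2 * ((cmod \<alpha>)\<^sup>2 + t)) / (y \<zeta>)\<^sup>2"
        by (simp add: diff_divide_distrib[symmetric] algebra_simps)
      finally have 1: "d - 2 * Re (l (V \<zeta>)) - Re (\<gamma> (V \<zeta>) (V \<zeta>)) = d * (1 - (cmod \<zeta>)\<^sup>2 * (1 - \<eta>)) / (y \<zeta>)\<^sup>2" unfolding \<alpha>t .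
      have "(cmod \<zeta>)\<^sup>2 * (1 - \<eta>) \<le> 1 * (1 - \<eta>)" using z2 \<eta>1 by (intro mult_right_mono) auto
      then have "d * \<eta> / (y \<zeta>)\<^sup>2 \<le> d * (1 - (cmod \<zeta>)\<^sup>2 * (1 - \<eta>)) / (y \<zeta>)\<^sup>2" using d by (intro divide_right_mono mult_left_mono) auto
      then show ?thesis using 1 by linarith
    qed
    \<comment> \<open>Using only t <= 1 would leave the square of a possibly small |1 + \<alpha>
      \<zeta>| in the denominator; t <= 1 - |\<alpha>|^2 <= 2 |1 + \<alpha> \<zeta>| saves one
      power.\<close>
    have V2: "(norm (V \<zeta>))\<^sup>2 \<le> b * (d / y \<zeta>)" if \<zeta>: "norm \<zeta> < 1" for \<zeta>
    proof -
      have z2: "(cmod \<zeta>)\<^sup>2 \<le> 1" using \<zeta> by (simp add: power_le_one)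
      have "t \<le> 1 - (cmod \<alpha>)\<^sup>2" using \<alpha>t \<eta>0 by linarith
      also have "\<dots> = (1 - cmod \<alpha>) * (1 + cmod \<alpha>)" by (simp add: power2_eq_square algebra_simps)
      also have "\<dots> \<le> y \<zeta> * 2" using y[OF \<zeta>] \<alpha>1 \<eta>0 by (intro mult_mono) auto
      finally have t2: "t \<le> 2 * y \<zeta>" by simp
      have "c * (norm (V \<zeta>))\<^sup>2 \<le> d * t * (cmod \<zeta>)\<^sup>2 / (y \<zeta>)\<^sup>2" using lp.\<gamma>_pos[of "V \<zeta>"] unfolding \<gamma>V .
      also have "\<dots> \<le> d * t * 1 / (y \<zeta>)\<^sup>2" using d t0 z2 by (intro divide_right_mono mult_left_mono) auto
      also have "\<dots> \<le> d * (2 * y \<zeta>) / (y \<zeta>)\<^sup>2" using d t2 by (intro divide_right_mono) auto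
      also have "\<dots> = 2 * (d / y \<zeta>)" using y(4)[OF \<zeta>] by (simp add: power2_eq_square)
      finally have "c * (norm (V \<zeta>))\<^sup>2 \<le> 2 * (d / y \<zeta>)" .
      from divide_right_mono[OF this, of c] show ?thesis using c by (simp add: b_def mult_ac)
    qed
    have dy: "d / y \<zeta> \<le> 2 / C0" if \<zeta>: "norm \<zeta> < 1" for \<zeta>
    proof -
      have "d / y \<zeta> \<le> d / (\<eta> / 2)" using y[OF \<zeta>] \<eta>0 d by (intro divide_left_mono mult_pos_pos) auto
      also have "\<dots> = 2 * (d / d powr \<theta>) / C0" by (simp add: \<eta>_def mult_ac)
      also have "\<dots> \<le> 2 * 1 / C0" using d\<theta> d C0 by (intro divide_right_mono mult_left_mono) auto
      finally show ?thesis by simp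
    qed
    have Vs: "norm (V \<zeta>) \<le> v3" if \<zeta>: "norm \<zeta> < 1" for \<zeta>
    proof (rule power2_le_imp_le)
      have "(norm (V \<zeta>))\<^sup>2 \<le> b * (2 / C0)" using order_trans[OF V2[OF \<zeta>] mult_left_mono[OF dy[OF \<zeta>]]] b by simp
      then show "(norm (V \<zeta>))\<^sup>2 \<le> v3\<^sup>2" using C0a by (simp add: mult.commute)
    qed (use v3 in simp)
    define w where "w \<zeta> = lp.unshear \<nu> (V \<zeta>)" for \<zeta>
    have est: "norm (w \<zeta>) \<le> M * norm (V \<zeta>)"
      "\<bar>2 * Re (lp.pol (w \<zeta>)) + Re (\<gamma> (w \<zeta>) (w \<zeta>)) + 2 * Re (\<mu> (w \<zeta>) (w \<zeta>) (w \<zeta>)) - (2 * Re (l (V \<zeta>)) + Re (\<gamma> (V \<zeta>) (V \<zeta>)))\<bar>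
         \<le> M * (norm (V \<zeta>) ^ 4 + (norm (V \<zeta>))\<^sup>2 * cmod (l (V \<zeta>)))" if \<zeta>: "norm \<zeta> < 1" for \<zeta>
    proof -
      have V1: "norm (V \<zeta>) \<le> 1" using Vs[OF \<zeta>] v3 by simp
      have "norm (w \<zeta>) \<le> 11 * N ^ 5 * norm (V \<zeta>)" unfolding w_def using lp.unshear_estimates(1)[OF \<nu> V1] unfolding N_eq .
      also have "\<dots> \<le> M * norm (V \<zeta>)" using M11 by (intro mult_right_mono) auto
      finally show "norm (w \<zeta>) \<le> M * norm (V \<zeta>)" .
      show "\<bar>2 * Re (lp.pol (w \<zeta>)) + Re (\<gamma> (w \<zeta>) (w \<zeta>)) + 2 * Re (\<mu> (w \<zeta>) (w \<zeta>) (w \<zeta>)) - (2 * Re (l (V \<zeta>)) + Re (\<gamma> (V \<zeta>) (V \<zeta>)))\<bar>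
         \<le> M * (norm (V \<zeta>) ^ 4 + (norm (V \<zeta>))\<^sup>2 * cmod (l (V \<zeta>)))"
        unfolding w_def M_def using lp.unshear_estimates(2)[OF \<nu> V1] unfolding N_eq .
    qed
    have wB: "z + w \<zeta> \<in> ball p (R / 2)" if \<zeta>: "norm \<zeta> < 1" for \<zeta>
    proof -
      have "norm (w \<zeta>) \<le> M * v3" using order_trans[OF est(1)[OF \<zeta>] mult_left_mono[OF Vs[OF \<zeta>]]] M1 by simp
      then have "norm (w \<zeta>) \<le> R / 4" using v3 by simp
      moreover have "norm (z - p) < R / 4" using zv v by (simp add: dist_norm)
      ultimately have "norm ((z - p) + w \<zeta>) < R / 2" using norm_triangle_ineq[of "z - p" "w \<zeta>"] by linarith
      then show ?thesis by (simp add: dist_norm norm_minus_commute algebra_simps)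
    qed
    have neg: "r (z + w \<zeta>) < 0" if \<zeta>: "norm \<zeta> < 1" for \<zeta>
    proof -
      define n where "n = norm (V \<zeta>)"
      define Y where "Y = y \<zeta>"
      have Y: "0 < Y" "Y \<le> 2" using y[OF \<zeta>] by (auto simp: Y_def)
      have n1: "0 \<le> n" "n \<le> 1" using Vs[OF \<zeta>] v3 by (auto simp: n_def)
      have wBR: "z + w \<zeta> \<in> ball p R" using wB[OF \<zeta>] R by auto
      have e1: "r (z + w \<zeta>) \<le> - d + (2 * Re (lp.pol (w \<zeta>)) + Re (\<gamma> (w \<zeta>) (w \<zeta>)) + 2 * Re (\<mu> (w \<zeta>) (w \<zeta>) (w \<zeta>))) + K * norm (w \<zeta>) powr (\<sigma> + 1)"
        using mp[OF spec[OF ex, of "w \<zeta>"] wBR] unfolding lp.pol_def l_def d_def abs_le_iff by linarith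
      have "norm (w \<zeta>) powr (\<sigma> + 1) \<le> (M * n) powr (\<sigma> + 1)" unfolding n_def using est(1)[OF \<zeta>] \<sigma> by (intro powr_mono2) auto
      also have "\<dots> = M powr (\<sigma> + 1) * n powr (\<sigma> + 1)" using M1 n1 by (simp add: powr_mult)
      also have "\<dots> \<le> M powr 4 * n powr (\<sigma> + 1)" using M1 \<sigma> by (intro mult_right_mono powr_mono) auto
      finally have e2: "K * norm (w \<zeta>) powr (\<sigma> + 1) \<le> K * M ^ 4 * n powr (\<sigma> + 1)"
        using K1 M1 by (simp add: mult.assoc)
      have "n ^ 4 \<le> n powr (\<sigma> + 1)" using powr_mono'[of "\<sigma> + 1" 4 n] n1 \<sigma> by simp
      then have "M * n ^ 4 \<le> M * n powr (\<sigma> + 1)" using M1 by simp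
      moreover have "M * (n\<^sup>2 * cmod (l (V \<zeta>))) \<le> M' * (n\<^sup>2 * cmod (l (V \<zeta>)))"
        using K1 M1 by (intro mult_right_mono) (auto simp: M'_def)
      ultimately have e3: "r (z + w \<zeta>) \<le> - (d * \<eta> / Y\<^sup>2) + M' * n powr (\<sigma> + 1) + M' * (n\<^sup>2 * cmod (l (V \<zeta>)))"
        using e1 e2 est(2)[OF \<zeta>] slack[OF \<zeta>] unfolding M'_def n_def[symmetric] Y_def[symmetric] abs_le_iff distrib_left distrib_right by linarith
      define D where "D = d * d powr \<theta> / Y\<^sup>2"
      have D0: "0 < D" using d Y by (simp add: D_def)
      \<comment> \<open>As Y <= 2 and \<theta> <= 1, one has Y^2 <= 2 Y^(1 + \<theta>) and hence (d
        / Y)^(1 + \<theta>) <= 2 D.\<close>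
      have e4: "n powr (\<sigma> + 1) \<le> 2 * (b + 1)\<^sup>2 * D"
      proof -
        have "n powr (\<sigma> + 1) = (n powr 2) powr (1 + \<theta>)" unfolding \<sigma>\<theta> by (simp add: powr_powr)
        also have "n powr 2 = n\<^sup>2" using n1 by (cases "n = 0") auto
        also have "(n\<^sup>2) powr (1 + \<theta>) \<le> (b * (d / Y)) powr (1 + \<theta>)"
          using V2[OF \<zeta>] \<theta> by (intro powr_mono2) (auto simp: n_def Y_def)
        also have "\<dots> = b powr (1 + \<theta>) * (d / Y) powr (1 + \<theta>)" by (rule powr_mult)
        also have "\<dots> \<le> (b + 1)\<^sup>2 * (2 * D)"
        proof (rule mult_mono)
          have "b powr (1 + \<theta>) \<le> (b + 1) powr (1 + \<theta>)" using b \<theta> by (intro powr_mono2) auto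
          also have "\<dots> \<le> (b + 1) powr 2" using b \<theta> by (intro powr_mono) auto
          finally show "b powr (1 + \<theta>) \<le> (b + 1)\<^sup>2" using b by simp
          have "Y\<^sup>2 = Y powr (1 + \<theta>) * Y powr (1 - \<theta>)" using Y by (simp add: powr_add[symmetric])
          also have "\<dots> \<le> Y powr (1 + \<theta>) * 2"
          proof (rule mult_left_mono)
            have "Y powr (1 - \<theta>) \<le> 2 powr (1 - \<theta>)" using Y \<theta> by (intro powr_mono2) auto
            also have "\<dots> \<le> 2 powr 1" using \<theta> by (intro powr_mono) auto
            finally show "Y powr (1 - \<theta>) \<le> 2" by simp
          qed simp
          finally have Y2: "Y\<^sup>2 \<le> Y powr (1 + \<theta>) * 2" .
          have "(d / Y) powr (1 + \<theta>) = d powr (1 + \<theta>) / Y powr (1 + \<theta>)" using d Y by (simp add: powr_divide)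
          also have "\<dots> = d * d powr \<theta> / Y powr (1 + \<theta>)" using d by (simp add: powr_add)
          also have "\<dots> \<le> d * d powr \<theta> / (Y\<^sup>2 / 2)" using Y2 d Y by (intro divide_left_mono mult_pos_pos) auto
          finally show "(d / Y) powr (1 + \<theta>) \<le> 2 * D" by (simp add: D_def mult_ac)
        qed (use b in auto)
        finally show ?thesis by (simp add: mult_ac)
      qed
      have e5: "n\<^sup>2 * cmod (l (V \<zeta>)) \<le> b * D"
      proof -
        have "cmod (l (V \<zeta>)) = d * cmod (\<alpha> * \<zeta>) / Y" unfolding lV Y_def y_def using d by (simp add: norm_mult norm_divide)
        also have "\<dots> \<le> d * 1 / Y" using \<alpha>1 \<eta>0 \<zeta> d Y mult_mono[of "cmod \<alpha>" 1 "cmod \<zeta>" 1]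
          by (intro divide_right_mono mult_left_mono) (auto simp: norm_mult)
        finally have l1: "cmod (l (V \<zeta>)) \<le> d / Y" by simp
        have "n\<^sup>2 * cmod (l (V \<zeta>)) \<le> b * (d / Y) * (d / Y)"
          using V2[OF \<zeta>] l1 b d Y by (intro mult_mono) (auto simp: n_def Y_def)
        also have "\<dots> = b * (d * d / Y\<^sup>2)" by (simp add: power2_eq_square)
        also have "\<dots> \<le> b * D" unfolding D_def using b d d\<theta> by (intro mult_left_mono divide_right_mono) auto
        finally show ?thesis .
      qed
      have "M' * n powr (\<sigma> + 1) + M' * (n\<^sup>2 * cmod (l (V \<zeta>))) \<le> M' * (2 * (b + 1)\<^sup>2 * D) + M' * (b * D)"
        using e4 e5 M' by (intro add_mono mult_left_mono) auto
      also have "\<dots> = (M' * (2 * (b + 1)\<^sup>2 + b)) * D" by (simp add: algebra_simps)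
      also have "\<dots> \<le> (C0 / 4) * D" using C0b D0 by (intro mult_right_mono) auto
      finally have e6: "M' * n powr (\<sigma> + 1) + M' * (n\<^sup>2 * cmod (l (V \<zeta>))) \<le> (C0 / 4) * D" .
      have "d * \<eta> / Y\<^sup>2 = C0 * D" by (simp add: \<eta>_def D_def)
      moreover have "0 < C0 * D" using C0 D0 by simp
      moreover have "(C0 / 4) * D = C0 * D / 4" by simp
      moreover have lin: "R' < 0" if "R' \<le> - A + B1 + B2" "B1 + B2 \<le> E" "A = G" "0 < G" "E = G / 4" for R' A B1 B2 E G :: real
        using that by linarith
      ultimately show ?thesis using lin[OF e3 e6] by blast
    qed
    define \<phi> where "\<phi> \<zeta> = z + w \<zeta>" for \<zeta>
    have whol: "holo_vec w (ball 0 1)" unfolding w_def by (rule lp.unshear_holomorphic[OF Vhol])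
    have \<phi>hol: "holo_vec \<phi> (ball 0 1)" using whol unfolding holo_vec_def \<phi>_def by (auto intro!: holomorphic_on_add)
    have wder: "vec_deriv w (of_real s *s X) 0" and w0: "w 0 = 0"
      unfolding w_def using lp.unshear_deriv[OF Vder V0] by auto
    have \<phi>0: "\<phi> 0 = z" by (simp add: \<phi>_def w0)
    have c\<phi>: "continuous_on (ball 0 1) \<phi>" by (rule holo_vec_continuous[OF \<phi>hol])
    \<comment> \<open>r < 0 along the disc only shows that it avoids the frontier; connectedness of
      the unit disc and \<phi> 0 = z then keep it in \<Omega>.\<close>
    have in\<Omega>: "\<phi> ` ball 0 1 \<subseteq> \<Omega>"
    proof -
      define T where "T = ball 0 1 \<inter> \<phi> -` \<Omega>"
      have "openin (top_of_set (ball 0 1)) T" unfolding T_def by (rule continuous_openin_preimage_gen[OF c\<phi> open_\<Omega>])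
      moreover have "T = ball 0 1 \<inter> \<phi> -` closure \<Omega>"
      proof -
        have "\<phi> \<zeta> \<in> \<Omega>" if "norm \<zeta> < 1" "\<phi> \<zeta> \<in> closure \<Omega>" for \<zeta>
        proof (rule ccontr)
          assume "\<phi> \<zeta> \<notin> \<Omega>"
          then have "\<phi> \<zeta> \<in> frontier \<Omega>" using that open_\<Omega> by (simp add: frontier_def interior_open)
          moreover have "\<phi> \<zeta> \<in> ball p R" using wB[OF that(1)] R by (auto simp: \<phi>_def)
          ultimately have "r (\<phi> \<zeta>) = 0" using r_frontier by blast
          then show False using neg[OF that(1)] by (simp add: \<phi>_def)
        qed
        then show ?thesis using closure_subset[of \<Omega>] by (auto simp: T_def)
      qed
      then have "closedin (top_of_set (ball 0 1)) T" using continuous_closedin_preimage[OF c\<phi> closed_closure] by simp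
      ultimately have "T = {} \<or> T = ball 0 1" using connected_ball[of "0::complex" 1] unfolding connected_clopen by blast
      moreover have "0 \<in> T" using \<phi>0 z\<Omega> by (simp add: T_def)
      ultimately have "T = ball 0 1" by blast
      then show ?thesis by (auto simp: T_def)
    qed
    have der: "of_real (1 / s) * deriv (\<lambda>\<zeta>. \<phi> \<zeta> $ i) 0 = X $ i" for i
    proof -
      have "((\<lambda>\<zeta>. w \<zeta> $ i) has_field_derivative (of_real s *s X) $ i) (at 0)" using wder by (simp add: vec_deriv_def)
      from DERIV_add[OF DERIV_const[of "z $ i"] this]
      have "((\<lambda>\<zeta>. \<phi> \<zeta> $ i) has_field_derivative (of_real s * X $ i)) (at 0)" by (simp add: \<phi>_def)
      then have "deriv (\<lambda>\<zeta>. \<phi> \<zeta> $ i) 0 = of_real s * X $ i" by (rule DERIV_imp_deriv)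
      then show ?thesis using s by simp
    qed
    have "cmod (of_real (1 / s)) \<le> (1 + \<eta>) * sqrt Q2"
    proof -
      \<comment> \<open>For \<eta> <= 1/2 this replaces the factor 1 / sqrt (1 - \<eta>) by 1 +
        \<eta>.\<close>
      have "1 \<le> (1 + \<eta>)\<^sup>2 * (1 - \<eta>)"
      proof -
        have "\<eta> * \<eta> \<le> \<eta> * (1 / 2)" using \<eta>0 \<eta>1 by (intro mult_left_mono) auto
        then have h1: "\<eta> * \<eta> \<le> \<eta> / 2" by simp
        have "\<eta> * (\<eta> * \<eta>) \<le> \<eta> * (1 / 2 * (1 / 2))" using \<eta>0 \<eta>1 by (intro mult_left_mono mult_mono) auto
        then have h2: "\<eta> * (\<eta> * \<eta>) \<le> \<eta> / 4" by simp
        have "(1 + \<eta>)\<^sup>2 * (1 - \<eta>) = 1 + \<eta> - \<eta> * \<eta> - \<eta> * (\<eta> * \<eta>)" by (simp add: power2_eq_square algebra_simps)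
        then show ?thesis using h1 h2 \<eta>0 by linarith
      qed
      then have "1 / s\<^sup>2 \<le> (1 + \<eta>)\<^sup>2 * Q2" unfolding s2 using \<eta>1 Q2 by (simp add: pos_divide_le_eq mult_ac)
      then have "(1 / s)\<^sup>2 \<le> ((1 + \<eta>) * sqrt Q2)\<^sup>2" using Q2 by (simp add: power_divide power_mult_distrib)
      then have "1 / s \<le> (1 + \<eta>) * sqrt Q2" by (rule power2_le_imp_le) (use \<eta>0 Q2 in simp)
      then show ?thesis using s by (simp add: norm_divide)
    qed
    then show ?thesis using \<phi>hol in\<Omega> \<phi>0 der unfolding mf \<eta>_def d_def
      by (intro exI[of _ \<phi>] exI[of _ "of_real (1 / s)"] conjI allI)
  qed
  have "v \<le> R" using v R by simp
  show ?thesis unfolding \<theta>_def[symmetric]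
    by (rule exI[of _ v], rule conjI[OF v(1)], rule exI[of _ C0], rule conjI[OF C0 conjI[OF \<open>v \<le> R\<close>]])
      (intro ballI allI impI main)
qed

end

text \<open>Here x = B \<delta>, \<open>a\<close> and \<open>b\<close> are the two summands of the
  squared metric in the theorem, and \<open>Q2\<close> is \<open>metric_form\<close>.
  \<open>b\<close> may be negative, since only the Levi form of r is known to be positive; this
  gives b >= - a / 9, so that a + b controls both \<open>a\<close> and |b|.\<close>

lemma metric_comparison:
  fixes a b x Q2 :: real
  assumes x: "0 \<le> x" "x \<le> 1 / 20" and a: "0 \<le> a" and pos: "0 \<le> (1 - 2 * x) * b + 2 * x * a"
    and Q2: "Q2 = ((1 - 2 * x) / (1 - x))\<^sup>2 * a + ((1 - 2 * x) * b + 2 * x * a) / (1 - x)"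
  shows "0 \<le> a + b" "(1 - 10 * x) * sqrt (a + b) \<le> sqrt Q2" "sqrt Q2 \<le> (1 + 10 * x) * sqrt (a + b)"
proof -
  define t where "t = x / (1 - x)"
  have t: "0 \<le> t" "t \<le> 2 * x"
  proof -
    show "0 \<le> t" using x by (simp add: t_def)
    have "x \<le> 2 * x * (1 - x)" using x mult_left_mono[of x "1 / 2" x] by (simp add: algebra_simps)
    then show "t \<le> 2 * x" using x by (simp add: t_def pos_divide_le_eq)
  qed
  have e1: "(1 - 2 * x) / (1 - x) = 1 - t" and e2: "1 / (1 - x) = 1 + t" using x by (auto simp: t_def field_simps)
  have "Q2 = (1 - t)\<^sup>2 * a + ((1 - t) * b + 2 * t * a)"
  proof -
    have "((1 - 2 * x) * b + 2 * x * a) / (1 - x) = ((1 - 2 * x) / (1 - x)) * b + 2 * (x / (1 - x)) * a"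
      by (simp add: add_divide_distrib)
    then show ?thesis unfolding Q2 e1 t_def[symmetric] by simp
  qed
  then have Q: "Q2 = (a + b) + t * (t * a - b)" by (simp add: power2_eq_square algebra_simps)
  have xa: "2 * x * a \<le> (1 / 10) * a" using x a by (intro mult_right_mono) auto
  have bl: "- (a / 9) \<le> b"
  proof (cases "0 \<le> b")
    case False
    then have "(1 - 2 * x) * (- b) \<ge> (9 / 10) * (- b)" using x by (intro mult_right_mono) auto
    then show ?thesis using pos xa by simp
  qed (use a in linarith)
  then have s0: "(8 / 9) * a \<le> a + b" by linarith
  then show ab: "0 \<le> a + b" using a by linarith
  have ta: "0 \<le> t * a" "t * a \<le> a" using t x a mult_right_mono[of t 1 a] by auto
  have "\<bar>t * a - b\<bar> \<le> 3 * (a + b)"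
  proof (rule abs_leI)
    have g: "u - b \<le> 3 * (a + b) \<and> - (u - b) \<le> 3 * (a + b)" if "0 \<le> u" "u \<le> a" for u
      using that bl s0 a ab by (intro conjI) (simp_all add: field_simps)
    show "t * a - b \<le> 3 * (a + b)" "- (t * a - b) \<le> 3 * (a + b)" using g[OF ta] by blast+
  qed
  then have "\<bar>t * (t * a - b)\<bar> \<le> t * (3 * (a + b))" unfolding abs_mult using t by (simp add: mult_left_mono)
  also have "\<dots> \<le> 2 * x * (3 * (a + b))" using t ab by (intro mult_right_mono) auto
  also have "\<dots> = 6 * (x * (a + b))" by simp
  also have "\<dots> \<le> 10 * (x * (a + b))" using mult_nonneg_nonneg[OF x(1) ab] by linarith
  also have "\<dots> = 10 * x * (a + b)" by simp
  finally have d: "\<bar>Q2 - (a + b)\<bar> \<le> 10 * x * (a + b)" unfolding Q by simp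
  then have lo: "(1 - 10 * x) * (a + b) \<le> Q2" and hi: "Q2 \<le> (1 + 10 * x) * (a + b)" by (auto simp: abs_le_iff algebra_simps)
  have "(1 - 10 * x)\<^sup>2 \<le> 1 - 10 * x" using x by (simp add: power2_eq_square mult_left_le_one_le)
  then have "(1 - 10 * x)\<^sup>2 * (a + b) \<le> Q2" using lo ab mult_right_mono by fastforce
  then have "sqrt ((1 - 10 * x)\<^sup>2 * (a + b)) \<le> sqrt Q2" by simp
  then show "(1 - 10 * x) * sqrt (a + b) \<le> sqrt Q2" using x by (simp add: real_sqrt_mult)
  have "1 + 10 * x \<le> (1 + 10 * x)\<^sup>2" using x by (intro self_le_power) auto
  then have "Q2 \<le> (1 + 10 * x)\<^sup>2 * (a + b)" using hi ab mult_right_mono by fastforce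
  then have "sqrt Q2 \<le> sqrt ((1 + 10 * x)\<^sup>2 * (a + b))" by simp
  then show "sqrt Q2 \<le> (1 + 10 * x) * sqrt (a + b)" using x by (simp add: real_sqrt_mult)
qed

theorem theorem2:
  fixes \<Omega> :: "(complex^'n) set" and p :: "complex^'n" and \<epsilon> :: real and k :: nat
  assumes "open \<Omega>" and "connected \<Omega>" and "\<Omega> \<noteq> {}"
    and "0 < \<epsilon>" and "\<epsilon> \<le> 1" and "k \<in> {0, 1}"
    and "spsc_boundary_point (k + 2) \<epsilon> \<Omega> p"
  shows "\<exists>C>0. \<exists>U. open U \<and> p \<in> U \<and>
    (\<forall>z\<in>\<Omega> \<inter> U. \<forall>X.
      let \<delta> = bdist \<Omega>; \<epsilon>k = (real k + \<epsilon>) / 2;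
          Q = sqrt ((cmod (del_pair \<delta> z X))\<^sup>2 / (\<delta> z)\<^sup>2 + levi (\<lambda>w. - \<delta> w) z X / \<delta> z)
      in (1 - C * \<delta> z powr \<epsilon>k) * Q \<le> kobayashi \<Omega> z X \<and>
         kobayashi \<Omega> z X \<le> (1 + C * \<delta> z powr \<epsilon>k) * Q)"
proof -
  define \<theta> where "\<theta> = (real k + \<epsilon>) / 2"
  have \<theta>: "0 < \<theta>" "\<theta> \<le> 1" using assms(4-6) by (auto simp: \<theta>_def)
  obtain R r m m1 m2 C c B where chart: "levi_chart \<Omega> p R r m m1 m2 C c (real k + 1 + \<epsilon>)" and B: "0 < B"
    and rel: "\<forall>z\<in>\<Omega> \<inter> ball p R. let \<delta> = bdist \<Omega> z in 0 < \<delta> \<and> B * \<delta> \<le> 1 / 8 \<and> r z = - \<delta> + B * \<delta>\<^sup>2 \<and>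
      (\<forall>X. hprod X (m z) / 2 = (2 * B * \<delta> - 1) * del_pair (bdist \<Omega>) z X \<and>
         (m1 z X \<bullet> X + m1 z (J X) \<bullet> J X) / 4 = (1 - 2 * B * \<delta>) * levi (\<lambda>w. - bdist \<Omega> w) z X
             + 2 * B * (cmod (del_pair (bdist \<Omega>) z X))\<^sup>2)"
    using levi_chart_exists[OF assms(1,4,5,6,7)] by (elim exE conjE)
  interpret levi_chart \<Omega> p R r m m1 m2 C c "real k + 1 + \<epsilon>" by (rule chart)
  have \<theta>_eq: "(real k + 1 + \<epsilon> - 1) / 2 = \<theta>" by (simp add: \<theta>_def)
  obtain v1 C2 where v1: "0 < v1" "v1 \<le> R" "0 < C2" and
    lower: "\<forall>\<phi> \<alpha> X. holo_vec \<phi> (ball 0 1) \<longrightarrow> \<phi> ` ball 0 1 \<subseteq> \<Omega> \<longrightarrow> dist (\<phi> 0) p < v1 \<longrightarrow>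
     (\<forall>i. \<alpha> * deriv (\<lambda>\<zeta>. \<phi> \<zeta> $ i) 0 = X $ i) \<longrightarrow>
     (1 - C2 * (- r (\<phi> 0)) powr \<theta>) * sqrt (metric_form (\<phi> 0) X) \<le> cmod \<alpha>"
    using kobayashi_disc_lower unfolding \<theta>_eq by (elim exE conjE)
  obtain v2 C3 where v2: "0 < v2" "0 < C3" and
    upper: "\<forall>z\<in>\<Omega>. \<forall>X. dist z p < v2 \<longrightarrow> X \<noteq> 0 \<longrightarrow>
     (\<exists>\<phi> \<alpha>. holo_vec \<phi> (ball 0 1) \<and> \<phi> ` ball 0 1 \<subseteq> \<Omega> \<and> \<phi> 0 = z \<and>
       (\<forall>i. \<alpha> * deriv (\<lambda>\<zeta>. \<phi> \<zeta> $ i) 0 = X $ i) \<and>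
       cmod \<alpha> \<le> (1 + C3 * (- r z) powr \<theta>) * sqrt (metric_form z X))"
    using kobayashi_disc_upper unfolding \<theta>_eq by (elim exE conjE)
  \<comment> \<open>v <= 1 / (20 B) gives x = B \<delta> <= 1/20 for the comparison of the metrics,
    and v <= 1 gives \<delta> <= \<delta>^\<theta>.\<close>
  define v where "v = min (min v1 v2) (min 1 (1 / (20 * B)))"
  have v: "0 < v" "v \<le> v1" "v \<le> v2" "v \<le> 1" "v \<le> 1 / (20 * B)" using v1 v2 B by (auto simp: v_def)
  \<comment> \<open>10 B is the loss in \<open>metric_comparison\<close>; 10 B C3 covers the product
    of the two upper factors, where x <= B is used.\<close>
  define C' where "C' = C2 + C3 + 10 * B + 10 * B * C3"
  have C': "0 < C'" using v1 v2 B by (simp add: C'_def add_pos_pos)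
  have main: "(1 - C' * bdist \<Omega> z powr \<theta>) * Q \<le> kobayashi \<Omega> z X \<and> kobayashi \<Omega> z X \<le> (1 + C' * bdist \<Omega> z powr \<theta>) * Q"
    if z: "z \<in> \<Omega> \<inter> ball p v" and Q: "Q = sqrt ((cmod (del_pair (bdist \<Omega>) z X))\<^sup>2 / (bdist \<Omega> z)\<^sup>2 + levi (\<lambda>w. - bdist \<Omega> w) z X / bdist \<Omega> z)"
    for z X Q
  proof -
    have zR: "z \<in> \<Omega> \<inter> ball p R" using z v v1 by auto
    have zv: "dist z p < v" using z by (simp add: dist_commute)
    define \<delta> where "\<delta> = bdist \<Omega> z"
    define lc where "lc = del_pair (bdist \<Omega>) z X"
    define L where "L = levi (\<lambda>w. - bdist \<Omega> w) z X"
    have \<delta>: "0 < \<delta>" "r z = - \<delta> + B * \<delta>\<^sup>2" and lX: "hprod X (m z) / 2 = (2 * B * \<delta> - 1) * lc"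
      and LX: "(m1 z X \<bullet> X + m1 z (J X) \<bullet> J X) / 4 = (1 - 2 * B * \<delta>) * L + 2 * B * (cmod lc)\<^sup>2"
      using bspec[OF rel zR] unfolding Let_def \<delta>_def lc_def L_def by blast+
    have "\<delta> \<le> dist z p" unfolding \<delta>_def bdist_def by (rule infdist_le[OF p_frontier])
    then have \<delta>v: "\<delta> < v" using zv by linarith
    define x where "x = B * \<delta>"
    have x: "0 \<le> x" "x \<le> 1 / 20"
    proof -
      have "B * \<delta> \<le> B * (1 / (20 * B))" using \<delta>v v B by (intro mult_left_mono) auto
      then show "x \<le> 1 / 20" using B by (simp add: x_def)
    qed (use B \<delta> in \<open>simp add: x_def\<close>)
    define d where "d = - r z"
    have d: "d = \<delta> * (1 - x)" by (simp add: d_def \<delta> x_def power2_eq_square algebra_simps)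
    have d0: "0 < d" and d\<delta>: "d \<le> \<delta>" using \<delta>(1) x unfolding d by (simp_all add: mult_left_le)
    have dp: "d powr \<theta> \<le> \<delta> powr \<theta>" using d0 d\<delta> \<theta> by (intro powr_mono2) auto
    have \<delta>p: "\<delta> \<le> \<delta> powr \<theta>" using powr_mono'[of \<theta> 1 \<delta>] \<theta> \<delta>(1) \<delta>v v by simp
    define a where "a = (cmod lc)\<^sup>2 / \<delta>\<^sup>2"
    define b where "b = L / \<delta>"
    have lb: "L = \<delta> * b" "(cmod lc)\<^sup>2 = \<delta>\<^sup>2 * a" using \<delta>(1) by (simp_all add: a_def b_def)
    have LX': "(1 - 2 * B * \<delta>) * L + 2 * B * (cmod lc)\<^sup>2 = \<delta> * ((1 - 2 * x) * b + 2 * x * a)"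
      unfolding lb x_def by (simp add: power2_eq_square algebra_simps)
    have pos: "0 \<le> (1 - 2 * x) * b + 2 * x * a"
    proof -
      have "0 \<le> c * (norm X)\<^sup>2" using c by simp
      also have "\<dots> \<le> \<delta> * ((1 - 2 * x) * b + 2 * x * a)" using levi_pos[of z X] zR unfolding LX LX' by simp
      finally show ?thesis using \<delta>(1) by (simp add: zero_le_mult_iff)
    qed
    have mf: "metric_form z X = ((1 - 2 * x) / (1 - x))\<^sup>2 * a + ((1 - 2 * x) * b + 2 * x * a) / (1 - x)"
    proof -
      have rd: "r z = - d" by (simp add: d_def)
      have "(cmod (hprod X (m z) / 2))\<^sup>2 = (1 - 2 * x)\<^sup>2 * (cmod lc)\<^sup>2"
      proof -
        have "complex_of_real (2 * B * \<delta> - 1) = complex_of_real (- (1 - 2 * x))" by (simp add: x_def)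
        then have "hprod X (m z) / 2 = complex_of_real (- (1 - 2 * x)) * lc" using lX by simp
        then have "cmod (hprod X (m z) / 2) = \<bar>- (1 - 2 * x)\<bar> * cmod lc" by (simp only: norm_mult norm_of_real)
        then show ?thesis by (simp only: power_mult_distrib power2_abs power2_minus)
      qed
      then have 1: "(cmod (hprod X (m z) / 2))\<^sup>2 / (r z)\<^sup>2 = ((1 - 2 * x) / (1 - x))\<^sup>2 * a"
        unfolding rd d lb(2) using \<delta>(1) by (simp add: power_mult_distrib power_divide)
      have 2: "(m1 z X \<bullet> X + m1 z (J X) \<bullet> J X) / 4 / (- r z) = ((1 - 2 * x) * b + 2 * x * a) / (1 - x)"
        unfolding LX LX' rd minus_minus d using \<delta>(1) by simp
      show ?thesis unfolding metric_form_def 1 2 ..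
    qed
    have a0: "0 \<le> a" by (simp add: a_def)
    note cmp = metric_comparison[OF x a0 pos mf]
    have Q_eq: "Q = sqrt (a + b)" unfolding Q a_def b_def \<delta>_def lc_def L_def ..
    have Q0: "0 \<le> Q" using cmp(1) by (simp add: Q_eq)
    define q where "q = sqrt (metric_form z X)"
    have lo: "(1 - 10 * x) * Q \<le> q" and hi: "q \<le> (1 + 10 * x) * Q" using cmp(2,3) by (simp_all add: q_def Q_eq)
    have q0: "0 \<le> q" using lo Q0 x mult_nonneg_nonneg[of "1 - 10 * x" Q] by linarith
    define y where "y = \<delta> powr \<theta>"
    have y: "0 \<le> y" "x \<le> B * y" using \<delta>p B by (auto simp: y_def x_def)
    define S where "S = {norm \<alpha> | \<alpha>. \<exists>\<phi> :: complex \<Rightarrow> complex^'n.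
      (\<forall>i. (\<lambda>\<zeta>. \<phi> \<zeta> $ i) holomorphic_on ball 0 1) \<and> \<phi> ` ball 0 1 \<subseteq> \<Omega> \<and>
      \<phi> 0 = z \<and> (\<forall>i. \<alpha> * deriv (\<lambda>\<zeta>. \<phi> \<zeta> $ i) 0 = X $ i)}"
    have kS: "kobayashi \<Omega> z X = Inf S" by (simp add: kobayashi_def S_def)
    have bdd: "bdd_below S" unfolding S_def by (rule bdd_belowI[of _ 0]) auto
    have ex: "\<exists>s\<in>S. s \<le> (1 + C3 * d powr \<theta>) * q"
    \<comment> \<open>For the zero vector a constant disc with \<alpha> = 0 serves;
      \<open>kobayashi_disc_upper\<close> needs a nonzero vector to normalize its disc.\<close>
    proof (cases "X = 0")
      case True
      have "norm (0::complex) \<in> S" unfolding S_def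
        using True zR by (intro CollectI exI[of _ 0] conjI refl exI[of _ "\<lambda>_. z"]) auto
      moreover have "0 \<le> (1 + C3 * d powr \<theta>) * q" using v2 q0 by simp
      ultimately show ?thesis by (intro bexI[of _ 0]) auto
    next
      case False
      have "dist z p < v2" using zv v by simp
      with upper zR False obtain \<phi> \<alpha> where *: "holo_vec \<phi> (ball 0 1)" "\<phi> ` ball 0 1 \<subseteq> \<Omega>" "\<phi> 0 = z"
        "\<forall>i. \<alpha> * deriv (\<lambda>\<zeta>. \<phi> \<zeta> $ i) 0 = X $ i" "cmod \<alpha> \<le> (1 + C3 * (- r z) powr \<theta>) * sqrt (metric_form z X)" by blast
      then have "cmod \<alpha> \<in> S" unfolding S_def holo_vec_def by blast
      then show ?thesis using *(5) unfolding d_def q_def by blast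
    qed
    have up: "kobayashi \<Omega> z X \<le> (1 + C' * y) * Q"
    proof -
      obtain s where s: "s \<in> S" "s \<le> (1 + C3 * d powr \<theta>) * q" using ex by blast
      have "kobayashi \<Omega> z X \<le> s" unfolding kS by (rule cInf_lower[OF s(1) bdd])
      also have "s \<le> (1 + C3 * d powr \<theta>) * q" by (rule s(2))
      also have "\<dots> \<le> (1 + C3 * y) * ((1 + 10 * x) * Q)"
        using dp v2 hi q0 y unfolding y_def by (intro mult_mono add_left_mono mult_left_mono) auto
      also have "\<dots> = ((1 + C3 * y) * (1 + 10 * x)) * Q" by simp
      also have "\<dots> \<le> (1 + C' * y) * Q"
      proof (rule mult_right_mono[OF _ Q0])
        have "x \<le> B" using \<delta>v v B by (simp add: x_def)
        then have "C3 * y * (10 * x) \<le> C3 * y * (10 * B)" using v2 y by (intro mult_left_mono mult_nonneg_nonneg) auto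
        moreover have "(1 + C3 * y) * (1 + 10 * x) = 1 + C3 * y + 10 * x + C3 * y * (10 * x)" by (simp add: algebra_simps)
        moreover have "(1 + C' * y) = 1 + C2 * y + C3 * y + 10 * (B * y) + C3 * y * (10 * B)" by (simp add: C'_def algebra_simps)
        moreover have "0 \<le> C2 * y" using v1 y by simp
        ultimately show "(1 + C3 * y) * (1 + 10 * x) \<le> 1 + C' * y" using y by linarith
      qed
      finally show ?thesis .
    qed
    have low: "(1 - C' * y) * Q \<le> s" if "s \<in> S" for s
    proof -
      obtain \<alpha> \<phi> where s: "s = norm \<alpha>" and *: "holo_vec \<phi> (ball 0 1)" "\<phi> ` ball 0 1 \<subseteq> \<Omega>" "\<phi> 0 = z"
        "\<forall>i. \<alpha> * deriv (\<lambda>\<zeta>. \<phi> \<zeta> $ i) 0 = X $ i" using \<open>s \<in> S\<close> unfolding S_def holo_vec_def by blast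
      have "dist (\<phi> 0) p < v1" using zv v *(3) by simp
      then have l1: "(1 - C2 * d powr \<theta>) * q \<le> s"
        using lower[rule_format, OF *(1,2), of \<alpha> X] *(4) unfolding *(3) s d_def q_def by blast
      have C'y: "C2 * y + 10 * (B * y) \<le> C' * y"
      proof -
        have "C' * y = C2 * y + C3 * y + 10 * (B * y) + 10 * B * C3 * y" by (simp add: C'_def algebra_simps)
        moreover have "0 \<le> C3 * y" "0 \<le> 10 * B * C3 * y" using v2 B y by simp_all
        ultimately show ?thesis by linarith
      qed
      show ?thesis
      \<comment> \<open>If C2 y > 1, then 1 - C' y <= 0 and the lower bound is trivial because Q >=
        0.\<close>
      proof (cases "C2 * y \<le> 1")
        case True
        have "1 - C' * y \<le> 1 - C2 * y - 10 * x" using C'y y by linarith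
        also have "\<dots> \<le> (1 - C2 * y) * (1 - 10 * x)"
        proof -
          have "0 \<le> C2 * y * (10 * x)" using v1 y x by simp
          then show ?thesis by (simp add: algebra_simps)
        qed
        finally have "(1 - C' * y) * Q \<le> ((1 - C2 * y) * (1 - 10 * x)) * Q" using Q0 by (rule mult_right_mono)
        also have "\<dots> = (1 - C2 * y) * ((1 - 10 * x) * Q)" by simp
        also have "\<dots> \<le> (1 - C2 * y) * q" using True lo by (intro mult_left_mono) auto
        also have "\<dots> \<le> (1 - C2 * d powr \<theta>) * q" using dp v1 q0 unfolding y_def by (intro mult_right_mono) auto
        also have "\<dots> \<le> s" by (rule l1)
        finally show ?thesis .
      next
        case False
        then have "1 - C' * y \<le> 0" using C'y B y by (smt (verit) mult_nonneg_nonneg)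
        then have "(1 - C' * y) * Q \<le> 0" using Q0 by (rule mult_nonpos_nonneg)
        then show ?thesis using s norm_ge_zero[of \<alpha>] by linarith
      qed
    qed
    have "S \<noteq> {}" using ex by blast
    then have "(1 - C' * y) * Q \<le> kobayashi \<Omega> z X" unfolding kS by (rule cInf_greatest) (rule low)
    then show ?thesis using up unfolding y_def \<delta>_def by blast
  qed
  show ?thesis
  proof (rule exI[of _ C'], rule conjI[OF C'], rule exI[of _ "ball p v"], intro conjI ballI allI)
    show "open (ball p v)" by simp
    show "p \<in> ball p v" using v by simp
    fix z X assume z: "z \<in> \<Omega> \<inter> ball p v"
    show "let \<delta> = bdist \<Omega>; \<epsilon>k = (real k + \<epsilon>) / 2;
          Q = sqrt ((cmod (del_pair \<delta> z X))\<^sup>2 / (\<delta> z)\<^sup>2 + levi (\<lambda>w. - \<delta> w) z X / \<delta> z)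
      in (1 - C' * \<delta> z powr \<epsilon>k) * Q \<le> kobayashi \<Omega> z X \<and> kobayashi \<Omega> z X \<le> (1 + C' * \<delta> z powr \<epsilon>k) * Q"
      unfolding Let_def \<theta>_def[symmetric] by (rule main[OF z refl])
  qed
qed

end
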